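(* Let $\Omega\subseteq\mathbb{S}^2$ be an arbitrary domain (possibly $\Omega=\mathbb{S}^2$) and let $2\le q<\infty$. Then for every $u\in\mathbf{H}^1_0(\Omega)$ with $\operatorname{div}u=0$, $$\|u\|_{L^q}\le\left(\frac{1}{4\pi}\right)^{(q-2)/2q}\left(\frac q2\right)^{1/2}\|u\|^{2/q}\,\|\operatorname{rot}u\|^{1-2/q},$$ where the norms on the left-hand and right-hand sides are taken over $\Omega$ (equivalently, over $\mathbb{S}^2$ after extending $u$ by zero).
   Context: $\mathbb{S}^2$ is the unit two-dimensional sphere with its standard round metric and the natural (non-normalized) surface measure $d\sigma$, of total mass $4\pi$; $L^q$-norms are with respect to $d\sigma$, and $\|\cdot\|$ without subscript is the $L^2$-norm. Vector functions are real tangent vector fields on $\Omega\subseteq\mathbb{S}^2$, with pointwise length $|u(x)|$ given by the metric. $\mathbf{H}^1_0(\Omega)$ is the Sobolev space of tangent vector fields of class $H^1$ vanishing on $\partial\Omega$ (the closure in $\mathbf{H}^1$ of the smooth vector fields compactly supported in $\Omega$); for $\Omega=\mathbb{S}^2$ it is $\mathbf{H}^1(\mathbb{S}^2)$. The operator $\operatorname{div}$ is the Riemannian divergence, and the scalar $\operatorname{rot}u$ of a vector field $u$ is $\operatorname{rot}u:=\operatorname{div}(u^\perp)$, where in a local orthonormal frame $u^\perp=(u_2,-u_1)$, i.e. $u^\perp$ is the rotation of $u$ by $\pi/2$ clockwise in the tangent plane. For $q=2$ the factor $\|\operatorname{rot}u\|^{1-2/q}$ is understood as $1$. *)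

theory Defs
  imports "HOL-Analysis.Analysis"
begin

abbreviation S2 :: "(real^3) set" where
  "S2 \<equiv> sphere 0 1"

text \<open>The surface measure of the unit sphere, by polar coordinates \<open>dx = r\<^sup>2 dr d\<sigma>\<close>:
  the measure of a Borel set \<open>A\<close> of the sphere is three times the volume of the cone
  \<open>{r y | 0 < r < 1, y \<in> A}\<close>. In particular the total mass is \<open>4\<pi>\<close>.
  Note that \<open>sgn x = x /\<^sub>R norm x\<close> is the radial projection. The measure is carried by the Borel
  sets of the ambient space and is concentrated on the sphere.\<close>

definition surface :: "(real^3) measure" where
  "surface = distr (density lborel (\<lambda>x. 3 * indicator (ball 0 1) x)) borel sgn"

abbreviation surface_on :: "(real^3) set \<Rightarrow> (real^3) measure" where
  "surface_on \<Omega> \<equiv> restrict_space surface \<Omega>"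

definition is_Lp :: "real \<Rightarrow> (real^3) set \<Rightarrow> (real^3 \<Rightarrow> 'b::real_normed_vector) \<Rightarrow> bool" where
  "is_Lp q \<Omega> f \<longleftrightarrow> f \<in> borel_measurable (surface_on \<Omega>)
     \<and> integrable (surface_on \<Omega>) (\<lambda>x. norm (f x) powr q)"

definition Lp_norm :: "real \<Rightarrow> (real^3) set \<Rightarrow> (real^3 \<Rightarrow> 'b::real_normed_vector) \<Rightarrow> real" where
  "Lp_norm q \<Omega> f = (LINT x|surface_on \<Omega>. norm (f x) powr q) powr (1 / q)"

definition domain_S2 :: "(real^3) set \<Rightarrow> bool" where
  "domain_S2 \<Omega> \<longleftrightarrow> openin (top_of_set S2) \<Omega> \<and> connected \<Omega> \<and> \<Omega> \<noteq> {}"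

text \<open>Vector fields are functions into the ambient space, of which only the values on
  the sphere (or on the domain) matter.\<close>

definition tangent_on :: "(real^3) set \<Rightarrow> (real^3 \<Rightarrow> real^3) \<Rightarrow> bool" where
  "tangent_on \<Omega> u \<longleftrightarrow> (\<forall>x\<in>\<Omega>. u x \<bullet> x = 0)"

text \<open>\<open>Ck_on k f U\<close>: all partial derivatives up to order \<open>k\<close> exist and are
  continuous; meant for open \<open>U\<close>.\<close>

primrec Ck_on :: "nat \<Rightarrow> (real^3 \<Rightarrow> real^3) \<Rightarrow> (real^3) set \<Rightarrow> bool" where
  "Ck_on 0 f U \<longleftrightarrow> continuous_on U f"
| "Ck_on (Suc k) f U \<longleftrightarrow> f differentiable_on U
     \<and> (\<forall>b\<in>Basis. Ck_on k (\<lambda>x. frechet_derivative f (at x) b) U)"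

text \<open>A map on the sphere is smooth iff its extension to the punctured space that is
  constant along rays is smooth.\<close>

definition smooth_S2 :: "(real^3 \<Rightarrow> real^3) \<Rightarrow> bool" where
  "smooth_S2 f \<longleftrightarrow> (\<forall>k. Ck_on k (f \<circ> sgn) (- {0}))"

definition test_fields :: "(real^3) set \<Rightarrow> (real^3 \<Rightarrow> real^3) set" where
  "test_fields \<Omega> = {v. smooth_S2 v \<and> tangent_on S2 v
     \<and> (\<exists>K. compact K \<and> K \<subseteq> \<Omega> \<and> (\<forall>x\<in>S2 - K. v x = 0))}"

text \<open>The Levi-Civita covariant derivative of a smooth tangent field: the tangential part
  of the ambient derivative. The tangent endomorphism \<open>h \<mapsto> \<nabla>\<^sub>h w\<close> at \<open>x\<close> is represented by the
  matrix that also maps the normal \<open>x\<close> to 0 (automatic here, as the extension of \<open>w\<close> is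
  constant along rays). With this representation, the trace and the Hilbert--Schmidt norm of the
  endomorphism are the \<open>trace\<close> and the \<open>norm\<close> of the matrix.\<close>

definition tangential :: "real^3 \<Rightarrow> real^3 \<Rightarrow> real^3" where
  "tangential x y = y - (x \<bullet> y) *\<^sub>R x"

definition cov_smooth :: "(real^3 \<Rightarrow> real^3) \<Rightarrow> real^3 \<Rightarrow> real^3^3" where
  "cov_smooth w x = matrix (\<lambda>h. tangential x (frechet_derivative (w \<circ> sgn) (at x) h))"

text \<open>Weak covariant derivative in \<open>L\<^sup>2\<close>; the integral identity is the integrated form of
  \<open>div (\<langle>u,w\<rangle> v) = \<langle>\<nabla>\<^sub>v u, w\<rangle> + \<langle>u, \<nabla>\<^sub>v w\<rangle> + \<langle>u,w\<rangle> div v\<close>.\<close>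

definition is_weak_cov :: "(real^3) set \<Rightarrow> (real^3 \<Rightarrow> real^3) \<Rightarrow> (real^3 \<Rightarrow> real^3^3) \<Rightarrow> bool" where
  "is_weak_cov \<Omega> u T \<longleftrightarrow> is_Lp 2 \<Omega> T
     \<and> (\<forall>x\<in>\<Omega>. T x *v x = 0 \<and> x v* T x = 0)
     \<and> (\<forall>v\<in>test_fields \<Omega>. \<forall>w\<in>test_fields \<Omega>.
          (LINT x|surface_on \<Omega>. (T x *v v x) \<bullet> w x) =
          - (LINT x|surface_on \<Omega>.
               u x \<bullet> (cov_smooth w x *v v x + trace (cov_smooth v x) *\<^sub>R w x)))"

definition H1 :: "(real^3) set \<Rightarrow> (real^3 \<Rightarrow> real^3) set" where
  "H1 \<Omega> = {u. tangent_on \<Omega> u \<and> is_Lp 2 \<Omega> u \<and> (\<exists>T. is_weak_cov \<Omega> u T)}"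

text \<open>The weak covariant derivative of \<open>u \<in> H1 \<Omega>\<close>, determined almost everywhere.\<close>

definition cov :: "(real^3) set \<Rightarrow> (real^3 \<Rightarrow> real^3) \<Rightarrow> real^3 \<Rightarrow> real^3^3" where
  "cov \<Omega> u = (SOME T. is_weak_cov \<Omega> u T)"

definition H1_norm :: "(real^3) set \<Rightarrow> (real^3 \<Rightarrow> real^3) \<Rightarrow> real" where
  "H1_norm \<Omega> u = sqrt ((Lp_norm 2 \<Omega> u)\<^sup>2 + (Lp_norm 2 \<Omega> (cov \<Omega> u))\<^sup>2)"

text \<open>The closure of the test fields in \<open>H1 \<Omega>\<close>. For \<open>\<Omega> = S2\<close> the support condition
  on test fields is void and this is all of \<open>H1 S2\<close>, by density of the smooth fields.\<close>

definition H10 :: "(real^3) set \<Rightarrow> (real^3 \<Rightarrow> real^3) set" where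
  "H10 \<Omega> = {u \<in> H1 \<Omega>. \<exists>\<phi>. (\<forall>n. \<phi> n \<in> test_fields \<Omega>)
     \<and> (\<lambda>n. H1_norm \<Omega> (\<lambda>x. u x - \<phi> n x)) \<longlonglongrightarrow> 0}"

definition sdiv :: "(real^3) set \<Rightarrow> (real^3 \<Rightarrow> real^3) \<Rightarrow> real^3 \<Rightarrow> real" where
  "sdiv \<Omega> u x = trace (cov \<Omega> u x)"

text \<open>With the outward normal \<open>x\<close> and a frame with \<open>e\<^sub>1 \<times> e\<^sub>2 = x\<close>, one has \<open>e\<^sub>1 \<times> x = - e\<^sub>2\<close> and
  \<open>e\<^sub>2 \<times> x = e\<^sub>1\<close>, so \<open>u \<times> x\<close> has the components \<open>(u\<^sub>2, - u\<^sub>1)\<close>.\<close>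

definition perp :: "(real^3 \<Rightarrow> real^3) \<Rightarrow> real^3 \<Rightarrow> real^3" where
  "perp u x = cross3 (u x) x"

definition rot :: "(real^3) set \<Rightarrow> (real^3 \<Rightarrow> real^3) \<Rightarrow> real^3 \<Rightarrow> real" where
  "rot \<Omega> u = sdiv \<Omega> (perp u)"

end

theory Submission
  imports Defs "HOL-Complex_Analysis.Complex_Analysis"
begin

text \<open>For a function \<open>f\<close> on the sphere let \<open>f\<^sub>n\<close> be its projection to the spherical harmonics of degree
  \<open>n\<close>, given by convolution with a multiple of the Legendre polynomial \<open>P\<^sub>n\<close>. Since
  \<open>|f\<^sub>n|\<^sup>2 \<le> (2n + 1)/(4\<pi>) \<parallel>f\<^sub>n\<parallel>\<^sup>2\<close> pointwise, interpolation yields a Hausdorff--Young inequality that bounds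
  \<open>\<parallel>f\<parallel>\<^sub>q\<close>, and Hoelder's inequality with the weights \<open>n(n + 1) + 1 + m\<close> together with
  \<open>\<Sum>\<^sub>n (2n + 1)(n(n + 1) + 1 + m) powr -p \<le> m powr (1 - p)/(p - 1)\<close> and the best \<open>m\<close> gives the theorem
  for scalar functions with \<open>\<parallel>\<nabla>f\<parallel>\<^sup>2 + \<parallel>f\<parallel>\<^sup>2\<close> in place of \<open>\<parallel>rot u\<parallel>\<^sup>2\<close>. By Kato's inequality it passes to
  \<open>f = |u|\<close> for a smooth field \<open>u\<close>, with \<open>|\<nabla>u|\<close> in place of \<open>|\<nabla>f|\<close>, and on the unit sphere, whose
  curvature is \<open>1\<close>, the Bochner identity reads \<open>\<parallel>\<nabla>u\<parallel>\<^sup>2 + \<parallel>u\<parallel>\<^sup>2 = \<parallel>rot u\<parallel>\<^sup>2 + \<parallel>div u\<parallel>\<^sup>2\<close>. Both norms on the right are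
  continuous in \<open>H1\<close>, so approximation by test fields and Fatou's lemma finish the proof.\<close>

section \<open>Smooth maps on open sets\<close>

text \<open>A scalar function on the sphere has a constant component, on which the gradient energy
  vanishes, so no bound by the gradient alone is possible for it. Curvature is the remedy: covariant
  differentiation drops the normal part of the ambient derivative, of length |u|, and the Bochner
  identity supplies exactly one |u|^2. This unit is the 1 in the weights; it puts the weight of
  degree n above the midpoint of the interval from n^2 + m to (n + 1)^2 + m, whose length is 2n + 1,
  and these intervals telescope down to m. The factor 1/(4\<pi>) is the pointwise density (2n +
  1)/(4\<pi>) of the harmonics without the multiplicity, and (q/2)^(1/2) is what the best m leaves.

  The expansions stay finite: convolution with powers of (1 + x \<bullet> y)/2 gives polynomials
  with multipliers in [-1, 1] that converge pointwise. Calculus on the sphere is done in the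
  punctured space, with extensions constant along rays. Test fields that approximate a
  divergence-free \<open>u\<close> need not be divergence-free; the smooth inequality therefore
  keeps the divergence term, which disappears only in the limit.\<close>

lemma Ck_on_cong:
  assumes "open U" "\<And>x. x \<in> U \<Longrightarrow> f x = g x"
  shows "Ck_on k f U \<longleftrightarrow> Ck_on k g U"
proof -
  have "Ck_on k f U \<Longrightarrow> Ck_on k g U" if "\<And>x. x \<in> U \<Longrightarrow> f x = g x" for f g
    using that
  proof (induction k arbitrary: f g)
    case 0
    then show ?case using continuous_on_cong by force
  next
    case (Suc k)
    have D: "(g has_derivative frechet_derivative f (at x)) (at x)" if "x \<in> U" for x
    proof -
      have "f differentiable at x"
        using Suc.prems(1) that assms(1) by (simp add: differentiable_on_eq_differentiable_at)
      then have "(f has_derivative frechet_derivative f (at x)) (at x)"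
        using frechet_derivative_works by blast
      then show ?thesis
        by (rule has_derivative_transform_within_open[OF _ assms(1) that]) (use Suc.prems in auto)
    qed
    then have e: "frechet_derivative f (at x) = frechet_derivative g (at x)" if "x \<in> U" for x
      using frechet_derivative_at that by blast
    have "g differentiable_on U"
      using D assms(1) by (auto simp: differentiable_on_eq_differentiable_at differentiable_def)
    moreover have "Ck_on k (\<lambda>x. frechet_derivative g (at x) b) U" if "b \<in> Basis" for b
      using Suc.IH[of "\<lambda>x. frechet_derivative f (at x) b" "\<lambda>x. frechet_derivative g (at x) b"]
        Suc.prems(1) that e by simp
    ultimately show ?case by simp
  qed
  from this[of f g] this[of g f] show ?thesis using assms(2) by auto
qed

text \<open>By uniqueness of derivatives on an open set, any explicit derivative may stand in for
  \<open>frechet_derivative\<close>. The closure rules below supply their derivatives in this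
  way.\<close>

lemma Ck_on_SucI:
  assumes "open U" "\<And>x. x \<in> U \<Longrightarrow> (f has_derivative f' x) (at x)"
    and "\<And>b. b \<in> Basis \<Longrightarrow> Ck_on k (\<lambda>x. f' x b) U"
  shows "Ck_on (Suc k) f U"
proof -
  have e: "frechet_derivative f (at x) = f' x" if "x \<in> U" for x
    using frechet_derivative_at assms(2) that by metis
  have "f differentiable_on U"
    using assms(1,2) by (auto simp: differentiable_on_eq_differentiable_at differentiable_def)
  moreover have "Ck_on k (\<lambda>x. frechet_derivative f (at x) b) U" if "b \<in> Basis" for b
    using Ck_on_cong[OF assms(1), of "\<lambda>x. frechet_derivative f (at x) b" "\<lambda>x. f' x b" k]
      e assms(3)[OF that] by simp
  ultimately show ?thesis by simp
qed

lemma Ck_on_SucD: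
  assumes "open U" "Ck_on (Suc k) f U"
  shows "\<And>x. x \<in> U \<Longrightarrow> (f has_derivative frechet_derivative f (at x)) (at x)"
    and "\<And>b. b \<in> Basis \<Longrightarrow> Ck_on k (\<lambda>x. frechet_derivative f (at x) b) U"
  using assms frechet_derivative_works
  by (auto simp: differentiable_on_eq_differentiable_at)

lemma Ck_on_mono: "Ck_on (Suc k) f U \<Longrightarrow> Ck_on k f U"
proof (induction k arbitrary: f)
  case 0
  then show ?case by (simp add: differentiable_imp_continuous_on)
qed simp

lemma Ck_on_continuous: "Ck_on k f U \<Longrightarrow> continuous_on U f"
  by (cases k) (auto simp: differentiable_imp_continuous_on)

lemma Ck_on_linear:
  assumes "open U" "bounded_linear L" "Ck_on k f U"
  shows "Ck_on k (\<lambda>x. L (f x)) U"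
  using assms(3)
proof (induction k arbitrary: f)
  case 0
  then show ?case using assms(2) by (auto intro: bounded_linear.continuous_on)
next
  case (Suc k)
  show ?case
    by (rule Ck_on_SucI[OF assms(1), where f'="\<lambda>x h. L (frechet_derivative f (at x) h)"])
      (use Ck_on_SucD[OF assms(1) Suc.prems] Suc.IH in
        \<open>auto intro!: bounded_linear.has_derivative[OF assms(2)]\<close>)
qed

lemma Ck_on_add:
  assumes "open U" "Ck_on k f U" "Ck_on k g U"
  shows "Ck_on k (\<lambda>x. f x + g x) U"
  using assms(2,3)
proof (induction k arbitrary: f g)
  case 0
  then show ?case by (auto intro!: continuous_intros)
next
  case (Suc k)
  show ?case
    by (rule Ck_on_SucI[OF assms(1), where f'="\<lambda>x h. frechet_derivative f (at x) h + frechet_derivative g (at x) h"])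
      (use Ck_on_SucD[OF assms(1) Suc.prems(1)] Ck_on_SucD[OF assms(1) Suc.prems(2)] Suc.IH in
        \<open>auto intro!: has_derivative_add\<close>)
qed

lemma Ck_on_const: "open U \<Longrightarrow> Ck_on k (\<lambda>x. c) U"
proof (induction k arbitrary: c)
  case (Suc k)
  show ?case
    by (rule Ck_on_SucI[OF Suc.prems, where f'="\<lambda>x h. 0"]) (use Suc in \<open>auto intro!: derivative_eq_intros\<close>)
qed auto

lemma Ck_on_id: "open U \<Longrightarrow> Ck_on k (\<lambda>x. x) U"
proof (cases k)
  case (Suc j)
  assume "open U"
  then show ?thesis unfolding Suc
    by (rule Ck_on_SucI[where f'="\<lambda>x h. h"]) (auto intro!: derivative_eq_intros Ck_on_const \<open>open U\<close>)
qed auto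

text \<open>The Leibniz rule for an arbitrary bounded bilinear map covers scalar multiples, inner
  products and cross products at once. It involves \<open>f\<close> and \<open>g\<close> themselves
  at order \<open>k\<close>, hence the appeal to \<open>Ck_on_mono\<close>.\<close>

lemma Ck_on_bilinear:
  assumes "open U" "bounded_bilinear B" "Ck_on k f U" "Ck_on k g U"
  shows "Ck_on k (\<lambda>x. B (f x) (g x)) U"
  using assms(3,4)
proof (induction k arbitrary: f g)
  case 0
  then show ?case using bounded_bilinear.continuous_on[OF assms(2)] by auto
next
  case (Suc k)
  show ?case
    by (rule Ck_on_SucI[OF assms(1), where
          f'="\<lambda>x h. B (f x) (frechet_derivative g (at x) h) + B (frechet_derivative f (at x) h) (g x)"])
      (use Ck_on_SucD[OF assms(1) Suc.prems(1)] Ck_on_SucD[OF assms(1) Suc.prems(2)] Suc.IH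
          Suc.prems[THEN Ck_on_mono] in
        \<open>auto intro!: bounded_bilinear.FDERIV[OF assms(2)] Ck_on_add[OF assms(1)]\<close>)
qed

text \<open>Since \<^const>\<open>Ck_on\<close> only applies to vector fields, scalar functions are encoded in
  the first component.\<close>

definition Ck_scalar :: "nat \<Rightarrow> (real^3 \<Rightarrow> real) \<Rightarrow> (real^3) set \<Rightarrow> bool" where
  "Ck_scalar k h U \<longleftrightarrow> Ck_on k (\<lambda>x. h x *\<^sub>R axis 1 1) U"

lemma bounded_linear_scaleR_axis: "bounded_linear (\<lambda>t::real. t *\<^sub>R (axis 1 1 :: real^3))"
  by (rule bounded_linear_scaleR_left)

lemma Ck_scalar_component:
  assumes "open U" "Ck_on k f U" "bounded_linear L"
  shows "Ck_scalar k (\<lambda>x. L (f x)) U"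
  unfolding Ck_scalar_def
  by (rule Ck_on_linear[OF assms(1) _ assms(2), where L="\<lambda>y. L y *\<^sub>R axis 1 1"])
    (rule bounded_linear_compose[OF bounded_linear_scaleR_axis assms(3)])

lemma Ck_on_scaleR:
  assumes "open U" "Ck_scalar k h U" "Ck_on k f U"
  shows "Ck_on k (\<lambda>x. h x *\<^sub>R f x) U"
proof -
  \<comment> \<open>The encoding of scalars is undone by a bilinear map that reads off the first
    component.\<close>
  have "bounded_bilinear (\<lambda>(a::real^3) (b::real^3). a $ 1 *\<^sub>R b)"
    using bounded_bilinear.comp1[OF bounded_bilinear_scaleR bounded_linear_vec_nth] .
  from Ck_on_bilinear[OF assms(1) this assms(2)[unfolded Ck_scalar_def] assms(3)]
  show ?thesis by (simp add: axis_def)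
qed

lemma Ck_scalar_mult:
  assumes "open U" "Ck_scalar k g U" "Ck_scalar k h U"
  shows "Ck_scalar k (\<lambda>x. g x * h x) U"
  using Ck_on_scaleR[OF assms(1,2) assms(3)[unfolded Ck_scalar_def]]
  by (simp add: Ck_scalar_def)

lemma Ck_scalar_prod:
  assumes "open U" "finite I" "\<And>i. i \<in> I \<Longrightarrow> Ck_scalar k (h i) U"
  shows "Ck_scalar k (\<lambda>x. \<Prod>i\<in>I. h i x) U"
  using assms(2,3)
proof (induction I rule: finite_induct)
  case empty
  show ?case using Ck_on_const[OF assms(1)] by (simp add: Ck_scalar_def)
next
  case (insert i I)
  then show ?case using Ck_scalar_mult[OF assms(1)] by simp
qed

lemma Ck_scalar_inner:
  assumes "open U" "Ck_on k f U" "Ck_on k g U"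
  shows "Ck_scalar k (\<lambda>x. f x \<bullet> g x) U"
proof -
  have "bounded_bilinear (\<lambda>(a::real^3) (b::real^3). (a \<bullet> b) *\<^sub>R (axis 1 1 :: real^3))"
    unfolding bilinear_conv_bounded_bilinear[symmetric] bilinear_def
    by (auto simp: linear_iff inner_simps scaleR_add_left)
  from Ck_on_bilinear[OF assms(1) this assms(2,3)]
  show ?thesis by (simp add: Ck_scalar_def)
qed

text \<open>\<open>G j\<close> stands for the j-th derivative of an outer function. The chain rule
  turns \<open>G j\<close> into \<open>G (Suc j)\<close>, so the induction over \<open>k\<close>
  runs for all \<open>j\<close> simultaneously.\<close>

lemma Ck_scalar_compose:
  assumes "open U" "\<And>j t. t \<in> S \<Longrightarrow> (G j has_real_derivative G (Suc j) t) (at t)"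
    and "\<And>x. x \<in> U \<Longrightarrow> h x \<in> S" "Ck_scalar k h U"
  shows "Ck_scalar k (\<lambda>x. G j (h x)) U"
  using assms(4)
proof (induction k arbitrary: j)
  case 0
  have "continuous_on U (\<lambda>x. h x *\<^sub>R (axis 1 1::real^3))"
    using 0 by (simp add: Ck_scalar_def)
  then have "continuous_on U (\<lambda>x. (h x *\<^sub>R (axis 1 1::real^3)) $ 1)"
    by (rule continuous_on_component)
  then have "continuous_on U h" by (simp add: axis_def)
  moreover have "continuous_on S (G j)"
    using assms(2) by (auto intro!: continuous_at_imp_continuous_on DERIV_isCont)
  ultimately have "continuous_on U (\<lambda>x. G j (h x))"
    using assms(3) by (auto intro: continuous_on_compose2)
  then show ?case unfolding Ck_scalar_def by (auto intro!: continuous_intros)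
next
  case (Suc k)
  let ?f = "\<lambda>x. h x *\<^sub>R (axis 1 1::real^3)"
  let ?D = "\<lambda>x b. frechet_derivative ?f (at x) b"
  note d = Ck_on_SucD[OF assms(1) Suc.prems[unfolded Ck_scalar_def]]
  have hd: "(h has_derivative (\<lambda>b. ?D x b $ 1)) (at x)" if "x \<in> U" for x
    using bounded_linear.has_derivative[OF bounded_linear_vec_nth[of 1] d(1)[OF that]]
    by (simp add: axis_def)
  have k: "Ck_scalar k h U" using Suc.prems Ck_on_mono by (auto simp: Ck_scalar_def)
  show ?case unfolding Ck_scalar_def
  proof (rule Ck_on_SucI[OF assms(1), where f'="\<lambda>x b. (G (Suc j) (h x) * (?D x b $ 1)) *\<^sub>R axis 1 1"])
    fix x assume x: "x \<in> U"
    have "((\<lambda>x. G j (h x)) has_derivative (\<lambda>b. G (Suc j) (h x) * ?D x b $ 1)) (at x)"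
      using has_derivative_compose[OF hd[OF x]
          assms(2)[OF assms(3)[OF x], THEN has_field_derivative_imp_has_derivative]]
      by (simp add: o_def)
    then show "((\<lambda>x. G j (h x) *\<^sub>R axis 1 1) has_derivative
        (\<lambda>b. (G (Suc j) (h x) * ?D x b $ 1) *\<^sub>R (axis 1 1::real^3))) (at x)"
      by (rule bounded_linear.has_derivative[OF bounded_linear_scaleR_axis])
  next
    fix b :: "real^3" assume b: "b \<in> Basis"
    have 1: "Ck_scalar k (\<lambda>x. ?D x b $ 1) U"
      by (rule Ck_scalar_component[OF assms(1) d(2)[OF b] bounded_linear_vec_nth])
    show "Ck_on k (\<lambda>x. (G (Suc j) (h x) * (?D x b $ 1)) *\<^sub>R axis 1 1) U"
      using Ck_scalar_mult[OF assms(1) Suc.IH[OF k, of "Suc j"] 1] by (simp add: Ck_scalar_def)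
  qed
qed

text \<open>Away from the origin \<open>sgn x\<close> is x times the power -1/2 of x \<bullet> x;
  \<open>G j\<close> is the j-th derivative of that power.\<close>

lemma Ck_on_sgn: "Ck_on k sgn (- {0 :: real^3})"
proof -
  have o: "open (- {0 :: real^3})" by auto
  define G :: "nat \<Rightarrow> real \<Rightarrow> real" where
    "G = (\<lambda>j t. (\<Prod>i<j. (- 1/2 - real i)) * t powr (- 1/2 - real j))"
  have "(G j has_real_derivative G (Suc j) t) (at t)" if "t \<in> {0<..}" for j t
    using that unfolding G_def
    by (auto intro!: derivative_eq_intros simp: powr_diff field_simps)
  then have "Ck_scalar k (\<lambda>x. G 0 (x \<bullet> x)) (- {0})"
    by (rule Ck_scalar_compose[OF o, where S="{0<..}"])
      (auto intro!: Ck_scalar_inner[OF o] Ck_on_id)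
  from Ck_on_scaleR[OF o this Ck_on_id[OF o]]
  have "Ck_on k (\<lambda>x. G 0 (x \<bullet> x) *\<^sub>R x) (- {0})" .
  moreover have "G 0 (x \<bullet> x) *\<^sub>R x = sgn x" if "x \<noteq> 0" for x :: "real^3"
  proof -
    have "(x \<bullet> x) powr (- 1 / 2) = inverse (norm x)"
      using that by (simp add: norm_eq_sqrt_inner powr_minus powr_half_sqrt)
    then show ?thesis by (simp add: G_def sgn_div_norm)
  qed
  ultimately show ?thesis
    using Ck_on_cong[OF o, of "\<lambda>x. G 0 (x \<bullet> x) *\<^sub>R x" sgn] by auto
qed

subsection \<open>A smooth bump function\<close>

definition bump :: "real \<Rightarrow> real" where
  "bump t = (if t > 0 then exp (- 1 / t) else 0)"

lemma tendsto_poly_exp_neg: "((\<lambda>s::real. poly p s * exp (- s)) \<longlongrightarrow> 0) at_top"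
proof -
  have "((\<lambda>s. \<Sum>i\<le>degree p. coeff p i * (s ^ i / exp s)) \<longlongrightarrow> (\<Sum>i\<le>degree p. coeff p i * 0)) at_top"
    by (intro tendsto_intros tendsto_power_div_exp_0)
  then show ?thesis
    by (simp add: poly_altdef sum_distrib_right exp_minus divide_inverse mult.assoc)
qed

text \<open>The functions p(1/t) exp(-1/t) are closed under differentiation: with s = 1/t, the
  polynomial p(s) becomes s^2 (p(s) - p'(s)). All derivatives of \<open>bump\<close> are of this
  form, starting from p = 1.\<close>

definition bump_deriv :: "real poly \<Rightarrow> real \<Rightarrow> real" where
  "bump_deriv p t = (if t > 0 then poly p (1 / t) * exp (- 1 / t) else 0)"

lemma bump_deriv_has_derivative:
  "(bump_deriv p has_real_derivative bump_deriv ([:0,0,1:] * (p - pderiv p)) t) (at t)"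
proof -
  consider "t > 0" | "t < 0" | "t = 0" by linarith
  then show ?thesis
  proof cases
    case 1
    have "((\<lambda>t. poly p (1 / t) * exp (- 1 / t)) has_real_derivative
        bump_deriv ([:0,0,1:] * (p - pderiv p)) t) (at t)"
      using 1 unfolding bump_deriv_def
      by (auto intro!: derivative_eq_intros DERIV_chain2[OF poly_DERIV] simp: field_simps power2_eq_square)
    moreover have "\<forall>\<^sub>F s in nhds t. bump_deriv p s = poly p (1 / s) * exp (- 1 / s)"
      using eventually_nhds_in_open[of "{0<..}" t] 1
      by (auto simp: bump_deriv_def elim!: eventually_mono)
    ultimately show ?thesis by (subst DERIV_cong_ev[OF refl _ refl]) auto
  next
    case 2
    moreover have "\<forall>\<^sub>F s in nhds t. bump_deriv p s = 0"
      using eventually_nhds_in_open[of "{..<0}" t] 2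
      by (auto simp: bump_deriv_def elim!: eventually_mono)
    ultimately show ?thesis by (subst DERIV_cong_ev[OF refl _ refl]) (auto simp: bump_deriv_def)
  next
    case 3
    \<comment> \<open>With r = 1/s the difference quotient at 0 is r p(r) exp(-r), and r tends to
      infinity.\<close>
    have 1: "((\<lambda>s. bump_deriv p s / s) \<longlongrightarrow> 0) (at_right 0)"
    proof (rule Lim_transform_eventually)
      show "((\<lambda>s. poly ([:0,1:] * p) (inverse s) * exp (- (inverse s))) \<longlongrightarrow> 0) (at_right 0)"
        by (rule filterlim_compose[OF tendsto_poly_exp_neg filterlim_inverse_at_top_right])
      show "\<forall>\<^sub>F s in at_right 0. poly ([:0,1:] * p) (inverse s) * exp (- (inverse s)) = bump_deriv p s / s"
        using eventually_at_right_less[of "0::real"]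
        by eventually_elim (simp add: bump_deriv_def field_simps)
    qed
    have 2: "((\<lambda>s. bump_deriv p s / s) \<longlongrightarrow> 0) (at_left 0)"
      by (rule Lim_transform_eventually[OF tendsto_const])
        (auto simp: bump_deriv_def eventually_at_filter)
    have "((\<lambda>s. bump_deriv p s / s) \<longlongrightarrow> 0) (at 0)"
      using 1 2 by (simp add: filterlim_split_at)
    then show ?thesis
      using 3 by (simp add: has_field_derivative_iff bump_deriv_def)
  qed
qed

lemma Ck_scalar_bump:
  assumes "open U" "Ck_scalar k h U"
  shows "Ck_scalar k (\<lambda>x. bump (h x)) U"
proof -
  define Q where "Q = (\<lambda>j. ((\<lambda>p::real poly. [:0,0,1:] * (p - pderiv p)) ^^ j) 1)"
  have "Ck_scalar k (\<lambda>x. bump_deriv (Q 0) (h x)) U"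
    by (rule Ck_scalar_compose[OF assms(1) _ _ assms(2), where S=UNIV and G="\<lambda>j. bump_deriv (Q j)"])
      (use bump_deriv_has_derivative in \<open>auto simp: Q_def\<close>)
  moreover have "bump_deriv (Q 0) = bump" by (auto simp: Q_def bump_deriv_def bump_def)
  ultimately show ?thesis by simp
qed

subsection \<open>Symmetry of second derivatives\<close>

text \<open>The second difference over a small parallelogram is evaluated by two mean value
  theorems, in either order. This gives h^2 times one mixed derivative at a nearby point and h^2
  times the other at another; continuity at \<open>x\<close> makes them equal there.\<close>

lemma second_derivative_symmetric:
  fixes f :: "'a::real_normed_vector \<Rightarrow> real"
  assumes "open U" "x \<in> U"
    and f: "\<And>y. y \<in> U \<Longrightarrow> (f has_derivative f' y) (at y)"
    and fa: "\<And>y. y \<in> U \<Longrightarrow> ((\<lambda>y. f' y a) has_derivative fa' y) (at y)"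
    and fb: "\<And>y. y \<in> U \<Longrightarrow> ((\<lambda>y. f' y b) has_derivative fb' y) (at y)"
    and cont: "continuous_on U (\<lambda>y. fa' y b)" "continuous_on U (\<lambda>y. fb' y a)"
  shows "fa' x b = fb' x a"
proof -
  obtain e where e: "e > 0" "ball x e \<subseteq> U" using assms(1,2) openE by blast
  have main: "\<exists>y\<in>ball x d. \<exists>z\<in>ball x d. fa' y b = fb' z a" if d: "0 < d" "d \<le> e" for d
  proof -
    \<comment> \<open>Small enough for the parallelogram spanned by h a and h b to stay in the ball;
      the added 1 covers a = b = 0.\<close>
    define h where "h = d / (2 * (norm a + norm b + 1))"
    have hp: "h > 0" using d by (auto simp: h_def intro!: divide_pos_pos add_nonneg_pos)
    have "h * (norm a + norm b) < d"
    proof -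
      have "h * (norm a + norm b) \<le> h * (norm a + norm b + 1)" using hp by simp
      also have "\<dots> = d / 2"
      proof -
        have "norm a + norm b + 1 \<noteq> 0"
          by (metis add_nonneg_eq_0_iff add_nonneg_nonneg norm_ge_zero zero_le_one zero_neq_one)
        then show ?thesis unfolding h_def by (simp add: field_simps)
      qed
      finally show ?thesis using d by simp
    qed
    then have inb: "x + s *\<^sub>R a + t *\<^sub>R b \<in> ball x d" if "0 \<le> s" "s \<le> h" "0 \<le> t" "t \<le> h" for s t
    proof -
      have "norm (s *\<^sub>R a + t *\<^sub>R b) \<le> s * norm a + t * norm b"
        using that by (metis abs_of_nonneg norm_scaleR norm_triangle_ineq)
      also have "\<dots> \<le> h * norm a + h * norm b"
        using that by (intro add_mono mult_right_mono) auto
      also have "\<dots> < d" using \<open>h * (norm a + norm b) < d\<close> by (simp add: algebra_simps)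
      finally have "dist (x + (s *\<^sub>R a + t *\<^sub>R b)) x < d" by (simp add: dist_norm)
      then show ?thesis by (simp add: dist_commute add.assoc)
    qed
    have inU: "x + s *\<^sub>R a + t *\<^sub>R b \<in> U" if "0 \<le> s" "s \<le> h" "0 \<le> t" "t \<le> h" for s t
      using inb[OF that] d e by auto
    have chain: "((\<lambda>s. g (p + s *\<^sub>R v)) has_real_derivative g' v) (at s)"
      if "(g has_derivative g') (at (p + s *\<^sub>R v))" for g :: "'a \<Rightarrow> real" and g' p v s
    proof -
      have "((\<lambda>s. p + s *\<^sub>R v) has_derivative (\<lambda>s. s *\<^sub>R v)) (at s)"
        by (auto intro!: derivative_eq_intros)
      from has_derivative_compose[OF this that]
      have "((\<lambda>s. g (p + s *\<^sub>R v)) has_derivative (\<lambda>s. g' (s *\<^sub>R v))) (at s)" .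
      then show ?thesis
        using has_derivative_bounded_linear[OF that]
        by (simp add: has_field_derivative_def linear_simps mult.commute bounded_linear.linear mult_commute_abs)
    qed
    define \<Delta> where "\<Delta> = f (x + h *\<^sub>R a + h *\<^sub>R b) - f (x + h *\<^sub>R a) - f (x + h *\<^sub>R b) + f x"
    have "\<exists>y\<in>ball x d. \<Delta> = h * h * fa' y b"
    proof -
      have inU1: "x + h *\<^sub>R b + s *\<^sub>R a \<in> U" "x + s *\<^sub>R a \<in> U" if "0 \<le> s" "s \<le> h" for s
        using inU[of s h] inU[of s 0] that hp by (auto simp: algebra_simps)
      have "((\<lambda>s. f (x + h *\<^sub>R b + s *\<^sub>R a) - f (x + s *\<^sub>R a)) has_real_derivative
          f' (x + h *\<^sub>R b + s *\<^sub>R a) a - f' (x + s *\<^sub>R a) a) (at s)" if "0 \<le> s" "s \<le> h" for s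
        by (intro DERIV_diff chain[OF f] inU1 that)
      from MVT2[OF hp this] obtain s where s: "0 < s" "s < h"
        "(f (x + h *\<^sub>R b + h *\<^sub>R a) - f (x + h *\<^sub>R a)) - (f (x + h *\<^sub>R b + 0 *\<^sub>R a) - f (x + 0 *\<^sub>R a))
          = (h - 0) * (f' (x + h *\<^sub>R b + s *\<^sub>R a) a - f' (x + s *\<^sub>R a) a)" by blast
      have "((\<lambda>t. f' (x + s *\<^sub>R a + t *\<^sub>R b) a) has_real_derivative fa' (x + s *\<^sub>R a + t *\<^sub>R b) b) (at t)"
        if "0 \<le> t" "t \<le> h" for t
        using chain[OF fa[OF inU[of s t]]] that s by auto
      from MVT2[OF hp this] obtain t where t: "0 < t" "t < h"
        "f' (x + s *\<^sub>R a + h *\<^sub>R b) a - f' (x + s *\<^sub>R a + 0 *\<^sub>R b) a = (h - 0) * fa' (x + s *\<^sub>R a + t *\<^sub>R b) b"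
        by blast
      have e1: "x + h *\<^sub>R b + h *\<^sub>R a = x + h *\<^sub>R a + h *\<^sub>R b" "x + h *\<^sub>R b + s *\<^sub>R a = x + s *\<^sub>R a + h *\<^sub>R b"
        by simp_all
      have "\<Delta> = h * h * fa' (x + s *\<^sub>R a + t *\<^sub>R b) b"
        using s(3) t(3) unfolding e1 by (simp add: \<Delta>_def algebra_simps)
      then show ?thesis using inb[of s t] s t by (auto simp del: mem_ball)
    qed
    moreover have "\<exists>y\<in>ball x d. \<Delta> = h * h * fb' y a"
    proof -
      have inU1: "x + h *\<^sub>R a + s *\<^sub>R b \<in> U" "x + s *\<^sub>R b \<in> U" if "0 \<le> s" "s \<le> h" for s
        using inU[of h s] inU[of 0 s] that hp by (auto simp: algebra_simps)
      have inU2: "x + s *\<^sub>R b + t *\<^sub>R a \<in> U" if "0 \<le> s" "s \<le> h" "0 \<le> t" "t \<le> h" for s t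
        using inU[of t s] that by (auto simp: algebra_simps)
      have "((\<lambda>s. f (x + h *\<^sub>R a + s *\<^sub>R b) - f (x + s *\<^sub>R b)) has_real_derivative
          f' (x + h *\<^sub>R a + s *\<^sub>R b) b - f' (x + s *\<^sub>R b) b) (at s)" if "0 \<le> s" "s \<le> h" for s
        by (intro DERIV_diff chain[OF f] inU1 that)
      from MVT2[OF hp this] obtain s where s: "0 < s" "s < h"
        "(f (x + h *\<^sub>R a + h *\<^sub>R b) - f (x + h *\<^sub>R b)) - (f (x + h *\<^sub>R a + 0 *\<^sub>R b) - f (x + 0 *\<^sub>R b))
          = (h - 0) * (f' (x + h *\<^sub>R a + s *\<^sub>R b) b - f' (x + s *\<^sub>R b) b)" by blast
      have "((\<lambda>t. f' (x + s *\<^sub>R b + t *\<^sub>R a) b) has_real_derivative fb' (x + s *\<^sub>R b + t *\<^sub>R a) a) (at t)"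
        if "0 \<le> t" "t \<le> h" for t
        using chain[OF fb[OF inU2[of s t]]] that s by auto
      from MVT2[OF hp this] obtain t where t: "0 < t" "t < h"
        "f' (x + s *\<^sub>R b + h *\<^sub>R a) b - f' (x + s *\<^sub>R b + 0 *\<^sub>R a) b = (h - 0) * fb' (x + s *\<^sub>R b + t *\<^sub>R a) a"
        by blast
      have e1: "x + h *\<^sub>R a + s *\<^sub>R b = x + s *\<^sub>R b + h *\<^sub>R a" by simp
      have "\<Delta> = h * h * fb' (x + s *\<^sub>R b + t *\<^sub>R a) a"
        using s(3) t(3) unfolding e1 by (simp add: \<Delta>_def algebra_simps)
      moreover have "x + s *\<^sub>R b + t *\<^sub>R a \<in> ball x d"
        using inb[of t s] s t by (simp add: algebra_simps del: mem_ball)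
      ultimately show ?thesis by blast
    qed
    ultimately obtain y z where "y \<in> ball x d" "z \<in> ball x d" "h * h * fa' y b = h * h * fb' z a"
      by metis
    then show ?thesis using hp by (intro bexI[of _ y] bexI[of _ z]) auto
  qed
  show ?thesis
  proof (rule ccontr)
    assume ne: "fa' x b \<noteq> fb' x a"
    \<comment> \<open>Half the supposed gap: equal values cannot lie strictly within \<eta> of both
      of its ends.\<close>
    define \<eta> where "\<eta> = \<bar>fa' x b - fb' x a\<bar> / 2"
    have \<eta>: "\<eta> > 0" using ne by (simp add: \<eta>_def)
    have "isCont (\<lambda>y. fa' y b) x" "isCont (\<lambda>y. fb' y a) x"
      using cont assms(1,2) continuous_on_eq_continuous_at by blast+
    note this[unfolded continuous_at_eps_delta, rule_format, OF \<eta>]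
    then obtain d1 d2 where d1: "d1 > 0" "\<And>y. dist y x < d1 \<Longrightarrow> \<bar>fa' y b - fa' x b\<bar> < \<eta>"
      and d2: "d2 > 0" "\<And>y. dist y x < d2 \<Longrightarrow> \<bar>fb' y a - fb' x a\<bar> < \<eta>"
      unfolding dist_real_def by blast
    obtain y z where "y \<in> ball x (min e (min d1 d2))" "z \<in> ball x (min e (min d1 d2))" "fa' y b = fb' z a"
      using main[of "min e (min d1 d2)"] e d1 d2 by auto
    then have "\<bar>fa' y b - fa' x b\<bar> < \<eta>" "\<bar>fb' z a - fb' x a\<bar> < \<eta>" "fa' y b = fb' z a"
      using d1(2)[of y] d2(2)[of z] by (auto simp: dist_commute)
    then show False unfolding \<eta>_def by (smt (verit) field_sum_of_halves)
  qed
qed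

section \<open>The surface measure\<close>

lemma measurable_sgn[measurable]: "(sgn :: real^3 \<Rightarrow> real^3) \<in> borel_measurable borel"
  unfolding sgn_div_norm by measurable

lemma sets_surface[simp, measurable_cong]: "sets surface = sets borel"
  by (simp add: surface_def)

lemma space_surface[simp]: "space surface = UNIV"
  by (simp add: surface_def)

lemma emeasure_surface:
  assumes [measurable]: "A \<in> sets borel"
  shows "emeasure surface A = 3 * emeasure lborel {x \<in> ball 0 1. sgn x \<in> A}"
proof -
  have [measurable]: "(\<lambda>x. 3 * indicator (ball (0::real^3) 1) x :: ennreal) \<in> borel_measurable borel"
    by (intro borel_measurable_times_ennreal borel_measurable_indicator) auto
  have "emeasure surface A = (\<integral>\<^sup>+x. 3 * indicator (ball 0 1) x * indicator (sgn -` A) x \<partial>lborel)"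
    unfolding surface_def using measurable_sets[OF measurable_sgn assms]
    by (subst emeasure_distr, simp, simp, subst emeasure_density) auto
  also have "\<dots> = (\<integral>\<^sup>+x. 3 * indicator {x \<in> ball 0 1. sgn x \<in> A} x \<partial>lborel)"
    by (intro nn_integral_cong) (auto simp: indicator_def)
  also have "\<dots> = 3 * emeasure lborel {x \<in> ball 0 1. sgn x \<in> A}"
    by (subst nn_integral_cmult_indicator) auto
  finally show ?thesis .
qed

text \<open>Dilation by \<open>R\<close> maps the unit cone over \<open>A\<close> onto this cone and
  multiplies volumes by R^3.\<close>

lemma emeasure_cone_scale:
  assumes [measurable]: "A \<in> sets borel" and R: "R > 0"
  shows "emeasure lborel {x \<in> ball (0::real^3) R. sgn x \<in> A}
    = ennreal (R ^ 3) * emeasure lborel {x \<in> ball 0 1. sgn x \<in> A}"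
proof -
  have "emeasure lborel {x \<in> ball (0::real^3) R. sgn x \<in> A}
    = emeasure (density (distr lborel borel (\<lambda>x. 0 + R *\<^sub>R x)) (\<lambda>_. \<bar>R\<bar>^DIM(real^3))) {x \<in> ball 0 R. sgn x \<in> A}"
    using lborel_affine[of R "0::real^3"] R by simp
  also have "\<dots> = ennreal (R ^ 3) * emeasure (distr lborel borel (\<lambda>x. R *\<^sub>R x)) {x \<in> ball (0::real^3) R. sgn x \<in> A}"
    using R by (subst emeasure_density_const) (auto simp: ennreal_power)
  also have "emeasure (distr lborel borel (\<lambda>x. R *\<^sub>R x)) {x \<in> ball (0::real^3) R. sgn x \<in> A}
      = emeasure lborel ((\<lambda>x. R *\<^sub>R x) -` {x \<in> ball (0::real^3) R. sgn x \<in> A})"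
    by (subst emeasure_distr) auto
  also have "(\<lambda>x. R *\<^sub>R x) -` {x \<in> ball (0::real^3) R. sgn x \<in> A} = {x \<in> ball 0 1. sgn x \<in> A}"
    using R by (auto simp: sgn_scaleR)
  finally show ?thesis .
qed

lemma emeasure_surface_UNIV: "emeasure surface UNIV = ennreal (4 * pi)"
proof -
  have "{x \<in> ball (0::real^3) 1. sgn x \<in> UNIV} = ball 0 1" by auto
  moreover have "unit_ball_vol 3 = 4 / 3 * pi"
    using unit_ball_vol_3 by (simp add: algebra_simps)
  ultimately show ?thesis
    by (subst emeasure_surface) (auto simp: emeasure_ball ennreal_mult'[symmetric] simp flip: ennreal_numeral)
qed

interpretation surface: finite_measure surface
  by standard (simp add: emeasure_surface_UNIV)

lemma measure_surface_UNIV: "measure surface UNIV = 4 * pi"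
  using emeasure_surface_UNIV by (simp add: measure_def)

text \<open>\<open>sgn x\<close> is a unit vector unless x = 0, so the cone over the complement of
  the sphere is a single point. Identities under the integral then have to be checked for unit
  vectors only, although the measure lives on the ambient space.\<close>

lemma AE_surface: "AE x in surface. norm x = 1"
proof -
  have "emeasure surface {x. norm x \<noteq> 1} = 3 * emeasure lborel {x \<in> ball (0::real^3) 1. sgn x \<in> {x. norm x \<noteq> 1}}"
    by (rule emeasure_surface) measurable
  also have "{x \<in> ball (0::real^3) 1. sgn x \<in> {x. norm x \<noteq> 1}} = {0}"
    by (auto simp: norm_sgn split: if_splits)
  finally show ?thesis
    by (intro AE_I[of _ _ "{x. norm x \<noteq> 1}"]) (auto simp: emeasure_lborel_singleton)
qed

lemma AE_surfaceI: "(\<And>x. norm x = 1 \<Longrightarrow> P x) \<Longrightarrow> AE x in surface. P x"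
  using AE_surface by (auto elim: AE_mp)

lemma integral_surface_cong:
  fixes f g :: "real^3 \<Rightarrow> 'b::{banach, second_countable_topology}"
  assumes "f \<in> borel_measurable borel" "g \<in> borel_measurable borel" "\<And>x. norm x = 1 \<Longrightarrow> f x = g x"
  shows "integral\<^sup>L surface f = integral\<^sup>L surface g"
  using assms by (intro integral_cong_AE AE_surfaceI) auto

lemma integrable_surface_bounded:
  fixes f :: "real^3 \<Rightarrow> 'b::{banach, second_countable_topology}"
  assumes "f \<in> borel_measurable borel" "\<And>x. norm x = 1 \<Longrightarrow> norm (f x) \<le> B"
  shows "integrable surface f"
  using assms by (intro surface.integrable_const_bound[where B=B] AE_surfaceI) auto

text \<open>Extensions constant along rays are in general discontinuous at the origin; one
  exceptional point does not affect measurability.\<close>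

lemma borel_measurable_punctured:
  fixes f :: "real^3 \<Rightarrow> 'b::{real_normed_vector, second_countable_topology}"
  assumes "continuous_on (- {0}) f"
  shows "f \<in> borel_measurable borel"
  by (rule borel_measurable_continuous_countable_exceptions[of "{0}"]) (use assms in auto)

lemma bounded_on_sphere:
  fixes f :: "real^3 \<Rightarrow> 'b::real_normed_vector"
  assumes "continuous_on (- {0}) f"
  obtains B where "\<And>x. norm x = 1 \<Longrightarrow> norm (f x) \<le> B"
proof -
  have "compact (f ` sphere 0 1)"
    by (intro compact_continuous_image compact_sphere continuous_on_subset[OF assms]) auto
  then have "bounded (f ` sphere 0 1)" by (rule compact_imp_bounded)
  then obtain B where "\<forall>x\<in>f ` sphere 0 1. norm x \<le> B" by (auto simp: bounded_iff)
  then show ?thesis by (intro that[of B]) auto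
qed

lemma integrable_surface:
  fixes f :: "real^3 \<Rightarrow> 'b::{banach, second_countable_topology}"
  assumes "continuous_on (- {0}) f"
  shows "integrable surface f"
  by (rule bounded_on_sphere[OF assms], rule integrable_surface_bounded[OF borel_measurable_punctured[OF assms]])

subsection \<open>Polar coordinates\<close>

definition radial :: "real measure" where
  "radial = density lborel (\<lambda>r. ennreal (r\<^sup>2) * indicator {0<..} r)"

lemma sets_radial[simp, measurable_cong]: "sets radial = sets borel"
  by (simp add: radial_def)

lemma space_radial[simp]: "space radial = UNIV"
  by (simp add: radial_def)

text \<open>For R \<le> 0 the right-hand side is 0 as well, since \<open>ennreal\<close> truncates
  negative numbers; one formula thus serves all half-lines of the generator.\<close>

lemma emeasure_radial: "emeasure radial {..<R} = ennreal (R ^ 3 / 3)"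
proof (cases "R > 0")
  case True
  have "emeasure radial {..<R} = (\<integral>\<^sup>+r. ennreal (r\<^sup>2) * indicator {0..R} r \<partial>lborel)"
    unfolding radial_def
  proof (subst emeasure_density)
    have "AE r in lborel. r \<noteq> 0 \<and> r \<noteq> R"
      using AE_lborel_singleton[of 0] AE_lborel_singleton[of R] by eventually_elim auto
    then show "(\<integral>\<^sup>+r. ennreal (r\<^sup>2) * indicator {0<..} r * indicator {..<R} r \<partial>lborel)
        = (\<integral>\<^sup>+r. ennreal (r\<^sup>2) * indicator {0..R} r \<partial>lborel)"
    proof (intro nn_integral_cong_AE)
      assume "AE r in lborel. r \<noteq> 0 \<and> r \<noteq> R"
      then show "AE r in lborel. ennreal (r\<^sup>2) * indicator {0<..} r * indicator {..<R} r
          = ennreal (r\<^sup>2) * indicator {0..R} r"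
        by eventually_elim (auto split: split_indicator)
    qed
  qed auto
  also have "\<dots> = ennreal (R ^ 3 / 3 - 0 ^ 3 / 3)"
    by (rule nn_integral_FTC_Icc) (use True in \<open>auto intro!: derivative_eq_intros\<close>)
  finally show ?thesis by simp
next
  case False
  have "emeasure radial {..<R} = (\<integral>\<^sup>+r. ennreal (r\<^sup>2) * indicator {0<..} r * indicator {..<R} r \<partial>lborel)"
    unfolding radial_def by (simp add: emeasure_density)
  also have "\<dots> = (\<integral>\<^sup>+(r::real). 0 \<partial>lborel)"
    using False by (intro nn_integral_cong) (simp split: split_indicator)
  finally have "emeasure radial {..<R} = 0" by simp
  moreover have "R ^ 3 \<le> 0" using False by (simp add: power_le_zero_eq)
  ultimately show ?thesis by (simp add: ennreal_neg)
qed

lemma sigma_finite_radial: "sigma_finite_measure radial"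
proof
  show "\<exists>A. countable A \<and> A \<subseteq> sets radial \<and> \<Union> A = space radial \<and> (\<forall>a\<in>A. emeasure radial a \<noteq> \<infinity>)"
    by (intro exI[of _ "range (\<lambda>n::nat. {..<real n})"])
      (auto simp: emeasure_radial intro: reals_Archimedean2)
qed

text \<open>For fixed \<open>B\<close> both sides are measures in \<open>A\<close>. They agree on
  the half-lines {..<R} by the scaling of cones, and these form an intersection-stable
  generator.\<close>

lemma emeasure_polar:
  assumes [measurable]: "A \<in> sets borel" "B \<in> sets borel"
  shows "emeasure lborel {x::real^3. norm x \<in> A \<and> sgn x \<in> B} = emeasure radial A * emeasure surface B"
proof -
  define M where "M = distr (density lborel (\<lambda>x. indicator B (sgn x :: real^3))) borel norm"
  define N where "N = density radial (\<lambda>_. emeasure surface B)"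
  have M: "emeasure M X = emeasure lborel {x::real^3. norm x \<in> X \<and> sgn x \<in> B}" if [measurable]: "X \<in> sets borel" for X
  proof -
    have "emeasure M X = (\<integral>\<^sup>+x. indicator B (sgn x) * indicator (norm -` X) x \<partial>lborel)"
      unfolding M_def using measurable_sets[of norm "borel :: (real^3) measure" borel X, OF _ that]
      by (subst emeasure_distr, simp, simp, subst emeasure_density) auto
    also have "\<dots> = (\<integral>\<^sup>+x. indicator {x. norm x \<in> X \<and> sgn x \<in> B} x \<partial>lborel)"
      by (intro nn_integral_cong) (auto simp: indicator_def)
    also have "\<dots> = emeasure lborel {x. norm x \<in> X \<and> sgn x \<in> B}"
      by (rule nn_integral_indicator) measurable
    finally show ?thesis .
  qed
  have N: "emeasure N X = emeasure radial X * emeasure surface B" if "X \<in> sets borel" for X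
    unfolding N_def using that by (subst emeasure_density_const) (auto simp: mult.commute)
  have eq: "emeasure M {..<R} = emeasure N {..<R}" for R
  proof (cases "R > 0")
    case True
    have "emeasure M {..<R} = emeasure lborel {x \<in> ball (0::real^3) R. sgn x \<in> B}"
      by (subst M) (auto intro!: arg_cong[where f="emeasure lborel"])
    also have "\<dots> = ennreal (R ^ 3) * emeasure lborel {x \<in> ball 0 1. sgn x \<in> B}"
      by (rule emeasure_cone_scale) (use True in auto)
    also have "\<dots> = ennreal (R ^ 3 / 3) * emeasure surface B"
      using True by (subst emeasure_surface)
        (auto simp: mult.assoc[symmetric] ennreal_mult'[symmetric] simp flip: ennreal_numeral)
    finally show ?thesis by (subst N) (auto simp: emeasure_radial)
  next
    case False
    have e0: "{x::real^3. norm x \<in> {..<R} \<and> sgn x \<in> B} = {}"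
      using False by (auto dest: le_less_trans[OF norm_ge_zero])
    have "emeasure M {..<R} = 0" using M[of "{..<R}"] unfolding e0 by simp
    moreover have "R ^ 3 \<le> 0" using False by (simp add: power_le_zero_eq)
    ultimately show ?thesis by (simp add: N emeasure_radial ennreal_neg)
  qed
  have "M = N"
  proof (rule measure_eqI_generator_eq[where \<Omega>=UNIV and E="range lessThan" and A="\<lambda>n. {..<real n}"])
    show "Int_stable (range (lessThan :: real \<Rightarrow> _))"
      by (auto simp: Int_stable_def image_iff intro: exI[of _ "min _ _"])
    show "sets M = sigma_sets UNIV (range lessThan)"
      unfolding M_def by (simp, subst borel_Iio) simp
    show "sets N = sigma_sets UNIV (range lessThan)"
      unfolding N_def by (simp, subst borel_Iio) simp
    show "emeasure M {..<real n} \<noteq> \<infinity>" for n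
      unfolding eq by (simp add: N emeasure_radial ennreal_mult_eq_top_iff)
    show "(\<Union>n. {..<real n}) = UNIV" by (auto intro: reals_Archimedean2)
  qed (use eq in auto)
  then show ?thesis using M[of A] N[of A] by simp
qed

lemma polar_distr: "radial \<Otimes>\<^sub>M surface = distr lborel (borel \<Otimes>\<^sub>M borel) (\<lambda>x::real^3. (norm x, sgn x))"
proof (rule pair_measure_eqI)
  fix A B assume "A \<in> sets radial" "B \<in> sets surface"
  then have [measurable]: "A \<in> sets borel" "B \<in> sets borel" by auto
  have "emeasure (distr lborel (borel \<Otimes>\<^sub>M borel) (\<lambda>x::real^3. (norm x, sgn x))) (A \<times> B)
      = emeasure lborel {x::real^3. norm x \<in> A \<and> sgn x \<in> B}"
    by (subst emeasure_distr) (auto intro!: arg_cong[where f="emeasure lborel"])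
  then show "emeasure radial A * emeasure surface B
    = emeasure (distr lborel (borel \<Otimes>\<^sub>M borel) (\<lambda>x::real^3. (norm x, sgn x))) (A \<times> B)"
    by (simp add: emeasure_polar)
qed (auto simp: sigma_finite_radial surface.sigma_finite_measure_axioms intro!: sets_pair_measure_cong)

lemma polar_integral:
  fixes g :: "real \<Rightarrow> real" and h :: "real^3 \<Rightarrow> real"
  assumes [measurable]: "g \<in> borel_measurable borel" "h \<in> borel_measurable borel"
    and g: "integrable radial g" and h: "integrable surface h"
  shows "integrable lborel (\<lambda>x::real^3. g (norm x) * h (sgn x))"
    and "(LINT x|lborel. g (norm x) * h (sgn x)) = (LINT r|radial. g r) * (LINT x|surface. h x)"
proof -
  interpret R: sigma_finite_measure radial by (rule sigma_finite_radial)
  interpret P: pair_sigma_finite radial surface ..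
  have i: "integrable (radial \<Otimes>\<^sub>M surface) (\<lambda>(r, x). g r * h x)"
    by (rule P.Fubini_integrable) (use g h in \<open>auto simp: abs_mult\<close>)
  have m: "(\<lambda>x::real^3. (norm x, sgn x)) \<in> lborel \<rightarrow>\<^sub>M borel \<Otimes>\<^sub>M borel" by measurable
  show "integrable lborel (\<lambda>x::real^3. g (norm x) * h (sgn x))"
    using i unfolding polar_distr by (subst (asm) integrable_distr_eq[OF m]) auto
  have "(LINT x|lborel. g (norm x) * h (sgn x)) = integral\<^sup>L (radial \<Otimes>\<^sub>M surface) (\<lambda>(r, x). g r * h x)"
    unfolding polar_distr by (subst integral_distr[OF m]) auto
  also have "\<dots> = (LINT r|radial. LINT x|surface. g r * h x)"
    using P.integral_fst[OF i] by simp
  finally show "(LINT x|lborel. g (norm x) * h (sgn x)) = (LINT r|radial. g r) * (LINT x|surface. h x)"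
    by simp
qed

subsection \<open>The divergence theorem on the sphere\<close>

text \<open>By translation invariance every difference quotient of \<open>G\<close> has integral 0.
  The quotients are bounded and supported in a common ball, so dominated convergence passes to the
  derivative.\<close>

lemma integral_derivative_compact_support:
  fixes G :: "'a::euclidean_space \<Rightarrow> real"
  assumes G: "\<And>x. (G has_derivative DG x) (at x)"
    and cont: "continuous_on UNIV (\<lambda>x. DG x e)"
    and supp: "\<And>x. norm x \<ge> R \<Longrightarrow> G x = 0"
  shows "integrable lborel (\<lambda>x. DG x e)" "(LINT x|lborel. DG x e) = 0"
proof -
  define t where "t n = 1 / real (Suc n)" for n
  have t: "0 < t n" "t n \<le> 1" for n by (auto simp: t_def)
  have Gc: "continuous_on UNIV G"
    by (meson G continuous_at_imp_continuous_on has_derivative_continuous)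
  have [measurable]: "G \<in> borel_measurable borel" "(\<lambda>x. DG x e) \<in> borel_measurable borel"
    using Gc cont by (auto intro: borel_measurable_continuous_onI)
  define q where "q n x = (G (x + t n *\<^sub>R e) - G x) / t n" for n x
  have [measurable]: "q n \<in> borel_measurable borel" for n unfolding q_def by measurable
  have line: "((\<lambda>s. G (x + s *\<^sub>R e)) has_real_derivative DG (x + s *\<^sub>R e) e) (at s)" for x s
  proof -
    have "((\<lambda>s. x + s *\<^sub>R e) has_derivative (\<lambda>s. s *\<^sub>R e)) (at s)"
      by (auto intro!: derivative_eq_intros)
    from has_derivative_compose[OF this G]
    have "((\<lambda>s. G (x + s *\<^sub>R e)) has_derivative (\<lambda>r. DG (x + s *\<^sub>R e) (r *\<^sub>R e))) (at s)" .
    moreover have "(\<lambda>r. DG (x + s *\<^sub>R e) (r *\<^sub>R e)) = (*) (DG (x + s *\<^sub>R e) e)"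
      using linear_scale[OF has_derivative_linear[OF G]] by (auto simp: mult.commute)
    ultimately show ?thesis by (simp add: has_field_derivative_def)
  qed
  \<comment> \<open>The radius leaves room for the intermediate point of the mean value theorem,
    which lies within |e| of a point of the ball of radius |R| + |e|.\<close>
  obtain B where B: "\<And>x. x \<in> cball 0 (\<bar>R\<bar> + 2 * norm e) \<Longrightarrow> \<bar>DG x e\<bar> \<le> B"
  proof -
    have "compact ((\<lambda>x. DG x e) ` cball 0 (\<bar>R\<bar> + 2 * norm e))"
      by (intro compact_continuous_image compact_cball continuous_on_subset[OF cont]) auto
    then show ?thesis using that compact_imp_bounded by (fastforce simp: bounded_iff)
  qed
  have bound: "\<bar>q n x\<bar> \<le> B * indicator (cball 0 (\<bar>R\<bar> + norm e)) x" for n x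
  proof (cases "x \<in> cball 0 (\<bar>R\<bar> + norm e)")
    case True
    obtain s where s: "0 < s" "s < t n"
      "G (x + t n *\<^sub>R e) - G (x + 0 *\<^sub>R e) = (t n - 0) * DG (x + s *\<^sub>R e) e"
      using MVT2[OF t(1)[of n], of "\<lambda>s. G (x + s *\<^sub>R e)" "\<lambda>s. DG (x + s *\<^sub>R e) e"] line by blast
    have "norm (x + s *\<^sub>R e) \<le> norm x + s * norm e"
      using s(1) norm_triangle_ineq[of x "s *\<^sub>R e"] by simp
    also have "\<dots> \<le> (\<bar>R\<bar> + norm e) + 1 * norm e"
      using True s t(2)[of n] by (intro add_mono mult_right_mono) auto
    finally have "\<bar>DG (x + s *\<^sub>R e) e\<bar> \<le> B" by (intro B) auto
    moreover have "q n x = DG (x + s *\<^sub>R e) e"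
      using s(3) t(1)[of n] by (simp add: q_def)
    ultimately show ?thesis using True by simp
  next
    case False
    then have x: "norm x > \<bar>R\<bar> + norm e" by auto
    have "norm x \<le> norm (x + t n *\<^sub>R e) + norm (t n *\<^sub>R e)"
      by (metis add_diff_cancel norm_triangle_ineq4)
    also have "norm (t n *\<^sub>R e) \<le> norm e"
      using t(1)[of n] t(2)[of n] by (simp add: mult_left_le_one_le)
    finally have "norm (x + t n *\<^sub>R e) \<ge> R" "norm x \<ge> R" using x norm_ge_zero[of e] by linarith+
    then show ?thesis using False by (simp add: q_def supp)
  qed
  have fin: "emeasure lborel (cball (0::'a) r) < top" for r
    using emeasure_lborel_cball_finite[of "0::'a" r] by simp
  have ib: "integrable lborel (\<lambda>x::'a. B * indicator (cball 0 (\<bar>R\<bar> + norm e)) x)"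
    by (intro integrable_mult_right integrable_real_indicator) (auto simp: fin)
  have lim: "(\<lambda>n. q n x) \<longlonglongrightarrow> DG x e" for x
  proof -
    have "((\<lambda>h. (G (x + h *\<^sub>R e) - G x) / h) \<longlongrightarrow> DG x e) (at 0)"
      using line[of x 0] by (simp add: DERIV_def)
    moreover have "filterlim t (at 0) sequentially"
    proof (subst filterlim_at, intro conjI)
      show "t \<longlonglongrightarrow> 0" unfolding t_def by (rule LIMSEQ_Suc[OF lim_1_over_n])
    qed (use t(1) in \<open>auto simp: less_imp_neq[symmetric] intro!: always_eventually\<close>)
    ultimately show ?thesis unfolding q_def by (rule filterlim_compose)
  qed
  have dom: "integrable lborel (\<lambda>x. DG x e)" "(\<lambda>n. integral\<^sup>L lborel (q n)) \<longlonglongrightarrow> (LINT x|lborel. DG x e)"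
    using integrable_dominated_convergence[OF _ _ ib, of "\<lambda>x. DG x e" q]
      integral_dominated_convergence[OF _ _ ib, of "\<lambda>x. DG x e" q] lim bound by auto
  have iG: "integrable lborel G"
  proof -
    obtain C where C: "\<And>x. x \<in> cball 0 \<bar>R\<bar> \<Longrightarrow> \<bar>G x\<bar> \<le> C"
    proof -
      have "compact (G ` cball 0 \<bar>R\<bar>)"
        by (intro compact_continuous_image compact_cball continuous_on_subset[OF Gc]) auto
      then show ?thesis using that compact_imp_bounded by (fastforce simp: bounded_iff)
    qed
    show ?thesis
    proof (rule Bochner_Integration.integrable_bound)
      show "integrable lborel (\<lambda>x::'a. C * indicator (cball 0 \<bar>R\<bar>) x)"
        by (intro integrable_mult_right integrable_real_indicator) (auto simp: fin)
      show "AE x in lborel. norm (G x) \<le> norm (C * indicator (cball 0 \<bar>R\<bar>) x)"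
      proof (intro AE_I2)
        fix x :: 'a
        show "norm (G x) \<le> norm (C * indicator (cball 0 \<bar>R\<bar>) x)"
          using C[of x] supp[of x] by (cases "x \<in> cball 0 \<bar>R\<bar>") auto
      qed
    qed auto
  qed
  have "integral\<^sup>L lborel (q n) = 0" for n
  proof -
    have d: "distr lborel borel (\<lambda>x. t n *\<^sub>R e + x) = lborel"
      using lborel_distr_plus[of "t n *\<^sub>R e"] by simp
    have s: "integrable lborel (\<lambda>x. G (t n *\<^sub>R e + x))"
      using iG by (subst (asm) d[symmetric], subst (asm) integrable_distr_eq) auto
    have "integral\<^sup>L lborel G = (LINT x|lborel. G (t n *\<^sub>R e + x))"
      by (subst d[symmetric], subst integral_distr) auto
    then show ?thesis
      unfolding q_def using iG s by (simp add: add.commute)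
  qed
  with dom show "integrable lborel (\<lambda>x. DG x e)" "(LINT x|lborel. DG x e) = 0"
    by (simp_all add: LIMSEQ_const_iff)
qed

text \<open>A field of degree -1 has a derivative of degree -2, by differentiating the homogeneity
  relation in x. The divergence at any point is thereby reduced to its value on the sphere.\<close>

lemma has_derivative_homogeneous:
  assumes W: "\<And>x. x \<noteq> 0 \<Longrightarrow> (W has_derivative DW x) (at x)"
    and hom: "\<And>x c. x \<noteq> 0 \<Longrightarrow> c > 0 \<Longrightarrow> W (c *\<^sub>R x) = W x /\<^sub>R c"
    and "x \<noteq> 0" "c > 0"
  shows "DW (c *\<^sub>R x) h = DW x h /\<^sub>R c\<^sup>2"
proof -
  have "((\<lambda>x. c *\<^sub>R x) has_derivative (\<lambda>h. c *\<^sub>R h)) (at x)" by (auto intro!: derivative_eq_intros)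
  from has_derivative_compose[OF this W]
  have "((\<lambda>x. W (c *\<^sub>R x)) has_derivative (\<lambda>h. DW (c *\<^sub>R x) (c *\<^sub>R h))) (at x)" using assms by auto
  moreover have "((\<lambda>x. W (c *\<^sub>R x)) has_derivative (\<lambda>h. DW x h /\<^sub>R c)) (at x)"
  proof (rule has_derivative_transform_within_open)
    show "((\<lambda>x. W x /\<^sub>R c) has_derivative (\<lambda>h. DW x h /\<^sub>R c)) (at x)"
      by (intro has_derivative_scaleR_right W assms)
    show "open (- {0::'a})" "x \<in> - {0}" using assms by auto
  qed (use assms in auto)
  ultimately have "(\<lambda>h. DW (c *\<^sub>R x) (c *\<^sub>R h)) = (\<lambda>h. DW x h /\<^sub>R c)" by (rule has_derivative_unique)
  then have "DW (c *\<^sub>R x) (c *\<^sub>R h) = DW x h /\<^sub>R c" by metis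
  moreover have "DW (c *\<^sub>R x) (c *\<^sub>R h) = c *\<^sub>R DW (c *\<^sub>R x) h"
    using linear_scale[OF has_derivative_linear[OF W[of "c *\<^sub>R x"]]] assms by auto
  ultimately have "c *\<^sub>R DW (c *\<^sub>R x) h = DW x h /\<^sub>R c" by simp
  then have "(c *\<^sub>R DW (c *\<^sub>R x) h) /\<^sub>R c = (DW x h /\<^sub>R c) /\<^sub>R c" by simp
  then have "DW (c *\<^sub>R x) h = (DW x h /\<^sub>R c) /\<^sub>R c" using assms(4) by simp
  then show ?thesis by (simp add: power2_eq_square)
qed

text \<open>The divergence theorem in the ambient space, applied to \<open>W\<close> times a radial cutoff: both
  radial integrals are multiples of the integral of the cutoff.\<close>

theorem sphere_divergence:
  fixes W :: "real^3 \<Rightarrow> real^3"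
  assumes W: "\<And>x. x \<noteq> 0 \<Longrightarrow> (W has_derivative DW x) (at x)"
    and cont: "\<And>b. b \<in> Basis \<Longrightarrow> continuous_on (- {0}) (\<lambda>x. DW x b)"
    and hom: "\<And>x c. x \<noteq> 0 \<Longrightarrow> c > 0 \<Longrightarrow> W (c *\<^sub>R x) = W x /\<^sub>R c"
  shows "(LINT x|surface. (\<Sum>b\<in>Basis. DW x b \<bullet> b)) = (LINT x|surface. W x \<bullet> x)"
proof -
  \<comment> \<open>(r - 1)(2 - r) is positive exactly on (1, 2), so this smooth cutoff stays away
    from the origin, where \<open>W\<close> is singular.\<close>
  define \<rho> \<rho>' where "\<rho> r = bump ((r - 1) * (2 - r))" and
    "\<rho>' r = bump_deriv ([:0,0,1:] * (1 - pderiv 1)) ((r - 1) * (2 - r)) * (3 - 2 * r)" for r :: real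
  have bd: "bump = bump_deriv 1" by (auto simp: bump_def bump_deriv_def)
  have \<rho>: "(\<rho> has_real_derivative \<rho>' r) (at r)" for r
    unfolding \<rho>_def \<rho>'_def bd
    by (rule DERIV_cong[OF DERIV_chain2[OF bump_deriv_has_derivative, where g="\<lambda>r. (r - 1) * (2 - r)"]])
      (rule derivative_eq_intros refl | simp)+
  have cbd: "continuous_on UNIV (bump_deriv p)" for p
    by (meson DERIV_isCont bump_deriv_has_derivative continuous_at_imp_continuous_on)
  have c\<rho>: "continuous_on UNIV \<rho>" "continuous_on UNIV \<rho>'"
    unfolding \<rho>_def \<rho>'_def bd
    by (intro continuous_intros continuous_on_compose2[OF cbd]; simp)+
  have [measurable]: "\<rho> \<in> borel_measurable borel" "\<rho>' \<in> borel_measurable borel"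
    using c\<rho> by (auto intro: borel_measurable_continuous_onI)
  have out: "\<rho> r = 0" "\<rho>' r = 0" if "r \<notin> {1<..<2}" for r
  proof -
    have "\<not> (r - 1) * (2 - r) > 0" using that by (auto simp: zero_less_mult_iff)
    then show "\<rho> r = 0" "\<rho>' r = 0" by (simp_all add: \<rho>_def \<rho>'_def bump_def bump_deriv_def)
  qed
  have \<rho>0: "\<rho> r \<ge> 0" for r by (simp add: \<rho>_def bump_def)
  have cW: "continuous_on (- {0}) W"
    by (intro continuous_at_imp_continuous_on ballI has_derivative_continuous[OF W]) auto
  define d where "d x = (\<Sum>b\<in>Basis. DW x b \<bullet> b)" for x
  define F where "F x = W x \<bullet> x" for x
  have cdF: "continuous_on (- {0}) d" "continuous_on (- {0}) F"
    unfolding d_def F_def by (intro continuous_intros cont cW; simp)+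
  have bounded: "integrable lborel g" if [measurable]: "g \<in> borel_measurable borel"
    and g: "\<And>r. r \<notin> {1<..<2} \<Longrightarrow> g r = 0" "continuous_on {1..2} g" for g :: "real \<Rightarrow> real"
  proof -
    have "integrable lborel (\<lambda>r. indicator {1..2} r *\<^sub>R g r)"
      using borel_integrable_atLeastAtMost'[OF g(2)] by (simp add: set_integrable_def)
    moreover have "(\<lambda>r. indicator {1..2} r *\<^sub>R g r) = g"
    proof
      show "indicator {1..2} r *\<^sub>R g r = g r" for r
        using g(1)[of r] by (cases "r \<in> {1..2}") auto
    qed
    ultimately show ?thesis by simp
  qed
  have radial: "(LINT r|radial. g r) = (LINT r|lborel. r\<^sup>2 * g r)" "integrable radial g"
    if [measurable]: "g \<in> borel_measurable borel" and g: "\<And>r. r \<notin> {1<..<2} \<Longrightarrow> g r = 0" "continuous_on {1..2} g" for g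
  proof -
    have eq: "radial = density lborel (\<lambda>r. ennreal (indicator {0<..} r * r\<^sup>2))"
      unfolding radial_def by (intro density_cong) (auto simp: indicator_def)
    have m: "(\<lambda>r. indicator {0<..} r * r\<^sup>2) \<in> borel_measurable (lborel :: real measure)" by measurable
    have e2: "indicator {0<..} r * r\<^sup>2 * g r = r\<^sup>2 * g r" for r
      using g(1)[of r] by (auto simp: indicator_def)
    show "(LINT r|radial. g r) = (LINT r|lborel. r\<^sup>2 * g r)"
    proof -
      have "(LINT r|radial. g r) = (LINT r|lborel. (indicator {0<..} r * r\<^sup>2) *\<^sub>R g r)"
        unfolding eq by (rule integral_density) (use m in auto)
      then show ?thesis by (simp only: real_scaleR_def e2)
    qed
    have "integrable lborel (\<lambda>r. r\<^sup>2 * g r)"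
      by (rule bounded) (use g in \<open>auto intro!: continuous_intros\<close>)
    then show "integrable radial g"
      unfolding eq using integrable_density[of g lborel "\<lambda>r. indicator {0<..} r * r\<^sup>2"] m
      by (simp only: real_scaleR_def e2) (simp add: that(1))
  qed
  have c12: "continuous_on {1..2} \<rho>" "continuous_on {1..2} \<rho>'"
    using c\<rho> continuous_on_subset by blast+
  have rad1: "(LINT r|radial. \<rho>' r / r) = (LINT r|lborel. r * \<rho>' r)" "integrable radial (\<lambda>r. \<rho>' r / r)"
  proof -
    have e: "r\<^sup>2 * (\<rho>' r / r) = r * \<rho>' r" for r by (simp add: power2_eq_square)
    have c: "continuous_on {1..2} (\<lambda>r. \<rho>' r / r)" using c12 by (intro continuous_intros) auto
    show "(LINT r|radial. \<rho>' r / r) = (LINT r|lborel. r * \<rho>' r)" "integrable radial (\<lambda>r. \<rho>' r / r)"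
    proof -
      have m: "(\<lambda>r. \<rho>' r / r) \<in> borel_measurable borel" by measurable
      have z: "\<rho>' r / r = 0" if "r \<notin> {1<..<2}" for r using out(2)[OF that] by simp
      show "(LINT r|radial. \<rho>' r / r) = (LINT r|lborel. r * \<rho>' r)"
        by (subst e[symmetric], rule radial(1)[OF m _ c]) (rule z)
      show "integrable radial (\<lambda>r. \<rho>' r / r)" by (rule radial(2)[OF m _ c]) (rule z)
    qed
  qed
  have rad2: "(LINT r|radial. \<rho> r / r\<^sup>2) = (LINT r|lborel. \<rho> r)" "integrable radial (\<lambda>r. \<rho> r / r\<^sup>2)"
  proof -
    have "r\<^sup>2 * (\<rho> r / r\<^sup>2) = \<rho> r" for r using out[of 0] by (cases "r = 0") auto
    note e = this
    have c: "continuous_on {1..2} (\<lambda>r. \<rho> r / r\<^sup>2)" using c12 by (intro continuous_intros) auto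
    show "(LINT r|radial. \<rho> r / r\<^sup>2) = (LINT r|lborel. \<rho> r)" "integrable radial (\<lambda>r. \<rho> r / r\<^sup>2)"
    proof -
      have m: "(\<lambda>r. \<rho> r / r\<^sup>2) \<in> borel_measurable borel" by measurable
      have z: "\<rho> r / r\<^sup>2 = 0" if "r \<notin> {1<..<2}" for r using out(1)[OF that] by simp
      show "(LINT r|radial. \<rho> r / r\<^sup>2) = (LINT r|lborel. \<rho> r)"
        by (subst e[symmetric], rule radial(1)[OF m _ c]) (rule z)
      show "integrable radial (\<lambda>r. \<rho> r / r\<^sup>2)" by (rule radial(2)[OF m _ c]) (rule z)
    qed
  qed
  have i\<rho>: "integrable lborel \<rho>" "integrable lborel (\<lambda>r. r * \<rho>' r)"
    by (intro bounded continuous_intros c12; simp add: out)+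
  have pos: "(LINT r|lborel. \<rho> r) > 0"
  proof -
    \<comment> \<open>On the middle half of [1, 2] the product (r - 1)(2 - r) is at least 3/16,
      hence \<open>\<rho>\<close> is at least exp(-16/3).\<close>
    have "0 < (LINT (r::real)|lborel. exp (- 16 / 3) * indicator {5/4..7/4} r :: real)" by simp
    also have "\<dots> \<le> (LINT r|lborel. \<rho> r)"
    proof (rule integral_mono)
      fix r :: real
      show "exp (- 16 / 3) * indicator {5/4..7/4} r \<le> \<rho> r"
      proof (cases "r \<in> {5/4..7/4}")
        case True
        have "0 \<le> (r - 5/4) * (7/4 - r)" using True by auto
        then have ge: "3 / 16 \<le> (r - 1) * (2 - r)" by (simp add: algebra_simps)
        then have "1 / ((r - 1) * (2 - r)) \<le> 16 / 3" by (simp add: divide_le_eq mult.commute)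
        then show ?thesis using True ge by (simp add: \<rho>_def bump_def)
      qed (use \<rho>0 in auto)
    next
      show "integrable lborel (\<lambda>r::real. exp (- 16 / 3) * indicator {5/4..7/4} r :: real)"
        by (intro integrable_mult_right integrable_real_indicator emeasure_bounded_finite) auto
    qed (rule i\<rho>)
    finally show ?thesis .
  qed
  \<comment> \<open>The derivative of r \<rho>(r) integrates to 0. This makes the two radial
    integrals opposite, so that a common nonzero factor can be cancelled at the end.\<close>
  have ibp: "(LINT r|lborel. r * \<rho>' r) = - (LINT r|lborel. \<rho> r)"
  proof -
    have D: "((\<lambda>r. r * \<rho> r) has_derivative (\<lambda>h. h * (\<rho> r + r * \<rho>' r))) (at r)" for r
    proof -
      have "((\<lambda>r. r * \<rho> r) has_real_derivative \<rho> r + r * \<rho>' r) (at r)"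
        using DERIV_mult[OF DERIV_ident \<rho>[of r]] by (simp add: mult.commute add.commute)
      then show ?thesis unfolding has_field_derivative_def by (simp only: mult_commute_abs)
    qed
    have "(LINT r|lborel. 1 * (\<rho> r + r * \<rho>' r)) = 0"
    proof (rule integral_derivative_compact_support(2)[where e=1 and R=2, OF D])
      show "continuous_on UNIV (\<lambda>r. 1 * (\<rho> r + r * \<rho>' r))"
        by (intro continuous_intros c\<rho>)
      show "r * \<rho> r = 0" if "2 \<le> norm r" for r :: real
      proof -
        have "r \<notin> {1<..<2}" using that by auto
        then show ?thesis using out(1) by simp
      qed
    qed
    then show ?thesis using i\<rho> by simp
  qed
  define G where "G b x = \<rho> (norm x) * (W x \<bullet> b)" for b x
  define DG where "DG b x h = (if x = 0 then 0 else
      \<rho>' (norm x) * (sgn x \<bullet> h) * (W x \<bullet> b) + \<rho> (norm x) * (DW x h \<bullet> b))" for b x h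
  have near0: "\<forall>\<^sub>F y in nhds (0::real^3). norm y < 1"
    using eventually_nhds_in_open[of "ball (0::real^3) 1" 0] by (auto elim: eventually_mono)
  have G: "(G b has_derivative DG b x) (at x)" for b x
  proof (cases "x = 0")
    case True
    have "(G b has_derivative (\<lambda>h. 0)) (at 0)"
    proof (rule has_derivative_transform_within_open[OF has_derivative_const[of 0]])
      show "open (ball (0::real^3) 1)" "0 \<in> ball (0::real^3) 1" by auto
      show "0 = G b y" if "y \<in> ball 0 1" for y using that by (simp add: G_def out)
    qed
    then show ?thesis using True by (simp add: DG_def[abs_def])
  next
    case False
    have "((\<lambda>x. \<rho> (norm x)) has_derivative (\<lambda>h. \<rho>' (norm x) * (sgn x \<bullet> h))) (at x)"
      using has_derivative_compose[OF has_derivative_norm[OF False] \<rho>[THEN has_field_derivative_imp_has_derivative]]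
      by (simp add: inner_commute mult.commute)
    then show ?thesis
      unfolding G_def[abs_def] DG_def[abs_def] using False
      by (auto intro!: derivative_eq_intros W simp: algebra_simps)
  qed
  have cDG: "continuous_on UNIV (\<lambda>x. DG b x b)" if "b \<in> Basis" for b
  proof -
    have "isCont (\<lambda>x. DG b x b) x" for x
    proof (cases "x = 0")
      case True
      have "\<forall>\<^sub>F y in nhds 0. DG b y b = 0"
        using near0 by eventually_elim (simp add: DG_def out)
      then have "isCont (\<lambda>x. DG b x b) 0 = isCont (\<lambda>x. 0::real) (0::real^3)"
        by (rule isCont_cong)
      then show ?thesis using True by simp
    next
      case False
      have "continuous_on (- {0}) (\<lambda>x. \<rho>' (norm x) * (sgn x \<bullet> b) * (W x \<bullet> b) + \<rho> (norm x) * (DW x b \<bullet> b))"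
        by (intro continuous_intros continuous_on_compose2[OF c\<rho>(1)] continuous_on_compose2[OF c\<rho>(2)]
            continuous_on_sgn cW cont that) auto
      then have "continuous_on (- {0}) (\<lambda>x. DG b x b)"
        by (rule continuous_on_eq) (auto simp: DG_def)
      then show ?thesis
        using False continuous_on_eq_continuous_at[of "- {0::real^3}" "\<lambda>x. DG b x b"]
        by (simp add: open_Compl)
    qed
    then show ?thesis by (simp add: continuous_at_imp_continuous_on)
  qed
  have z: "integrable lborel (\<lambda>x. DG b x b)" "(LINT x|lborel. DG b x b) = 0" if "b \<in> Basis" for b
    using integral_derivative_compact_support[OF G cDG[OF that], where R=2]
    by (auto simp: G_def out)
  \<comment> \<open>The degrees -1 of \<open>W\<close> and -2 of its derivative turn the divergence
    of the cut-off field into two products of a radial and an angular function, to which polar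
    coordinates apply.\<close>
  have sum: "(\<Sum>b\<in>Basis. DG b x b) = \<rho>' (norm x) / norm x * F (sgn x) + \<rho> (norm x) / (norm x)\<^sup>2 * d (sgn x)"
    for x
  proof (cases "x = 0")
    case False
    have n: "norm x > 0" using False by simp
    have xe: "x = norm x *\<^sub>R sgn x" by (simp add: sgn_div_norm False)
    have sn: "sgn x \<noteq> 0" using False by (simp add: sgn_zero_iff)
    have Wx: "W x = W (sgn x) /\<^sub>R norm x" using hom[OF sn n] by (simp only: xe[symmetric])
    have DWx: "DW x h = DW (sgn x) h /\<^sub>R (norm x)\<^sup>2" for h
    proof -
      have "DW (norm x *\<^sub>R sgn x) h = DW (sgn x) h /\<^sub>R (norm x)\<^sup>2"
        by (rule has_derivative_homogeneous[where W=W, OF _ _ sn n]) (fact W, fact hom)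
      then show ?thesis by (simp only: xe[symmetric])
    qed
    have "(\<Sum>b\<in>Basis. DG b x b) = \<rho>' (norm x) * (\<Sum>b\<in>Basis. (sgn x \<bullet> b) * (W x \<bullet> b)) + \<rho> (norm x) * (\<Sum>b\<in>Basis. DW x b \<bullet> b)"
      using False by (simp add: DG_def sum.distrib sum_distrib_left mult.assoc)
    also have "(\<Sum>b\<in>Basis. (sgn x \<bullet> b) * (W x \<bullet> b)) = sgn x \<bullet> W x"
      by (rule euclidean_inner[symmetric])
    also have "\<dots> = F (sgn x) / norm x" by (simp add: Wx F_def inner_commute divide_inverse mult.commute)
    also have "(\<Sum>b\<in>Basis. DW x b \<bullet> b) = d (sgn x) / (norm x)\<^sup>2"
      by (simp only: DWx d_def inner_scaleR_left sum_distrib_left[symmetric]) (simp add: divide_inverse)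
    finally show ?thesis by simp
  qed (simp add: DG_def out)
  have [measurable]: "F \<in> borel_measurable borel" "d \<in> borel_measurable borel"
    using cdF by (auto intro: borel_measurable_punctured)
  note p1 = polar_integral[of "\<lambda>r. \<rho>' r / r" F, OF _ _ rad1(2) integrable_surface[OF cdF(2)]]
  note p2 = polar_integral[of "\<lambda>r. \<rho> r / r\<^sup>2" d, OF _ _ rad2(2) integrable_surface[OF cdF(1)]]
  have "(LINT x|lborel. (\<Sum>b\<in>Basis. DG b x b)) = (\<Sum>b\<in>Basis. LINT x|lborel. DG b x b)"
    by (rule Bochner_Integration.integral_sum) (rule z)
  also have "\<dots> = 0" using z(2) by (intro sum.neutral) auto
  finally have "0 = (LINT x|lborel. \<rho>' (norm x) / norm x * F (sgn x) + \<rho> (norm x) / (norm x)\<^sup>2 * d (sgn x))"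
    by (simp only: sum)
  also have "\<dots> = (LINT r|radial. \<rho>' r / r) * (LINT x|surface. F x) + (LINT r|radial. \<rho> r / r\<^sup>2) * (LINT x|surface. d x)"
    by (subst Bochner_Integration.integral_add) (use p1 p2 in simp_all)
  also have "\<dots> = (LINT r|lborel. \<rho> r) * ((LINT x|surface. d x) - (LINT x|surface. F x))"
    unfolding rad1 rad2 ibp by (simp add: algebra_simps)
  finally show ?thesis using pos by (simp add: d_def F_def)
qed

section \<open>A Hausdorff--Young inequality for finite orthogonal systems\<close>

text \<open>The integral of (f - t g)^2 is a nonnegative quadratic polynomial in t; evaluating it at
  suitable t bounds the mixed coefficient.\<close>

lemma integral_Cauchy_Schwarz:
  fixes f g :: "'a \<Rightarrow> real"
  assumes [measurable]: "f \<in> borel_measurable M" "g \<in> borel_measurable M"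
    and i: "integrable M (\<lambda>x. (f x)\<^sup>2)" "integrable M (\<lambda>x. (g x)\<^sup>2)"
  shows "integrable M (\<lambda>x. f x * g x)"
    and "(LINT x|M. f x * g x)\<^sup>2 \<le> (LINT x|M. (f x)\<^sup>2) * (LINT x|M. (g x)\<^sup>2)"
proof -
  show fg: "integrable M (\<lambda>x. f x * g x)"
  proof (rule Bochner_Integration.integrable_bound)
    show "integrable M (\<lambda>x. (f x)\<^sup>2 + (g x)\<^sup>2)" using i by simp
    have "\<bar>a * b\<bar> \<le> a\<^sup>2 + b\<^sup>2" for a b :: real
    proof -
      have "0 \<le> (\<bar>a\<bar> - \<bar>b\<bar>)\<^sup>2" by simp
      then have "2 * \<bar>a * b\<bar> \<le> a\<^sup>2 + b\<^sup>2" by (simp add: power2_diff abs_mult)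
      then show ?thesis using abs_ge_zero[of "a * b"] by linarith
    qed
    then show "AE x in M. norm (f x * g x) \<le> norm ((f x)\<^sup>2 + (g x)\<^sup>2)" by (intro AE_I2) simp
  qed measurable
  define a b c where "a = (LINT x|M. (f x)\<^sup>2)" and "b = (LINT x|M. (g x)\<^sup>2)" and "c = (LINT x|M. f x * g x)"
  have q: "0 \<le> a - 2 * t * c + t\<^sup>2 * b" for t
  proof -
    have "0 \<le> (LINT x|M. (f x - t * g x)\<^sup>2)" by simp
    also have "(\<lambda>x. (f x - t * g x)\<^sup>2) = (\<lambda>x. (f x)\<^sup>2 - 2 * t * (f x * g x) + t\<^sup>2 * (g x)\<^sup>2)"
      by (auto simp: power2_diff power_mult_distrib algebra_simps)
    also have "(LINT x|M. (f x)\<^sup>2 - 2 * t * (f x * g x) + t\<^sup>2 * (g x)\<^sup>2) = a - 2 * t * c + t\<^sup>2 * b"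
      unfolding a_def b_def c_def using i fg by simp
    finally show ?thesis .
  qed
  have b0: "b \<ge> 0" by (simp add: b_def)
  have "c\<^sup>2 \<le> a * b"
  proof (cases "b = 0")
    case True
    have "c = 0"
    proof (rule ccontr)
      assume "c \<noteq> 0"
      \<comment> \<open>With b = 0 the polynomial is linear, and this t gives it the value
        -1.\<close>
      then show False using q[of "(a + 1) / (2 * c)"] True by (simp add: field_simps)
    qed
    then show ?thesis using True by simp
  next
    case False
    then have "0 \<le> (a - 2 * (c / b) * c + (c / b)\<^sup>2 * b) * b" using q[of "c / b"] b0 by simp
    also have "\<dots> = a * b - c\<^sup>2" using False by (simp add: field_simps power2_eq_square)
    finally show ?thesis by simp
  qed
  then show "(LINT x|M. f x * g x)\<^sup>2 \<le> (LINT x|M. (f x)\<^sup>2) * (LINT x|M. (g x)\<^sup>2)"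
    by (simp add: a_def b_def c_def)
qed

section \<open>Three lines theorem\<close>

lemma three_lines_unit:
  fixes F :: "complex \<Rightarrow> complex"
  assumes hol: "F holomorphic_on UNIV"
    and bdd: "\<And>z. 0 \<le> Re z \<Longrightarrow> Re z \<le> 1 \<Longrightarrow> norm (F z) \<le> B"
    and edge: "\<And>z. Re z = 0 \<or> Re z = 1 \<Longrightarrow> norm (F z) \<le> 1"
    and \<theta>: "0 \<le> \<theta>" "\<theta> \<le> 1"
  shows "norm (F (of_real \<theta>)) \<le> 1"
proof -
  have main: "norm (F (of_real \<theta>)) \<le> exp (\<epsilon> * (1 - \<theta>\<^sup>2))" if e: "\<epsilon> > 0" for \<epsilon>
  proof -
    \<comment> \<open>The Gaussian factor decays along the strip and has modulus at most 1 on its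
      edges, so the maximum principle applies on a rectangle; letting \<epsilon> tend to 0 removes
      the factor.\<close>
    define G where "G z = F z * exp (of_real \<epsilon> * (z\<^sup>2 - 1))" for z
    \<comment> \<open>Chosen so that \<epsilon> R^2 = |B|: on the horizontal sides the factor is at
      most exp(-|B|), and |B| exp(-|B|) \<le> 1.\<close>
    define R where "R = sqrt (\<bar>B\<bar> / \<epsilon>)"
    have R: "R \<ge> 0" "\<epsilon> * R\<^sup>2 = \<bar>B\<bar>" using e by (simp_all add: R_def)
    have nG: "norm (G z) = norm (F z) * exp (\<epsilon> * ((Re z)\<^sup>2 - (Im z)\<^sup>2 - 1))" for z
      by (simp add: G_def norm_mult Re_power2)
    have "norm (G (of_real \<theta>)) \<le> 1"
    proof (rule maximum_modulus_frontier[where f=G and S="cbox (Complex 0 (-R)) (Complex 1 R)"])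
      have "G holomorphic_on UNIV"
        unfolding G_def by (intro holomorphic_intros hol)
      then show "G holomorphic_on interior (cbox (Complex 0 (-R)) (Complex 1 R))"
        "continuous_on (closure (cbox (Complex 0 (-R)) (Complex 1 R))) G"
        using holomorphic_on_subset holomorphic_on_imp_continuous_on continuous_on_subset by blast+
      show "bounded (cbox (Complex 0 (-R)) (Complex 1 R))" by (rule bounded_cbox)
      show "complex_of_real \<theta> \<in> cbox (Complex 0 (-R)) (Complex 1 R)"
        using \<theta> R by (simp add: in_cbox_complex_iff)
      show "norm (G z) \<le> 1" if "z \<in> frontier (cbox (Complex 0 (-R)) (Complex 1 R))" for z
      proof -
        have z: "0 \<le> Re z" "Re z \<le> 1" and
          z2: "Re z = 0 \<or> Re z = 1 \<or> (Im z)\<^sup>2 = R\<^sup>2"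
          using that by (auto simp: frontier_cbox in_cbox_complex_iff in_box_complex_iff power2_eq_iff not_less)
        have z1: "(Re z)\<^sup>2 \<le> 1" using z by (simp add: power_le_one)
        show ?thesis
        proof (cases "Re z = 0 \<or> Re z = 1")
          case True
          have "\<epsilon> * ((Re z)\<^sup>2 - (Im z)\<^sup>2 - 1) \<le> 0"
            using e z1 by (intro mult_nonneg_nonpos) (auto simp: diff_le_eq intro: order_trans[OF z1])
          then have "exp (\<epsilon> * ((Re z)\<^sup>2 - (Im z)\<^sup>2 - 1)) \<le> 1" by simp
          with edge[OF True] show ?thesis unfolding nG using mult_mono[of "norm (F z)" 1 _ 1] by simp
        next
          case False
          then have "\<epsilon> * ((Re z)\<^sup>2 - (Im z)\<^sup>2 - 1) = \<epsilon> * ((Re z)\<^sup>2 - 1) - \<bar>B\<bar>"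
            using z2 R(2) by (auto simp: algebra_simps)
          also have "\<dots> \<le> - \<bar>B\<bar>"
            using mult_nonneg_nonpos[of \<epsilon> "(Re z)\<^sup>2 - 1"] e z1 by simp
          finally have "norm (G z) \<le> norm (F z) * exp (- \<bar>B\<bar>)"
            unfolding nG by (intro mult_left_mono) auto
          also have "\<dots> \<le> \<bar>B\<bar> * exp (- \<bar>B\<bar>)"
            using bdd[OF z] by (intro mult_right_mono) auto
          also have "\<dots> \<le> 1"
            using order_trans[OF _ exp_ge_add_one_self[of "\<bar>B\<bar>"], of "\<bar>B\<bar>"] by (simp add: exp_minus divide_simps)
          finally show ?thesis .
        qed
      qed
    qed
    then have "norm (F (of_real \<theta>)) * exp (\<epsilon> * (\<theta>\<^sup>2 - 1)) \<le> 1" unfolding nG by simp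
    then have "norm (F (of_real \<theta>)) * exp (\<epsilon> * (\<theta>\<^sup>2 - 1)) * exp (\<epsilon> * (1 - \<theta>\<^sup>2)) \<le> 1 * exp (\<epsilon> * (1 - \<theta>\<^sup>2))"
      by (intro mult_right_mono) auto
    then show ?thesis by (simp add: mult.assoc algebra_simps flip: exp_add)
  qed
  show ?thesis
  proof (rule tendsto_lowerbound)
    show "((\<lambda>\<epsilon>. exp (\<epsilon> * (1 - \<theta>\<^sup>2))) \<longlongrightarrow> 1) (at_right 0)"
      by (auto intro!: tendsto_eq_intros)
    show "\<forall>\<^sub>F \<epsilon> in at_right 0. norm (F (of_real \<theta>)) \<le> exp (\<epsilon> * (1 - \<theta>\<^sup>2))"
      using eventually_at_right_less[of "0::real"] by eventually_elim (rule main)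
  qed simp
qed

text \<open>The entire function M0^(1 - z) M1^z has no zeros and has the prescribed moduli on the
  edges; dividing by it reduces both bounds to 1.\<close>

lemma three_lines:
  fixes F :: "complex \<Rightarrow> complex"
  assumes hol: "F holomorphic_on UNIV"
    and bdd: "\<And>z. 0 \<le> Re z \<Longrightarrow> Re z \<le> 1 \<Longrightarrow> norm (F z) \<le> B"
    and M: "M0 > 0" "M1 > 0"
    and edge0: "\<And>z. Re z = 0 \<Longrightarrow> norm (F z) \<le> M0"
    and edge1: "\<And>z. Re z = 1 \<Longrightarrow> norm (F z) \<le> M1"
    and \<theta>: "0 \<le> \<theta>" "\<theta> \<le> 1"
  shows "norm (F (of_real \<theta>)) \<le> M0 powr (1 - \<theta>) * M1 powr \<theta>"
proof -
  define G where "G z = F z * exp ((z - 1) * of_real (ln M0) - z * of_real (ln M1))" for z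
  have nG: "norm (G z) = norm (F z) * exp ((Re z - 1) * ln M0 - Re z * ln M1)" for z
    by (simp add: G_def norm_mult)
  have "norm (G (of_real \<theta>)) \<le> 1"
  proof (rule three_lines_unit[where B="\<bar>B\<bar> * exp (\<bar>ln M0\<bar> + \<bar>ln M1\<bar>)", OF _ _ _ \<theta>])
    show "G holomorphic_on UNIV" unfolding G_def by (intro holomorphic_intros hol)
    show "norm (G z) \<le> \<bar>B\<bar> * exp (\<bar>ln M0\<bar> + \<bar>ln M1\<bar>)" if z: "0 \<le> Re z" "Re z \<le> 1" for z
    proof -
      have a: "\<bar>(Re z - 1) * ln M0\<bar> \<le> 1 * \<bar>ln M0\<bar>" "\<bar>Re z * ln M1\<bar> \<le> 1 * \<bar>ln M1\<bar>"
        unfolding abs_mult using z by (intro mult_right_mono; simp)+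
      have "(Re z - 1) * ln M0 - Re z * ln M1 \<le> \<bar>ln M0\<bar> + \<bar>ln M1\<bar>"
        using a by linarith
      then show ?thesis unfolding nG using bdd[OF z] by (intro mult_mono) auto
    qed
    show "norm (G z) \<le> 1" if "Re z = 0 \<or> Re z = 1" for z
      using that
    proof
      assume z: "Re z = 0"
      then show ?thesis unfolding nG using edge0[OF z] M by (simp add: exp_minus divide_simps)
    next
      assume z: "Re z = 1"
      then show ?thesis unfolding nG using edge1[OF z] M by (simp add: exp_minus divide_simps)
    qed
  qed
  then have "norm (F (of_real \<theta>)) * exp ((\<theta> - 1) * ln M0 - \<theta> * ln M1) \<le> 1" by (simp add: nG)
  then have "norm (F (of_real \<theta>)) * exp ((\<theta> - 1) * ln M0 - \<theta> * ln M1) * exp ((1 - \<theta>) * ln M0 + \<theta> * ln M1)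
      \<le> 1 * exp ((1 - \<theta>) * ln M0 + \<theta> * ln M1)"
    by (rule mult_right_mono) simp
  moreover have "exp ((\<theta> - 1) * ln M0 - \<theta> * ln M1) * exp ((1 - \<theta>) * ln M0 + \<theta> * ln M1) = 1"
    by (simp add: algebra_simps flip: exp_add)
  ultimately have "norm (F (of_real \<theta>)) \<le> exp ((1 - \<theta>) * ln M0 + \<theta> * ln M1)"
    by (simp add: mult.assoc)
  also have "\<dots> = M0 powr (1 - \<theta>) * M1 powr \<theta>"
    using M by (simp add: powr_def exp_add)
  finally show ?thesis .
qed

text \<open>Riesz--Thorin interpolation between the \<open>L\<^sup>2\<close> bound by orthogonality and the \<open>L\<^sup>\<infinity>\<close> bound by
  the triangle inequality.\<close>

locale orthogonal_system = finite_measure M for M :: "'a measure" +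
  fixes I :: "nat set" and h :: "nat \<Rightarrow> 'a \<Rightarrow> real" and A \<mu> :: "nat \<Rightarrow> real" and K :: real
  assumes finI: "finite I"
    and meas[measurable]: "\<And>n. n \<in> I \<Longrightarrow> h n \<in> borel_measurable M"
    and A: "\<And>n. n \<in> I \<Longrightarrow> A n > 0" and \<mu>: "\<And>n. n \<in> I \<Longrightarrow> \<mu> n > 0" and K: "K > 0"
    and bound: "\<And>n x. n \<in> I \<Longrightarrow> \<bar>h n x\<bar> \<le> K * sqrt (\<mu> n) * A n"
    and orth: "\<And>n m. n \<in> I \<Longrightarrow> m \<in> I \<Longrightarrow> n \<noteq> m \<Longrightarrow> (LINT x|M. h n x * h m x) = 0"
    and norm2: "\<And>n. n \<in> I \<Longrightarrow> (LINT x|M. (h n x)\<^sup>2) \<le> (A n)\<^sup>2"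
begin

text \<open>Regard \<open>a\<close> as a function on \<open>I\<close> with point masses
  \<open>\<mu>\<close>. The sum of \<mu> a^2 is the sum of A^2, which dominates the square integral
  by orthogonality, and K times the sum of \<mu> a dominates the supremum: the endpoints from L2 to
  L2 and from L1 to L\<infinity>.\<close>

definition "a n = A n / sqrt (\<mu> n)"

lemma a_pos: "n \<in> I \<Longrightarrow> a n > 0"
  using A \<mu> by (simp add: a_def)

lemma A_eq: "n \<in> I \<Longrightarrow> (A n)\<^sup>2 = \<mu> n * (a n)\<^sup>2" "n \<in> I \<Longrightarrow> sqrt (\<mu> n) * A n = \<mu> n * a n"
  using \<mu>[of n] by (auto simp: a_def power_divide real_div_sqrt field_simps)

lemma integrable_hh: "n \<in> I \<Longrightarrow> m \<in> I \<Longrightarrow> integrable M (\<lambda>x. h n x * h m x)"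
proof (rule integrable_const_bound[where B="(K * sqrt (\<mu> n) * A n) * (K * sqrt (\<mu> m) * A m)"])
  assume nm: "n \<in> I" "m \<in> I"
  have "\<bar>h n x\<bar> * \<bar>h m x\<bar> \<le> (K * sqrt (\<mu> n) * A n) * (K * sqrt (\<mu> m) * A m)" for x
    by (rule mult_mono) (use bound nm A \<mu> K in \<open>auto intro!: mult_nonneg_nonneg simp: less_imp_le\<close>)
  then show "AE x in M. norm (h n x * h m x) \<le> (K * sqrt (\<mu> n) * A n) * (K * sqrt (\<mu> m) * A m)"
    by (auto simp: abs_mult)
qed measurable

text \<open>Interpolation multiplies the real functions \<open>h n\<close> by complex powers, hence
  the complex coefficients. Orthogonality removes the cross terms of the expanded square.\<close>

lemma integral_norm_square:
  fixes w :: "nat \<Rightarrow> complex"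
  shows "integrable M (\<lambda>x. (norm (\<Sum>n\<in>I. w n * of_real (h n x)))\<^sup>2)"
    and "(LINT x|M. (norm (\<Sum>n\<in>I. w n * of_real (h n x)))\<^sup>2) \<le> (\<Sum>n\<in>I. (norm (w n))\<^sup>2 * (A n)\<^sup>2)"
proof -
  have e: "(norm (\<Sum>n\<in>I. w n * of_real (h n x)))\<^sup>2 = (\<Sum>n\<in>I. \<Sum>m\<in>I. Re (w n * cnj (w m)) * (h n x * h m x))" for x
  proof -
    have "complex_of_real ((norm (\<Sum>n\<in>I. w n * of_real (h n x)))\<^sup>2)
        = (\<Sum>n\<in>I. w n * of_real (h n x)) * (\<Sum>m\<in>I. cnj (w m) * of_real (h m x))"
      by (subst complex_norm_square) (simp add: cnj_sum)
    also have "\<dots> = (\<Sum>n\<in>I. \<Sum>m\<in>I. (w n * cnj (w m)) * of_real (h n x * h m x))"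
      by (simp add: sum_product mult.assoc mult.left_commute)
    finally have "Re (complex_of_real ((norm (\<Sum>n\<in>I. w n * of_real (h n x)))\<^sup>2))
        = Re (\<Sum>n\<in>I. \<Sum>m\<in>I. (w n * cnj (w m)) * of_real (h n x * h m x))"
      by simp
    then show ?thesis unfolding Re_sum Re_complex_of_real by (simp add: Re_divide_of_real)
  qed
  show "integrable M (\<lambda>x. (norm (\<Sum>n\<in>I. w n * of_real (h n x)))\<^sup>2)"
    unfolding e by (intro Bochner_Integration.integrable_sum integrable_mult_right integrable_hh)
  have "(LINT x|M. (norm (\<Sum>n\<in>I. w n * of_real (h n x)))\<^sup>2)
      = (\<Sum>n\<in>I. \<Sum>m\<in>I. Re (w n * cnj (w m)) * (LINT x|M. h n x * h m x))"
  proof -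
    have "(LINT x|M. (norm (\<Sum>n\<in>I. w n * of_real (h n x)))\<^sup>2)
        = (\<Sum>n\<in>I. LINT x|M. (\<Sum>m\<in>I. Re (w n * cnj (w m)) * (h n x * h m x)))"
      unfolding e
      by (rule Bochner_Integration.integral_sum)
        (intro Bochner_Integration.integrable_sum integrable_mult_right integrable_hh)
    also have "\<dots> = (\<Sum>n\<in>I. \<Sum>m\<in>I. LINT x|M. Re (w n * cnj (w m)) * (h n x * h m x))"
      by (intro sum.cong refl Bochner_Integration.integral_sum integrable_mult_right integrable_hh)
    finally show ?thesis by (simp only: integral_mult_right_zero)
  qed
  also have "\<dots> = (\<Sum>n\<in>I. (norm (w n))\<^sup>2 * (LINT x|M. (h n x)\<^sup>2))"
  proof (intro sum.cong refl)
    fix n assume n: "n \<in> I"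
    have "(\<Sum>m\<in>I. Re (w n * cnj (w m)) * (LINT x|M. h n x * h m x))
        = (\<Sum>m\<in>I. if m = n then Re (w n * cnj (w n)) * (LINT x|M. h n x * h n x) else 0)"
      using orth[OF n] by (intro sum.cong) auto
    also have "\<dots> = Re (w n * cnj (w n)) * (LINT x|M. h n x * h n x)"
      using finI n by simp
    also have "Re (w n * cnj (w n)) = (norm (w n))\<^sup>2"
      using cmod_power2[of "w n"] by (simp add: power2_eq_square)
    finally show "(\<Sum>m\<in>I. Re (w n * cnj (w m)) * (LINT x|M. h n x * h m x)) = (norm (w n))\<^sup>2 * (LINT x|M. (h n x)\<^sup>2)"
      by (simp add: power2_eq_square)
  qed
  also have "\<dots> \<le> (\<Sum>n\<in>I. (norm (w n))\<^sup>2 * (A n)\<^sup>2)"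
    by (intro sum_mono mult_left_mono norm2) auto
  finally show "(LINT x|M. (norm (\<Sum>n\<in>I. w n * of_real (h n x)))\<^sup>2) \<le> (\<Sum>n\<in>I. (norm (w n))\<^sup>2 * (A n)\<^sup>2)" .
qed

text \<open>Complex powers of \<open>a\<close> and \<open>\<psi>\<close> produce a function F of z.
  On Re z = 0, orthogonality and Cauchy-Schwarz bound it by sqrt (S N), with N the integral of
  |\<psi>|^r; on Re z = 1 the pointwise bound gives K S N; at an intermediate point it is the
  integral in question. As \<open>\<psi>\<close> takes finitely many values, F is a finite
  combination of exponentials, hence entire and bounded in the strip.\<close>

lemma dual_bound_simple:
  assumes q: "q > 2" and [measurable]: "\<psi> \<in> borel_measurable M" and fin: "finite (range \<psi>)"
  defines "r \<equiv> q / (q - 1)" and "S \<equiv> (\<Sum>n\<in>I. \<mu> n * a n powr (q / (q - 1)))"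
  shows "\<bar>LINT x|M. (\<Sum>n\<in>I. h n x) * \<psi> x\<bar>
    \<le> K powr (1 - 2 / q) * (S * (LINT x|M. \<bar>\<psi> x\<bar> powr r)) powr (1 / r)"
proof -
  define N where "N = (LINT x|M. \<bar>\<psi> x\<bar> powr r)"
  have r: "r > 1" "r < 2" using q by (auto simp: r_def field_simps)
  have S_eq: "S = (\<Sum>n\<in>I. \<mu> n * a n powr r)" by (simp add: S_def r_def)
  obtain C where C: "\<And>x. \<bar>\<psi> x\<bar> \<le> C"
    using finite_imp_bounded[OF fin] by (auto simp: bounded_iff)
  have i\<psi>: "integrable M (\<lambda>x. \<bar>\<psi> x\<bar> powr s)" if "s \<ge> 0" for s
    by (rule integrable_const_bound[where B="C powr s"]) (use C that in \<open>auto intro!: AE_I2 powr_mono2\<close>)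
  consider "I = {}" | "N = 0" | "I \<noteq> {}" "N > 0"
  proof -
    have "N \<ge> 0" by (simp add: N_def)
    then show thesis using that by (cases "N = 0"; cases "I = {}") auto
  qed
  then show ?thesis
  proof cases
    case 1
    then show ?thesis by (simp add: S_eq)
  next
    case 2
    then have "AE x in M. \<bar>\<psi> x\<bar> powr r = 0"
      using integral_nonneg_eq_0_iff_AE[OF i\<psi>[of r]] r by (simp add: N_def)
    then have "(LINT x|M. (\<Sum>n\<in>I. h n x) * \<psi> x) = (LINT x|M. 0)"
      by (intro integral_cong_AE) auto
    then show ?thesis using K by simp
  next
    case 3
    have S: "S > 0" unfolding S_eq
      using 3 finI \<mu> a_pos by (intro sum_pos) (auto simp: less_imp_neq[symmetric])
    \<comment> \<open>The exponent has real part r/2 on the left edge, where squaring yields r-th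
      powers, and r on the right edge; it equals 1 at z = 1 - 2/q, where the original functions
      reappear.\<close>
    define l where "l z = of_real (r / 2) * (1 + z)" for z :: complex
    define w where "w z n = exp ((l z - 1) * of_real (ln (a n)))" for z n
    define v where "v z t = (if t = 0 then 0 else of_real (sgn t) * exp (l z * of_real (ln \<bar>t\<bar>)))" for z and t :: real
    define H where "H z x = (\<Sum>n\<in>I. w z n * of_real (h n x))" for z x
    define F where "F z = (\<Sum>n\<in>I. \<Sum>t\<in>range \<psi>. w z n * v z t * of_real (LINT x|M. h n x * indicator {x. \<psi> x = t} x))" for z
    have Rel: "Re (l z) = r / 2 * (1 + Re z)" for z by (simp add: l_def)
    have nw: "norm (w z n) = a n powr (Re (l z) - 1)" if "n \<in> I" for z n
      using a_pos[OF that] by (simp add: w_def powr_def)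
    have nv: "norm (v z t) = \<bar>t\<bar> powr Re (l z)" for z t
      by (simp add: v_def powr_def norm_mult)
    have [measurable]: "(\<lambda>x. v z (\<psi> x)) \<in> borel_measurable M" for z
      unfolding v_def by measurable
    have [measurable]: "H z \<in> borel_measurable M" for z
      unfolding H_def[abs_def] by measurable
    have ind: "integrable M (\<lambda>x. h n x * indicator {x. \<psi> x = t} x)" if "n \<in> I" for n t
    proof (rule integrable_const_bound[where B="K * sqrt (\<mu> n) * A n"])
      have "{x \<in> space M. \<psi> x = t} \<in> sets M" by measurable
      then have "(\<lambda>x. indicator {x. \<psi> x = t} x :: real) \<in> borel_measurable M"
        by (simp add: borel_measurable_indicator_iff Int_def conj_commute)
      then show "(\<lambda>x. h n x * indicator {x. \<psi> x = t} x) \<in> borel_measurable M"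
        using that by measurable
      show "AE x in M. norm (h n x * indicator {x. \<psi> x = t} x) \<le> K * sqrt (\<mu> n) * A n"
        using bound[OF that] order_trans[OF abs_ge_zero bound[OF that]]
        by (intro AE_I2) (auto simp: indicator_def)
    qed
    have FH: "F z = (LINT x|M. H z x * v z (\<psi> x))" for z
    proof -
      have "H z x * v z (\<psi> x) = (\<Sum>n\<in>I. \<Sum>t\<in>range \<psi>. w z n * v z t * of_real (h n x * indicator {x. \<psi> x = t} x))" for x
      proof -
        have "(\<Sum>t\<in>range \<psi>. w z n * v z t * of_real (h n x * indicator {x. \<psi> x = t} x))
            = (\<Sum>t\<in>range \<psi>. if t = \<psi> x then w z n * v z (\<psi> x) * of_real (h n x) else 0)" for n
          by (intro sum.cong) (auto simp: indicator_def)
        then have s: "(\<Sum>t\<in>range \<psi>. w z n * v z t * of_real (h n x * indicator {x. \<psi> x = t} x))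
            = w z n * v z (\<psi> x) * of_real (h n x)" for n
          using fin by simp
        show ?thesis unfolding s H_def sum_distrib_right by (intro sum.cong) (simp_all add: mult_ac)
      qed
      then have "(LINT x|M. H z x * v z (\<psi> x))
          = (LINT x|M. (\<Sum>n\<in>I. \<Sum>t\<in>range \<psi>. w z n * v z t * of_real (h n x * indicator {x. \<psi> x = t} x)))"
        by simp
      also have "\<dots> = (\<Sum>n\<in>I. LINT x|M. (\<Sum>t\<in>range \<psi>. w z n * v z t * of_real (h n x * indicator {x. \<psi> x = t} x)))"
        by (intro Bochner_Integration.integral_sum Bochner_Integration.integrable_sum integrable_mult_right
            integrable_of_real ind)
      also have "\<dots> = (\<Sum>n\<in>I. \<Sum>t\<in>range \<psi>. LINT x|M. w z n * v z t * of_real (h n x * indicator {x. \<psi> x = t} x))"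
        by (intro sum.cong refl Bochner_Integration.integral_sum integrable_mult_right integrable_of_real ind)
      also have "\<dots> = F z"
        unfolding F_def by (intro sum.cong refl) (simp only: integral_mult_right_zero integral_complex_of_real)
      finally show ?thesis by simp
    qed
    have hol_v: "(\<lambda>z. v z t) holomorphic_on UNIV" for t
      unfolding v_def l_def by (cases "t = 0") (auto intro!: holomorphic_intros)
    have hol_w: "(\<lambda>z. w z n) holomorphic_on UNIV" for n
      unfolding w_def l_def by (auto intro!: holomorphic_intros)
    have hol: "F holomorphic_on UNIV"
      unfolding F_def by (intro holomorphic_intros hol_v hol_w)
    have bdd: "\<exists>B. \<forall>z. 0 \<le> Re z \<longrightarrow> Re z \<le> 1 \<longrightarrow> norm (F z) \<le> B"
    proof -
      define B where "B = (\<Sum>n\<in>I. \<Sum>t\<in>range \<psi>. exp (3 * \<bar>ln (a n)\<bar>) * exp (3 * \<bar>ln \<bar>t\<bar>\<bar>)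
        * norm (complex_of_real (LINT x|M. h n x * indicator {x. \<psi> x = t} x)))"
      have "norm (F z) \<le> B" if z: "0 \<le> Re z" "Re z \<le> 1" for z
      proof -
        have l: "0 \<le> Re (l z)" "Re (l z) \<le> 2"
          using z r mult_mono[of "r / 2" 1 "1 + Re z" 2] by (auto simp: Rel)
        have 1: "norm (w z n) \<le> exp (3 * \<bar>ln (a n)\<bar>)" for n
        proof -
          have "(Re (l z) - 1) * ln (a n) \<le> \<bar>(Re (l z) - 1) * ln (a n)\<bar>" by simp
          also have "\<dots> \<le> 3 * \<bar>ln (a n)\<bar>" unfolding abs_mult using l by (intro mult_right_mono) auto
          finally show ?thesis by (simp add: w_def)
        qed
        have 2: "norm (v z t) \<le> exp (3 * \<bar>ln \<bar>t\<bar>\<bar>)" for t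
        proof -
          have "Re (l z) * ln \<bar>t\<bar> \<le> \<bar>Re (l z) * ln \<bar>t\<bar>\<bar>" by simp
          also have "\<dots> \<le> 3 * \<bar>ln \<bar>t\<bar>\<bar>" unfolding abs_mult using l by (intro mult_right_mono) auto
          finally show ?thesis by (simp add: v_def norm_mult)
        qed
        show ?thesis unfolding F_def B_def
          by (rule order_trans[OF norm_sum] sum_mono)+
            (simp only: norm_mult, intro mult_mono 1 2 mult_nonneg_nonneg norm_ge_zero exp_ge_zero order_refl)
      qed
      then show ?thesis by blast
    qed
    have e0: "norm (F z) \<le> sqrt (S * N)" if "Re z = 0" for z
    proof -
      have 1: "(LINT x|M. (norm (H z x))\<^sup>2) \<le> S"
      proof -
        have "(LINT x|M. (norm (H z x))\<^sup>2) \<le> (\<Sum>n\<in>I. (norm (w z n))\<^sup>2 * (A n)\<^sup>2)"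
          unfolding H_def by (rule integral_norm_square(2))
        also have "\<dots> = S" unfolding S_eq
        proof (intro sum.cong refl)
          fix n assume n: "n \<in> I"
          have "(norm (w z n))\<^sup>2 * (a n)\<^sup>2 = a n powr (2 * (r / 2 - 1)) * a n powr 2"
            using a_pos[OF n] that by (simp add: nw[OF n] Rel powr_power)
          also have "\<dots> = a n powr r" unfolding powr_add[symmetric] by simp
          finally show "(norm (w z n))\<^sup>2 * (A n)\<^sup>2 = \<mu> n * a n powr r"
            by (simp add: A_eq[OF n])
        qed
        finally show ?thesis .
      qed
      have 2: "(norm (v z (\<psi> x)))\<^sup>2 = \<bar>\<psi> x\<bar> powr r" for x
        using that by (simp add: nv Rel power2_eq_square flip: powr_add)
      have "norm (F z) \<le> (LINT x|M. norm (H z x) * norm (v z (\<psi> x)))"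
        unfolding FH using integral_norm_bound[of M "\<lambda>x. H z x * v z (\<psi> x)"] by (simp add: norm_mult)
      also have "\<dots> \<le> sqrt ((LINT x|M. norm (H z x) * norm (v z (\<psi> x)))\<^sup>2)" by simp
      also have "\<dots> \<le> sqrt ((LINT x|M. (norm (H z x))\<^sup>2) * (LINT x|M. (norm (v z (\<psi> x)))\<^sup>2))"
        by (intro real_sqrt_le_mono integral_Cauchy_Schwarz(2))
          (use integral_norm_square(1)[of "w z"] i\<psi>[of r] r in \<open>auto simp: 2 H_def\<close>)
      also have "\<dots> \<le> sqrt (S * N)"
        unfolding 2 N_def by (intro real_sqrt_le_mono mult_right_mono 1) auto
      finally show ?thesis .
    qed
    have e1: "norm (F z) \<le> K * S * N" if "Re z = 1" for z
    proof -
      have 1: "norm (H z x) \<le> K * S" for x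
      proof -
        have "norm (H z x) \<le> (\<Sum>n\<in>I. norm (w z n) * \<bar>h n x\<bar>)"
          unfolding H_def by (rule order_trans[OF norm_sum]) (simp add: norm_mult)
        also have "\<dots> \<le> (\<Sum>n\<in>I. norm (w z n) * (K * sqrt (\<mu> n) * A n))"
          by (intro sum_mono mult_left_mono bound) auto
        also have "\<dots> = (\<Sum>n\<in>I. K * (\<mu> n * a n powr r))"
        proof (intro sum.cong refl)
          fix n assume n: "n \<in> I"
          have "a n powr (r - 1) * a n = a n powr r"
            using a_pos[OF n] by (simp add: powr_diff)
          then show "norm (w z n) * (K * sqrt (\<mu> n) * A n) = K * (\<mu> n * a n powr r)"
            using that A_eq(2)[OF n] by (simp add: nw[OF n] Rel mult.assoc)
        qed
        also have "\<dots> = K * S" by (simp add: S_eq sum_distrib_left)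
        finally show ?thesis .
      qed
      have "norm (F z) \<le> (LINT x|M. norm (H z x * v z (\<psi> x)))"
        unfolding FH by (rule integral_norm_bound)
      also have "\<dots> \<le> (LINT x|M. K * S * \<bar>\<psi> x\<bar> powr r)"
      proof (rule integral_mono')
        show "integrable M (\<lambda>x. K * S * \<bar>\<psi> x\<bar> powr r)" using i\<psi>[of r] r by simp
        show "norm (H z x * v z (\<psi> x)) \<le> K * S * \<bar>\<psi> x\<bar> powr r" for x
          using that by (auto simp: norm_mult nv Rel intro!: mult_right_mono 1)
      qed (use K S in auto)
      finally show ?thesis by (simp add: N_def)
    qed
    define \<theta> where "\<theta> = 1 - 2 / q"
    have \<theta>: "0 \<le> \<theta>" "\<theta> \<le> 1" using q by (auto simp: \<theta>_def)
    have l1: "l (of_real \<theta>) = 1"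
    proof -
      have "r / 2 * (1 + \<theta>) = 1" using q by (simp add: r_def \<theta>_def field_simps)
      then have "complex_of_real (r / 2 * (1 + \<theta>)) = 1" by simp
      then show ?thesis by (simp add: l_def)
    qed
    obtain B where B: "\<And>z. 0 \<le> Re z \<Longrightarrow> Re z \<le> 1 \<Longrightarrow> norm (F z) \<le> B" using bdd by blast
    have "norm (F (of_real \<theta>)) \<le> sqrt (S * N) powr (1 - \<theta>) * (K * S * N) powr \<theta>"
      by (rule three_lines[OF hol B _ _ e0 e1 \<theta>]) (use K S 3 in auto)
    also have "\<dots> = K powr \<theta> * (S * N) powr (1 / r)"
    proof -
      have "(1 - \<theta>) / 2 + \<theta> = 1 / r" using q by (simp add: r_def \<theta>_def field_simps)
      then have "(S * N) powr ((1 - \<theta>) / 2) * (S * N) powr \<theta> = (S * N) powr (1 / r)"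
        by (metis powr_add)
      moreover have "sqrt (S * N) powr (1 - \<theta>) = (S * N) powr ((1 - \<theta>) / 2)"
        using S 3 by (simp add: powr_half_sqrt[symmetric] powr_powr)
      moreover have "(K * S * N) powr \<theta> = K powr \<theta> * (S * N) powr \<theta>"
        using K S 3 by (simp add: powr_mult mult.assoc)
      ultimately show ?thesis by (simp add: mult.left_commute)
    qed
    also have "F (of_real \<theta>) = of_real (LINT x|M. (\<Sum>n\<in>I. h n x) * \<psi> x)"
    proof -
      have "v (of_real \<theta>) t = of_real t" for t
        unfolding v_def l1 by (auto simp: exp_of_real sgn_mult_abs simp flip: of_real_mult)
      moreover have "H (of_real \<theta>) x = of_real (\<Sum>n\<in>I. h n x)" for x
        by (simp add: H_def w_def l1)
      ultimately have "F (of_real \<theta>) = (LINT x|M. complex_of_real ((\<Sum>n\<in>I. h n x) * \<psi> x))"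
        by (simp add: FH)
      then show ?thesis by (simp only: integral_complex_of_real)
    qed
    finally show ?thesis by (simp add: \<theta>_def N_def)
  qed
qed

text \<open>Duality with sgn g |g|^(q - 1), rounded towards 0 to multiples of 1/k so that it takes
  finitely many values. For X the integral of |g|^q this gives X \<le> C X^(1/r) + O(1/k), and
  division by X^(1/r) leaves X^(1/q) \<le> C.\<close>

lemma Lq_bound:
  assumes q: "q > 2"
  shows "(LINT x|M. \<bar>\<Sum>n\<in>I. h n x\<bar> powr q)
    \<le> (K powr (1 - 2 / q) * (\<Sum>n\<in>I. \<mu> n * a n powr (q / (q - 1))) powr (1 - 1 / q)) powr q"
proof -
  define r where "r = q / (q - 1)"
  define S where "S = (\<Sum>n\<in>I. \<mu> n * a n powr r)"
  define g where "g x = (\<Sum>n\<in>I. h n x)" for x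
  define B where "B = (\<Sum>n\<in>I. K * sqrt (\<mu> n) * A n)"
  define X where "X = (LINT x|M. \<bar>g x\<bar> powr q)"
  define C where "C = K powr (1 - 2 / q) * S powr (1 / r)"
  have r: "r > 1" "1 / r = 1 - 1 / q" "(q - 1) * r = q" using q by (auto simp: r_def field_simps)
  have S0: "S \<ge> 0" unfolding S_def using \<mu> by (intro sum_nonneg mult_nonneg_nonneg) (auto simp: less_imp_le)
  have [measurable]: "g \<in> borel_measurable M" unfolding g_def[abs_def] by measurable
  have B: "\<bar>g x\<bar> \<le> B" for x
    unfolding g_def B_def by (rule order_trans[OF sum_abs]) (intro sum_mono bound)
  have B0: "B \<ge> 0" using order_trans[OF abs_ge_zero B] .
  have ig: "integrable M (\<lambda>x. \<bar>g x\<bar> powr q)"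
    by (rule integrable_const_bound[where B="B powr q"]) (use B q in \<open>auto intro!: AE_I2 powr_mono2\<close>)
  have X0: "X \<ge> 0" by (simp add: X_def)
  have step: "X \<le> C * X powr (1 / r) + B * measure M (space M) / real (Suc j)" for j
  proof -
    define k where "k = real (Suc j)"
    have k: "k > 0" by (simp add: k_def)
    define \<psi> where "\<psi> x = sgn (g x) * (of_int \<lfloor>k * \<bar>g x\<bar> powr (q - 1)\<rfloor> / k)" for x
    have [measurable]: "\<psi> \<in> borel_measurable M" unfolding \<psi>_def[abs_def] by measurable
    have fl: "0 \<le> \<lfloor>k * \<bar>g x\<bar> powr (q - 1)\<rfloor>" "\<lfloor>k * \<bar>g x\<bar> powr (q - 1)\<rfloor> \<le> \<lfloor>k * B powr (q - 1)\<rfloor>" for x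
      using k B q by (auto intro!: floor_mono mult_left_mono powr_mono2)
    have "range \<psi> \<subseteq> (\<lambda>(s, i). s * (of_int i / k)) ` ({-1, 0, 1} \<times> {0..\<lfloor>k * B powr (q - 1)\<rfloor>})"
    proof
      fix y assume "y \<in> range \<psi>"
      then obtain x where y: "y = \<psi> x" by blast
      have "sgn (g x) \<in> {-1, 0, 1}" by (simp add: sgn_if)
      with fl[of x] show "y \<in> (\<lambda>(s, i). s * (of_int i / k)) ` ({-1, 0, 1} \<times> {0..\<lfloor>k * B powr (q - 1)\<rfloor>})"
        unfolding y \<psi>_def by (intro image_eqI[where x="(sgn (g x), \<lfloor>k * \<bar>g x\<bar> powr (q - 1)\<rfloor>)"]) auto
    qed
    then have fin: "finite (range \<psi>)" by (rule finite_subset) simp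
    have up: "\<bar>\<psi> x\<bar> \<le> \<bar>g x\<bar> powr (q - 1)" for x
    proof -
      have "of_int \<lfloor>k * \<bar>g x\<bar> powr (q - 1)\<rfloor> / k \<le> \<bar>g x\<bar> powr (q - 1)"
        using k of_int_floor_le[of "k * \<bar>g x\<bar> powr (q - 1)"] by (simp add: divide_le_eq mult.commute)
      moreover have "0 \<le> of_int \<lfloor>k * \<bar>g x\<bar> powr (q - 1)\<rfloor> / k" using fl(1)[of x] k by simp
      ultimately show ?thesis by (auto simp: \<psi>_def abs_mult sgn_if)
    qed
    have \<psi>r: "\<bar>\<psi> x\<bar> powr r \<le> \<bar>g x\<bar> powr q" for x
    proof -
      have "\<bar>\<psi> x\<bar> powr r \<le> (\<bar>g x\<bar> powr (q - 1)) powr r" using up r by (intro powr_mono2) auto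
      then show ?thesis by (simp add: powr_powr r)
    qed
    \<comment> \<open>Rounding loses at most 1/k of |g|^(q - 1), which is then multiplied by |g|
      \<le> B.\<close>
    have low: "\<bar>g x\<bar> powr q \<le> g x * \<psi> x + B / k" for x
    proof -
      have "\<bar>g x\<bar> powr (q - 1) \<le> of_int \<lfloor>k * \<bar>g x\<bar> powr (q - 1)\<rfloor> / k + 1 / k"
        using k real_of_int_floor_add_one_ge[of "k * \<bar>g x\<bar> powr (q - 1)"]
        by (simp add: field_simps)
      then have "\<bar>g x\<bar> * \<bar>g x\<bar> powr (q - 1) \<le> \<bar>g x\<bar> * (of_int \<lfloor>k * \<bar>g x\<bar> powr (q - 1)\<rfloor> / k + 1 / k)"
        by (rule mult_left_mono) simp
      also have "\<dots> = g x * \<psi> x + \<bar>g x\<bar> / k"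
        by (simp add: \<psi>_def distrib_left mult.assoc[symmetric] abs_sgn)
      also have "\<dots> \<le> g x * \<psi> x + B / k" using B k by (simp add: divide_right_mono)
      also have "\<bar>g x\<bar> * \<bar>g x\<bar> powr (q - 1) = \<bar>g x\<bar> powr q"
        by (cases "g x = 0") (simp_all add: powr_diff)
      finally show ?thesis .
    qed
    have i\<psi>: "integrable M (\<lambda>x. g x * \<psi> x)"
    proof (rule integrable_const_bound[where B="B * B powr (q - 1)"])
      have "\<bar>g x\<bar> * \<bar>\<psi> x\<bar> \<le> B * B powr (q - 1)" for x
        by (rule mult_mono[OF B]) (use up[of x] B0 powr_mono2[of "q - 1" "\<bar>g x\<bar>" B] B q in \<open>auto intro: order_trans\<close>)
      then show "AE x in M. norm (g x * \<psi> x) \<le> B * B powr (q - 1)" by (simp add: abs_mult)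
    qed measurable
    have "X \<le> (LINT x|M. g x * \<psi> x + B / k)"
      unfolding X_def by (rule integral_mono) (use ig i\<psi> low in auto)
    also have "\<dots> = (LINT x|M. g x * \<psi> x) + B * measure M (space M) / k"
      using i\<psi> by simp
    also have "(LINT x|M. g x * \<psi> x) \<le> K powr (1 - 2 / q) * (S * (LINT x|M. \<bar>\<psi> x\<bar> powr r)) powr (1 / r)"
      using dual_bound_simple[OF q _ fin] unfolding g_def r_def S_def by (auto dest: abs_le_D1)
    also have "\<dots> \<le> K powr (1 - 2 / q) * (S * X) powr (1 / r)"
    proof (intro mult_left_mono powr_mono2)
      show "(LINT x|M. \<bar>\<psi> x\<bar> powr r) \<le> X" unfolding X_def
        by (rule integral_mono') (use ig \<psi>r in auto)
    qed (use S0 q in \<open>auto simp: r(2)\<close>)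
    also have "\<dots> = C * X powr (1 / r)" using S0 X0 by (simp add: C_def powr_mult)
    finally show ?thesis by (simp add: k_def)
  qed
  have "X \<le> C * X powr (1 / r)"
  proof (rule tendsto_lowerbound)
    have "(\<lambda>j. C * X powr (1 / r) + (B * measure M (space M)) * (1 / real (Suc j))) \<longlonglongrightarrow> C * X powr (1 / r) + (B * measure M (space M)) * 0"
      by (intro tendsto_intros LIMSEQ_Suc[OF lim_1_over_n])
    then show "(\<lambda>j. C * X powr (1 / r) + B * measure M (space M) / real (Suc j)) \<longlonglongrightarrow> C * X powr (1 / r)"
      by simp
  qed (use step in auto)
  have C0: "C \<ge> 0" by (simp add: C_def)
  have "X \<le> C powr q"
  proof (cases "X = 0")
    case False
    then have Xp: "X > 0" using X0 by simp
    have "X powr (1 / q) * X powr (1 / r) = X" using Xp by (simp add: r(2) flip: powr_add)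
    with \<open>X \<le> C * X powr (1 / r)\<close> have "X powr (1 / q) * X powr (1 / r) \<le> C * X powr (1 / r)" by simp
    then have "X powr (1 / q) \<le> C" using Xp by simp
    then have "(X powr (1 / q)) powr q \<le> C powr q" using q by (intro powr_mono2) auto
    then show ?thesis using Xp q by (simp add: powr_powr)
  qed simp
  moreover have "C = K powr (1 - 2 / q) * S powr (1 - 1 / q)" by (simp add: C_def r(2))
  ultimately show ?thesis by (simp only: X_def g_def S_def r_def)
qed

end

section \<open>Weighted form of the bound and the eigenvalue sum\<close>

lemma Holder_sum:
  fixes X Y :: "'i \<Rightarrow> real"
  assumes "finite I" and pos: "\<And>i. i \<in> I \<Longrightarrow> X i > 0" "\<And>i. i \<in> I \<Longrightarrow> Y i > 0" and s: "0 < s" "s < 1"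
  shows "(\<Sum>i\<in>I. X i powr s * Y i powr (1 - s)) \<le> (\<Sum>i\<in>I. X i) powr s * (\<Sum>i\<in>I. Y i) powr (1 - s)"
proof (cases "I = {}")
  case False
  define P Q where "P = (\<Sum>i\<in>I. X i)" and "Q = (\<Sum>i\<in>I. Y i)"
  have PQ: "P > 0" "Q > 0" unfolding P_def Q_def using False assms by (auto intro!: sum_pos)
  have "X i powr s * Y i powr (1 - s) \<le> (P powr s * Q powr (1 - s)) * (s * (X i / P) + (1 - s) * (Y i / Q))"
    if i: "i \<in> I" for i
  proof -
    have "(X i / P) powr s * (Y i / Q) powr (1 - s) \<le> s * (X i / P) + (1 - s) * (Y i / Q)"
      by (rule Youngs_inequality_0) (use s pos[OF i] PQ in auto)
    moreover have "(X i / P) powr s * (Y i / Q) powr (1 - s) = X i powr s * Y i powr (1 - s) / (P powr s * Q powr (1 - s))"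
      using pos[OF i] PQ by (simp add: powr_divide)
    ultimately show ?thesis using PQ by (simp add: divide_le_eq mult.commute)
  qed
  then have "(\<Sum>i\<in>I. X i powr s * Y i powr (1 - s))
      \<le> (\<Sum>i\<in>I. (P powr s * Q powr (1 - s)) * (s * (X i / P) + (1 - s) * (Y i / Q)))"
    by (rule sum_mono)
  also have "\<dots> = (P powr s * Q powr (1 - s)) * (s * (P / P) + (1 - s) * (Q / Q))"
    by (simp only: sum_distrib_left[symmetric] sum.distrib sum_divide_distrib[symmetric] P_def Q_def)
  finally show ?thesis using PQ by (simp add: P_def Q_def)
qed simp

text \<open>Hoelder's inequality with s = r/2 turns the powers of A^2 into a^r and leaves \<mu> to
  the first power. The exponent p = q/(q - 2) is the one with p (1 - s) = s, for which the weights
  \<open>v\<close> cancel.\<close>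

lemma (in orthogonal_system) Lq_bound_weighted:
  assumes q: "q > 2" and v: "\<And>n. n \<in> I \<Longrightarrow> v n > 0"
  shows "(LINT x|M. \<bar>\<Sum>n\<in>I. h n x\<bar> powr q)
    \<le> K powr (q - 2) * (\<Sum>n\<in>I. (A n)\<^sup>2 * v n) powr (q / 2)
      * (\<Sum>n\<in>I. \<mu> n * v n powr (- (q / (q - 2)))) powr ((q - 2) / 2)"
proof -
  define r p s where "r = q / (q - 1)" and "p = q / (q - 2)" and "s = q / (2 * (q - 1))"
  have s1: "1 - s = (q - 2) / (2 * (q - 1))" using q by (simp add: s_def field_simps)
  have "p * (1 - s) = s"
    unfolding s1 unfolding p_def s_def times_divide_times_eq mult.commute[of q "q - 2"]
    by (rule nonzero_mult_divide_mult_cancel_left) (use q in auto)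
  then have s: "0 < s" "s < 1" "s - p * (1 - s) = 0" "2 * s = r"
    using q by (auto simp: s_def r_def field_simps)
  define P Q where "P = (\<Sum>n\<in>I. (A n)\<^sup>2 * v n)" and "Q = (\<Sum>n\<in>I. \<mu> n * v n powr (- p))"
  have PQ: "P \<ge> 0" "Q \<ge> 0" unfolding P_def Q_def using v \<mu>
    by (auto intro!: sum_nonneg mult_nonneg_nonneg simp: less_imp_le)
  have "(\<Sum>n\<in>I. \<mu> n * a n powr r) = (\<Sum>n\<in>I. ((A n)\<^sup>2 * v n) powr s * (\<mu> n * v n powr (- p)) powr (1 - s))"
  proof (rule sum.cong[OF refl])
    fix n assume n: "n \<in> I"
    note pos = \<mu>[OF n] a_pos[OF n] v[OF n]
    have "((A n)\<^sup>2 * v n) powr s * (\<mu> n * v n powr (- p)) powr (1 - s)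
      = (\<mu> n powr s * \<mu> n powr (1 - s)) * (((a n)\<^sup>2) powr s) * (v n powr s * v n powr (- p * (1 - s)))"
      using pos by (simp add: A_eq[OF n] powr_mult powr_powr mult_ac)
    also have "\<mu> n powr s * \<mu> n powr (1 - s) = \<mu> n" using pos by (simp flip: powr_add)
    also have "((a n)\<^sup>2) powr s = a n powr r" using pos s(4) by (simp add: powr_powr flip: powr_numeral)
    also have "v n powr s * v n powr (- p * (1 - s)) = 1" using pos s(3) by (simp flip: powr_add)
    finally show "\<mu> n * a n powr r = ((A n)\<^sup>2 * v n) powr s * (\<mu> n * v n powr (- p)) powr (1 - s)" by simp
  qed
  also have "\<dots> \<le> P powr s * Q powr (1 - s)"
    unfolding P_def Q_def
  proof (rule Holder_sum[OF finI _ _ s(1,2)])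
    fix n assume n: "n \<in> I"
    show "0 < (A n)\<^sup>2 * v n" "0 < \<mu> n * v n powr - p"
      using v[OF n] \<mu>[OF n] A[OF n] by simp_all
  qed
  finally have S: "(\<Sum>n\<in>I. \<mu> n * a n powr r) \<le> P powr s * Q powr (1 - s)" .
  have S0: "(\<Sum>n\<in>I. \<mu> n * a n powr r) \<ge> 0"
    using \<mu> by (intro sum_nonneg mult_nonneg_nonneg) (auto simp: less_imp_le)
  have "(LINT x|M. \<bar>\<Sum>n\<in>I. h n x\<bar> powr q)
      \<le> (K powr (1 - 2 / q) * (\<Sum>n\<in>I. \<mu> n * a n powr r) powr (1 - 1 / q)) powr q"
    unfolding r_def by (rule Lq_bound[OF q])
  also have "\<dots> \<le> (K powr (1 - 2 / q) * (P powr s * Q powr (1 - s)) powr (1 - 1 / q)) powr q"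
    using q S S0 by (intro powr_mono2 mult_left_mono) auto
  also have "\<dots> = K powr ((1 - 2 / q) * q) * (P powr (s * (1 - 1 / q) * q) * Q powr ((1 - s) * (1 - 1 / q) * q))"
    using PQ by (simp add: powr_mult powr_powr mult.assoc)
  also have "(1 - 2 / q) * q = q - 2" using q by (simp add: field_simps)
  also have "s * (1 - 1 / q) * q = q / 2" using q by (simp add: s_def field_simps)
  also have "(1 - s) * (1 - 1 / q) * q = (q - 2) / 2" using q by (simp add: s_def field_simps)
  finally show ?thesis by (simp add: P_def Q_def p_def mult.assoc)
qed

text \<open>The Hermite--Hadamard inequality for the convex function \<open>x powr -p\<close>.\<close>

lemma powr_midpoint_le:
  fixes p c h :: real
  assumes p: "p > 1" and h: "0 \<le> h" "h < c"
  shows "2 * h * c powr (- p) \<le> ((c - h) powr (1 - p) - (c + h) powr (1 - p)) / (p - 1)"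
proof -
  \<comment> \<open>The difference of the two sides as a function of the half-width: it vanishes at
    0, and its derivative measures the midpoint convexity of the power -p.\<close>
  define \<phi> where "\<phi> t = ((c - t) powr (1 - p) - (c + t) powr (1 - p)) / (p - 1) - 2 * t * c powr (- p)" for t
  have "\<phi> 0 \<le> \<phi> h"
  proof (rule DERIV_nonneg_imp_nondecreasing[OF h(1)])
    fix t assume t: "0 \<le> t" "t \<le> h"
    then have ct: "c - t > 0" "c + t > 0" "c > 0" using h by auto
    have "(\<phi> has_real_derivative (c - t) powr (- p) + (c + t) powr (- p) - 2 * c powr (- p)) (at t)"
    proof -
      have "((\<lambda>t. (c - t) powr (1 - p)) has_real_derivative (1 - p) * (c - t) powr (1 - p - of_nat 1) * (-1)) (at t)"
        "((\<lambda>t. (c + t) powr (1 - p)) has_real_derivative (1 - p) * (c + t) powr (1 - p - of_nat 1) * 1) (at t)"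
        using ct by (auto intro!: DERIV_fun_powr derivative_eq_intros)
      then have "(\<phi> has_real_derivative ((1 - p) * (c - t) powr (1 - p - of_nat 1) * (-1) - (1 - p) * (c + t) powr (1 - p - of_nat 1) * 1) / (p - 1)
          - 2 * c powr (- p)) (at t)"
        unfolding \<phi>_def by (intro derivative_intros DERIV_cdivide DERIV_diff) (auto intro!: derivative_eq_intros)
      moreover have "((1 - p) * x * (-1) - (1 - p) * y * 1) / (p - 1) = x + y" for x y
        using p by (simp add: field_simps)
      ultimately show ?thesis by simp
    qed
    moreover have "(c - t) powr (- p) + (c + t) powr (- p) - 2 * c powr (- p) \<ge> 0"
    proof -
      \<comment> \<open>Convexity comes from (c - t)(c + t) \<le> c^2 followed by 2 x y \<le> x^2 +
        y^2.\<close>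
      define x y where "x = (c - t) powr (- p / 2)" and "y = (c + t) powr (- p / 2)"
      have "c powr (- p) = (c * c) powr (- p / 2)" using ct by (simp add: powr_mult flip: powr_add)
      also have "\<dots> \<le> ((c - t) * (c + t)) powr (- p / 2)"
      proof (intro powr_mono2')
        show "0 < (c - t) * (c + t)" using ct by simp
        show "(c - t) * (c + t) \<le> c * c" by (simp add: algebra_simps)
      qed (use p in auto)
      also have "\<dots> = x * y" using ct by (simp add: x_def y_def powr_mult)
      finally have "2 * c powr (- p) \<le> 2 * x * y" by simp
      also have "\<dots> \<le> x\<^sup>2 + y\<^sup>2" using zero_le_power2[of "x - y"] by (simp add: power2_diff)
      also have "\<dots> = (c - t) powr (- p) + (c + t) powr (- p)"
        by (simp add: x_def y_def power2_eq_square flip: powr_add)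
      finally show ?thesis by simp
    qed
    ultimately show "\<exists>y. (\<phi> has_real_derivative y) (at t) \<and> 0 \<le> y" by blast
  qed
  then show ?thesis by (simp add: \<phi>_def)
qed

text \<open>The interval from n^2 + m to (n + 1)^2 + m has length 2n + 1 and midpoint n^2 + n + 1/2
  + m, which lies below n(n + 1) + 1 + m. The midpoint inequality thus bounds the n-th term by the
  integral of the power over this interval; the intervals are adjacent and the first one starts at
  \<open>m\<close>.\<close>

lemma eigenvalue_sum_bound:
  fixes p m :: real
  assumes p: "p > 1" and m: "m > 0" and I: "finite I"
  shows "(\<Sum>n\<in>I. (2 * real n + 1) * (real n * (real n + 1) + 1 + m) powr (- p)) \<le> m powr (1 - p) / (p - 1)"
proof -
  define G where "G n = ((real n)\<^sup>2 + m) powr (1 - p) / (p - 1)" for n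
  have step: "(2 * real n + 1) * (real n * (real n + 1) + 1 + m) powr (- p) \<le> G n - G (Suc n)" for n
  proof -
    define c h where "c = (real n)\<^sup>2 + real n + 1/2 + m" and "h = real n + 1/2"
    have hc: "0 \<le> h" "h < c" using m by (auto simp: c_def h_def add_pos_nonneg add_nonneg_pos)
    have "(2 * real n + 1) * (real n * (real n + 1) + 1 + m) powr (- p) \<le> 2 * h * c powr (- p)"
      using p hc m by (intro mult_mono powr_mono2') (auto simp: c_def h_def power2_eq_square algebra_simps)
    also have "\<dots> \<le> ((c - h) powr (1 - p) - (c + h) powr (1 - p)) / (p - 1)"
      by (rule powr_midpoint_le[OF p hc])
    also have "\<dots> = G n - G (Suc n)"
      by (simp add: G_def c_def h_def diff_divide_distrib power2_eq_square algebra_simps)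
    finally show ?thesis .
  qed
  obtain N where N: "I \<subseteq> {..<N}" using I finite_nat_bounded by blast
  have "(\<Sum>n\<in>I. (2 * real n + 1) * (real n * (real n + 1) + 1 + m) powr (- p))
      \<le> (\<Sum>n<N. (2 * real n + 1) * (real n * (real n + 1) + 1 + m) powr (- p))"
    by (rule sum_mono2) (use N in auto)
  also have "\<dots> \<le> (\<Sum>n<N. G n - G (Suc n))" by (intro sum_mono step)
  also have "\<dots> = G 0 - G N" by (rule sum_lessThan_telescope')
  also have "\<dots> \<le> G 0" using p by (simp add: G_def)
  finally show ?thesis by (simp add: G_def)
qed

text \<open>As a function of m the bound is a constant times (E + m N)^(q/2) / m. It is minimal at m
  = 2E/((q - 2)N), where E + m N = E q/(q - 2).\<close>

lemma optimise_shift: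
  fixes q N E k X :: real
  assumes q: "q > 2" and NE: "N > 0" "E > 0"
    and X: "\<And>m. m > 0 \<Longrightarrow> X \<le> k * (E + m * N) powr (q / 2)
      * (m powr (1 - q / (q - 2)) / (q / (q - 2) - 1)) powr ((q - 2) / 2)"
  shows "X \<le> k * (q / 2) powr (q / 2) * N * E powr ((q - 2) / 2)"
proof -
  define m where "m = 2 * E / ((q - 2) * N)"
  have m: "m > 0" using q NE by (simp add: m_def)
  have 1: "E + m * N = E * (q / (q - 2))" using q NE by (simp add: m_def field_simps)
  have e: "1 - q / (q - 2) = - (2 / (q - 2))" "q / (q - 2) - 1 = 2 / (q - 2)" using q by (auto simp: field_simps)
  have e1: "(1 - q / (q - 2)) * ((q - 2) / 2) = - 1" using q by (simp add: field_simps)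
  have 2: "(m powr (1 - q / (q - 2)) / (q / (q - 2) - 1)) powr ((q - 2) / 2)
      = ((q - 2) / 2) powr ((q - 2) / 2) / m"
  proof -
    have "(m powr (1 - q / (q - 2)) / (q / (q - 2) - 1)) powr ((q - 2) / 2)
        = (m powr (1 - q / (q - 2)) * ((q - 2) / 2)) powr ((q - 2) / 2)"
      unfolding e(2) using q by (simp add: field_simps)
    also have "\<dots> = m powr ((1 - q / (q - 2)) * ((q - 2) / 2)) * ((q - 2) / 2) powr ((q - 2) / 2)"
      using q m by (subst powr_mult) (simp_all add: powr_powr)
    also have "\<dots> = ((q - 2) / 2) powr ((q - 2) / 2) / m"
      unfolding e1 powr_neg_one[OF m] by simp
    finally show ?thesis .
  qed
  have h: "(q - 2) / 2 = q / 2 - 1" by simp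
  have 3: "((q - 2) / 2) powr ((q - 2) / 2) = ((q - 2) / 2) powr (q / 2) / ((q - 2) / 2)"
    unfolding h using q by (subst powr_diff) auto
  have 4: "E powr ((q - 2) / 2) = E powr (q / 2) / E"
    unfolding h using NE by (subst powr_diff) auto
  have "(E * (q / (q - 2))) powr (q / 2) * ((q - 2) / 2) powr (q / 2) = (E * (q / (q - 2)) * ((q - 2) / 2)) powr (q / 2)"
    by (rule powr_mult[symmetric])
  also have "E * (q / (q - 2)) * ((q - 2) / 2) = E * (q / 2)" using q by (simp add: field_simps)
  also have "(E * (q / 2)) powr (q / 2) = E powr (q / 2) * (q / 2) powr (q / 2)"
    by (rule powr_mult)
  finally have 5: "(E * (q / (q - 2))) powr (q / 2) * ((q - 2) / 2) powr (q / 2) = E powr (q / 2) * (q / 2) powr (q / 2)" .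
  have "X \<le> k * (E * (q / (q - 2))) powr (q / 2) * (((q - 2) / 2) powr ((q - 2) / 2) / m)"
    using X[OF m] unfolding 1 2 .
  also have "\<dots> = k * ((E * (q / (q - 2))) powr (q / 2) * ((q - 2) / 2) powr (q / 2)) / (((q - 2) / 2) * m)"
    unfolding 3 by simp
  also have "((q - 2) / 2) * m = E / N" using q NE by (simp add: m_def)
  also have "k * ((E * (q / (q - 2))) powr (q / 2) * ((q - 2) / 2) powr (q / 2)) / (E / N)
      = k * (q / 2) powr (q / 2) * N * E powr ((q - 2) / 2)"
    unfolding 5 4 using NE by simp
  finally show ?thesis .
qed

section \<open>Legendre polynomials\<close>

text \<open>Bonnet's recursion, with its coefficients written for the degree n + 2.\<close>

fun legendre :: "nat \<Rightarrow> real poly" where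
  "legendre 0 = 1"
| "legendre (Suc 0) = [:0, 1:]"
| "legendre (Suc (Suc n)) = smult (1 / (real n + 2))
    (smult (2 * real n + 3) ([:0, 1:] * legendre (Suc n)) - smult (real n + 1) (legendre n))"

text \<open>At n = 0 the truncated index \<open>n - 1\<close> carries the factor 0, so one formula
  serves all degrees.\<close>

lemma legendre_rec:
  "(2 * real n + 1) * (t * poly (legendre n) t)
    = (real n + 1) * poly (legendre (Suc n)) t + real n * poly (legendre (n - 1)) t"
proof (cases n)
  case (Suc k)
  have "(real k + 2) * poly (legendre (Suc (Suc k))) t
      = (2 * real k + 3) * (t * poly (legendre (Suc k)) t) - (real k + 1) * poly (legendre k) t"
    by simp
  then show ?thesis using Suc by (simp del: legendre.simps add: algebra_simps)
qed simp

text \<open>The inductive step for each identity uses the other, hence the joint induction. Together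
  they lead to Legendre's differential equation.\<close>

lemma legendre_deriv:
  "poly (pderiv (legendre (Suc n))) t = (real n + 1) * poly (legendre n) t + t * poly (pderiv (legendre n)) t"
  "t * poly (pderiv (legendre (Suc n))) t = poly (pderiv (legendre n)) t + (real n + 1) * poly (legendre (Suc n)) t"
proof (induction n)
  case 0
  show "poly (pderiv (legendre (Suc 0))) t = (real 0 + 1) * poly (legendre 0) t + t * poly (pderiv (legendre 0)) t"
    "t * poly (pderiv (legendre (Suc 0))) t = poly (pderiv (legendre 0)) t + (real 0 + 1) * poly (legendre (Suc 0)) t"
    by (simp_all add: pderiv_pCons)
next
  case (Suc n)
  let ?P = "\<lambda>k. poly (legendre k) t" and ?D = "\<lambda>k. poly (pderiv (legendre k)) t"
  have P: "(real n + 2) * ?P (Suc (Suc n)) = (2 * real n + 3) * (t * ?P (Suc n)) - (real n + 1) * ?P n"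
    by simp
  have D: "(real n + 2) * ?D (Suc (Suc n)) = (2 * real n + 3) * (?P (Suc n) + t * ?D (Suc n)) - (real n + 1) * ?D n"
  proof -
    define Q where "Q = smult (2 * real n + 3) ([:0, 1:] * legendre (Suc n)) - smult (real n + 1) (legendre n)"
    have "legendre (Suc (Suc n)) = smult (1 / (real n + 2)) Q" by (simp add: Q_def)
    then have "?D (Suc (Suc n)) = 1 / (real n + 2) * poly (pderiv Q) t" by (simp only: pderiv_smult poly_smult)
    then have "(real n + 2) * ?D (Suc (Suc n)) = poly (pderiv Q) t" by simp
    also have "\<dots> = (2 * real n + 3) * (?P (Suc n) + t * ?D (Suc n)) - (real n + 1) * ?D n"
      unfolding Q_def pderiv_diff pderiv_smult pderiv_mult poly_diff poly_smult poly_add poly_mult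
      by (simp add: pderiv_pCons algebra_simps del: legendre.simps)
    finally show ?thesis .
  qed
  have d: "?D n = t * ?D (Suc n) - (real n + 1) * ?P (Suc n)" using Suc.IH(2) by simp
  have "(real n + 2) * ?D (Suc (Suc n)) = (real n + 2) * ((real n + 2) * ?P (Suc n) + t * ?D (Suc n))"
    unfolding D d by (simp add: algebra_simps)
  then have a: "?D (Suc (Suc n)) = (real n + 2) * ?P (Suc n) + t * ?D (Suc n)"
    by (subst (asm) mult_left_cancel) auto
  then show "?D (Suc (Suc n)) = (real (Suc n) + 1) * ?P (Suc n) + t * ?D (Suc n)" by (simp add: add.commute)
  have "t * (t * ?D (Suc n)) = t * ?D n + (real n + 1) * (t * ?P (Suc n))"
    using Suc.IH(2) by (simp add: algebra_simps)
  also have "t * ?D n = ?D (Suc n) - (real n + 1) * ?P n" using Suc.IH(1) by simp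
  finally have "t * ?D (Suc (Suc n)) = ?D (Suc n) + (real n + 2) * ?P (Suc (Suc n))"
    unfolding P a by (simp add: algebra_simps)
  then show "t * ?D (Suc (Suc n)) = ?D (Suc n) + (real (Suc n) + 1) * ?P (Suc (Suc n))" by (simp add: add.commute)
qed

lemma legendre_at_1: "poly (legendre n) 1 = 1"
proof (induction n rule: legendre.induct)
  case (3 n)
  then show ?case by (simp add: field_simps)
qed simp_all

text \<open>The Laplace--Beltrami operator acting on \<open>x \<mapsto> p (x \<bullet> y)\<close>.\<close>

definition zonal_laplace :: "real poly \<Rightarrow> real poly" where
  "zonal_laplace p = [:1, 0, -1:] * pderiv (pderiv p) - smult 2 ([:0, 1:] * pderiv p)"

lemma poly_zonal_laplace:
  "poly (zonal_laplace p) t = (1 - t\<^sup>2) * poly (pderiv (pderiv p)) t - 2 * t * poly (pderiv p) t"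
  by (simp add: zonal_laplace_def power2_eq_square algebra_simps)

text \<open>With P of degree k + 1 and P_k its predecessor, the two derivative identities give (1 -
  t^2) P' = (k + 1)(P_k - t P). Differentiating once more produces the operator on the left, and the
  second identity removes the remaining derivatives.\<close>

lemma zonal_laplace_legendre:
  "zonal_laplace (legendre n) = smult (- (real n * (real n + 1))) (legendre n)"
proof (cases n)
  case 0
  then show ?thesis by (simp add: zonal_laplace_def)
next
  case (Suc k)
  let ?P = "legendre k" and ?Q = "legendre (Suc k)"
  have "[:1, 0, -1:] * pderiv ?Q = smult (real k + 1) (?P - [:0, 1:] * ?Q)"
  proof (rule poly_ext)
    fix t
    have "(1 - t * t) * poly (pderiv ?Q) t = poly (pderiv ?Q) t - t * (t * poly (pderiv ?Q) t)"
      by (simp add: algebra_simps)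
    also have "\<dots> = (real k + 1) * (poly ?P t - t * poly ?Q t)"
      unfolding legendre_deriv(2) unfolding legendre_deriv(1) by (simp add: algebra_simps)
    finally show "poly ([:1, 0, -1:] * pderiv ?Q) t = poly (smult (real k + 1) (?P - [:0, 1:] * ?Q)) t"
      by (simp add: algebra_simps)
  qed
  then have e: "pderiv ([:1, 0, -1:] * pderiv ?Q) = pderiv (smult (real k + 1) (?P - [:0, 1:] * ?Q))"
    by simp
  show ?thesis unfolding Suc
  proof (rule poly_ext)
    fix t
    have "poly (pderiv ([:1, 0, -1:] * pderiv ?Q)) t = poly (zonal_laplace ?Q) t"
      unfolding pderiv_mult poly_add poly_mult poly_zonal_laplace
      by (simp add: pderiv_pCons algebra_simps power2_eq_square del: legendre.simps)
    moreover have "poly (pderiv (smult (real k + 1) (?P - [:0, 1:] * ?Q))) t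
        = (real k + 1) * (poly (pderiv ?P) t - poly ?Q t - t * poly (pderiv ?Q) t)"
      unfolding pderiv_smult pderiv_diff pderiv_mult poly_smult poly_diff poly_add poly_mult
      by (simp add: pderiv_pCons algebra_simps del: legendre.simps)
    ultimately have "poly (zonal_laplace ?Q) t = (real k + 1) * (poly (pderiv ?P) t - poly ?Q t - t * poly (pderiv ?Q) t)"
      using e by simp
    then show "poly (zonal_laplace ?Q) t = poly (smult (- (real (Suc k) * (real (Suc k) + 1))) ?Q) t"
      unfolding legendre_deriv(2) by (simp add: algebra_simps del: legendre.simps)
  qed
qed

text \<open>On [-1, 1] the base lies in [0, 1] and reaches 1 only at t = 1, so high powers
  concentrate at coinciding points; as polynomials they have finite Legendre expansions.\<close>

definition kernel_poly :: "nat \<Rightarrow> real poly" where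
  "kernel_poly k = [:1/2, 1/2:] ^ k"

lemma poly_kernel: "poly (kernel_poly k) t = ((1 + t) / 2) ^ k"
  by (simp add: kernel_poly_def poly_power add_divide_distrib)

text \<open>The operator lowers the power by one, up to a multiple of the same power. As a Laplacian
  integrates to 0 over the sphere, this becomes a recursion for the masses of the kernels.\<close>

lemma zonal_laplace_kernel:
  "zonal_laplace (kernel_poly (Suc j))
    = smult ((real j + 1)\<^sup>2) (kernel_poly j) - smult ((real j + 1) * (real j + 2)) (kernel_poly (Suc j))"
proof (rule poly_ext)
  fix t :: real
  define s where "s = (1 + t) / 2"
  have t: "t = 2 * s - 1" by (simp add: s_def field_simps)
  have d1: "pderiv (kernel_poly (Suc j)) = smult ((real j + 1) / 2) (kernel_poly j)" for j
    unfolding kernel_poly_def by (subst pderiv_power) (simp add: pderiv_pCons algebra_simps)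
  have d2: "(1 - t\<^sup>2) * poly (pderiv (kernel_poly j)) t = real j * 2 * (1 - s) * s ^ j"
  proof (cases j)
    case 0
    then show ?thesis by (simp add: kernel_poly_def)
  next
    case (Suc i)
    have "1 - t\<^sup>2 = 4 * s * (1 - s)" by (simp add: t power2_eq_square algebra_simps)
    then show ?thesis unfolding Suc d1 by (simp add: poly_kernel flip: s_def)
  qed
  have "poly (zonal_laplace (kernel_poly (Suc j))) t = (real j + 1) / 2 * (real j * 2 * (1 - s) * s ^ j)
      - 2 * t * ((real j + 1) / 2 * s ^ j)"
    unfolding poly_zonal_laplace d1 pderiv_smult poly_smult d2[symmetric] by (simp add: poly_kernel s_def)
  also have "\<dots> = (real j + 1)\<^sup>2 * s ^ j - (real j + 1) * (real j + 2) * (s * s ^ j)"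
    by (simp add: t power2_eq_square field_simps)
  finally show "poly (zonal_laplace (kernel_poly (Suc j))) t
    = poly (smult ((real j + 1)\<^sup>2) (kernel_poly j) - smult ((real j + 1) * (real j + 2)) (kernel_poly (Suc j))) t"
    by (simp add: poly_kernel s_def)
qed

text \<open>Bonnet's recursion makes multiplication by t a shift of the Legendre index by one in
  either direction. Powers of (1 + t)/2 are expanded by repeating this.\<close>

lemma legendre_span_mult:
  assumes "\<And>t. f t = (\<Sum>n\<le>k. a n * poly (legendre n) t)"
  shows "\<exists>b. \<forall>t. t * f t = (\<Sum>n\<le>Suc k. b n * poly (legendre n) t)"
  using assms
proof (induction k arbitrary: f)
  case 0
  then show ?case by (intro exI[of _ "\<lambda>n. if n = 1 then a 0 else 0"]) simp
next
  case (Suc k)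
  let ?P = "\<lambda>n. poly (legendre n)"
  obtain b where b: "\<And>t. t * (\<Sum>n\<le>k. a n * ?P n t) = (\<Sum>n\<le>Suc k. b n * ?P n t)"
    using Suc.IH[OF refl] by blast
  define c where "c n = (if n \<le> Suc k then b n else 0) + (if n = Suc (Suc k) then a (Suc k) * (real k + 2) / (2 * real k + 3) else 0)
      + (if n = k then a (Suc k) * (real k + 1) / (2 * real k + 3) else 0)" for n
  have rec: "(2 * real k + 3) * (t * ?P (Suc k) t) = (real k + 2) * ?P (Suc (Suc k)) t + (real k + 1) * ?P k t" for t
    using legendre_rec[of "Suc k" t] by (simp del: legendre.simps add: algebra_simps)
  have "t * f t = (\<Sum>n\<le>Suc (Suc k). c n * ?P n t)" for t
  proof -
    have "a (Suc k) * (t * ?P (Suc k) t) = a (Suc k) * ((2 * real k + 3) * (t * ?P (Suc k) t)) / (2 * real k + 3)"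
    proof -
      have "2 * real k + 3 \<noteq> 0" by (simp add: add_nonneg_eq_0_iff)
      then show ?thesis by (simp del: legendre.simps)
    qed
    also have "\<dots> = a (Suc k) * (real k + 2) / (2 * real k + 3) * ?P (Suc (Suc k)) t + a (Suc k) * (real k + 1) / (2 * real k + 3) * ?P k t"
    proof -
      have "A * (x * P + y * Q) / u = A * x / u * P + A * y / u * Q" for A x y P Q u :: real
        by (simp add: distrib_left add_divide_distrib mult.assoc)
      then show ?thesis unfolding rec .
    qed
    finally have "t * f t = (\<Sum>n\<le>Suc k. b n * ?P n t) + a (Suc k) * (real k + 2) / (2 * real k + 3) * ?P (Suc (Suc k)) t
        + a (Suc k) * (real k + 1) / (2 * real k + 3) * ?P k t"
      unfolding Suc.prems b[symmetric] by (simp add: algebra_simps del: legendre.simps)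
    also have "\<dots> = (\<Sum>n\<le>Suc (Suc k). c n * ?P n t)"
    proof -
      have c: "c n * ?P n t = (if n \<le> Suc k then b n * ?P n t else 0)
          + (if n = Suc (Suc k) then a (Suc k) * (real k + 2) / (2 * real k + 3) * ?P n t else 0)
          + (if n = k then a (Suc k) * (real k + 1) / (2 * real k + 3) * ?P n t else 0)" for n
        unfolding c_def by (simp add: algebra_simps del: legendre.simps)
      then have "(\<Sum>n\<le>Suc (Suc k). c n * ?P n t) = (\<Sum>n\<le>Suc (Suc k). if n \<le> Suc k then b n * ?P n t else 0)
          + a (Suc k) * (real k + 2) / (2 * real k + 3) * ?P (Suc (Suc k)) t
          + a (Suc k) * (real k + 1) / (2 * real k + 3) * ?P k t"
        unfolding c sum.distrib sum.delta[OF finite_atMost] by simp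
      also have "(\<Sum>n\<le>Suc (Suc k). if n \<le> Suc k then b n * ?P n t else 0) = (\<Sum>n\<le>Suc k. b n * ?P n t)"
        by (rule sum.mono_neutral_cong_right) auto
      finally show ?thesis by simp
    qed
    finally show ?thesis .
  qed
  then show ?case by blast
qed

lemma kernel_legendre:
  "\<exists>a. \<forall>t. poly (kernel_poly k) t = (\<Sum>n\<le>k. a n * poly (legendre n) t)"
proof (induction k)
  case 0
  show ?case by (intro exI[of _ "\<lambda>_. 1"]) (simp add: kernel_poly_def)
next
  case (Suc k)
  then obtain a where a: "\<And>t. poly (kernel_poly k) t = (\<Sum>n\<le>k. a n * poly (legendre n) t)" by blast
  obtain b where b: "\<And>t. t * poly (kernel_poly k) t = (\<Sum>n\<le>Suc k. b n * poly (legendre n) t)"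
    using legendre_span_mult[OF a] by blast
  define c where "c n = (if n \<le> k then a n / 2 else 0) + b n / 2" for n
  have "poly (kernel_poly (Suc k)) t = (\<Sum>n\<le>Suc k. c n * poly (legendre n) t)" for t
  proof -
    have k: "poly (kernel_poly k) t = (\<Sum>n\<le>Suc k. (if n \<le> k then a n else 0) * poly (legendre n) t)"
      unfolding a by (rule sum.mono_neutral_cong_left) auto
    have "poly (kernel_poly (Suc k)) t = 1 / 2 * poly (kernel_poly k) t + 1 / 2 * (t * poly (kernel_poly k) t)"
      by (simp add: poly_kernel field_simps)
    also have "\<dots> = (\<Sum>n\<le>Suc k. c n * poly (legendre n) t)"
      unfolding b unfolding k sum_distrib_left sum.distrib[symmetric]
      by (intro sum.cong refl) (simp add: c_def algebra_simps del: legendre.simps)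
    finally show ?thesis .
  qed
  then show ?case by blast
qed

section \<open>Zonal functions on the sphere\<close>

lemma measurable_poly[measurable]: "poly (p :: real poly) \<in> borel_measurable borel"
  by (intro borel_measurable_continuous_onI continuous_intros)

text \<open>For unit vectors this is the tangential gradient of x \<mapsto> p(x \<bullet> y): p'
  times the projection of y to the tangent plane at x.\<close>

definition zonal_grad :: "real poly \<Rightarrow> real^3 \<Rightarrow> real^3 \<Rightarrow> real^3" where
  "zonal_grad p y x = poly (pderiv p) (x \<bullet> y) *\<^sub>R (y - (x \<bullet> y) *\<^sub>R x)"

lemma norm_inner_le_1: "norm x = 1 \<Longrightarrow> norm y = 1 \<Longrightarrow> \<bar>x \<bullet> y\<bar> \<le> 1"
  using Cauchy_Schwarz_ineq2[of x y] by simp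

lemma zonal_bounded:
  obtains B where "\<And>x y :: real^3. norm x = 1 \<Longrightarrow> norm y = 1 \<Longrightarrow> \<bar>poly p (x \<bullet> y)\<bar> \<le> B"
proof -
  have "compact (poly p ` {-1..1})"
    by (intro compact_continuous_image continuous_intros compact_Icc)
  then obtain B where "\<forall>t\<in>{-1..1}. \<bar>poly p t\<bar> \<le> B"
    using compact_imp_bounded by (force simp: bounded_iff)
  moreover have "x \<bullet> y \<in> {-1..1}" if "norm x = 1" "norm y = 1" for x y :: "real^3"
    using norm_inner_le_1[OF that] by (auto simp: abs_le_iff)
  ultimately show ?thesis by (intro that[of B]) blast
qed

lemma zonal_grad_bounded:
  obtains B where "\<And>x y :: real^3. norm x = 1 \<Longrightarrow> norm y = 1 \<Longrightarrow> norm (zonal_grad p y x) \<le> B"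
proof -
  obtain B where B: "\<And>x y :: real^3. norm x = 1 \<Longrightarrow> norm y = 1 \<Longrightarrow> \<bar>poly (pderiv p) (x \<bullet> y)\<bar> \<le> B"
    using zonal_bounded by blast
  have "norm (zonal_grad p y x) \<le> B * 2" if xy: "norm x = 1" "norm y = 1" for x y
  proof -
    have "norm (y - (x \<bullet> y) *\<^sub>R x) \<le> norm y + \<bar>x \<bullet> y\<bar> * norm x"
      by (metis norm_scaleR norm_triangle_ineq4)
    also have "\<dots> \<le> 2" using xy norm_inner_le_1[OF xy] by simp
    finally show ?thesis
      unfolding zonal_grad_def norm_scaleR using B[OF xy] by (intro mult_mono) auto
  qed
  then show ?thesis using that by blast
qed

lemma integrable_zonal: "integrable surface (\<lambda>x. poly p (x \<bullet> y))"
  by (rule integrable_surface) (intro continuous_intros)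

lemma integrable_zonal2: "integrable surface (\<lambda>x. poly p (x \<bullet> y) * poly q (x \<bullet> z))"
  by (rule integrable_surface) (intro continuous_intros)

lemma has_derivative_direction:
  assumes "x \<noteq> 0"
  shows "((\<lambda>x. poly p ((x \<bullet> y) / norm x)) has_derivative
    (\<lambda>h. poly (pderiv p) ((x \<bullet> y) / norm x) * ((h \<bullet> y) / norm x - (x \<bullet> y) * (sgn x \<bullet> h) / (norm x)\<^sup>2))) (at x)"
proof -
  have "((\<lambda>x. (x \<bullet> y) / norm x) has_derivative (\<lambda>h. (h \<bullet> y) / norm x - (x \<bullet> y) * (sgn x \<bullet> h) / (norm x)\<^sup>2)) (at x)"
    using assms by (auto intro!: derivative_eq_intros has_derivative_norm simp: field_simps power2_eq_square inner_commute)
  from has_derivative_compose[OF this poly_DERIV[THEN has_field_derivative_imp_has_derivative]]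
  show ?thesis .
qed

text \<open>Green's formula against a zonal function: the divergence theorem for \<open>f \<nabla>g\<close> with
  \<open>g x = p (sgn x \<bullet> y)\<close>.\<close>

lemma zonal_Green:
  assumes f: "\<And>x. x \<noteq> 0 \<Longrightarrow> (f has_derivative f' x) (at x)"
    and cont: "\<And>b. b \<in> Basis \<Longrightarrow> continuous_on (- {0}) (\<lambda>x. f' x b)"
    and hom: "\<And>x c. x \<noteq> 0 \<Longrightarrow> c > 0 \<Longrightarrow> f (c *\<^sub>R x) = f x"
    and y: "norm y = 1"
  shows "(LINT x|surface. f' x (zonal_grad p y x)) = - (LINT x|surface. f x * poly (zonal_laplace p) (x \<bullet> y))"
proof -
  define \<tau> where "\<tau> x = (x \<bullet> y) / norm x" for x
  \<comment> \<open>The ambient gradient of p((x \<bullet> y)/|x|). It has degree -1, as the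
    divergence theorem demands, and is orthogonal to x, so the normal term of that theorem
    vanishes.\<close>
  define V where "V x = poly (pderiv p) (\<tau> x) *\<^sub>R ((1 / norm x) *\<^sub>R y - ((x \<bullet> y) / norm x ^ 3) *\<^sub>R x)" for x
  define D\<tau> where "D\<tau> x h = (h \<bullet> y) / norm x - (x \<bullet> y) * (sgn x \<bullet> h) / (norm x)\<^sup>2" for x h
  define DR where "DR x h = (- (sgn x \<bullet> h) / (norm x)\<^sup>2) *\<^sub>R y
      - (((h \<bullet> y) / norm x ^ 3 - 3 * (x \<bullet> y) * (sgn x \<bullet> h) / norm x ^ 4) *\<^sub>R x + ((x \<bullet> y) / norm x ^ 3) *\<^sub>R h)" for x h
  define DV where "DV x h = poly (pderiv p) (\<tau> x) *\<^sub>R DR x h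
      + (poly (pderiv (pderiv p)) (\<tau> x) * D\<tau> x h) *\<^sub>R ((1 / norm x) *\<^sub>R y - ((x \<bullet> y) / norm x ^ 3) *\<^sub>R x)" for x h
  have n3: "((\<lambda>x. (x \<bullet> y) / norm x ^ 3) has_derivative
      (\<lambda>h. (h \<bullet> y) / norm x ^ 3 - 3 * (x \<bullet> y) * (sgn x \<bullet> h) / norm x ^ 4)) (at x)" if x: "x \<noteq> 0" for x
    using x by (auto intro!: derivative_eq_intros has_derivative_norm simp: field_simps inner_commute power_numeral_reduce)
  have n1: "((\<lambda>x. 1 / norm x) has_derivative (\<lambda>h. - (sgn x \<bullet> h) / (norm x)\<^sup>2)) (at x)" if x: "x \<noteq> 0" for x :: "real^3"
    using x by (auto intro!: derivative_eq_intros has_derivative_norm simp: field_simps inner_commute power2_eq_square)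
  have DR: "((\<lambda>x. (1 / norm x) *\<^sub>R y - ((x \<bullet> y) / norm x ^ 3) *\<^sub>R x) has_derivative DR x) (at x)" if x: "x \<noteq> 0" for x
    unfolding DR_def
    by (rule has_derivative_eq_rhs, (rule has_derivative_diff has_derivative_scaleR n1[OF x] n3[OF x] has_derivative_ident has_derivative_const)+)
      (auto simp: fun_eq_iff algebra_simps)
  have DV: "(V has_derivative DV x) (at x)" if x: "x \<noteq> 0" for x
    unfolding V_def \<tau>_def
    by (rule has_derivative_eq_rhs, rule has_derivative_scaleR[OF has_derivative_direction[OF x] DR[OF x]])
      (auto simp: fun_eq_iff DV_def D\<tau>_def \<tau>_def)
  define W where "W x = f x *\<^sub>R V x" for x
  define DW where "DW x h = f x *\<^sub>R DV x h + f' x h *\<^sub>R V x" for x h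
  have cf: "continuous_on (- {0}) f"
    by (intro continuous_at_imp_continuous_on ballI has_derivative_continuous[OF f]) auto
  have div: "(\<Sum>b\<in>Basis. DW x b \<bullet> b) = f x * poly (zonal_laplace p) (x \<bullet> y) + f' x (zonal_grad p y x)" if x: "norm x = 1" for x
  proof -
    have x0: "x \<noteq> 0" using x by auto
    have sx: "sgn x = x" using x by (simp add: sgn_div_norm)
    have Vx: "V x = zonal_grad p y x" using x by (simp add: V_def \<tau>_def zonal_grad_def)
    have "(\<Sum>b\<in>Basis. f' x b *\<^sub>R V x \<bullet> b) = f' x (\<Sum>b\<in>Basis. (V x \<bullet> b) *\<^sub>R b)"
      using has_derivative_linear[OF f[OF x0]] by (simp add: linear_sum linear_scale mult.commute)
    then have 1: "(\<Sum>b\<in>Basis. f' x b *\<^sub>R V x \<bullet> b) = f' x (zonal_grad p y x)"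
      by (simp only: euclidean_representation Vx)
    have b1: "(\<Sum>b\<in>Basis. (b \<bullet> v) * (w \<bullet> b)) = v \<bullet> w" "(\<Sum>b\<in>Basis. (v \<bullet> b) * (w \<bullet> b)) = v \<bullet> w" for v w :: "real^3"
      by (simp_all only: euclidean_inner[of v w] inner_commute)
    have "DV x b \<bullet> b = poly (pderiv p) (x \<bullet> y) * (- ((x \<bullet> b) * (y \<bullet> b)) - (b \<bullet> y) * (x \<bullet> b)
          + 3 * (x \<bullet> y) * ((x \<bullet> b) * (x \<bullet> b)) - (x \<bullet> y) * (b \<bullet> b))
        + poly (pderiv (pderiv p)) (x \<bullet> y) * ((b \<bullet> y) * (y \<bullet> b) - (x \<bullet> y) * ((b \<bullet> y) * (x \<bullet> b))
          - (x \<bullet> y) * ((x \<bullet> b) * (y \<bullet> b)) + (x \<bullet> y)\<^sup>2 * ((x \<bullet> b) * (x \<bullet> b)))" for b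
      unfolding DV_def DR_def D\<tau>_def \<tau>_def x sx
      by (simp add: inner_simps algebra_simps power2_eq_square)
    then have "(\<Sum>b\<in>Basis. DV x b \<bullet> b)
        = poly (pderiv p) (x \<bullet> y) * (- (x \<bullet> y) - (y \<bullet> x) + 3 * (x \<bullet> y) * (x \<bullet> x) - (x \<bullet> y) * (\<Sum>b\<in>(Basis :: (real^3) set). b \<bullet> b))
        + poly (pderiv (pderiv p)) (x \<bullet> y) * (y \<bullet> y - (x \<bullet> y) * (y \<bullet> x) - (x \<bullet> y) * (x \<bullet> y) + (x \<bullet> y)\<^sup>2 * (x \<bullet> x))"
      by (simp only: sum_distrib_left[symmetric] sum.distrib sum_subtractf sum_negf b1)
    moreover have "(\<Sum>b\<in>(Basis :: (real^3) set). b \<bullet> b) = 3"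
      by (simp add: inner_Basis)
    ultimately have 2: "(\<Sum>b\<in>Basis. DV x b \<bullet> b) = poly (zonal_laplace p) (x \<bullet> y)"
      using x y by (simp add: dot_square_norm poly_zonal_laplace inner_commute[of y x] power2_eq_square algebra_simps)
    have "(\<Sum>b\<in>Basis. DW x b \<bullet> b) = f x * (\<Sum>b\<in>Basis. DV x b \<bullet> b) + (\<Sum>b\<in>Basis. f' x b *\<^sub>R V x \<bullet> b)"
      by (simp add: DW_def inner_add_left sum.distrib sum_distrib_left)
    then show ?thesis unfolding 1 2 .
  qed
  have cV: "continuous_on (- {0}) V" "continuous_on (- {0}) (\<lambda>x. DV x h)" for h
    unfolding V_def DV_def DR_def D\<tau>_def \<tau>_def
    by (intro continuous_intros continuous_on_sgn; simp)+
  have cDW: "continuous_on (- {0}) (\<lambda>x. DW x b)" if "b \<in> Basis" for b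
    unfolding DW_def by (intro continuous_intros cf cV cont that)
  have "(LINT x|surface. (\<Sum>b\<in>Basis. DW x b \<bullet> b)) = (LINT x|surface. W x \<bullet> x)"
  proof (rule sphere_divergence)
    show "(W has_derivative DW x) (at x)" if x: "x \<noteq> 0" for x
      unfolding W_def[abs_def] DW_def[abs_def]
      by (rule has_derivative_eq_rhs, rule has_derivative_scaleR[OF f[OF x] DV[OF x]]) auto
    show "W (c *\<^sub>R x) = W x /\<^sub>R c" if "x \<noteq> 0" "c > 0" for x c
      using that hom[OF that] by (simp add: W_def V_def \<tau>_def scaleR_diff_right power_mult_distrib power3_eq_cube field_simps)
  qed (rule cDW)
  also have "\<dots> = (LINT x|surface. 0)"
  proof (rule integral_surface_cong)
    show "(\<lambda>x. W x \<bullet> x) \<in> borel_measurable borel"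
      unfolding W_def by (intro borel_measurable_punctured continuous_intros cf cV)
    show "W x \<bullet> x = 0" if x: "norm x = 1" for x
    proof -
      have "V x \<bullet> x = poly (pderiv p) (x \<bullet> y) * (y \<bullet> x - (x \<bullet> y) * (x \<bullet> x))"
        using x by (simp add: V_def \<tau>_def inner_diff_left)
      also have "\<dots> = 0" using x by (simp add: dot_square_norm inner_commute)
      finally show ?thesis by (simp add: W_def)
    qed
  qed simp
  finally have "0 = (LINT x|surface. (\<Sum>b\<in>Basis. DW x b \<bullet> b))" by simp
  also have "\<dots> = (LINT x|surface. f x * poly (zonal_laplace p) (x \<bullet> y) + f' x (zonal_grad p y x))"
  proof -
    have "f' x (zonal_grad p y x) = (\<Sum>b\<in>Basis. (zonal_grad p y x \<bullet> b) * f' x b)" if "x \<noteq> 0" for x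
    proof -
      have "f' x (\<Sum>b\<in>Basis. (zonal_grad p y x \<bullet> b) *\<^sub>R b) = (\<Sum>b\<in>Basis. (zonal_grad p y x \<bullet> b) * f' x b)"
        using has_derivative_linear[OF f[OF that]] by (simp add: linear_sum linear_scale)
      then show ?thesis by (simp only: euclidean_representation)
    qed
    moreover have "continuous_on (- {0}) (\<lambda>x. \<Sum>b\<in>Basis. (zonal_grad p y x \<bullet> b) * f' x b)"
      unfolding zonal_grad_def by (intro continuous_intros cont)
    ultimately have c: "continuous_on (- {0}) (\<lambda>x. f' x (zonal_grad p y x))"
      by (subst continuous_on_cong[OF refl]) auto
    then have "(\<lambda>x. f' x (zonal_grad p y x)) \<in> borel_measurable borel" "integrable surface (\<lambda>x. f' x (zonal_grad p y x))"
      by (auto intro: borel_measurable_punctured integrable_surface)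
    show ?thesis
    proof (rule integral_surface_cong)
      show "(\<lambda>x. \<Sum>b\<in>Basis. DW x b \<bullet> b) \<in> borel_measurable borel"
        by (intro borel_measurable_punctured continuous_intros cDW)
      show "(\<lambda>x. f x * poly (zonal_laplace p) (x \<bullet> y) + f' x (zonal_grad p y x)) \<in> borel_measurable borel"
        by (intro borel_measurable_punctured continuous_intros cf c)
    qed (rule div)
  qed
  also have "\<dots> = (LINT x|surface. f x * poly (zonal_laplace p) (x \<bullet> y)) + (LINT x|surface. f' x (zonal_grad p y x))"
  proof -
    have "f' x (zonal_grad p y x) = (\<Sum>b\<in>Basis. (zonal_grad p y x \<bullet> b) * f' x b)" if "x \<noteq> 0" for x
    proof -
      have "f' x (\<Sum>b\<in>Basis. (zonal_grad p y x \<bullet> b) *\<^sub>R b) = (\<Sum>b\<in>Basis. (zonal_grad p y x \<bullet> b) * f' x b)"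
        using has_derivative_linear[OF f[OF that]] by (simp add: linear_sum linear_scale)
      then show ?thesis by (simp only: euclidean_representation)
    qed
    moreover have "continuous_on (- {0}) (\<lambda>x. \<Sum>b\<in>Basis. (zonal_grad p y x \<bullet> b) * f' x b)"
      unfolding zonal_grad_def by (intro continuous_intros cont)
    ultimately have c: "continuous_on (- {0}) (\<lambda>x. f' x (zonal_grad p y x))"
      by (subst continuous_on_cong[OF refl]) auto
    show ?thesis
      by (intro Bochner_Integration.integral_add integrable_surface c continuous_intros cf)
  qed
  finally show ?thesis by simp
qed

section \<open>Legendre projections\<close>

lemma measurable_zonal_grad[measurable (raw)]:
  assumes [measurable]: "f \<in> borel_measurable M" "g \<in> borel_measurable M"
  shows "(\<lambda>x. zonal_grad p (f x) (g x)) \<in> borel_measurable M"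
  unfolding zonal_grad_def by measurable

lemma zonal_Green2:
  assumes "norm y = 1"
  shows "(LINT x|surface. zonal_grad q z x \<bullet> zonal_grad p y x)
    = - (LINT x|surface. poly q (x \<bullet> z) * poly (zonal_laplace p) (x \<bullet> y))"
proof -
  define f where "f x = poly q ((x \<bullet> z) / norm x)" for x
  define f' where "f' x h = poly (pderiv q) ((x \<bullet> z) / norm x) * ((h \<bullet> z) / norm x - (x \<bullet> z) * (sgn x \<bullet> h) / (norm x)\<^sup>2)" for x h
  have c: "continuous_on (- {0}) f" "continuous_on (- {0}) (\<lambda>x. f' x (zonal_grad p y x))"
    unfolding f_def f'_def zonal_grad_def by (intro continuous_intros continuous_on_sgn; simp)+
  have "(LINT x|surface. f' x (zonal_grad p y x)) = - (LINT x|surface. f x * poly (zonal_laplace p) (x \<bullet> y))"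
  proof (rule zonal_Green[OF _ _ _ assms])
    show "(f has_derivative f' x) (at x)" if "x \<noteq> 0" for x
      unfolding f_def[abs_def] f'_def[abs_def] by (rule has_derivative_direction[OF that])
    show "continuous_on (- {0}) (\<lambda>x. f' x b)" for b
      unfolding f'_def by (intro continuous_intros continuous_on_sgn; simp)
    show "f (c *\<^sub>R x) = f x" if "x \<noteq> 0" "c > 0" for x c
      using that by (simp add: f_def)
  qed
  moreover have "(LINT x|surface. f' x (zonal_grad p y x)) = (LINT x|surface. zonal_grad q z x \<bullet> zonal_grad p y x)"
  proof (rule integral_surface_cong)
    show "f' x (zonal_grad p y x) = zonal_grad q z x \<bullet> zonal_grad p y x" if "norm x = 1" for x
      using that by (simp add: f'_def zonal_grad_def[of q] sgn_div_norm inner_diff_left inner_commute algebra_simps)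
  qed (use c in \<open>auto intro: borel_measurable_punctured\<close>)
  moreover have "(LINT x|surface. f x * poly (zonal_laplace p) (x \<bullet> y))
      = (LINT x|surface. poly q (x \<bullet> z) * poly (zonal_laplace p) (x \<bullet> y))"
    by (rule integral_surface_cong) (auto simp: f_def intro!: borel_measurable_punctured continuous_intros)
  ultimately show ?thesis by simp
qed

lemma legendre_grad_product:
  assumes "norm y = 1"
  shows "(LINT x|surface. zonal_grad q z x \<bullet> zonal_grad (legendre n) y x)
    = real n * (real n + 1) * (LINT x|surface. poly q (x \<bullet> z) * poly (legendre n) (x \<bullet> y))"
proof -
  have e: "poly q s * (- (real n * (real n + 1)) * t) = - (real n * (real n + 1)) * (poly q s * t)" for s t by simp
  show ?thesis
    unfolding zonal_Green2[OF assms] zonal_laplace_legendre poly_smult e integral_mult_right_zero by simp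
qed

text \<open>Green's formula evaluates the integrated product of the two gradients with either
  eigenvalue. The eigenvalues differ by (n - m)(n + m + 1), which is nonzero for distinct
  degrees.\<close>

lemma legendre_orthogonal:
  assumes "norm y = 1" "norm z = 1" "n \<noteq> m"
  shows "(LINT x|surface. poly (legendre n) (x \<bullet> y) * poly (legendre m) (x \<bullet> z)) = 0"
proof -
  define J where "J = (LINT x|surface. poly (legendre n) (x \<bullet> y) * poly (legendre m) (x \<bullet> z))"
  have "real n * (real n + 1) * J = real m * (real m + 1) * J"
    using legendre_grad_product[OF assms(1), of "legendre m" z n] legendre_grad_product[OF assms(2), of "legendre n" y m]
    by (simp add: J_def inner_commute mult.commute)
  then have "(real n - real m) * (real n + real m + 1) * J = 0" by (simp add: algebra_simps)
  moreover have "real n + real m + 1 \<noteq> 0" by (simp add: add_nonneg_eq_0_iff)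
  ultimately show ?thesis using assms(3) by (simp add: J_def)
qed

text \<open>The integral T of t P_n P_(n+1) is computed with the recursion in degree n and again in
  degree n + 1; orthogonality leaves one term each time. Comparison gives the ratio (2n + 1)/(2n +
  3) of successive integrals.\<close>

lemma legendre_norm:
  assumes y: "norm y = 1"
  shows "(LINT x|surface. (poly (legendre n) (x \<bullet> y))\<^sup>2) = 4 * pi / (2 * real n + 1)"
proof (induction n)
  case 0
  show ?case using measure_surface_UNIV by simp
next
  case (Suc n)
  let ?P = "\<lambda>n x. poly (legendre n) (x \<bullet> y)"
  define T where "T = (LINT x|surface. (x \<bullet> y) * ?P n x * ?P (Suc n) x)"
  note i = integrable_zonal2[of _ y _ y]
  have 1: "(2 * real n + 1) * T = (real n + 1) * (LINT x|surface. (?P (Suc n) x)\<^sup>2)"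
  proof -
    have "(2 * real n + 1) * T = (LINT x|surface. (2 * real n + 1) * ((x \<bullet> y) * ?P n x) * ?P (Suc n) x)"
      by (simp add: T_def mult.assoc del: legendre.simps flip: integral_mult_right_zero)
    also have "\<dots> = (LINT x|surface. (real n + 1) * (?P (Suc n) x * ?P (Suc n) x) + real n * (?P (n - 1) x * ?P (Suc n) x))"
      unfolding legendre_rec by (simp add: algebra_simps del: legendre.simps)
    also have "\<dots> = (real n + 1) * (LINT x|surface. ?P (Suc n) x * ?P (Suc n) x) + real n * (LINT x|surface. ?P (n - 1) x * ?P (Suc n) x)"
      using i by (simp del: legendre.simps)
    also have "(LINT x|surface. ?P (n - 1) x * ?P (Suc n) x) = 0"
      by (rule legendre_orthogonal[OF y y]) auto
    finally show ?thesis by (simp add: power2_eq_square del: legendre.simps)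
  qed
  have 2: "(2 * real n + 3) * T = (real n + 1) * (LINT x|surface. (?P n x)\<^sup>2)"
  proof -
    have rec: "(2 * real n + 3) * (t * poly (legendre (Suc n)) t) = (real n + 2) * poly (legendre (Suc (Suc n))) t + (real n + 1) * poly (legendre n) t" for t
      using legendre_rec[of "Suc n" t] by (simp del: legendre.simps add: algebra_simps)
    have "(2 * real n + 3) * T = (LINT x|surface. ((2 * real n + 3) * ((x \<bullet> y) * ?P (Suc n) x)) * ?P n x)"
      by (simp add: T_def mult_ac del: legendre.simps flip: integral_mult_right_zero)
    also have "\<dots> = (LINT x|surface. (real n + 2) * (?P (Suc (Suc n)) x * ?P n x) + (real n + 1) * (?P n x * ?P n x))"
      unfolding rec by (simp add: algebra_simps del: legendre.simps)
    also have "\<dots> = (real n + 2) * (LINT x|surface. ?P (Suc (Suc n)) x * ?P n x) + (real n + 1) * (LINT x|surface. ?P n x * ?P n x)"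
      using i by (simp del: legendre.simps)
    also have "(LINT x|surface. ?P (Suc (Suc n)) x * ?P n x) = 0"
      by (rule legendre_orthogonal[OF y y]) auto
    finally show ?thesis by (simp add: power2_eq_square del: legendre.simps)
  qed
  have "(2 * real n + 3) * ((real n + 1) * (LINT x|surface. (?P (Suc n) x)\<^sup>2)) = (2 * real n + 1) * ((2 * real n + 3) * T)"
    unfolding 1[symmetric] by simp
  also have "\<dots> = (real n + 1) * (4 * pi)"
    unfolding 2 Suc.IH by (simp add: field_simps add_nonneg_eq_0_iff)
  finally have "(real n + 1) * ((2 * real n + 3) * (LINT x|surface. (?P (Suc n) x)\<^sup>2)) = (real n + 1) * (4 * pi)"
    by (simp add: mult.left_commute)
  then have "(2 * real n + 3) * (LINT x|surface. (?P (Suc n) x)\<^sup>2) = 4 * pi"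
    by (subst (asm) mult_left_cancel) auto
  moreover have "2 * real n + 3 \<noteq> 0" by (simp add: add_nonneg_eq_0_iff)
  ultimately have "(LINT x|surface. (?P (Suc n) x)\<^sup>2) = 4 * pi / (2 * real n + 3)"
    by (simp add: eq_divide_eq mult.commute)
  then show ?case by (simp add: add.commute del: legendre.simps)
qed

section \<open>Concentration of the kernels and the reproducing formula\<close>

lemma kernel_mass:
  assumes y: "norm y = 1"
  shows "(LINT x|surface. poly (kernel_poly k) (x \<bullet> y)) = 4 * pi / (real k + 1)"
proof (induction k)
  case 0
  show ?case using measure_surface_UNIV by (simp add: kernel_poly_def)
next
  case (Suc j)
  have g0: "zonal_grad 1 y x = 0" for x by (simp add: zonal_grad_def)
  \<comment> \<open>Green's formula against the constant 1, whose gradient vanishes: the Laplacian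
    of a zonal function integrates to 0.\<close>
  have "0 = (LINT x|surface. poly 1 (x \<bullet> y) * poly (zonal_laplace (kernel_poly (Suc j))) (x \<bullet> y))"
    using zonal_Green2[OF y, of 1 y "kernel_poly (Suc j)"] unfolding g0 by simp
  also have "\<dots> = (LINT x|surface. (real j + 1)\<^sup>2 * poly (kernel_poly j) (x \<bullet> y)
      - (real j + 1) * (real j + 2) * poly (kernel_poly (Suc j)) (x \<bullet> y))"
    unfolding zonal_laplace_kernel by simp
  also have "\<dots> = (real j + 1)\<^sup>2 * (LINT x|surface. poly (kernel_poly j) (x \<bullet> y))
      - (real j + 1) * (real j + 2) * (LINT x|surface. poly (kernel_poly (Suc j)) (x \<bullet> y))"
    using integrable_zonal by simp
  also have "(LINT x|surface. poly (kernel_poly j) (x \<bullet> y)) = 4 * pi / (real j + 1)" by (rule Suc.IH)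
  also have "(real j + 1)\<^sup>2 * (4 * pi / (real j + 1)) = (real j + 1) * (4 * pi)"
    by (simp add: power2_eq_square add_nonneg_eq_0_iff)
  finally have "(real j + 1) * ((real j + 2) * (LINT x|surface. poly (kernel_poly (Suc j)) (x \<bullet> y))) = (real j + 1) * (4 * pi)"
    by (simp add: mult.assoc)
  then have "(real j + 2) * (LINT x|surface. poly (kernel_poly (Suc j)) (x \<bullet> y)) = 4 * pi"
    by (subst (asm) mult_left_cancel) auto
  moreover have "real j + 2 \<noteq> 0" by (simp add: add_nonneg_eq_0_iff)
  ultimately have "(LINT x|surface. poly (kernel_poly (Suc j)) (x \<bullet> y)) = 4 * pi / (real j + 2)"
    by (simp add: eq_divide_eq mult.commute)
  then show ?case by (simp add: add.commute)
qed

lemma kernel_nonneg: "norm x = 1 \<Longrightarrow> norm y = 1 \<Longrightarrow> poly (kernel_poly k) (x \<bullet> y) \<ge> 0"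
  using norm_inner_le_1[of x y] by (auto simp: poly_kernel abs_le_iff)

text \<open>The kernels \<open>(k + 1) / 4\<pi> \<cdot> ((1 + x \<bullet> y) / 2)\<^sup>k\<close> form an approximate identity.\<close>

definition kernel_conv :: "nat \<Rightarrow> (real^3 \<Rightarrow> real) \<Rightarrow> real^3 \<Rightarrow> real" where
  "kernel_conv k f y = (real k + 1) / (4 * pi) * (LINT x|surface. poly (kernel_poly k) (x \<bullet> y) * f x)"

text \<open>The normalised kernel has mass 1. Near y, continuity controls f(x) - f(y); at distance
  at least \<delta> the kernel is at most \<rho>^k with \<rho> < 1, and (k + 1) \<rho>^k tends to
  0.\<close>

lemma kernel_conv_tendsto:
  assumes c: "continuous_on (- {0}) f" and y: "norm y = 1"
  shows "(\<lambda>k. kernel_conv k f y) \<longlonglongrightarrow> f y"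
proof (rule LIMSEQ_I)
  fix e :: real assume e: "e > 0"
  obtain B where B: "\<And>x. norm x = 1 \<Longrightarrow> norm (f x) \<le> B" using bounded_on_sphere[OF c] by blast
  have B0: "B \<ge> 0" using B[OF y] norm_ge_zero order_trans by blast
  have "isCont f y" using c y by (subst (asm) continuous_on_eq_continuous_at) auto
  then obtain d where d: "d > 0" "\<And>x. dist x y < d \<Longrightarrow> \<bar>f x - f y\<bar> < e / 2"
    using e unfolding continuous_at_eps_delta by (metis dist_real_def half_gt_zero)
  define \<delta> where "\<delta> = min d 1"
  have \<delta>: "\<delta> > 0" "\<delta> \<le> 1" "\<And>x. dist x y < \<delta> \<Longrightarrow> \<bar>f x - f y\<bar> < e / 2" using d by (auto simp: \<delta>_def)
  \<comment> \<open>For unit vectors |x - y|^2 = 2 - 2 (x \<bullet> y), so |x - y| \<ge> \<delta>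
    means (1 + x \<bullet> y)/2 \<le> 1 - \<delta>^2/4.\<close>
  define \<rho> where "\<rho> = 1 - \<delta>\<^sup>2 / 4"
  have "\<delta>\<^sup>2 \<le> 1" using \<delta> by (simp add: power_le_one)
  then have \<rho>: "0 \<le> \<rho>" "\<rho> < 1" using \<delta> by (auto simp: \<rho>_def)
  have pt: "\<bar>poly (kernel_poly k) (x \<bullet> y) * (f x - f y)\<bar> \<le> e / 2 * poly (kernel_poly k) (x \<bullet> y) + 2 * B * \<rho> ^ k"
    if x: "norm x = 1" for x k
  proof (cases "dist x y < \<delta>")
    case True
    have "\<bar>poly (kernel_poly k) (x \<bullet> y) * (f x - f y)\<bar> \<le> poly (kernel_poly k) (x \<bullet> y) * (e / 2)"
      unfolding abs_mult using kernel_nonneg[OF x y, of k] \<delta>(3)[OF True] by (intro mult_mono) auto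
    moreover have "0 \<le> 2 * B * \<rho> ^ k" using B0 \<rho> by simp
    ultimately show ?thesis using mult.commute[of "poly (kernel_poly k) (x \<bullet> y)" "e / 2"] by linarith
  next
    case False
    then have "\<delta>\<^sup>2 \<le> (dist x y)\<^sup>2" using \<delta>(1) by (intro power_mono) auto
    also have "(dist x y)\<^sup>2 = 2 - 2 * (x \<bullet> y)"
    proof -
      have "x \<bullet> x = 1" "y \<bullet> y = 1" using x y by (simp_all add: dot_square_norm)
      then show ?thesis
        unfolding dist_norm power2_norm_eq_inner
        by (simp add: inner_diff_left inner_diff_right inner_commute[of y x])
    qed
    finally have "(1 + x \<bullet> y) / 2 \<le> \<rho>" by (simp add: \<rho>_def)
    moreover have "0 \<le> (1 + x \<bullet> y) / 2" using norm_inner_le_1[OF x y] by (simp add: abs_le_iff)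
    ultimately have k: "poly (kernel_poly k) (x \<bullet> y) \<le> \<rho> ^ k" unfolding poly_kernel by (rule power_mono)
    have "\<bar>f x - f y\<bar> \<le> 2 * B" using B[OF x] B[OF y] by auto
    then have "\<bar>poly (kernel_poly k) (x \<bullet> y) * (f x - f y)\<bar> \<le> \<rho> ^ k * (2 * B)"
      unfolding abs_mult using kernel_nonneg[OF x y, of k] k B0 by (intro mult_mono) auto
    moreover have "0 \<le> e / 2 * poly (kernel_poly k) (x \<bullet> y)" using e kernel_nonneg[OF x y] by simp
    ultimately show ?thesis using mult.commute[of "\<rho> ^ k" "2 * B"] by linarith
  qed
  have bd: "\<bar>kernel_conv k f y - f y\<bar> \<le> e / 2 + 2 * B * ((real k + 1) * \<rho> ^ k)" for k
  proof -
    have i: "integrable surface (\<lambda>x. poly (kernel_poly k) (x \<bullet> y) * f x)"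
      "integrable surface (\<lambda>x. poly (kernel_poly k) (x \<bullet> y) * (f x - f y))"
      by (rule integrable_surface, intro continuous_intros c)+
    have "kernel_conv k f y - f y = (real k + 1) / (4 * pi) * (LINT x|surface. poly (kernel_poly k) (x \<bullet> y) * f x)
        - (real k + 1) / (4 * pi) * (f y * (LINT x|surface. poly (kernel_poly k) (x \<bullet> y)))"
      unfolding kernel_conv_def kernel_mass[OF y] by (simp add: add_nonneg_eq_0_iff)
    also have "\<dots> = (real k + 1) / (4 * pi) * (LINT x|surface. poly (kernel_poly k) (x \<bullet> y) * (f x - f y))"
      using i(1) integrable_zonal[of "kernel_poly k" y]
      by (simp add: right_diff_distrib mult.commute[of "poly (kernel_poly k) _" "f y"])
    finally have "\<bar>kernel_conv k f y - f y\<bar> = (real k + 1) / (4 * pi) * \<bar>LINT x|surface. poly (kernel_poly k) (x \<bullet> y) * (f x - f y)\<bar>"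
      by (simp add: abs_mult)
    also have "\<dots> \<le> (real k + 1) / (4 * pi) * (e / 2 * (4 * pi / (real k + 1)) + 2 * B * \<rho> ^ k * (4 * pi))"
    proof (rule mult_left_mono)
      have "\<bar>LINT x|surface. poly (kernel_poly k) (x \<bullet> y) * (f x - f y)\<bar>
          \<le> (LINT x|surface. \<bar>poly (kernel_poly k) (x \<bullet> y) * (f x - f y)\<bar>)"
        by (rule integral_abs_bound)
      also have "\<dots> \<le> (LINT x|surface. e / 2 * poly (kernel_poly k) (x \<bullet> y) + 2 * B * \<rho> ^ k)"
        by (rule integral_mono_AE) (use i(2) integrable_zonal pt in \<open>auto intro!: AE_surfaceI\<close>)
      also have "\<dots> = e / 2 * (LINT x|surface. poly (kernel_poly k) (x \<bullet> y)) + 2 * B * \<rho> ^ k * (4 * pi)"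
        using integrable_zonal[of "kernel_poly k" y] measure_surface_UNIV by simp
      finally show "\<bar>LINT x|surface. poly (kernel_poly k) (x \<bullet> y) * (f x - f y)\<bar>
        \<le> e / 2 * (4 * pi / (real k + 1)) + 2 * B * \<rho> ^ k * (4 * pi)"
        unfolding kernel_mass[OF y] .
    qed simp
    also have "\<dots> = e / 2 + 2 * B * ((real k + 1) * \<rho> ^ k)"
    proof -
      have "u / c * (e / 2 * (c / u) + 2 * B * r * c) = e / 2 + 2 * B * (u * r)" if "u \<noteq> 0" "c \<noteq> 0" for u c r
        using that by (simp add: field_simps)
      from this[of "real k + 1" "4 * pi"] show ?thesis by (simp add: add_nonneg_eq_0_iff)
    qed
    finally show ?thesis .
  qed
  have "(\<lambda>k. e / 2 + 2 * B * ((real k + 1) * \<rho> ^ k)) \<longlonglongrightarrow> e / 2 + 2 * B * (0 + 0)"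
    unfolding distrib_right using \<rho>
    by (intro tendsto_intros) (auto intro!: LIMSEQ_power_zero powser_times_n_limit_0)
  from order_tendstoD(2)[OF this, of e] e
  have "\<forall>\<^sub>F k in sequentially. e / 2 + 2 * B * ((real k + 1) * \<rho> ^ k) < e" by simp
  then obtain K where "\<And>k. k \<ge> K \<Longrightarrow> e / 2 + 2 * B * ((real k + 1) * \<rho> ^ k) < e"
    by (auto simp: eventually_sequentially)
  then show "\<exists>no. \<forall>n\<ge>no. norm (kernel_conv n f y - f y) < e"
    using bd by (metis le_less_trans real_norm_def)
qed

text \<open>For k \<ge> n, orthogonality retains only the n-th term of the kernel, so the
  convolution with P_n(x \<bullet> z) is c_k R(z) with c_k independent of z. It tends to P_n(y
  \<bullet> z) as k grows. The case z = y, where R is the known norm and P_n(1) = 1, calibrates the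
  unknown coefficients.\<close>

lemma legendre_reproducing:
  assumes y: "norm y = 1" and z: "norm z = 1"
  shows "(LINT x|surface. poly (legendre n) (x \<bullet> y) * poly (legendre n) (x \<bullet> z))
    = 4 * pi / (2 * real n + 1) * poly (legendre n) (y \<bullet> z)"
proof -
  have "\<exists>a. \<forall>k t. poly (kernel_poly k) t = (\<Sum>n\<le>k. a k n * poly (legendre n) t)"
    using kernel_legendre by (intro choice allI)
  then obtain a where a: "\<And>k t. poly (kernel_poly k) t = (\<Sum>n\<le>k. a k n * poly (legendre n) t)" by blast
  define R where "R z = (LINT x|surface. poly (legendre n) (x \<bullet> y) * poly (legendre n) (x \<bullet> z))" for z :: "real^3"
  define c where "c k = (real k + 1) / (4 * pi) * a k n" for k
  have eq: "kernel_conv k (\<lambda>x. poly (legendre n) (x \<bullet> z)) y = c k * R z" if k: "k \<ge> n" and z: "norm z = 1" for k z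
  proof -
    have "(LINT x|surface. poly (kernel_poly k) (x \<bullet> y) * poly (legendre n) (x \<bullet> z))
        = (LINT x|surface. (\<Sum>m\<le>k. a k m * (poly (legendre m) (x \<bullet> y) * poly (legendre n) (x \<bullet> z))))"
      unfolding a by (simp add: sum_distrib_right mult.assoc)
    also have "\<dots> = (\<Sum>m\<le>k. a k m * (LINT x|surface. poly (legendre m) (x \<bullet> y) * poly (legendre n) (x \<bullet> z)))"
      using integrable_zonal2 by (subst Bochner_Integration.integral_sum) auto
    also have "\<dots> = (\<Sum>m\<le>k. if m = n then a k n * R z else 0)"
      using legendre_orthogonal[OF y z] by (intro sum.cong) (auto simp: R_def)
    also have "\<dots> = a k n * R z" using k by simp
    finally show ?thesis by (simp add: kernel_conv_def c_def)
  qed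
  have lim: "(\<lambda>k. c k * R z) \<longlonglongrightarrow> poly (legendre n) (y \<bullet> z)" if z: "norm z = 1" for z
  proof (rule Lim_transform_eventually)
    show "(\<lambda>k. kernel_conv k (\<lambda>x. poly (legendre n) (x \<bullet> z)) y) \<longlonglongrightarrow> poly (legendre n) (y \<bullet> z)"
      by (rule kernel_conv_tendsto[OF _ y]) (intro continuous_intros)
    show "\<forall>\<^sub>F k in sequentially. kernel_conv k (\<lambda>x. poly (legendre n) (x \<bullet> z)) y = c k * R z"
      using eventually_ge_at_top[of n] by eventually_elim (rule eq[OF _ z])
  qed
  have Ry: "R y = 4 * pi / (2 * real n + 1)"
    using legendre_norm[OF y, of n] by (simp add: R_def power2_eq_square)
  have "y \<bullet> y = 1" using y by (simp add: dot_square_norm)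
  then have "(\<lambda>k. c k * R y) \<longlonglongrightarrow> 1" using lim[OF y] by (simp add: legendre_at_1)
  \<comment> \<open>Crosswise multiplication by R z and R y compares the two limits without solving
    for c_k.\<close>
  then have "(\<lambda>k. R z * (c k * R y)) \<longlonglongrightarrow> R z * 1" by (intro tendsto_intros)
  moreover have "(\<lambda>k. R y * (c k * R z)) \<longlonglongrightarrow> R y * poly (legendre n) (y \<bullet> z)"
    by (intro tendsto_intros lim z)
  ultimately have "R z * 1 = R y * poly (legendre n) (y \<bullet> z)"
    by (intro LIMSEQ_unique[of "\<lambda>k. R z * (c k * R y)"]) (simp_all add: mult_ac)
  then have "R z = 4 * pi / (2 * real n + 1) * poly (legendre n) (y \<bullet> z)" by (simp add: Ry)
  then show ?thesis unfolding R_def .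
qed

text \<open>Cauchy-Schwarz in the reproducing formula: both factors have the same norm, which
  cancels against its constant.\<close>

lemma legendre_bound:
  fixes y z :: "real^3"
  assumes y: "norm y = 1" and z: "norm z = 1"
  shows "\<bar>poly (legendre n) (y \<bullet> z)\<bar> \<le> 1"
proof -
  define I where "I = 4 * pi / (2 * real n + 1)"
  have I: "I > 0" by (simp add: I_def add_nonneg_pos)
  have "(LINT x|surface. poly (legendre n) (x \<bullet> y) * poly (legendre n) (x \<bullet> z))\<^sup>2 \<le> I * I"
    using integral_Cauchy_Schwarz(2)[of "\<lambda>x. poly (legendre n) (x \<bullet> y)" surface "\<lambda>x. poly (legendre n) (x \<bullet> z)"]
      integrable_zonal2[of "legendre n" y "legendre n" y] integrable_zonal2[of "legendre n" z "legendre n" z]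
    unfolding legendre_norm[OF y] legendre_norm[OF z] I_def by (simp add: power2_eq_square)
  then have "(I * poly (legendre n) (y \<bullet> z))\<^sup>2 \<le> I\<^sup>2"
    unfolding legendre_reproducing[OF y z] I_def by (simp add: power2_eq_square)
  then have "I * \<bar>poly (legendre n) (y \<bullet> z)\<bar> \<le> I * 1"
    using I by (simp add: abs_le_square_iff[symmetric] abs_mult)
  then show ?thesis using I by (simp only: mult_le_cancel_left_pos)
qed

section \<open>Zonal convolutions\<close>

interpretation surface_pair: pair_sigma_finite surface surface ..

lemma surface_Fubini:
  fixes F :: "real^3 \<Rightarrow> real^3 \<Rightarrow> real"
  assumes [measurable]: "case_prod F \<in> borel_measurable (borel \<Otimes>\<^sub>M borel)"
    and B: "\<And>x y. norm x = 1 \<Longrightarrow> norm y = 1 \<Longrightarrow> \<bar>F x y\<bar> \<le> B"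
  shows "(LINT x|surface. LINT y|surface. F x y) = (LINT y|surface. LINT x|surface. F x y)"
proof -
  interpret P: finite_measure "surface \<Otimes>\<^sub>M surface"
    by (rule finite_measure_pair_measure) unfold_locales
  have "AE z in surface \<Otimes>\<^sub>M surface. norm (fst z) = 1 \<and> norm (snd z) = 1"
  proof (rule surface_pair.AE_pair_measure)
    have "Measurable.pred (surface \<Otimes>\<^sub>M surface) (\<lambda>z. norm (fst z) = 1 \<and> norm (snd z) = 1)"
      by measurable
    then show "{z \<in> space (surface \<Otimes>\<^sub>M surface). norm (fst z) = 1 \<and> norm (snd z) = 1} \<in> sets (surface \<Otimes>\<^sub>M surface)"
      by (simp only: pred_def)
    show "AE x in surface. AE y in surface. norm (fst (x, y)) = 1 \<and> norm (snd (x, y)) = 1"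
      by (rule AE_surfaceI, rule AE_surfaceI) simp
  qed
  then have "AE z in surface \<Otimes>\<^sub>M surface. norm (case_prod F z) \<le> B"
    by eventually_elim (auto simp: B split: prod.split)
  then have "integrable (surface \<Otimes>\<^sub>M surface) (case_prod F)"
    by (intro P.integrable_const_bound[where B=B]) auto
  from surface_pair.Fubini_integral[OF this] show ?thesis by simp
qed

text \<open>A class closed under sums, products and zonal convolution. Bounds are imposed on the
  sphere alone, where the measure is concentrated.\<close>

definition sphere_bounded :: "(real^3 \<Rightarrow> real) \<Rightarrow> bool" where
  "sphere_bounded f \<longleftrightarrow> f \<in> borel_measurable borel \<and> (\<exists>B. \<forall>x. norm x = 1 \<longrightarrow> \<bar>f x\<bar> \<le> B)"

lemma sphere_boundedD: "sphere_bounded f \<Longrightarrow> f \<in> borel_measurable borel"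
  by (simp add: sphere_bounded_def)

lemma sphere_boundedE:
  assumes "sphere_bounded f"
  obtains B where "B \<ge> 0" "\<And>x. norm x = 1 \<Longrightarrow> \<bar>f x\<bar> \<le> B"
proof -
  obtain B where "\<And>x. norm x = 1 \<Longrightarrow> \<bar>f x\<bar> \<le> B" using assms by (auto simp: sphere_bounded_def)
  then show ?thesis using that[of "\<bar>B\<bar>"] by force
qed

lemma sphere_boundedI: "f \<in> borel_measurable borel \<Longrightarrow> (\<And>x. norm x = 1 \<Longrightarrow> \<bar>f x\<bar> \<le> B) \<Longrightarrow> sphere_bounded f"
  by (auto simp: sphere_bounded_def)

lemma sphere_bounded_integrable: "sphere_bounded f \<Longrightarrow> integrable surface f"
  by (rule sphere_boundedE, assumption, rule integrable_surface_bounded[OF sphere_boundedD]) auto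

lemma sphere_bounded_punctured: "continuous_on (- {0}) f \<Longrightarrow> sphere_bounded f"
  using bounded_on_sphere[of f] by (auto simp: sphere_bounded_def borel_measurable_punctured)

lemma sphere_bounded_mult:
  assumes "sphere_bounded f" "sphere_bounded g"
  shows "sphere_bounded (\<lambda>x. f x * g x)"
proof -
  note [measurable] = assms[THEN sphere_boundedD]
  obtain B C where "B \<ge> 0" "\<And>x. norm x = 1 \<Longrightarrow> \<bar>f x\<bar> \<le> B" "C \<ge> 0" "\<And>x. norm x = 1 \<Longrightarrow> \<bar>g x\<bar> \<le> C"
    using assms by (metis sphere_boundedE)
  then show ?thesis
    by (intro sphere_boundedI[where B="B * C"]) (auto simp: abs_mult intro!: mult_mono)
qed

lemma sphere_bounded_add:
  assumes "sphere_bounded f" "sphere_bounded g"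
  shows "sphere_bounded (\<lambda>x. f x + g x)"
proof -
  note [measurable] = assms[THEN sphere_boundedD]
  obtain B C where BC: "\<And>x. norm x = 1 \<Longrightarrow> \<bar>f x\<bar> \<le> B" "\<And>x. norm x = 1 \<Longrightarrow> \<bar>g x\<bar> \<le> C"
    using assms by (metis sphere_boundedE)
  have "\<bar>f x + g x\<bar> \<le> B + C" if "norm x = 1" for x
    using BC[OF that] by linarith
  then show ?thesis
    by (intro sphere_boundedI[where B="B + C"]) auto
qed

lemma sphere_bounded_const: "sphere_bounded (\<lambda>x. c)"
  by (rule sphere_boundedI[where B="\<bar>c\<bar>"]) auto

lemma sphere_bounded_cmult: "sphere_bounded f \<Longrightarrow> sphere_bounded (\<lambda>x. c * f x)"
  by (intro sphere_bounded_mult sphere_bounded_const)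

lemma sphere_bounded_sum: "(\<And>i. i \<in> I \<Longrightarrow> sphere_bounded (f i)) \<Longrightarrow> sphere_bounded (\<lambda>x. \<Sum>i\<in>I. f i x)"
  by (induction I rule: infinite_finite_induct) (auto intro: sphere_bounded_const sphere_bounded_add)

definition zonal_conv :: "real poly \<Rightarrow> (real^3 \<Rightarrow> real) \<Rightarrow> real^3 \<Rightarrow> real" where
  "zonal_conv p f y = (LINT x|surface. poly p (x \<bullet> y) * f x)"

lemma sphere_bounded_zonal: "sphere_bounded (\<lambda>x. poly p (x \<bullet> y))"
  by (intro sphere_bounded_punctured continuous_intros)

lemma integrable_zonal_conv: "sphere_bounded f \<Longrightarrow> integrable surface (\<lambda>x. poly p (x \<bullet> y) * f x)"
  by (intro sphere_bounded_integrable sphere_bounded_mult sphere_bounded_zonal)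

lemma sphere_bounded_zonal_conv:
  assumes f: "sphere_bounded f"
  shows "sphere_bounded (zonal_conv p f)"
proof -
  note [measurable] = sphere_boundedD[OF f]
  obtain B where B: "B \<ge> 0" "\<And>x. norm x = 1 \<Longrightarrow> \<bar>f x\<bar> \<le> B" using f by (rule sphere_boundedE) auto
  obtain C where C: "\<And>x y :: real^3. norm x = 1 \<Longrightarrow> norm y = 1 \<Longrightarrow> \<bar>poly p (x \<bullet> y)\<bar> \<le> C"
    using zonal_bounded by blast
  show ?thesis
  proof (rule sphere_boundedI[where B="C * B * (4 * pi)"])
    show "zonal_conv p f \<in> borel_measurable borel"
      unfolding zonal_conv_def[abs_def] by measurable
    fix y :: "real^3" assume y: "norm y = 1"
    have C0: "C \<ge> 0" using order_trans[OF abs_ge_zero C[OF y y]] .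
    have "\<bar>zonal_conv p f y\<bar> \<le> (LINT x|surface. \<bar>poly p (x \<bullet> y) * f x\<bar>)"
      unfolding zonal_conv_def by (rule integral_abs_bound)
    also have "\<dots> \<le> (LINT x|surface. C * B)"
    proof (rule integral_mono_AE)
      show "integrable surface (\<lambda>x. \<bar>poly p (x \<bullet> y) * f x\<bar>)"
        by (intro integrable_abs integrable_zonal_conv f)
      show "AE x in surface. \<bar>poly p (x \<bullet> y) * f x\<bar> \<le> C * B"
        unfolding abs_mult using C B y C0 by (intro AE_surfaceI mult_mono) auto
    qed simp
    finally show "\<bar>zonal_conv p f y\<bar> \<le> C * B * (4 * pi)" by (simp add: measure_surface_UNIV mult_ac)
  qed
qed

lemma zonal_conv_symmetric:
  assumes f: "sphere_bounded f" and g: "sphere_bounded g"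
  shows "(LINT y|surface. zonal_conv p f y * g y) = (LINT x|surface. f x * zonal_conv p g x)"
proof -
  note [measurable] = sphere_boundedD[OF f] sphere_boundedD[OF g]
  obtain B where B: "B \<ge> 0" "\<And>x. norm x = 1 \<Longrightarrow> \<bar>f x\<bar> \<le> B" using f by (rule sphere_boundedE) auto
  obtain D where D: "D \<ge> 0" "\<And>x. norm x = 1 \<Longrightarrow> \<bar>g x\<bar> \<le> D" using g by (rule sphere_boundedE) auto
  obtain C where C: "\<And>x y :: real^3. norm x = 1 \<Longrightarrow> norm y = 1 \<Longrightarrow> \<bar>poly p (x \<bullet> y)\<bar> \<le> C"
    using zonal_bounded by blast
  have "(LINT y|surface. zonal_conv p f y * g y) = (LINT y|surface. LINT x|surface. poly p (x \<bullet> y) * f x * g y)"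
    by (simp add: zonal_conv_def)
  also have "\<dots> = (LINT x|surface. LINT y|surface. poly p (x \<bullet> y) * f x * g y)"
  proof (rule surface_Fubini[where B="C * B * D"])
    show "(\<lambda>(y, x). poly p (x \<bullet> y) * f x * g y) \<in> borel_measurable (borel \<Otimes>\<^sub>M borel)" by measurable
    show "\<bar>poly p (x \<bullet> y) * f x * g y\<bar> \<le> C * B * D" if "norm y = 1" "norm x = 1" for x y
      unfolding abs_mult using that B D C[OF that(2,1)] order_trans[OF abs_ge_zero C[OF that(2,1)]]
      by (intro mult_mono mult_nonneg_nonneg) auto
  qed
  also have "\<dots> = (LINT x|surface. f x * zonal_conv p g x)"
  proof -
    have "(LINT y|surface. poly p (x \<bullet> y) * f x * g y) = f x * zonal_conv p g x" for x
    proof -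
      have "(LINT y|surface. poly p (x \<bullet> y) * f x * g y) = (LINT y|surface. f x * (poly p (y \<bullet> x) * g y))"
        by (simp add: inner_commute mult_ac)
      then show ?thesis by (simp add: zonal_conv_def)
    qed
    then show ?thesis by simp
  qed
  finally show ?thesis .
qed

text \<open>The kernel is symmetric, so the inner convolution can be moved from \<open>f\<close> to
  the outer zonal function, where orthogonality and the reproducing formula apply.\<close>

lemma zonal_conv_legendre:
  assumes f: "sphere_bounded f" and z: "norm z = 1"
  shows "zonal_conv (legendre m) (zonal_conv (legendre n) f) z
    = (if n = m then 4 * pi / (2 * real n + 1) * zonal_conv (legendre n) f z else 0)"
proof -
  note [measurable] = sphere_boundedD[OF f]
  have "zonal_conv (legendre m) (zonal_conv (legendre n) f) z
      = (LINT y|surface. zonal_conv (legendre n) f y * poly (legendre m) (y \<bullet> z))"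
    by (simp add: zonal_conv_def[of "legendre m"] mult.commute)
  also have "\<dots> = (LINT x|surface. f x * zonal_conv (legendre n) (\<lambda>y. poly (legendre m) (y \<bullet> z)) x)"
    by (rule zonal_conv_symmetric[OF f sphere_bounded_zonal])
  also have "\<dots> = (LINT x|surface. (if n = m then 4 * pi / (2 * real n + 1) else 0) * (poly (legendre n) (x \<bullet> z) * f x))"
  proof (rule integral_surface_cong)
    show "(\<lambda>x. f x * zonal_conv (legendre n) (\<lambda>y. poly (legendre m) (y \<bullet> z)) x) \<in> borel_measurable borel"
      by (intro borel_measurable_times sphere_boundedD[OF f] sphere_boundedD sphere_bounded_zonal_conv sphere_bounded_zonal)
    show "f x * zonal_conv (legendre n) (\<lambda>y. poly (legendre m) (y \<bullet> z)) x
        = (if n = m then 4 * pi / (2 * real n + 1) else 0) * (poly (legendre n) (x \<bullet> z) * f x)" if x: "norm x = 1" for x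
    proof (cases "n = m")
      case True
      show ?thesis unfolding True zonal_conv_def legendre_reproducing[OF x z] by simp
    next
      case False
      show ?thesis unfolding zonal_conv_def legendre_orthogonal[OF x z False] using False by simp
    qed
  qed measurable
  also have "\<dots> = (if n = m then 4 * pi / (2 * real n + 1) * zonal_conv (legendre n) f z else 0)"
    unfolding integral_mult_right_zero by (simp add: zonal_conv_def)
  finally show ?thesis .
qed

text \<open>The factor is the reciprocal of the constant in the reproducing formula, which makes the
  map idempotent.\<close>

definition legendre_proj :: "nat \<Rightarrow> (real^3 \<Rightarrow> real) \<Rightarrow> real^3 \<Rightarrow> real" where
  "legendre_proj n f y = (2 * real n + 1) / (4 * pi) * zonal_conv (legendre n) f y"

lemma sphere_bounded_proj: "sphere_bounded f \<Longrightarrow> sphere_bounded (legendre_proj n f)"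
  unfolding legendre_proj_def[abs_def] by (intro sphere_bounded_cmult sphere_bounded_zonal_conv)

lemma legendre_proj_symmetric:
  assumes "sphere_bounded f" "sphere_bounded g"
  shows "(LINT y|surface. legendre_proj n f y * g y) = (LINT x|surface. f x * legendre_proj n g x)"
proof -
  let ?c = "(2 * real n + 1) / (4 * pi)"
  have "(\<lambda>y. legendre_proj n f y * g y) = (\<lambda>y. ?c * (zonal_conv (legendre n) f y * g y))"
    "(\<lambda>x. f x * legendre_proj n g x) = (\<lambda>x. ?c * (f x * zonal_conv (legendre n) g x))"
    by (auto simp: legendre_proj_def)
  then show ?thesis by (simp only: integral_mult_right_zero zonal_conv_symmetric[OF assms])
qed

lemma legendre_proj_proj:
  assumes f: "sphere_bounded f" and z: "norm z = 1"
  shows "legendre_proj m (legendre_proj n f) z = (if n = m then legendre_proj n f z else 0)"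
proof -
  have "zonal_conv (legendre m) (legendre_proj n f) z = (2 * real n + 1) / (4 * pi) * zonal_conv (legendre m) (zonal_conv (legendre n) f) z"
    unfolding legendre_proj_def zonal_conv_def[of "legendre m"]
    by (simp add: mult.left_commute flip: integral_mult_right_zero)
  then show ?thesis
    by (simp add: legendre_proj_def[of m] legendre_proj_def[of n] zonal_conv_legendre[OF f z] add_nonneg_eq_0_iff)
qed

text \<open>By symmetry and idempotence this is the squared norm of the projection.\<close>

definition proj_energy :: "nat \<Rightarrow> (real^3 \<Rightarrow> real) \<Rightarrow> real" where
  "proj_energy n f = (LINT x|surface. f x * legendre_proj n f x)"

lemma proj_product:
  assumes f: "sphere_bounded f"
  shows "(LINT x|surface. legendre_proj n f x * legendre_proj m f x) = (if n = m then proj_energy n f else 0)"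
proof -
  note b = sphere_bounded_proj[OF f]
  have "(LINT x|surface. legendre_proj n f x * legendre_proj m f x) = (LINT x|surface. f x * legendre_proj n (legendre_proj m f) x)"
    by (rule legendre_proj_symmetric[OF f b])
  also have "\<dots> = (LINT x|surface. (if n = m then 1 else 0) * (f x * legendre_proj n f x))"
  proof (rule integral_surface_cong)
    show "f x * legendre_proj n (legendre_proj m f) x = (if n = m then 1 else 0) * (f x * legendre_proj n f x)" if "norm x = 1" for x
      using legendre_proj_proj[OF f that, of n m] by simp
  next
    note [measurable] = sphere_boundedD[OF f] sphere_boundedD[OF b] sphere_boundedD[OF sphere_bounded_proj[OF b]]
    show "(\<lambda>x. f x * legendre_proj n (legendre_proj m f) x) \<in> borel_measurable borel" by measurable
    show "(\<lambda>x. (if n = m then 1 else 0) * (f x * legendre_proj n f x)) \<in> borel_measurable borel" by measurable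
  qed
  finally show ?thesis by (simp add: proj_energy_def)
qed

lemma proj_energy_nonneg: "sphere_bounded f \<Longrightarrow> proj_energy n f \<ge> 0"
  using Bochner_Integration.integral_nonneg[of surface "\<lambda>x. legendre_proj n f x * legendre_proj n f x"]
  by (simp add: proj_product)

text \<open>The projection reproduces itself by convolution with P_n; Cauchy-Schwarz with the known
  norm of P_n bounds its values. This is the pointwise hypothesis of
  \<open>orthogonal_system\<close> with \<mu> n = 2n + 1.\<close>

lemma proj_pointwise:
  assumes f: "sphere_bounded f" and y: "norm y = 1"
  shows "\<bar>legendre_proj n f y\<bar> \<le> sqrt (1 / (4 * pi)) * sqrt (2 * real n + 1) * sqrt (proj_energy n f)"
proof -
  let ?c = "(2 * real n + 1) / (4 * pi)"
  note b = sphere_bounded_proj[OF f, of n]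
  have c: "?c > 0" by (simp add: add_nonneg_pos)
  have "(zonal_conv (legendre n) (legendre_proj n f) y)\<^sup>2
      \<le> (LINT x|surface. (poly (legendre n) (x \<bullet> y))\<^sup>2) * (LINT x|surface. (legendre_proj n f x)\<^sup>2)"
    unfolding zonal_conv_def
    by (rule integral_Cauchy_Schwarz(2))
      (use b in \<open>auto simp: power2_eq_square intro!: integrable_zonal2 sphere_bounded_integrable sphere_bounded_mult dest: sphere_boundedD\<close>)
  also have "\<dots> = proj_energy n f / ?c"
    unfolding legendre_norm[OF y] using proj_product[OF f, of n n] by (simp add: power2_eq_square)
  finally have 1: "(zonal_conv (legendre n) (legendre_proj n f) y)\<^sup>2 \<le> proj_energy n f / ?c" .
  have e: "legendre_proj n f y = ?c * zonal_conv (legendre n) (legendre_proj n f) y"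
    using legendre_proj_proj[OF f y, of n n] by (simp add: legendre_proj_def[of n "legendre_proj n f"])
  have "(legendre_proj n f y)\<^sup>2 = ?c\<^sup>2 * (zonal_conv (legendre n) (legendre_proj n f) y)\<^sup>2"
    by (simp only: e power_mult_distrib)
  also have "\<dots> \<le> ?c\<^sup>2 * (proj_energy n f / ?c)" using 1 by (intro mult_left_mono) auto
  also have "\<dots> = ?c * proj_energy n f" using c by (simp add: power2_eq_square)
  finally have "sqrt ((legendre_proj n f y)\<^sup>2) \<le> sqrt (?c * proj_energy n f)" by (rule real_sqrt_le_mono)
  then show ?thesis by (simp add: real_sqrt_mult real_sqrt_divide)
qed

lemma legendre_Bessel:
  assumes f: "sphere_bounded f" and I: "finite I"
  shows "(\<Sum>n\<in>I. proj_energy n f) \<le> (LINT x|surface. (f x)\<^sup>2)"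
proof -
  note b = sphere_bounded_proj[OF f]
  let ?g = "\<lambda>x. \<Sum>n\<in>I. legendre_proj n f x"
  have g: "sphere_bounded ?g" by (intro sphere_bounded_sum b)
  have fg: "(LINT x|surface. f x * ?g x) = (\<Sum>n\<in>I. proj_energy n f)"
    unfolding proj_energy_def sum_distrib_left
    by (intro Bochner_Integration.integral_sum sphere_bounded_integrable sphere_bounded_mult f b)
  have gg: "(LINT x|surface. ?g x * ?g x) = (\<Sum>n\<in>I. proj_energy n f)"
  proof -
    have "(LINT x|surface. ?g x * ?g x) = (\<Sum>n\<in>I. \<Sum>m\<in>I. LINT x|surface. legendre_proj n f x * legendre_proj m f x)"
      unfolding sum_product
      by (subst Bochner_Integration.integral_sum)
        (auto intro!: sum.cong Bochner_Integration.integral_sum sphere_bounded_integrable sphere_bounded_mult sphere_bounded_sum b)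
    also have "\<dots> = (\<Sum>n\<in>I. proj_energy n f)"
      unfolding proj_product[OF f] using I by (intro sum.cong) auto
    finally show ?thesis .
  qed
  have "0 \<le> (LINT x|surface. (f x - ?g x)\<^sup>2)" by simp
  also have "(\<lambda>x. (f x - ?g x)\<^sup>2) = (\<lambda>x. (f x)\<^sup>2 - 2 * (f x * ?g x) + ?g x * ?g x)"
    by (auto simp: power2_eq_square algebra_simps)
  also have "(LINT x|surface. (f x)\<^sup>2 - 2 * (f x * ?g x) + ?g x * ?g x)
      = (LINT x|surface. (f x)\<^sup>2) - 2 * (LINT x|surface. f x * ?g x) + (LINT x|surface. ?g x * ?g x)"
    using sphere_bounded_integrable[OF sphere_bounded_mult[OF f f]] sphere_bounded_integrable[OF sphere_bounded_mult[OF f g]]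
      sphere_bounded_integrable[OF sphere_bounded_mult[OF g g]]
    by (simp add: power2_eq_square)
  finally show ?thesis unfolding fg gg by simp
qed

subsection \<open>Bessel's inequality for the gradient\<close>

text \<open>The gradient of the projection, written as if its reproducing formula were
  differentiated under the integral. With this as definition no such differentiation has to be
  justified: only integral identities for the right-hand side enter.\<close>

definition proj_grad :: "nat \<Rightarrow> (real^3 \<Rightarrow> real) \<Rightarrow> real^3 \<Rightarrow> real^3" where
  "proj_grad n f x = ((2 * real n + 1) / (4 * pi)) *\<^sub>R
    (LINT y|surface. legendre_proj n f y *\<^sub>R zonal_grad (legendre n) y x)"

lemma proj_grad_measurable:
  assumes f: "sphere_bounded f"
  shows "proj_grad n f \<in> borel_measurable borel"
proof -
  note [measurable] = sphere_boundedD[OF sphere_bounded_proj[OF f]]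
  show ?thesis unfolding proj_grad_def[abs_def] by measurable
qed

lemma proj_grad_integrable:
  assumes f: "sphere_bounded f" and x: "norm x = 1"
  shows "integrable surface (\<lambda>y. legendre_proj n f y *\<^sub>R zonal_grad (legendre n) y x)"
proof -
  note [measurable] = sphere_boundedD[OF sphere_bounded_proj[OF f]]
  obtain B where B: "B \<ge> 0" "\<And>x. norm x = 1 \<Longrightarrow> \<bar>legendre_proj n f x\<bar> \<le> B"
    using sphere_bounded_proj[OF f] by (rule sphere_boundedE) auto
  obtain C where C: "\<And>x y :: real^3. norm x = 1 \<Longrightarrow> norm y = 1 \<Longrightarrow> norm (zonal_grad (legendre n) y x) \<le> C"
    using zonal_grad_bounded by blast
  show ?thesis
    by (rule integrable_surface_bounded[where B="B * C"]) (auto intro!: mult_mono B C x)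
qed

lemma proj_grad_bounded:
  assumes f: "sphere_bounded f"
  obtains B where "\<And>x. norm x = 1 \<Longrightarrow> norm (proj_grad n f x) \<le> B"
proof -
  note [measurable] = sphere_boundedD[OF sphere_bounded_proj[OF f]]
  obtain B where B: "B \<ge> 0" "\<And>x. norm x = 1 \<Longrightarrow> \<bar>legendre_proj n f x\<bar> \<le> B"
    using sphere_bounded_proj[OF f] by (rule sphere_boundedE) auto
  obtain C where C: "\<And>x y :: real^3. norm x = 1 \<Longrightarrow> norm y = 1 \<Longrightarrow> norm (zonal_grad (legendre n) y x) \<le> C"
    using zonal_grad_bounded by blast
  have "norm (proj_grad n f x) \<le> (2 * real n + 1) / (4 * pi) * (B * C * (4 * pi))" if x: "norm x = 1" for x
  proof -
    have "norm (LINT y|surface. legendre_proj n f y *\<^sub>R zonal_grad (legendre n) y x)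
        \<le> (LINT y|surface. norm (legendre_proj n f y *\<^sub>R zonal_grad (legendre n) y x))"
      by (rule integral_norm_bound)
    also have "\<dots> \<le> (LINT y::real^3|surface. B * C)"
    proof (rule integral_mono_AE)
      show "integrable surface (\<lambda>y. norm (legendre_proj n f y *\<^sub>R zonal_grad (legendre n) y x))"
        by (intro integrable_norm proj_grad_integrable[OF f x])
      show "AE y in surface. norm (legendre_proj n f y *\<^sub>R zonal_grad (legendre n) y x) \<le> B * C"
        by (auto intro!: AE_surfaceI mult_mono B C x)
    qed simp
    finally have "norm (LINT y|surface. legendre_proj n f y *\<^sub>R zonal_grad (legendre n) y x) \<le> B * C * (4 * pi)"
      by (simp add: measure_surface_UNIV mult_ac)
    then show ?thesis unfolding proj_grad_def norm_scaleR by (intro mult_mono) auto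
  qed
  then show ?thesis using that by blast
qed

lemma integral_inner_proj_grad:
  fixes U :: "real^3 \<Rightarrow> real^3"
  assumes f: "sphere_bounded f" and [measurable]: "U \<in> borel_measurable borel"
    and U: "\<And>x. norm x = 1 \<Longrightarrow> norm (U x) \<le> D"
  shows "(LINT x|surface. U x \<bullet> proj_grad n f x) = (2 * real n + 1) / (4 * pi) *
    (LINT y|surface. legendre_proj n f y * (LINT x|surface. U x \<bullet> zonal_grad (legendre n) y x))"
proof -
  note [measurable] = sphere_boundedD[OF sphere_bounded_proj[OF f]] proj_grad_measurable[OF f]
  let ?c = "(2 * real n + 1) / (4 * pi)"
  obtain B where B: "B \<ge> 0" "\<And>x. norm x = 1 \<Longrightarrow> \<bar>legendre_proj n f x\<bar> \<le> B"
    using sphere_bounded_proj[OF f] by (rule sphere_boundedE) auto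
  obtain C where C: "\<And>x y :: real^3. norm x = 1 \<Longrightarrow> norm y = 1 \<Longrightarrow> norm (zonal_grad (legendre n) y x) \<le> C"
    using zonal_grad_bounded by blast
  have "(LINT x|surface. U x \<bullet> proj_grad n f x)
      = (LINT x|surface. ?c * (LINT y|surface. legendre_proj n f y * (U x \<bullet> zonal_grad (legendre n) y x)))"
  proof (rule integral_surface_cong)
    show "U x \<bullet> proj_grad n f x = ?c * (LINT y|surface. legendre_proj n f y * (U x \<bullet> zonal_grad (legendre n) y x))"
      if x: "norm x = 1" for x
    proof -
      have "(LINT y|surface. U x \<bullet> (legendre_proj n f y *\<^sub>R zonal_grad (legendre n) y x))
          = U x \<bullet> (LINT y|surface. legendre_proj n f y *\<^sub>R zonal_grad (legendre n) y x)"
        by (rule integral_inner_right) (use proj_grad_integrable[OF f x] in auto)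
      then show ?thesis by (simp add: proj_grad_def)
    qed
  qed measurable
  also have "\<dots> = ?c * (LINT x|surface. LINT y|surface. legendre_proj n f y * (U x \<bullet> zonal_grad (legendre n) y x))"
    by simp
  also have "(LINT x|surface. LINT y|surface. legendre_proj n f y * (U x \<bullet> zonal_grad (legendre n) y x))
      = (LINT y|surface. LINT x|surface. legendre_proj n f y * (U x \<bullet> zonal_grad (legendre n) y x))"
  proof (rule surface_Fubini[where B="B * (D * C)"])
    show "(\<lambda>(x, y). legendre_proj n f y * (U x \<bullet> zonal_grad (legendre n) y x)) \<in> borel_measurable (borel \<Otimes>\<^sub>M borel)"
      by measurable
    fix x y :: "real^3" assume xy: "norm x = 1" "norm y = 1"
    have "\<bar>U x \<bullet> zonal_grad (legendre n) y x\<bar> \<le> norm (U x) * norm (zonal_grad (legendre n) y x)"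
      by (rule Cauchy_Schwarz_ineq2)
    also have "\<dots> \<le> D * C"
      using U[OF xy(1)] C[OF xy] order_trans[OF norm_ge_zero U[OF xy(1)]] by (intro mult_mono) auto
    finally show "\<bar>legendre_proj n f y * (U x \<bullet> zonal_grad (legendre n) y x)\<bar> \<le> B * (D * C)"
      unfolding abs_mult using B xy by (intro mult_mono) auto
  qed
  finally show ?thesis by simp
qed

text \<open>Green's formula reduces inner products of zonal gradients to those of the zonal
  functions times the eigenvalue, so the orthogonality of the degrees carries over to the
  gradients.\<close>

lemma proj_grad_product:
  assumes f: "sphere_bounded f"
  shows "(LINT x|surface. proj_grad n f x \<bullet> proj_grad m f x) = (if n = m then real n * (real n + 1) * proj_energy n f else 0)"
proof -
  let ?c = "\<lambda>n. (2 * real n + 1) / (4 * pi)"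
  note b = sphere_bounded_proj[OF f]
  note [measurable] = sphere_boundedD[OF b] proj_grad_measurable[OF f]
  have inner: "(LINT x|surface. proj_grad n f x \<bullet> zonal_grad (legendre m) z x)
      = (if n = m then real n * (real n + 1) / ?c n * legendre_proj n f z else 0)" if z: "norm z = 1" for z
  proof -
    obtain C where C: "\<And>x y :: real^3. norm x = 1 \<Longrightarrow> norm y = 1 \<Longrightarrow> norm (zonal_grad (legendre m) y x) \<le> C"
      using zonal_grad_bounded by blast
    have "(LINT x|surface. proj_grad n f x \<bullet> zonal_grad (legendre m) z x)
        = (LINT x|surface. zonal_grad (legendre m) z x \<bullet> proj_grad n f x)"
      by (simp add: inner_commute)
    also have "\<dots> = ?c n * (LINT y|surface. legendre_proj n f y
        * (LINT x|surface. zonal_grad (legendre m) z x \<bullet> zonal_grad (legendre n) y x))"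
      by (rule integral_inner_proj_grad[OF f]) (auto intro: C z)
    also have "(LINT y|surface. legendre_proj n f y
        * (LINT x|surface. zonal_grad (legendre m) z x \<bullet> zonal_grad (legendre n) y x))
        = (LINT y|surface. (real n * (real n + 1)) * (if n = m then 1 / ?c n else 0) * (poly (legendre n) (y \<bullet> z) * legendre_proj n f y))"
    proof (rule integral_surface_cong)
      fix y :: "real^3" assume y: "norm y = 1"
      have "(LINT x|surface. poly (legendre m) (x \<bullet> z) * poly (legendre n) (x \<bullet> y))
          = (if n = m then 1 / ?c n else 0) * poly (legendre n) (y \<bullet> z)"
        using legendre_orthogonal[OF z y, of m n] legendre_reproducing[OF z y, of n] by (auto simp: inner_commute)
      then show "legendre_proj n f y * (LINT x|surface. zonal_grad (legendre m) z x \<bullet> zonal_grad (legendre n) y x)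
        = (real n * (real n + 1)) * (if n = m then 1 / ?c n else 0) * (poly (legendre n) (y \<bullet> z) * legendre_proj n f y)"
        unfolding legendre_grad_product[OF y] by simp
    qed measurable
    also have "\<dots> = (real n * (real n + 1)) * (if n = m then 1 / ?c n else 0) * zonal_conv (legendre n) (legendre_proj n f) z"
      unfolding integral_mult_right_zero by (simp add: zonal_conv_def)
    also have "?c n * \<dots> = (if n = m then real n * (real n + 1) / ?c n * (?c n * zonal_conv (legendre n) (legendre_proj n f) z) else 0)"
      by simp
    also have "?c n * zonal_conv (legendre n) (legendre_proj n f) z = legendre_proj n f z"
      using legendre_proj_proj[OF f z, of n n] by (simp add: legendre_proj_def[of n "legendre_proj n f"])
    finally show ?thesis .
  qed
  obtain D where D: "\<And>x. norm x = 1 \<Longrightarrow> norm (proj_grad n f x) \<le> D" using proj_grad_bounded[OF f] by blast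
  have "(LINT x|surface. proj_grad n f x \<bullet> proj_grad m f x)
      = ?c m * (LINT z|surface. legendre_proj m f z * (LINT x|surface. proj_grad n f x \<bullet> zonal_grad (legendre m) z x))"
    by (rule integral_inner_proj_grad[OF f _ D]) auto
  also have "(LINT z|surface. legendre_proj m f z * (LINT x|surface. proj_grad n f x \<bullet> zonal_grad (legendre m) z x))
      = (LINT z|surface. (if n = m then real n * (real n + 1) / ?c n else 0) * (legendre_proj n f z * legendre_proj m f z))"
  proof (rule integral_surface_cong)
    show "legendre_proj m f z * (LINT x|surface. proj_grad n f x \<bullet> zonal_grad (legendre m) z x)
        = (if n = m then real n * (real n + 1) / ?c n else 0) * (legendre_proj n f z * legendre_proj m f z)" if "norm z = 1" for z
      unfolding inner[OF that] by simp
  qed measurable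
  also have "\<dots> = (if n = m then real n * (real n + 1) / ?c n * proj_energy n f else 0)"
    unfolding integral_mult_right_zero proj_product[OF f] by simp
  finally show ?thesis by (auto simp: add_nonneg_eq_0_iff)
qed

text \<open>The square integral of \<open>gf\<close> minus the sum of the projected gradients is
  nonnegative. Green's formula makes the cross term equal to the eigenvalue times the energy, which
  is also the squared norm of each projected gradient.\<close>

lemma legendre_Bessel_grad:
  assumes f: "\<And>x. x \<noteq> 0 \<Longrightarrow> (f has_derivative (\<lambda>h. gf x \<bullet> h)) (at x)"
    and cont: "continuous_on (- {0}) gf"
    and hom: "\<And>x c. x \<noteq> 0 \<Longrightarrow> c > 0 \<Longrightarrow> f (c *\<^sub>R x) = f x"
    and I: "finite I"
  shows "(\<Sum>n\<in>I. real n * (real n + 1) * proj_energy n f) \<le> (LINT x|surface. (norm (gf x))\<^sup>2)"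
proof -
  have cf: "continuous_on (- {0}) f"
    by (intro continuous_at_imp_continuous_on ballI has_derivative_continuous[OF f]) auto
  have b: "sphere_bounded f" by (rule sphere_bounded_punctured[OF cf])
  note [measurable] = borel_measurable_punctured[OF cont] proj_grad_measurable[OF b]
    sphere_boundedD[OF b] sphere_boundedD[OF sphere_bounded_proj[OF b]]
  obtain D where D: "\<And>x. norm x = 1 \<Longrightarrow> norm (gf x) \<le> D" using bounded_on_sphere[OF cont] by blast
  have ii: "integrable surface (\<lambda>x. U x \<bullet> V x)"
    if [measurable]: "U \<in> borel_measurable borel" "V \<in> borel_measurable borel" and B: "\<exists>B. \<forall>x. norm x = 1 \<longrightarrow> norm (U x) \<le> B"
      "\<exists>B. \<forall>x. norm x = 1 \<longrightarrow> norm (V x) \<le> B" for U V :: "real^3 \<Rightarrow> real^3"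
  proof -
    obtain B C where B: "\<And>x. norm x = 1 \<Longrightarrow> norm (U x) \<le> B" "\<And>x. norm x = 1 \<Longrightarrow> norm (V x) \<le> C" using B by blast
    have "norm (U x \<bullet> V x) \<le> B * C" if x: "norm x = 1" for x
      using Cauchy_Schwarz_ineq2[of "U x" "V x"] mult_mono[OF B(1)[OF x] B(2)[OF x] order_trans[OF norm_ge_zero B(1)[OF x]] norm_ge_zero]
      by simp
    then show ?thesis by (intro integrable_surface_bounded) auto
  qed
  have bG: "\<exists>B. \<forall>x. norm x = 1 \<longrightarrow> norm (proj_grad n f x) \<le> B" for n
    using proj_grad_bounded[OF b] by metis
  have bg: "\<exists>B. \<forall>x. norm x = 1 \<longrightarrow> norm (gf x) \<le> B" using D by blast
  have 1: "(LINT x|surface. gf x \<bullet> proj_grad n f x) = real n * (real n + 1) * proj_energy n f" for n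
  proof -
    have "(LINT x|surface. gf x \<bullet> proj_grad n f x) = (2 * real n + 1) / (4 * pi) *
        (LINT y|surface. legendre_proj n f y * (LINT x|surface. gf x \<bullet> zonal_grad (legendre n) y x))"
      by (rule integral_inner_proj_grad[OF b _ D]) auto
    also have "(LINT y|surface. legendre_proj n f y * (LINT x|surface. gf x \<bullet> zonal_grad (legendre n) y x))
        = (LINT y|surface. (real n * (real n + 1)) * (legendre_proj n f y * zonal_conv (legendre n) f y))"
    proof (rule integral_surface_cong)
      fix y :: "real^3" assume y: "norm y = 1"
      have "(LINT x|surface. gf x \<bullet> zonal_grad (legendre n) y x)
          = - (LINT x|surface. f x * poly (zonal_laplace (legendre n)) (x \<bullet> y))"
        by (rule zonal_Green[OF f _ hom y]) (auto intro!: continuous_intros cont)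
      also have "\<dots> = - (LINT x|surface. - (real n * (real n + 1)) * (poly (legendre n) (x \<bullet> y) * f x))"
        unfolding zonal_laplace_legendre by (simp add: mult_ac)
      also have "\<dots> = real n * (real n + 1) * zonal_conv (legendre n) f y"
        unfolding integral_mult_right_zero by (simp add: zonal_conv_def)
      finally show "legendre_proj n f y * (LINT x|surface. gf x \<bullet> zonal_grad (legendre n) y x)
          = (real n * (real n + 1)) * (legendre_proj n f y * zonal_conv (legendre n) f y)" by simp
    next
      note [measurable] = sphere_boundedD[OF sphere_bounded_zonal_conv[OF b]]
      show "(\<lambda>y. (real n * (real n + 1)) * (legendre_proj n f y * zonal_conv (legendre n) f y)) \<in> borel_measurable borel"
        by measurable
    qed measurable
    also have "(2 * real n + 1) / (4 * pi) * (LINT y|surface. (real n * (real n + 1)) * (legendre_proj n f y * zonal_conv (legendre n) f y))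
        = real n * (real n + 1) * (LINT y|surface. legendre_proj n f y * legendre_proj n f y)"
      unfolding legendre_proj_def[of n f] by (simp add: mult_ac flip: integral_mult_right_zero)
    finally show ?thesis unfolding proj_product[OF b] by simp
  qed
  let ?G = "\<lambda>x. \<Sum>n\<in>I. proj_grad n f x"
  have 2: "(LINT x|surface. gf x \<bullet> ?G x) = (\<Sum>n\<in>I. real n * (real n + 1) * proj_energy n f)"
    unfolding inner_sum_right 1[symmetric]
    by (intro Bochner_Integration.integral_sum ii bg bG; measurable)
  have 3: "(LINT x|surface. ?G x \<bullet> ?G x) = (\<Sum>n\<in>I. real n * (real n + 1) * proj_energy n f)"
  proof -
    have "(LINT x|surface. ?G x \<bullet> ?G x) = (LINT x|surface. (\<Sum>n\<in>I. \<Sum>m\<in>I. proj_grad n f x \<bullet> proj_grad m f x))"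
      unfolding inner_sum_left unfolding inner_sum_right ..
    also have "\<dots> = (\<Sum>n\<in>I. LINT x|surface. (\<Sum>m\<in>I. proj_grad n f x \<bullet> proj_grad m f x))"
      by (intro Bochner_Integration.integral_sum Bochner_Integration.integrable_sum ii bG; measurable)
    also have "\<dots> = (\<Sum>n\<in>I. \<Sum>m\<in>I. LINT x|surface. proj_grad n f x \<bullet> proj_grad m f x)"
      by (intro sum.cong refl Bochner_Integration.integral_sum ii bG; measurable)
    also have "\<dots> = (\<Sum>n\<in>I. real n * (real n + 1) * proj_energy n f)"
      unfolding proj_grad_product[OF b] using I by (intro sum.cong) auto
    finally show ?thesis .
  qed
  have i: "integrable surface (\<lambda>x. gf x \<bullet> gf x)" "integrable surface (\<lambda>x. gf x \<bullet> ?G x)" "integrable surface (\<lambda>x. ?G x \<bullet> ?G x)"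
    unfolding inner_sum_left inner_sum_right
    by (intro Bochner_Integration.integrable_sum ii bg bG; measurable)+
  have "0 \<le> (LINT x|surface. (gf x - ?G x) \<bullet> (gf x - ?G x))" by simp
  also have "(\<lambda>x. (gf x - ?G x) \<bullet> (gf x - ?G x)) = (\<lambda>x. gf x \<bullet> gf x - 2 * (gf x \<bullet> ?G x) + ?G x \<bullet> ?G x)"
    by (rule ext) (simp add: inner_diff_left inner_diff_right inner_commute)
  also have "(LINT x|surface. gf x \<bullet> gf x - 2 * (gf x \<bullet> ?G x) + ?G x \<bullet> ?G x)
      = (LINT x|surface. gf x \<bullet> gf x) - 2 * (LINT x|surface. gf x \<bullet> ?G x) + (LINT x|surface. ?G x \<bullet> ?G x)"
    using i by simp
  finally show ?thesis unfolding 2 3 by (simp add: power2_norm_eq_inner)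
qed

section \<open>The inequality for scalar functions\<close>

text \<open>Testing the normalised kernel against P_n gives b n as a mean of P_n for a positive
  density of mass 1, and |P_n| \<le> 1 on [-1, 1].\<close>

lemma kernel_conv_expansion:
  "\<exists>b. (\<forall>n\<le>k. \<bar>b n\<bar> \<le> 1) \<and>
    (\<forall>f y. sphere_bounded f \<longrightarrow> kernel_conv k f y = (\<Sum>n\<le>k. b n * legendre_proj n f y))"
proof -
  obtain a where a: "\<And>t. poly (kernel_poly k) t = (\<Sum>n\<le>k. a n * poly (legendre n) t)"
    using kernel_legendre[of k] by blast
  define b where "b n = (real k + 1) * a n / (2 * real n + 1)" for n
  have exp: "(LINT x|surface. poly (kernel_poly k) (x \<bullet> y) * f x) = (\<Sum>n\<le>k. a n * zonal_conv (legendre n) f y)"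
    if f: "sphere_bounded f" for f y
  proof -
    have "(LINT x|surface. poly (kernel_poly k) (x \<bullet> y) * f x)
        = (LINT x|surface. (\<Sum>n\<le>k. a n * (poly (legendre n) (x \<bullet> y) * f x)))"
      unfolding a by (simp add: sum_distrib_right mult.assoc)
    also have "\<dots> = (\<Sum>n\<le>k. LINT x|surface. a n * (poly (legendre n) (x \<bullet> y) * f x))"
      by (intro Bochner_Integration.integral_sum integrable_mult_right integrable_zonal_conv f)
    finally show ?thesis by (simp add: zonal_conv_def)
  qed
  have "kernel_conv k f y = (\<Sum>n\<le>k. b n * legendre_proj n f y)" if f: "sphere_bounded f" for f y
  proof -
    have nz: "2 * real n + 1 \<noteq> 0" for n by (simp add: add_nonneg_eq_0_iff)
    show ?thesis
      unfolding kernel_conv_def exp[OF f] sum_distrib_left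
      by (intro sum.cong refl) (simp add: b_def legendre_proj_def nz)
  qed
  moreover have "\<bar>b n\<bar> \<le> 1" if n: "n \<le> k" for n
  proof -
    define y :: "real^3" where "y = axis 1 1"
    have y: "norm y = 1" by (simp add: y_def)
    let ?P = "\<lambda>x. poly (legendre n) (x \<bullet> y)"
    have k0: "real k + 1 > 0" by simp
    have "(LINT x|surface. poly (kernel_poly k) (x \<bullet> y) * ?P x)
        = (\<Sum>m\<le>k. if m = n then a n * (4 * pi / (2 * real n + 1)) else 0)"
      unfolding exp[OF sphere_bounded_zonal]
    proof (intro sum.cong refl)
      fix m
      show "a m * zonal_conv (legendre m) ?P y = (if m = n then a n * (4 * pi / (2 * real n + 1)) else 0)"
        using legendre_orthogonal[OF y y, of m n] legendre_norm[OF y, of n]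
        by (auto simp: zonal_conv_def power2_eq_square)
    qed
    also have "\<dots> = a n * (4 * pi / (2 * real n + 1))" using n by simp
    also have "\<dots> = b n * (4 * pi / (real k + 1))" using k0 by (simp add: b_def)
    finally have "\<bar>b n\<bar> * (4 * pi / (real k + 1)) = \<bar>LINT x|surface. poly (kernel_poly k) (x \<bullet> y) * ?P x\<bar>"
      by (simp add: abs_mult)
    also have "\<dots> \<le> (LINT x|surface. \<bar>poly (kernel_poly k) (x \<bullet> y) * ?P x\<bar>)"
      by (rule integral_abs_bound)
    also have "\<dots> \<le> (LINT x|surface. poly (kernel_poly k) (x \<bullet> y))"
    proof (rule integral_mono_AE)
      show "AE x in surface. \<bar>poly (kernel_poly k) (x \<bullet> y) * ?P x\<bar> \<le> poly (kernel_poly k) (x \<bullet> y)"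
      proof (rule AE_surfaceI)
        fix x :: "real^3" assume x: "norm x = 1"
        show "\<bar>poly (kernel_poly k) (x \<bullet> y) * ?P x\<bar> \<le> poly (kernel_poly k) (x \<bullet> y)"
          unfolding abs_mult using mult_left_mono[OF legendre_bound[OF x y, of n] kernel_nonneg[OF x y, of k]] kernel_nonneg[OF x y, of k]
          by simp
      qed
    qed (intro integrable_abs integrable_zonal2 integrable_zonal)+
    also have "\<dots> = 1 * (4 * pi / (real k + 1))" using kernel_mass[OF y, of k] by simp
    finally have "\<bar>b n\<bar> * (4 * pi / (real k + 1)) \<le> 1 * (4 * pi / (real k + 1))" .
    moreover have "4 * pi / (real k + 1) > 0" using k0 by simp
    ultimately show ?thesis by (simp only: mult_le_cancel_right_pos)
  qed
  ultimately show ?thesis by blast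
qed

text \<open>The convolution averages \<open>f\<close> with a positive density of mass 1. The bound
  is uniform in k and serves as majorant for dominated convergence.\<close>

lemma kernel_conv_bounded:
  assumes f: "sphere_bounded f" "\<And>x. norm x = 1 \<Longrightarrow> \<bar>f x\<bar> \<le> B" and y: "norm y = 1"
  shows "\<bar>kernel_conv k f y\<bar> \<le> B"
proof -
  have k0: "real k + 1 > 0" by simp
  have "\<bar>LINT x|surface. poly (kernel_poly k) (x \<bullet> y) * f x\<bar> \<le> (LINT x|surface. \<bar>poly (kernel_poly k) (x \<bullet> y) * f x\<bar>)"
    by (rule integral_abs_bound)
  also have "\<dots> \<le> (LINT x|surface. B * poly (kernel_poly k) (x \<bullet> y))"
  proof (rule integral_mono_AE)
    show "AE x in surface. \<bar>poly (kernel_poly k) (x \<bullet> y) * f x\<bar> \<le> B * poly (kernel_poly k) (x \<bullet> y)"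
    proof (rule AE_surfaceI)
      fix x :: "real^3" assume x: "norm x = 1"
      show "\<bar>poly (kernel_poly k) (x \<bullet> y) * f x\<bar> \<le> B * poly (kernel_poly k) (x \<bullet> y)"
        unfolding abs_mult using mult_left_mono[OF f(2)[OF x] kernel_nonneg[OF x y, of k]] kernel_nonneg[OF x y, of k]
        by (simp add: mult.commute)
    qed
  qed (intro integrable_abs integrable_zonal_conv integrable_zonal integrable_mult_right f)+
  also have "\<dots> = B * (4 * pi / (real k + 1))" by (simp add: kernel_mass[OF y])
  finally have "(real k + 1) / (4 * pi) * \<bar>LINT x|surface. poly (kernel_poly k) (x \<bullet> y) * f x\<bar>
      \<le> (real k + 1) / (4 * pi) * (B * (4 * pi / (real k + 1)))"
    by (rule mult_left_mono) simp
  then show ?thesis unfolding kernel_conv_def abs_mult using k0 by simp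
qed

context
  fixes f :: "real^3 \<Rightarrow> real" and gf :: "real^3 \<Rightarrow> real^3"
  assumes f: "\<And>x. x \<noteq> 0 \<Longrightarrow> (f has_derivative (\<lambda>h. gf x \<bullet> h)) (at x)"
    and cont: "continuous_on (- {0}) gf"
    and hom: "\<And>x c. x \<noteq> 0 \<Longrightarrow> c > 0 \<Longrightarrow> f (c *\<^sub>R x) = f x"
begin

lemma scalar_bounded: "sphere_bounded f" and scalar_continuous: "continuous_on (- {0}) f"
proof -
  show "continuous_on (- {0}) f"
    by (intro continuous_at_imp_continuous_on ballI has_derivative_continuous[OF f]) auto
  then show "sphere_bounded f" by (rule sphere_bounded_punctured)
qed

text \<open>The damped projections form an orthogonal system with K = (4 \<pi>)^(-1/2) and \<mu> n =
  2n + 1. With the weights n(n + 1) + 1 + m the energy sum is at most E + m N by the two Bessel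
  inequalities, and the dual sum is the eigenvalue sum.\<close>

lemma scalar_kernel_bound:
  assumes q: "q > 2" and m: "m > 0"
  shows "(LINT x|surface. \<bar>kernel_conv k f x\<bar> powr q) \<le> (1 / (4 * pi)) powr ((q - 2) / 2)
    * (((LINT x|surface. (norm (gf x))\<^sup>2) + (LINT x|surface. (f x)\<^sup>2)) + m * (LINT x|surface. (f x)\<^sup>2)) powr (q / 2)
    * (m powr (1 - q / (q - 2)) / (q / (q - 2) - 1)) powr ((q - 2) / 2)"
proof -
  define E where "E = (LINT x|surface. (norm (gf x))\<^sup>2) + (LINT x|surface. (f x)\<^sup>2)"
  define N where "N = (LINT x|surface. (f x)\<^sup>2)"
  note sb = scalar_bounded
  have S[measurable]: "sphere 0 1 \<in> sets (borel :: (real^3) measure)" by (simp add: closed_sphere)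
  note [measurable] = sphere_boundedD[OF sb] sphere_boundedD[OF sphere_bounded_proj[OF sb]]
  obtain b where b: "\<And>n. n \<le> k \<Longrightarrow> \<bar>b n\<bar> \<le> 1"
    "\<And>y. kernel_conv k f y = (\<Sum>n\<le>k. b n * legendre_proj n f y)"
    using kernel_conv_expansion[of k] sb by blast
  \<comment> \<open>The locale asks for A n > 0; degrees with energy 0 have a projection that
    vanishes on the sphere.\<close>
  define I where "I = {n. n \<le> k \<and> proj_energy n f > 0}"
  \<comment> \<open>The indicator is present because the pointwise bound of the locale is required
    at every point of the ambient space.\<close>
  define h where "h n x = b n * legendre_proj n f x * indicator (sphere 0 1) x" for n x
  define A where "A n = sqrt (proj_energy n f)" for n
  define v where "v n = real n * (real n + 1) + 1 + m" for n
  have finI: "finite I" unfolding I_def by simp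
  have v: "v n > 0" for n using m by (simp add: v_def add_nonneg_pos)
  have hh: "(LINT x|surface. h n x * h l x) = b n * b l * (if n = l then proj_energy n f else 0)" for n l
  proof -
    have "(LINT x|surface. h n x * h l x) = (LINT x|surface. (b n * b l) * (legendre_proj n f x * legendre_proj l f x))"
    proof (rule integral_surface_cong)
      show "(\<lambda>x. h n x * h l x) \<in> borel_measurable borel" unfolding h_def by measurable
      show "(\<lambda>x. (b n * b l) * (legendre_proj n f x * legendre_proj l f x)) \<in> borel_measurable borel" by measurable
    qed (simp add: h_def)
    then show ?thesis by (simp only: integral_mult_right_zero proj_product[OF sb])
  qed
  interpret H: orthogonal_system surface I h A "\<lambda>n. 2 * real n + 1" "sqrt (1 / (4 * pi))"
  proof
    show "finite I" by (rule finI)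
    show "h n \<in> borel_measurable surface" for n unfolding h_def by measurable
    show "0 < A n" if "n \<in> I" for n using that by (simp add: A_def I_def)
    show "0 < 2 * real n + 1" for n by (simp add: add_nonneg_pos)
    show "0 < sqrt (1 / (4 * pi))" by simp
    show "\<bar>h n x\<bar> \<le> sqrt (1 / (4 * pi)) * sqrt (2 * real n + 1) * A n" if n: "n \<in> I" for n x
    proof (cases "norm x = 1")
      case True
      have "\<bar>b n\<bar> * \<bar>legendre_proj n f x\<bar> \<le> 1 * (sqrt (1 / (4 * pi)) * sqrt (2 * real n + 1) * sqrt (proj_energy n f))"
        by (rule mult_mono[OF b(1) proj_pointwise[OF sb True]]) (use n in \<open>auto simp: I_def\<close>)
      then show ?thesis using True by (simp add: h_def abs_mult A_def)
    next
      case False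
      then show ?thesis using n by (simp add: h_def A_def I_def)
    qed
    show "(LINT x|surface. h n x * h l x) = 0" if "n \<noteq> l" for n l using that by (simp add: hh)
    show "(LINT x|surface. (h n x)\<^sup>2) \<le> (A n)\<^sup>2" if n: "n \<in> I" for n
    proof -
      have "(b n)\<^sup>2 \<le> 1" using b(1)[of n] n by (simp add: I_def abs_square_le_1)
      then have "(b n)\<^sup>2 * proj_energy n f \<le> 1 * proj_energy n f"
        using n by (intro mult_right_mono) (auto simp: I_def)
      then show ?thesis using n hh[of n n] by (simp add: power2_eq_square A_def I_def)
    qed
  qed
  have sum_eq: "(\<Sum>n\<in>I. h n x) = kernel_conv k f x" if x: "norm x = 1" for x
  proof -
    have "kernel_conv k f x = (\<Sum>n\<in>I. b n * legendre_proj n f x)"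
      unfolding b(2)
    proof (rule sum.mono_neutral_right)
      show "\<forall>n\<in>{..k} - I. b n * legendre_proj n f x = 0"
      proof
        fix n assume "n \<in> {..k} - I"
        then have "proj_energy n f = 0" using proj_energy_nonneg[OF sb, of n] by (auto simp: I_def)
        then have "legendre_proj n f x = 0" using proj_pointwise[OF sb x, of n] by simp
        then show "b n * legendre_proj n f x = 0" by simp
      qed
    qed (auto simp: I_def)
    then show ?thesis using x by (simp add: h_def)
  qed
  have meas_k: "kernel_conv k f \<in> borel_measurable borel"
  proof -
    have "kernel_conv k f = (\<lambda>y. \<Sum>n\<le>k. b n * legendre_proj n f y)" using b(2) by auto
    then show ?thesis by simp
  qed
  have "(LINT x|surface. \<bar>kernel_conv k f x\<bar> powr q) = (LINT x|surface. \<bar>\<Sum>n\<in>I. h n x\<bar> powr q)"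
  proof (rule integral_surface_cong)
    show "(\<lambda>x. \<bar>kernel_conv k f x\<bar> powr q) \<in> borel_measurable borel" using meas_k by measurable
    show "(\<lambda>x. \<bar>\<Sum>n\<in>I. h n x\<bar> powr q) \<in> borel_measurable borel" unfolding h_def by measurable
  qed (simp add: sum_eq)
  also have "\<dots> \<le> sqrt (1 / (4 * pi)) powr (q - 2) * (\<Sum>n\<in>I. (A n)\<^sup>2 * v n) powr (q / 2)
      * (\<Sum>n\<in>I. (2 * real n + 1) * v n powr (- (q / (q - 2)))) powr ((q - 2) / 2)"
    by (rule H.Lq_bound_weighted[OF q v])
  also have "\<dots> \<le> sqrt (1 / (4 * pi)) powr (q - 2) * (E + m * N) powr (q / 2)
      * (m powr (1 - q / (q - 2)) / (q / (q - 2) - 1)) powr ((q - 2) / 2)"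
  proof (intro mult_mono powr_mono2 mult_nonneg_nonneg)
    show "(\<Sum>n\<in>I. (2 * real n + 1) * v n powr (- (q / (q - 2)))) \<le> m powr (1 - q / (q - 2)) / (q / (q - 2) - 1)"
      unfolding v_def by (rule eigenvalue_sum_bound[OF _ m finI]) (use q in \<open>simp add: divide_simps\<close>)
    show "(\<Sum>n\<in>I. (A n)\<^sup>2 * v n) \<le> E + m * N"
    proof -
      have "(\<Sum>n\<in>I. (A n)\<^sup>2 * v n) = (\<Sum>n\<in>I. real n * (real n + 1) * proj_energy n f) + (1 + m) * (\<Sum>n\<in>I. proj_energy n f)"
        unfolding sum_distrib_left sum.distrib[symmetric]
        by (intro sum.cong refl) (auto simp: A_def I_def v_def algebra_simps)
      also have "\<dots> \<le> (LINT x|surface. (norm (gf x))\<^sup>2) + (1 + m) * N"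
        unfolding N_def
        by (intro add_mono mult_left_mono legendre_Bessel_grad[OF f cont hom finI] legendre_Bessel[OF sb finI])
          (use m in auto)
      finally show ?thesis by (simp add: E_def N_def algebra_simps)
    qed
  qed (use q v in \<open>auto intro!: sum_nonneg mult_nonneg_nonneg simp: less_imp_le\<close>)
  also have "sqrt (1 / (4 * pi)) powr (q - 2) = (1 / (4 * pi)) powr ((q - 2) / 2)"
    by (subst powr_half_sqrt[symmetric]) (simp_all add: powr_powr)
  finally show ?thesis by (simp add: E_def N_def)
qed

text \<open>The bound for the kernel convolutions holds for every m > 0 and does not depend on k;
  dominated convergence passes to \<open>f\<close>, and only then is m optimised, which requires N >
  0.\<close>

theorem scalar_inequality:
  assumes q: "q > 2" and pos: "(LINT x|surface. (f x)\<^sup>2) > 0"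
  shows "(LINT x|surface. \<bar>f x\<bar> powr q) \<le> (1 / (4 * pi)) powr ((q - 2) / 2) * (q / 2) powr (q / 2)
    * (LINT x|surface. (f x)\<^sup>2)
    * ((LINT x|surface. (norm (gf x))\<^sup>2) + (LINT x|surface. (f x)\<^sup>2)) powr ((q - 2) / 2)"
proof -
  define E where "E = (LINT x|surface. (norm (gf x))\<^sup>2) + (LINT x|surface. (f x)\<^sup>2)"
  define N where "N = (LINT x|surface. (f x)\<^sup>2)"
  note sb = scalar_bounded
  note [measurable] = sphere_boundedD[OF sb]
  obtain B where B: "B \<ge> 0" "\<And>x. norm x = 1 \<Longrightarrow> \<bar>f x\<bar> \<le> B" using sb by (rule sphere_boundedE) auto
  have N: "N > 0" and E: "E > 0" using pos by (auto simp: N_def E_def add_nonneg_pos)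
  have meas_k[measurable]: "kernel_conv k f \<in> borel_measurable borel" for k
    unfolding kernel_conv_def by (intro borel_measurable_times borel_measurable_const
        sphere_boundedD[OF sphere_bounded_zonal_conv[OF sb], unfolded zonal_conv_def])
  have lim: "(\<lambda>k. LINT x|surface. \<bar>kernel_conv k f x\<bar> powr q) \<longlonglongrightarrow> (LINT x|surface. \<bar>f x\<bar> powr q)"
  proof (rule integral_dominated_convergence[where w="\<lambda>_. B powr q"])
    show "AE x in surface. (\<lambda>k. \<bar>kernel_conv k f x\<bar> powr q) \<longlonglongrightarrow> \<bar>f x\<bar> powr q"
      by (intro AE_surfaceI tendsto_powr' tendsto_intros kernel_conv_tendsto scalar_continuous) (use q in auto)
    show "AE x in surface. norm (\<bar>kernel_conv k f x\<bar> powr q) \<le> B powr q" for k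
      using kernel_conv_bounded[OF sb B(2)] q by (intro AE_surfaceI) (auto intro!: powr_mono2)
  qed auto
  show ?thesis unfolding E_def[symmetric] unfolding N_def[symmetric]
  proof (rule optimise_shift[OF q N E])
    fix m :: real assume m: "m > 0"
    show "(LINT x|surface. \<bar>f x\<bar> powr q) \<le> (1 / (4 * pi)) powr ((q - 2) / 2) * (E + m * N) powr (q / 2)
        * (m powr (1 - q / (q - 2)) / (q / (q - 2) - 1)) powr ((q - 2) / 2)"
    proof (rule tendsto_upperbound[OF lim])
      show "\<forall>\<^sub>F k in sequentially. (LINT x|surface. \<bar>kernel_conv k f x\<bar> powr q) \<le> (1 / (4 * pi)) powr ((q - 2) / 2) * (E + m * N) powr (q / 2)
        * (m powr (1 - q / (q - 2)) / (q / (q - 2) - 1)) powr ((q - 2) / 2)"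
        unfolding E_def N_def by (intro always_eventually allI scalar_kernel_bound[OF q m])
    qed simp
  qed
qed

end

section \<open>Smooth tangent fields\<close>

unbundle no set_product_syntax
unbundle cross3_syntax

section \<open>Matrix and cross product identities\<close>

lemma sum_Basis_vec:
  fixes f :: "real^'n \<Rightarrow> 'b::comm_monoid_add"
  shows "(\<Sum>b\<in>Basis. f b) = (\<Sum>i\<in>UNIV. f (axis i 1))"
proof -
  have B: "(Basis :: (real^'n) set) = range (\<lambda>i. axis i 1)" by (auto simp: Basis_vec_def)
  have inj: "inj (\<lambda>i::'n. axis i (1::real))" by (simp add: inj_on_def axis_eq_axis)
  show ?thesis unfolding B sum.reindex[OF inj] by simp
qed

lemma sum_Basis_3:
  fixes f :: "real^3 \<Rightarrow> 'b::comm_monoid_add"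
  shows "(\<Sum>b\<in>Basis. f b) = f (axis 1 1) + f (axis 2 1) + f (axis 3 1)"
  by (simp only: sum_Basis_vec sum_3)

lemma trace_sum: "trace (M :: real^3^3) = (\<Sum>b\<in>Basis. (M *v b) \<bullet> b)"
  by (simp add: sum_Basis_vec trace_def matrix_vector_mult_basis inner_axis column_def)

lemma norm_matrix_square: "(norm (M :: real^3^3))\<^sup>2 = (\<Sum>b\<in>Basis. (norm (M *v b))\<^sup>2)"
proof -
  have n: "(norm x)\<^sup>2 = (\<Sum>i\<in>UNIV. (norm (x $ i))\<^sup>2)" for x :: "'a::real_normed_vector^3"
    by (simp add: norm_vec_def L2_set_def sum_nonneg)
  have n': "(norm x)\<^sup>2 = (\<Sum>i\<in>UNIV. (x $ i)\<^sup>2)" for x :: "real^3"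
    by (simp add: norm_vec_def L2_set_def sum_nonneg)
  have "(norm M)\<^sup>2 = (\<Sum>i\<in>UNIV. \<Sum>j\<in>UNIV. (M $ i $ j)\<^sup>2)" by (simp only: n n' real_norm_def power2_abs)
  also have "\<dots> = (\<Sum>j\<in>UNIV. \<Sum>i\<in>UNIV. (M $ i $ j)\<^sup>2)" by (rule sum.swap)
  also have "\<dots> = (\<Sum>b\<in>Basis. (norm (M *v b))\<^sup>2)"
    by (simp only: sum_Basis_vec matrix_vector_mult_basis n') (simp add: column_def)
  finally show ?thesis .
qed

lemma cross_cross: "(a \<times> b) \<times> c = (a \<bullet> c) *\<^sub>R b - (b \<bullet> c) *\<^sub>R (a :: real^3)"
  unfolding vec_eq_iff forall_3 by (simp add: cross_components inner_vec_def sum_3 algebra_simps)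

lemma cross_triple_swap: "a \<bullet> (b \<times> c) = - ((b \<times> a) \<bullet> (c :: real^3))"
  by (simp add: cross_components inner_vec_def sum_3 algebra_simps)

lemma cross_triple_rotate: "(a \<times> b) \<bullet> c = (c \<times> a) \<bullet> (b :: real^3)"
  by (simp add: cross_components inner_vec_def sum_3 algebra_simps)

locale smooth_tangent_field =
  fixes \<phi> :: "real^3 \<Rightarrow> real^3"
  assumes smooth: "smooth_S2 \<phi>" and tangent: "tangent_on S2 \<phi>"
begin

text \<open>The extension constant along rays is where all differentiation takes place:
  \<open>D x\<close> is its Jacobian at x, and \<open>D2 b x c\<close> its second derivative in the
  directions b and c.\<close>

definition "F = \<phi> \<circ> sgn"
definition "D x = frechet_derivative F (at x)"
definition "D2 b x = frechet_derivative (\<lambda>x. D x b) (at x)"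

lemma punctured_open: "open (- {0 :: real^3})" by auto

lemma F_smooth: "Ck_on k F (- {0})"
  using smooth by (simp add: smooth_S2_def F_def)

lemma F_deriv: "x \<noteq> 0 \<Longrightarrow> (F has_derivative D x) (at x)"
  using Ck_on_SucD(1)[OF punctured_open F_smooth] by (simp add: D_def)

lemma D_smooth: "b \<in> Basis \<Longrightarrow> Ck_on k (\<lambda>x. D x b) (- {0})"
  using Ck_on_SucD(2)[OF punctured_open F_smooth] by (simp add: D_def)

lemma D_deriv: "b \<in> Basis \<Longrightarrow> x \<noteq> 0 \<Longrightarrow> ((\<lambda>x. D x b) has_derivative D2 b x) (at x)"
  using Ck_on_SucD(1)[OF punctured_open D_smooth] by (simp add: D2_def)

lemma D2_continuous: "b \<in> Basis \<Longrightarrow> c \<in> Basis \<Longrightarrow> continuous_on (- {0}) (\<lambda>x. D2 b x c)"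
  using Ck_on_SucD(2)[OF punctured_open D_smooth, of b c 0] by (simp add: D2_def)

lemma F_continuous: "continuous_on (- {0}) F"
  by (rule Ck_on_continuous[OF F_smooth])

lemma linear_D: "x \<noteq> 0 \<Longrightarrow> linear (D x)"
  using F_deriv has_derivative_linear by blast

lemma D_expand: "x \<noteq> 0 \<Longrightarrow> D x h = (\<Sum>b\<in>Basis. (h \<bullet> b) *\<^sub>R D x b)"
proof -
  assume x: "x \<noteq> 0"
  have "D x (\<Sum>b\<in>Basis. (h \<bullet> b) *\<^sub>R b) = (\<Sum>b\<in>Basis. (h \<bullet> b) *\<^sub>R D x b)"
    using linear_D[OF x] by (simp add: linear_sum linear_scale)
  then show ?thesis by (simp only: euclidean_representation)
qed

lemma D_continuous: "continuous_on (- {0}) h \<Longrightarrow> continuous_on (- {0}) (\<lambda>x. D x (h x))"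
proof -
  assume h: "continuous_on (- {0}) h"
  have "continuous_on (- {0}) (\<lambda>x. \<Sum>b\<in>Basis. (h x \<bullet> b) *\<^sub>R D x b)"
    by (intro continuous_intros h Ck_on_continuous[OF D_smooth])
  then show ?thesis by (rule continuous_on_eq) (use D_expand in auto)
qed

lemma F_homogeneous: "c > 0 \<Longrightarrow> F (c *\<^sub>R x) = F x"
  by (simp add: F_def sgn_scaleR)

lemma F_sphere: "norm x = 1 \<Longrightarrow> F x = \<phi> x"
  by (simp add: F_def sgn_div_norm)

lemma F_tangent: "F x \<bullet> x = 0"
proof (cases "x = 0")
  case False
  then have "\<phi> (sgn x) \<bullet> sgn x = 0" using tangent by (simp add: tangent_on_def norm_sgn)
  moreover have "x = norm x *\<^sub>R sgn x" by (simp add: sgn_div_norm False)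
  ultimately show ?thesis by (metis F_def comp_apply inner_scaleR_right mult_zero_right)
qed simp

text \<open>Differentiating F \<bullet> x = 0 determines the normal part of the derivative from the
  field itself; this is the second fundamental form of the sphere.\<close>

lemma D_inner: "x \<noteq> 0 \<Longrightarrow> D x h \<bullet> x = - (F x \<bullet> h)"
proof -
  assume x: "x \<noteq> 0"
  have "((\<lambda>x. F x \<bullet> x) has_derivative (\<lambda>h. F x \<bullet> h + D x h \<bullet> x)) (at x)"
    by (rule has_derivative_inner[OF F_deriv[OF x] has_derivative_ident])
  moreover have "((\<lambda>x. F x \<bullet> x) has_derivative (\<lambda>h. 0)) (at x)"
    unfolding F_tangent by (rule has_derivative_const)
  ultimately have "(\<lambda>h. F x \<bullet> h + D x h \<bullet> x) = (\<lambda>h. 0)" by (rule has_derivative_unique)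
  then have "F x \<bullet> h + D x h \<bullet> x = 0" by metis
  then show ?thesis by simp
qed

lemma D_scale:
  assumes x: "x \<noteq> 0" and c: "c > 0"
  shows "D (c *\<^sub>R x) h = D x h /\<^sub>R c"
proof -
  have "((\<lambda>x. c *\<^sub>R x) has_derivative (\<lambda>h. c *\<^sub>R h)) (at x)" by (auto intro!: derivative_eq_intros)
  from has_derivative_compose[OF this F_deriv]
  have "((\<lambda>x. F (c *\<^sub>R x)) has_derivative (\<lambda>h. D (c *\<^sub>R x) (c *\<^sub>R h))) (at x)" using assms by auto
  then have "(F has_derivative (\<lambda>h. D (c *\<^sub>R x) (c *\<^sub>R h))) (at x)" by (simp only: F_homogeneous[OF c])
  from has_derivative_unique[OF this F_deriv[OF x]]
  have "D (c *\<^sub>R x) (c *\<^sub>R h) = D x h" by metis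
  moreover have "D (c *\<^sub>R x) (c *\<^sub>R h) = c *\<^sub>R D (c *\<^sub>R x) h"
    using linear_scale[OF linear_D[of "c *\<^sub>R x"]] assms by auto
  ultimately have "(c *\<^sub>R D (c *\<^sub>R x) h) /\<^sub>R c = D x h /\<^sub>R c" by simp
  then show ?thesis using c by simp
qed

lemma D_radial: "x \<noteq> 0 \<Longrightarrow> D x x = 0"
proof -
  assume x: "x \<noteq> 0"
  have "((\<lambda>t. t *\<^sub>R x) has_derivative (\<lambda>t. t *\<^sub>R x)) (at 1)" by (auto intro!: derivative_eq_intros)
  from has_derivative_compose[OF this, of F "D x"]
  have "((\<lambda>t. F (t *\<^sub>R x)) has_derivative (\<lambda>t. D x (t *\<^sub>R x))) (at 1)" using F_deriv[OF x] by simp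
  moreover have "((\<lambda>t. F (t *\<^sub>R x)) has_derivative (\<lambda>t. 0)) (at (1::real))"
  proof (rule has_derivative_transform_within_open[OF has_derivative_const[of "F x"]])
    show "open {0::real<..}" "1 \<in> {0::real<..}" by auto
    show "F x = F (t *\<^sub>R x)" if "t \<in> {0<..}" for t using that F_homogeneous[of t x] by simp
  qed
  ultimately have "(\<lambda>t. D x (t *\<^sub>R x)) = (\<lambda>t. 0)" by (rule has_derivative_unique)
  then have "D x (1 *\<^sub>R x) = 0" by metis
  then show ?thesis by simp
qed

lemma D2_symmetric:
  assumes bc: "b \<in> Basis" "c \<in> Basis" and x: "x \<noteq> 0"
  shows "D2 b x c = D2 c x b"
proof (rule euclidean_eqI)
  fix i :: "real^3" assume "i \<in> Basis"
  show "D2 b x c \<bullet> i = D2 c x b \<bullet> i"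
  proof (rule second_derivative_symmetric[OF punctured_open, where f="\<lambda>x. F x \<bullet> i" and f'="\<lambda>x h. D x h \<bullet> i"
        and fa'="\<lambda>x h. D2 b x h \<bullet> i" and fb'="\<lambda>x h. D2 c x h \<bullet> i"])
    show "continuous_on (- {0}) (\<lambda>y. D2 b y c \<bullet> i)" "continuous_on (- {0}) (\<lambda>y. D2 c y b \<bullet> i)"
      using D2_continuous bc by (auto intro!: continuous_intros)
  qed (use x bc in \<open>auto intro!: has_derivative_inner_left F_deriv D_deriv\<close>)
qed

lemma cov_apply:
  assumes x: "norm x = 1"
  shows "cov_smooth \<phi> x *v h = D x h + (F x \<bullet> h) *\<^sub>R x"
proof -
  have x0: "x \<noteq> 0" using x by auto
  have "linear (\<lambda>h. tangential x (D x h))"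
    using linear_D[OF x0] by (auto simp: linear_iff tangential_def inner_add_right algebra_simps)
  then have "cov_smooth \<phi> x *v h = tangential x (D x h)"
    unfolding cov_smooth_def F_def[symmetric] D_def[symmetric]
    using matrix_vector_mul(2)[of "\<lambda>h. tangential x (D x h)"] by simp
  also have "\<dots> = D x h + (F x \<bullet> h) *\<^sub>R x"
    using D_inner[OF x0, of h] by (simp add: tangential_def inner_commute)
  finally show ?thesis .
qed

lemma trace_cov:
  assumes x: "norm x = 1"
  shows "trace (cov_smooth \<phi> x) = (\<Sum>b\<in>Basis. D x b \<bullet> b)"
proof -
  have "(\<Sum>b\<in>Basis. (F x \<bullet> b) * (x \<bullet> b)) = F x \<bullet> x" by (rule euclidean_inner[symmetric])
  then show ?thesis unfolding trace_sum cov_apply[OF x] by (simp add: inner_add_left sum.distrib F_tangent)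
qed

text \<open>The normal part of \<open>D x b\<close> is -(F \<bullet> b) x, and the squares of these
  coefficients add up to |\<phi>|^2. This is the zeroth-order term that accompanies the covariant
  derivative throughout.\<close>

lemma norm_cov:
  assumes x: "norm x = 1"
  shows "(norm (cov_smooth \<phi> x))\<^sup>2 + (norm (\<phi> x))\<^sup>2 = (\<Sum>b\<in>Basis. (norm (D x b))\<^sup>2)"
proof -
  have x0: "x \<noteq> 0" using x by auto
  have xx: "x \<bullet> x = 1" using x by (simp add: dot_square_norm)
  have "(norm (D x b + (F x \<bullet> b) *\<^sub>R x))\<^sup>2 = (norm (D x b))\<^sup>2 - (F x \<bullet> b) * (F x \<bullet> b)" for b
    using D_inner[OF x0, of b] by (simp add: power2_norm_eq_inner inner_add_left inner_add_right inner_commute xx)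
  then have "(norm (cov_smooth \<phi> x))\<^sup>2 = (\<Sum>b\<in>Basis. (norm (D x b))\<^sup>2) - (\<Sum>b\<in>Basis. (F x \<bullet> b) * (F x \<bullet> b))"
    unfolding norm_matrix_square cov_apply[OF x] by (simp add: sum_subtractf)
  also have "(\<Sum>b\<in>Basis. (F x \<bullet> b) * (F x \<bullet> b)) = (norm (\<phi> x))\<^sup>2"
    using F_sphere[OF x] by (simp add: power2_norm_eq_inner flip: euclidean_inner)
  finally show ?thesis by simp
qed

lemma cov_continuous: "continuous_on (- {0}) (cov_smooth \<phi>)"
proof -
  have "cov_smooth \<phi> x = (\<chi> i j. (D x (axis j 1) - (x \<bullet> D x (axis j 1)) *\<^sub>R x) $ i)" for x
    by (simp add: cov_smooth_def matrix_def tangential_def D_def F_def)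
  then have "cov_smooth \<phi> = (\<lambda>x. \<chi> i j. (D x (axis j 1) - (x \<bullet> D x (axis j 1)) *\<^sub>R x) $ i)" by auto
  moreover have "continuous_on (- {0}) (\<lambda>x. \<chi> i j. (D x (axis j 1) - (x \<bullet> D x (axis j 1)) *\<^sub>R x) $ i)"
    by (intro continuous_on_vec_lambda continuous_intros D_continuous)
  ultimately show ?thesis by simp
qed

lemma perp_smooth: "smooth_tangent_field (perp \<phi>)"
proof
  have "Ck_on k (\<lambda>x. F x \<times> sgn x) (- {0})" for k
    using Ck_on_bilinear[OF punctured_open bilinear_cross[unfolded bilinear_conv_bounded_bilinear] F_smooth Ck_on_sgn] .
  moreover have "perp \<phi> \<circ> sgn = (\<lambda>x. F x \<times> sgn x)" by (auto simp: perp_def F_def)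
  ultimately show "smooth_S2 (perp \<phi>)" by (simp add: smooth_S2_def)
  show "tangent_on S2 (perp \<phi>)" by (simp add: tangent_on_def perp_def dot_cross_self)
qed

text \<open>Covariant differentiation commutes with the rotation by a right angle. Differentiating
  the factor x of the cross product contributes only a normal vector, which the projection to the
  tangent plane removes.\<close>

lemma cov_perp:
  assumes x: "norm x = 1"
  shows "cov_smooth (perp \<phi>) x *v h = (cov_smooth \<phi> x *v h) \<times> x"
proof -
  interpret P: smooth_tangent_field "perp \<phi>" by (rule perp_smooth)
  have x0: "x \<noteq> 0" using x by auto
  have sx: "sgn x = x" using x by (simp add: sgn_div_norm)
  have xx: "x \<bullet> x = 1" using x by (simp add: dot_square_norm)
  have PF: "P.F = (\<lambda>x. F x \<times> ((1 / norm x) *\<^sub>R x))"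
    by (auto simp: P.F_def F_def perp_def sgn_div_norm divide_inverse)
  have "((\<lambda>x. (1 / norm x) *\<^sub>R x) has_derivative (\<lambda>h. h - (x \<bullet> h) *\<^sub>R x)) (at x)"
    using x0 x sx by (auto intro!: derivative_eq_intros has_derivative_norm simp: inner_commute algebra_simps)
  from bounded_bilinear.FDERIV[OF bilinear_cross[unfolded bilinear_conv_bounded_bilinear] F_deriv[OF x0] this]
  have "(P.F has_derivative (\<lambda>h. F x \<times> (h - (x \<bullet> h) *\<^sub>R x) + D x h \<times> x)) (at x)"
    unfolding PF using x by simp
  from fun_cong[OF has_derivative_unique[OF this P.F_deriv[OF x0]], of h]
  have "P.D x h = F x \<times> (h - (x \<bullet> h) *\<^sub>R x) + D x h \<times> x" by (rule sym)
  then have e: "cov_smooth (perp \<phi>) x *v h = F x \<times> (h - (x \<bullet> h) *\<^sub>R x) + D x h \<times> x + ((F x \<times> x) \<bullet> h) *\<^sub>R x"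
    using P.cov_apply[OF x, of h] x by (simp add: PF)
  define k where "k = h - (x \<bullet> h) *\<^sub>R x"
  have k: "k \<bullet> x = 0" "(F x \<times> x) \<bullet> h = (F x \<times> x) \<bullet> k"
    by (simp_all add: k_def inner_diff_left inner_diff_right xx inner_commute[of h] dot_cross_self)
  \<comment> \<open>Both F x and k are tangent, so F x \<times> k is a multiple of x; crossing with
    x on both sides makes this explicit.\<close>
  have "F x \<times> k + ((F x \<times> x) \<bullet> k) *\<^sub>R x = 0"
  proof -
    have "(F x \<times> k) \<times> x = 0"
    proof -
      have "(F x \<times> k) \<times> x = (F x \<bullet> x) *\<^sub>R k - (k \<bullet> x) *\<^sub>R F x"
        by (rule cross_cross)
      then show ?thesis using k F_tangent by simp
    qed
    then have "x \<times> ((F x \<times> k) \<times> x) = 0" by simp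
    moreover have "x \<times> ((F x \<times> k) \<times> x) = (x \<bullet> x) *\<^sub>R (F x \<times> k) - (x \<bullet> (F x \<times> k)) *\<^sub>R x"
      by (rule Lagrange)
    moreover have "x \<bullet> (F x \<times> k) = - ((F x \<times> x) \<bullet> k)"
      by (rule cross_triple_swap)
    ultimately show ?thesis by (simp add: xx)
  qed
  then have "cov_smooth (perp \<phi>) x *v h = D x h \<times> x"
    unfolding e k(2) unfolding k_def[symmetric] by (metis add.commute add.left_commute add.right_neutral)
  then show ?thesis unfolding cov_apply[OF x] by (simp add: cross_add_left cross_mult_left)
qed

text \<open>The curl of the homogeneous extension has normal part \<open>rot \<phi>\<close> (up to sign) and tangential
  part of length \<open>|\<phi>|\<close>.\<close>

lemma norm_D_decomposition:
  assumes x: "norm x = 1"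
  shows "(\<Sum>b\<in>Basis. (norm (D x b))\<^sup>2)
    = (trace (cov_smooth (perp \<phi>) x))\<^sup>2 + (norm (\<phi> x))\<^sup>2 + (\<Sum>b\<in>Basis. \<Sum>c\<in>Basis. (D x c \<bullet> b) * (D x b \<bullet> c))"
proof -
  have x0: "x \<noteq> 0" using x by auto
  define r where "r = (\<Sum>b\<in>Basis. b \<times> D x b)"
  \<comment> \<open>The antisymmetric part of the Jacobian: |D|^2 minus the trace of D^2 is the
    squared length of the curl \<open>r\<close>.\<close>
  have 1: "(\<Sum>b\<in>Basis. (norm (D x b))\<^sup>2) - (\<Sum>b\<in>Basis. \<Sum>c\<in>Basis. (D x c \<bullet> b) * (D x b \<bullet> c)) = (norm r)\<^sup>2"
    unfolding r_def sum_Basis_3 power2_norm_eq_inner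
    by (simp add: cross3_simps axis_def power2_eq_square)
  have 2: "r \<times> x = \<phi> x"
  proof -
    have cc: "(b \<times> v) \<times> x = (b \<bullet> x) *\<^sub>R v - (v \<bullet> x) *\<^sub>R b" for b v
      by (rule cross_cross)
    have "r \<times> x = (\<Sum>b\<in>Basis. (x \<bullet> b) *\<^sub>R D x b) + (\<Sum>b\<in>Basis. (F x \<bullet> b) *\<^sub>R b)"
      unfolding r_def sum_Basis_3 cross_add_left cc D_inner[OF x0]
      by (simp add: inner_commute[of x])
    also have "\<dots> = D x x + F x" unfolding D_expand[OF x0, of x, symmetric] euclidean_representation ..
    finally show ?thesis by (simp add: D_radial[OF x0] F_sphere[OF x])
  qed
  have 3: "r \<bullet> x = trace (cov_smooth (perp \<phi>) x)"
  proof -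
    have "((cov_smooth \<phi> x *v b) \<times> x) \<bullet> b = (b \<times> D x b) \<bullet> x" for b
      unfolding cov_apply[OF x] cross_add_left cross_mult_left by (simp add: cross_triple_rotate)
    then show ?thesis unfolding trace_sum cov_perp[OF x] r_def by (simp add: inner_sum_left)
  qed
  have "(norm r)\<^sup>2 = (norm (r \<times> x))\<^sup>2 + (r \<bullet> x)\<^sup>2" using norm_cross_dot[of r x] x by simp
  then show ?thesis using 1 unfolding 2 3 by simp
qed

text \<open>The divergence theorem for W = D_F F - (div F) F, which has degree -1. In its divergence
  the second derivatives cancel by symmetry, leaving the trace of D^2 minus (div F)^2; its normal
  component is -|F|^2 on the sphere. The latter is the curvature term.\<close>

lemma integral_trace_square:
  "(LINT x|surface. (\<Sum>b\<in>Basis. \<Sum>c\<in>Basis. (D x c \<bullet> b) * (D x b \<bullet> c)) - (\<Sum>b\<in>Basis. D x b \<bullet> b)\<^sup>2)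
    = (LINT x|surface. - (norm (F x))\<^sup>2)"
proof -
  define W where "W x = (\<Sum>b\<in>Basis. (F x \<bullet> b) *\<^sub>R D x b - (D x b \<bullet> b) *\<^sub>R F x)" for x
  define DW where "DW x h = (\<Sum>b\<in>Basis. ((D x h \<bullet> b) *\<^sub>R D x b + (F x \<bullet> b) *\<^sub>R D2 b x h)
      - ((D2 b x h \<bullet> b) *\<^sub>R F x + (D x b \<bullet> b) *\<^sub>R D x h))" for x h
  have "(LINT x|surface. (\<Sum>c\<in>Basis. DW x c \<bullet> c)) = (LINT x|surface. W x \<bullet> x)"
  proof (rule sphere_divergence)
    fix x :: "real^3" assume x: "x \<noteq> 0"
    show "(W has_derivative DW x) (at x)"
      unfolding W_def[abs_def] DW_def[abs_def]
    proof (rule has_derivative_sum)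
      fix b :: "real^3" assume b: "b \<in> Basis"
      have "((\<lambda>x. (F x \<bullet> b) *\<^sub>R D x b - (D x b \<bullet> b) *\<^sub>R F x) has_derivative
          (\<lambda>h. ((F x \<bullet> b) *\<^sub>R D2 b x h + (D x h \<bullet> b) *\<^sub>R D x b) - ((D x b \<bullet> b) *\<^sub>R D x h + (D2 b x h \<bullet> b) *\<^sub>R F x))) (at x)"
        by (intro has_derivative_diff has_derivative_scaleR has_derivative_inner_left F_deriv D_deriv x b)
      then show "((\<lambda>x. (F x \<bullet> b) *\<^sub>R D x b - (D x b \<bullet> b) *\<^sub>R F x) has_derivative
          (\<lambda>h. ((D x h \<bullet> b) *\<^sub>R D x b + (F x \<bullet> b) *\<^sub>R D2 b x h) - ((D2 b x h \<bullet> b) *\<^sub>R F x + (D x b \<bullet> b) *\<^sub>R D x h))) (at x)"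
        by (simp add: add.commute)
    qed
  next
    show "continuous_on (- {0}) (\<lambda>x. DW x c)" if c: "c \<in> Basis" for c
      unfolding DW_def by (intro continuous_intros D_continuous D2_continuous F_continuous c)
    show "W (c *\<^sub>R x) = W x /\<^sub>R c" if "x \<noteq> 0" "c > 0" for x c
      unfolding W_def scaleR_sum_right
      by (intro sum.cong refl) (simp add: F_homogeneous[OF that(2)] D_scale[OF that] scaleR_diff_right)
  qed
  moreover have "(LINT x|surface. (\<Sum>c\<in>Basis. DW x c \<bullet> c))
      = (LINT x|surface. (\<Sum>b\<in>Basis. \<Sum>c\<in>Basis. (D x c \<bullet> b) * (D x b \<bullet> c)) - (\<Sum>b\<in>Basis. D x b \<bullet> b)\<^sup>2)"
  proof (rule integral_surface_cong)
    fix x :: "real^3" assume "norm x = 1"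
    then have x: "x \<noteq> 0" by auto
    have "DW x c \<bullet> c = (\<Sum>b\<in>Basis. (D x c \<bullet> b) * (D x b \<bullet> c)) + (\<Sum>b\<in>Basis. (F x \<bullet> b) * (D2 b x c \<bullet> c))
        - (\<Sum>b\<in>Basis. (D2 b x c \<bullet> b) * (F x \<bullet> c)) - (\<Sum>b\<in>Basis. (D x b \<bullet> b) * (D x c \<bullet> c))" for c
      unfolding DW_def by (simp add: inner_sum_left inner_diff_left inner_add_left sum.distrib sum_subtractf)
    then have "(\<Sum>c\<in>Basis. DW x c \<bullet> c) = (\<Sum>c\<in>Basis. \<Sum>b\<in>Basis. (D x c \<bullet> b) * (D x b \<bullet> c))
        + (\<Sum>c\<in>Basis. \<Sum>b\<in>Basis. (F x \<bullet> b) * (D2 b x c \<bullet> c))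
        - (\<Sum>c\<in>Basis. \<Sum>b\<in>Basis. (D2 b x c \<bullet> b) * (F x \<bullet> c)) - (\<Sum>c\<in>Basis. \<Sum>b\<in>Basis. (D x b \<bullet> b) * (D x c \<bullet> c))"
      by (simp add: sum.distrib sum_subtractf)
    also have "(\<Sum>c\<in>Basis. \<Sum>b\<in>Basis. (F x \<bullet> b) * (D2 b x c \<bullet> c)) = (\<Sum>c\<in>Basis. \<Sum>b\<in>Basis. (D2 b x c \<bullet> b) * (F x \<bullet> c))"
    proof (subst sum.swap, intro sum.cong refl)
      fix b c :: "real^3" assume "b \<in> Basis" "c \<in> Basis"
      then show "(F x \<bullet> b) * (D2 b x c \<bullet> c) = (D2 c x b \<bullet> c) * (F x \<bullet> b)"
        using D2_symmetric[OF _ _ x, of b c] by simp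
    qed
    also have "(\<Sum>c\<in>Basis. \<Sum>b\<in>Basis. (D x b \<bullet> b) * (D x c \<bullet> c)) = (\<Sum>b\<in>Basis. D x b \<bullet> b)\<^sup>2"
      unfolding power2_eq_square sum_product by (rule sum.swap)
    also have "(\<Sum>c\<in>Basis. \<Sum>b\<in>Basis. (D x c \<bullet> b) * (D x b \<bullet> c)) = (\<Sum>b\<in>Basis. \<Sum>c\<in>Basis. (D x c \<bullet> b) * (D x b \<bullet> c))"
      by (rule sum.swap)
    finally show "(\<Sum>c\<in>Basis. DW x c \<bullet> c)
        = (\<Sum>b\<in>Basis. \<Sum>c\<in>Basis. (D x c \<bullet> b) * (D x b \<bullet> c)) - (\<Sum>b\<in>Basis. D x b \<bullet> b)\<^sup>2" by simp
  next
    show "(\<lambda>x. \<Sum>c\<in>Basis. DW x c \<bullet> c) \<in> borel_measurable borel"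
      unfolding DW_def by (intro borel_measurable_punctured continuous_intros D_continuous D2_continuous F_continuous)
    show "(\<lambda>x. (\<Sum>b\<in>Basis. \<Sum>c\<in>Basis. (D x c \<bullet> b) * (D x b \<bullet> c)) - (\<Sum>b\<in>Basis. D x b \<bullet> b)\<^sup>2) \<in> borel_measurable borel"
      by (intro borel_measurable_punctured continuous_intros D_continuous)
  qed
  moreover have "(LINT x|surface. W x \<bullet> x) = (LINT x|surface. - (norm (F x))\<^sup>2)"
  proof (rule integral_surface_cong)
    fix x :: "real^3" assume "norm x = 1"
    then have x: "x \<noteq> 0" by auto
    have "W x \<bullet> x = - (\<Sum>b\<in>Basis. (F x \<bullet> b) * (F x \<bullet> b))"
      unfolding W_def by (simp add: inner_sum_left inner_diff_left D_inner[OF x] F_tangent sum_negf)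
    then show "W x \<bullet> x = - (norm (F x))\<^sup>2" by (simp add: power2_norm_eq_inner flip: euclidean_inner)
  next
    show "(\<lambda>x. W x \<bullet> x) \<in> borel_measurable borel" "(\<lambda>x. - (norm (F x))\<^sup>2) \<in> borel_measurable borel"
      unfolding W_def by (intro borel_measurable_punctured continuous_intros D_continuous F_continuous)+
  qed
  ultimately show ?thesis by simp
qed

text \<open>Pointwise, the left integrand is the squared rotation plus |\<phi>|^2 plus the trace of
  D^2. Up to the squared divergence, the trace of D^2 integrates to minus the integral of
  |\<phi>|^2, so the two zeroth-order terms cancel.\<close>

lemma Bochner_identity:
  "(LINT x|surface. (norm (cov_smooth \<phi> x))\<^sup>2 + (norm (F x))\<^sup>2)
    = (LINT x|surface. (trace (cov_smooth \<phi> x))\<^sup>2 + (trace (cov_smooth (perp \<phi>) x))\<^sup>2)"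
proof -
  interpret P: smooth_tangent_field "perp \<phi>" by (rule perp_smooth)
  have ct: "continuous_on (- {0}) (\<lambda>x. trace (cov_smooth \<phi> x))" "continuous_on (- {0}) (\<lambda>x. trace (cov_smooth (perp \<phi>) x))"
    unfolding trace_def by (intro continuous_intros cov_continuous P.cov_continuous)+
  define S where "S x = (\<Sum>b\<in>Basis. \<Sum>c\<in>Basis. (D x c \<bullet> b) * (D x b \<bullet> c))" for x
  define d where "d x = (\<Sum>b\<in>Basis. D x b \<bullet> b)" for x
  have c: "continuous_on (- {0}) S" "continuous_on (- {0}) d"
    unfolding S_def d_def by (intro continuous_intros D_continuous)+
  \<comment> \<open>Written so that the last bracket is a difference of two functions with equal
    integrals.\<close>
  have "(LINT x|surface. (norm (cov_smooth \<phi> x))\<^sup>2 + (norm (F x))\<^sup>2)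
      = (LINT x|surface. (d x)\<^sup>2 + (trace (cov_smooth (perp \<phi>) x))\<^sup>2 + ((S x - (d x)\<^sup>2) - (- (norm (F x))\<^sup>2)))"
  proof (rule integral_surface_cong)
    show "(norm (cov_smooth \<phi> x))\<^sup>2 + (norm (F x))\<^sup>2 = (d x)\<^sup>2 + (trace (cov_smooth (perp \<phi>) x))\<^sup>2 + ((S x - (d x)\<^sup>2) - (- (norm (F x))\<^sup>2))"
      if x: "norm x = 1" for x
      using norm_cov[OF x] norm_D_decomposition[OF x] F_sphere[OF x] by (simp add: S_def)
  qed (intro borel_measurable_punctured continuous_intros ct c cov_continuous F_continuous)+
  also have "\<dots> = (LINT x|surface. (d x)\<^sup>2 + (trace (cov_smooth (perp \<phi>) x))\<^sup>2)
      + ((LINT x|surface. S x - (d x)\<^sup>2) - (LINT x|surface. - (norm (F x))\<^sup>2))"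
  proof -
    have "integrable surface (\<lambda>x. (d x)\<^sup>2 + (trace (cov_smooth (perp \<phi>) x))\<^sup>2)"
      "integrable surface (\<lambda>x. S x - (d x)\<^sup>2)" "integrable surface (\<lambda>x. - (norm (F x))\<^sup>2)"
      by (intro integrable_surface continuous_intros ct c F_continuous)+
    then show ?thesis by (simp only: Bochner_Integration.integral_add Bochner_Integration.integral_diff Bochner_Integration.integrable_diff)
  qed
  also have "(LINT x|surface. S x - (d x)\<^sup>2) = (LINT x|surface. - (norm (F x))\<^sup>2)"
    unfolding S_def d_def by (rule integral_trace_square)
  also have "(LINT x|surface. (d x)\<^sup>2 + (trace (cov_smooth (perp \<phi>) x))\<^sup>2)
      = (LINT x|surface. (trace (cov_smooth \<phi> x))\<^sup>2 + (trace (cov_smooth (perp \<phi>) x))\<^sup>2)"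
    by (rule integral_surface_cong)
      (use ct c in \<open>auto simp: d_def trace_cov intro!: borel_measurable_punctured continuous_intros\<close>)
  finally show ?thesis by simp
qed

end

unbundle no cross3_syntax
unbundle set_product_syntax

section \<open>The inequality for smooth tangent fields\<close>

context smooth_tangent_field
begin

text \<open>Kato's inequality: the regularised length \<open>\<surd>(|\<phi>|\<^sup>2 + \<epsilon>\<^sup>2)\<close> has a gradient of length at most
  \<open>|\<nabla>\<phi>|\<close>.\<close>

lemma field_inequality_regularised:
  assumes q: "q > 2" and e: "\<epsilon> > 0"
  shows "(LINT x|surface. norm (F x) powr q) \<le> (1 / (4 * pi)) powr ((q - 2) / 2) * (q / 2) powr (q / 2)
    * ((LINT x|surface. (norm (F x))\<^sup>2) + 4 * pi * \<epsilon>\<^sup>2)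
    * ((LINT x|surface. (norm (cov_smooth \<phi> x))\<^sup>2 + (norm (F x))\<^sup>2) + 4 * pi * \<epsilon>\<^sup>2) powr ((q - 2) / 2)"
proof -
  \<comment> \<open>The positive \<epsilon> keeps the length differentiable at zeros of the field
    and makes its square integral positive, as the scalar inequality demands.\<close>
  define f where "f x = sqrt (F x \<bullet> F x + \<epsilon>\<^sup>2)" for x
  define gf where "gf x = (\<Sum>b\<in>Basis. ((F x \<bullet> D x b) / f x) *\<^sub>R b)" for x
  have f0: "f x > 0" for x using e by (simp add: f_def add_nonneg_pos)
  have f2: "(f x)\<^sup>2 = (norm (F x))\<^sup>2 + \<epsilon>\<^sup>2" for x by (simp add: f_def power2_norm_eq_inner)
  have deriv: "(f has_derivative (\<lambda>h. gf x \<bullet> h)) (at x)" if x: "x \<noteq> 0" for x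
  proof -
    have "((\<lambda>x. F x \<bullet> F x + \<epsilon>\<^sup>2) has_derivative (\<lambda>h. 2 * (F x \<bullet> D x h))) (at x)"
      by (rule has_derivative_eq_rhs, (rule has_derivative_add has_derivative_inner F_deriv[OF x] has_derivative_const)+)
        (auto simp: inner_commute)
    moreover have "(sqrt has_real_derivative inverse (f x) / 2) (at (F x \<bullet> F x + \<epsilon>\<^sup>2))"
      unfolding f_def by (rule DERIV_real_sqrt) (use e in \<open>auto intro: add_nonneg_pos\<close>)
    ultimately have "((\<lambda>x. sqrt (F x \<bullet> F x + \<epsilon>\<^sup>2)) has_derivative (\<lambda>h. inverse (f x) / 2 * (2 * (F x \<bullet> D x h)))) (at x)"
      using has_derivative_compose has_field_derivative_imp_has_derivative by blast
    moreover have "inverse (f x) / 2 * (2 * (F x \<bullet> D x h)) = gf x \<bullet> h" for h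
    proof -
      have "gf x \<bullet> h = (\<Sum>b\<in>Basis. ((F x \<bullet> D x b) / f x) * (b \<bullet> h))" by (simp add: gf_def inner_sum_left)
      also have "\<dots> = F x \<bullet> (\<Sum>b\<in>Basis. (h \<bullet> b) *\<^sub>R D x b) / f x"
        unfolding inner_sum_right sum_divide_distrib inner_commute[of h] by (intro sum.cong refl) simp
      also have "(\<Sum>b\<in>Basis. (h \<bullet> b) *\<^sub>R D x b) = D x h" by (rule D_expand[OF x, symmetric])
      finally show ?thesis by (simp add: inverse_eq_divide)
    qed
    ultimately show ?thesis by (simp add: f_def[abs_def])
  qed
  have cf: "continuous_on (- {0}) f" unfolding f_def by (intro continuous_intros F_continuous)
  have cg: "continuous_on (- {0}) gf"
    unfolding gf_def by (intro continuous_intros F_continuous D_continuous cf) (use f0 in \<open>auto simp: less_imp_neq[symmetric]\<close>)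
  have hom: "f (c *\<^sub>R x) = f x" if "x \<noteq> 0" "c > 0" for x c
    using that by (simp add: f_def F_homogeneous)
  have Kato: "(norm (gf x))\<^sup>2 \<le> (norm (cov_smooth \<phi> x))\<^sup>2" if x: "norm x = 1" for x
  proof -
    have "(norm (gf x))\<^sup>2 = (\<Sum>b\<in>Basis. (gf x \<bullet> b)\<^sup>2)"
      unfolding power2_norm_eq_inner unfolding power2_eq_square by (rule euclidean_inner)
    also have "\<dots> \<le> (\<Sum>b\<in>Basis. (norm (cov_smooth \<phi> x *v b))\<^sup>2)"
    proof (rule sum_mono)
      fix b :: "real^3" assume b: "b \<in> Basis"
      have "gf x \<bullet> b = (F x \<bullet> D x b) / f x"
        unfolding gf_def using b by (simp add: inner_sum_left inner_Basis if_distrib[of "\<lambda>t. _ * t"] cong: if_cong)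
      \<comment> \<open>F x is tangent, so the inner product sees only the tangential part of the
        derivative; this is why the smaller covariant derivative suffices in Kato's
        inequality.\<close>
      also have "F x \<bullet> D x b = F x \<bullet> (cov_smooth \<phi> x *v b)"
        unfolding cov_apply[OF x] by (simp add: inner_add_right F_tangent)
      finally have "(gf x \<bullet> b)\<^sup>2 = (F x \<bullet> (cov_smooth \<phi> x *v b))\<^sup>2 / (f x)\<^sup>2" by (simp add: power_divide)
      also have "\<dots> \<le> ((norm (F x))\<^sup>2 * (norm (cov_smooth \<phi> x *v b))\<^sup>2) / (f x)\<^sup>2"
        using Cauchy_Schwarz_ineq[of "F x" "cov_smooth \<phi> x *v b"]
        by (intro divide_right_mono) (simp_all add: power2_norm_eq_inner)
      also have "\<dots> \<le> ((f x)\<^sup>2 * (norm (cov_smooth \<phi> x *v b))\<^sup>2) / (f x)\<^sup>2"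
        unfolding f2 by (intro divide_right_mono mult_right_mono) auto
      finally show "(gf x \<bullet> b)\<^sup>2 \<le> (norm (cov_smooth \<phi> x *v b))\<^sup>2" using f0[of x] by simp
    qed
    finally show ?thesis by (simp add: norm_matrix_square)
  qed
  have i: "integrable surface (\<lambda>x. (norm (F x))\<^sup>2)" "integrable surface (\<lambda>x. (norm (cov_smooth \<phi> x))\<^sup>2)"
    "integrable surface (\<lambda>x. (norm (gf x))\<^sup>2)" "integrable surface (\<lambda>x. f x powr q)" "integrable surface (\<lambda>x. norm (F x) powr q)"
    "integrable surface (\<lambda>x. (f x)\<^sup>2)"
    by (intro integrable_surface continuous_intros F_continuous cov_continuous cf cg continuous_on_powr'; use f0 q in \<open>auto simp: less_imp_le less_imp_neq[symmetric]\<close>)+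
  have N: "(LINT x|surface. (f x)\<^sup>2) = (LINT x|surface. (norm (F x))\<^sup>2) + 4 * pi * \<epsilon>\<^sup>2"
    unfolding f2 using i(1) by (simp add: measure_surface_UNIV)
  have Np: "(LINT x|surface. (f x)\<^sup>2) > 0"
    unfolding N using e by (intro add_nonneg_pos) auto
  have "(LINT x|surface. norm (F x) powr q) \<le> (LINT x|surface. \<bar>f x\<bar> powr q)"
  proof (rule integral_mono)
    show "norm (F x) powr q \<le> \<bar>f x\<bar> powr q" for x
    proof (rule powr_mono2)
      have "(norm (F x))\<^sup>2 \<le> \<bar>f x\<bar>\<^sup>2" unfolding power2_abs f2 by simp
      then show "norm (F x) \<le> \<bar>f x\<bar>" by (rule power2_le_imp_le) simp
    qed (use q in auto)
    show "integrable surface (\<lambda>x. \<bar>f x\<bar> powr q)" using i(4) f0 by (simp add: less_imp_le)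
  qed (rule i)
  also have "\<dots> \<le> (1 / (4 * pi)) powr ((q - 2) / 2) * (q / 2) powr (q / 2)
    * (LINT x|surface. (f x)\<^sup>2)
    * ((LINT x|surface. (norm (gf x))\<^sup>2) + (LINT x|surface. (f x)\<^sup>2)) powr ((q - 2) / 2)"
    by (rule scalar_inequality[OF deriv cg hom q Np])
  also have "\<dots> \<le> (1 / (4 * pi)) powr ((q - 2) / 2) * (q / 2) powr (q / 2)
    * (LINT x|surface. (f x)\<^sup>2)
    * ((LINT x|surface. (norm (cov_smooth \<phi> x))\<^sup>2) + (LINT x|surface. (f x)\<^sup>2)) powr ((q - 2) / 2)"
  proof (intro mult_left_mono powr_mono2 add_right_mono)
    show "(LINT x|surface. (norm (gf x))\<^sup>2) \<le> (LINT x|surface. (norm (cov_smooth \<phi> x))\<^sup>2)"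
      by (rule integral_mono_AE) (use i Kato in \<open>auto intro!: AE_surfaceI\<close>)
  qed (use q in \<open>auto intro!: mult_nonneg_nonneg add_nonneg_nonneg\<close>)
  also have "(LINT x|surface. (norm (cov_smooth \<phi> x))\<^sup>2) + (LINT x|surface. (f x)\<^sup>2)
      = (LINT x|surface. (norm (cov_smooth \<phi> x))\<^sup>2 + (norm (F x))\<^sup>2) + 4 * pi * \<epsilon>\<^sup>2"
    unfolding N using i by simp
  finally show ?thesis unfolding N .
qed

lemma field_inequality:
  assumes q: "q > 2"
  shows "(LINT x|surface. norm (F x) powr q) \<le> (1 / (4 * pi)) powr ((q - 2) / 2) * (q / 2) powr (q / 2)
    * (LINT x|surface. (norm (F x))\<^sup>2)
    * (LINT x|surface. (norm (cov_smooth \<phi> x))\<^sup>2 + (norm (F x))\<^sup>2) powr ((q - 2) / 2)"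
proof (rule tendsto_lowerbound)
  let ?C = "(1 / (4 * pi)) powr ((q - 2) / 2) * (q / 2) powr (q / 2)"
  let ?N = "LINT x|surface. (norm (F x))\<^sup>2"
  let ?E = "LINT x|surface. (norm (cov_smooth \<phi> x))\<^sup>2 + (norm (F x))\<^sup>2"
  have "((\<lambda>\<epsilon>. ?C * (?N + 4 * pi * \<epsilon>\<^sup>2) * (?E + 4 * pi * \<epsilon>\<^sup>2) powr ((q - 2) / 2)) \<longlongrightarrow>
      ?C * (?N + 4 * pi * 0\<^sup>2) * (?E + 4 * pi * 0\<^sup>2) powr ((q - 2) / 2)) (at_right 0)"
    by (intro tendsto_intros tendsto_powr') (use q in \<open>auto intro!: always_eventually add_nonneg_nonneg\<close>)
  then show "((\<lambda>\<epsilon>. ?C * (?N + 4 * pi * \<epsilon>\<^sup>2) * (?E + 4 * pi * \<epsilon>\<^sup>2) powr ((q - 2) / 2)) \<longlongrightarrow>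
      ?C * ?N * ?E powr ((q - 2) / 2)) (at_right 0)" by simp
  show "\<forall>\<^sub>F \<epsilon> in at_right 0. (LINT x|surface. norm (F x) powr q)
      \<le> ?C * (?N + 4 * pi * \<epsilon>\<^sup>2) * (?E + 4 * pi * \<epsilon>\<^sup>2) powr ((q - 2) / 2)"
    using eventually_at_right_less[of "0::real"] by eventually_elim (rule field_inequality_regularised[OF q])
qed simp

end

section \<open>Weak covariant derivatives\<close>

text \<open>The divergence theorem for the field (\<phi> \<bullet> w) v / |x|, extended along rays.
  The factor 1/|x| gives it degree -1, and it has no normal part. The compositions with
  \<open>sgn\<close> make the integrand measurable on the ambient space, as the fields are arbitrary
  off the sphere.\<close>

lemma smooth_integration_by_parts:
  assumes "smooth_tangent_field \<phi>" "smooth_tangent_field v" "smooth_tangent_field w"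
  shows "(LINT x|surface. (cov_smooth \<phi> x *v v (sgn x)) \<bullet> w (sgn x)
    + \<phi> (sgn x) \<bullet> (cov_smooth w x *v v (sgn x) + trace (cov_smooth v x) *\<^sub>R w (sgn x))) = 0"
proof -
  interpret A: smooth_tangent_field \<phi> by fact
  interpret V: smooth_tangent_field v by fact
  interpret B: smooth_tangent_field w by fact
  define g where "g x = (A.F x \<bullet> B.F x) / norm x" for x
  define g' where "g' x h = (A.F x \<bullet> B.D x h + A.D x h \<bullet> B.F x) / norm x - (A.F x \<bullet> B.F x) * (sgn x \<bullet> h) / (norm x)\<^sup>2" for x h
  define W where "W x = g x *\<^sub>R V.F x" for x
  define DW where "DW x h = g x *\<^sub>R V.D x h + g' x h *\<^sub>R V.F x" for x h
  have "(LINT x|surface. (\<Sum>b\<in>Basis. DW x b \<bullet> b)) = (LINT x|surface. W x \<bullet> x)"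
  proof (rule sphere_divergence)
    show "(W has_derivative DW x) (at x)" if x: "x \<noteq> 0" for x
    proof -
      have 1: "((\<lambda>x. A.F x \<bullet> B.F x) has_derivative (\<lambda>h. A.F x \<bullet> B.D x h + A.D x h \<bullet> B.F x)) (at x)"
        by (rule has_derivative_inner[OF A.F_deriv[OF x] B.F_deriv[OF x]])
      have 2: "(norm has_derivative (\<lambda>h. sgn x \<bullet> h)) (at x)"
        using has_derivative_norm[OF x] by (simp add: inner_commute)
      have "(g has_derivative g' x) (at x)"
        unfolding g_def[abs_def] g'_def[abs_def]
        by (rule has_derivative_eq_rhs[OF has_derivative_divide'[OF 1 2]])
          (use x in \<open>auto simp: fun_eq_iff field_simps power2_eq_square\<close>)
      from has_derivative_scaleR[OF this V.F_deriv[OF x]] show ?thesis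
        unfolding W_def[abs_def] DW_def[abs_def] .
    qed
    show "continuous_on (- {0}) (\<lambda>x. DW x b)" for b
      unfolding DW_def g_def g'_def
      by (intro continuous_intros A.F_continuous B.F_continuous V.F_continuous A.D_continuous B.D_continuous V.D_continuous
          continuous_on_sgn; simp)
    show "W (c *\<^sub>R x) = W x /\<^sub>R c" if "x \<noteq> 0" "c > 0" for x c
      using that by (simp add: W_def g_def A.F_homogeneous B.F_homogeneous V.F_homogeneous field_simps)
  qed
  moreover have "W x \<bullet> x = 0" for x by (simp add: W_def V.F_tangent)
  moreover have "(LINT x|surface. (\<Sum>b\<in>Basis. DW x b \<bullet> b))
      = (LINT x|surface. (cov_smooth \<phi> x *v v (sgn x)) \<bullet> w (sgn x)
        + \<phi> (sgn x) \<bullet> (cov_smooth w x *v v (sgn x) + trace (cov_smooth v x) *\<^sub>R w (sgn x)))"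
  proof (rule integral_surface_cong)
    show "(\<lambda>x. \<Sum>b\<in>Basis. DW x b \<bullet> b) \<in> borel_measurable borel"
      unfolding DW_def g_def g'_def
      by (intro borel_measurable_punctured continuous_intros A.F_continuous B.F_continuous V.F_continuous
          A.D_continuous B.D_continuous V.D_continuous continuous_on_sgn; simp)
    have mv: "continuous_on (- {0}) (\<lambda>x. C x *v y x)" if "continuous_on (- {0}) C" "continuous_on (- {0}) y"
      for C :: "real^3 \<Rightarrow> real^3^3" and y
      unfolding matrix_vector_mult_def using that by (intro continuous_on_vec_lambda continuous_intros)
    have tr: "continuous_on (- {0}) (\<lambda>x. trace (C x))" if "continuous_on (- {0}) C" for C :: "real^3 \<Rightarrow> real^3^3"
      unfolding trace_def using that by (intro continuous_intros)
    show "(\<lambda>x. (cov_smooth \<phi> x *v v (sgn x)) \<bullet> w (sgn x)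
        + \<phi> (sgn x) \<bullet> (cov_smooth w x *v v (sgn x) + trace (cov_smooth v x) *\<^sub>R w (sgn x))) \<in> borel_measurable borel"
      using A.F_continuous B.F_continuous V.F_continuous unfolding A.F_def B.F_def V.F_def o_def
      by (intro borel_measurable_punctured continuous_intros mv tr A.cov_continuous B.cov_continuous V.cov_continuous)
    fix x :: "real^3" assume x: "norm x = 1"
    then have x0: "x \<noteq> 0" by auto
    have sx: "sgn x = x" using x by (simp add: sgn_div_norm)
    have F: "A.F x = \<phi> x" "B.F x = w x" "V.F x = v x" using x by (simp_all add: A.F_sphere B.F_sphere V.F_sphere)
    have "(\<Sum>b\<in>Basis. g' x b *\<^sub>R V.F x \<bullet> b) = g' x (V.F x)"
    proof -
      have "linear (g' x)"
        using A.linear_D[OF x0] B.linear_D[OF x0]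
        by (auto simp: linear_iff g'_def x inner_add_left inner_add_right algebra_simps)
      then have "g' x (\<Sum>b\<in>Basis. (V.F x \<bullet> b) *\<^sub>R b) = (\<Sum>b\<in>Basis. (V.F x \<bullet> b) * g' x b)"
        by (simp add: linear_sum linear_scale)
      then show ?thesis unfolding euclidean_representation by (simp add: mult.commute)
    qed
    then have "(\<Sum>b\<in>Basis. DW x b \<bullet> b) = g x * (\<Sum>b\<in>Basis. V.D x b \<bullet> b) + g' x (V.F x)"
      by (simp add: DW_def inner_add_left sum.distrib sum_distrib_left)
    also have "\<dots> = (\<phi> x \<bullet> w x) * trace (cov_smooth v x) + (\<phi> x \<bullet> B.D x (v x) + A.D x (v x) \<bullet> w x)"
      using V.F_tangent[of x] by (simp add: g_def g'_def x sx F V.trace_cov[OF x] inner_commute[of x])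
    also have "\<dots> = (cov_smooth \<phi> x *v v (sgn x)) \<bullet> w (sgn x)
        + \<phi> (sgn x) \<bullet> (cov_smooth w x *v v (sgn x) + trace (cov_smooth v x) *\<^sub>R w (sgn x))"
      using A.F_tangent[of x] B.F_tangent[of x]
      by (simp add: A.cov_apply[OF x] B.cov_apply[OF x] sx F inner_add_left inner_add_right inner_commute[of x])
    finally show "(\<Sum>b\<in>Basis. DW x b \<bullet> b) = (cov_smooth \<phi> x *v v (sgn x)) \<bullet> w (sgn x)
        + \<phi> (sgn x) \<bullet> (cov_smooth w x *v v (sgn x) + trace (cov_smooth v x) *\<^sub>R w (sgn x))" .
  qed
  ultimately show ?thesis by simp
qed

section \<open>Estimates for matrices and the rotated derivative\<close>

lemma norm_matrix_vector_le: "norm ((A :: real^3^3) *v x) \<le> norm A * norm x"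
proof (rule power2_le_imp_le)
  have n: "(norm y)\<^sup>2 = (\<Sum>i\<in>UNIV. (norm (y $ i))\<^sup>2)" for y :: "'a::real_normed_vector^3"
    by (simp add: norm_vec_def L2_set_def sum_nonneg)
  have "(norm (A *v x))\<^sup>2 = (\<Sum>i\<in>UNIV. (A $ i \<bullet> x)\<^sup>2)"
    unfolding n by (simp add: matrix_vector_mult_def inner_vec_def)
  also have "\<dots> \<le> (\<Sum>i\<in>UNIV. (norm (A $ i))\<^sup>2 * (norm x)\<^sup>2)"
    using Cauchy_Schwarz_ineq[of "A $ _" x] by (intro sum_mono) (simp add: power2_norm_eq_inner)
  also have "\<dots> = (norm A * norm x)\<^sup>2"
    unfolding n[of A] power_mult_distrib by (simp add: sum_distrib_right)
  finally show "(norm (A *v x))\<^sup>2 \<le> (norm A * norm x)\<^sup>2" .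
qed simp

lemma trace_square_le: "(trace (A :: real^3^3))\<^sup>2 \<le> 3 * (norm A)\<^sup>2"
proof -
  have n: "(norm y)\<^sup>2 = (\<Sum>i\<in>UNIV. (norm (y $ i))\<^sup>2)" for y :: "'a::real_normed_vector^3"
    by (simp add: norm_vec_def L2_set_def sum_nonneg)
  have "(a + b + c)\<^sup>2 \<le> 3 * (a\<^sup>2 + b\<^sup>2 + c\<^sup>2)" for a b c :: real
  proof -
    have "0 \<le> (a - b)\<^sup>2 + (b - c)\<^sup>2 + (a - c)\<^sup>2" by simp
    then show ?thesis by (simp add: power2_eq_square algebra_simps)
  qed
  then have "(trace A)\<^sup>2 \<le> 3 * (\<Sum>i\<in>UNIV. (A $ i $ i)\<^sup>2)" by (simp add: trace_def sum_3)
  also have "\<dots> \<le> 3 * (\<Sum>i\<in>UNIV. (norm (A $ i))\<^sup>2)"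
    using component_le_norm_cart[of "A $ _"] by (intro mult_left_mono sum_mono) (auto simp: abs_le_square_iff[symmetric])
  finally show ?thesis unfolding n[of A] .
qed

text \<open>By \<open>cov_perp\<close> this is the derivative of the rotated field when
  \<open>A\<close> is that of the field.\<close>

definition perp_matrix :: "real^3 \<Rightarrow> real^3^3 \<Rightarrow> real^3^3" where
  "perp_matrix x A = matrix (\<lambda>h. cross3 (A *v h) x)"

lemma perp_matrix_apply: "perp_matrix x A *v h = cross3 (A *v h) x"
proof -
  have "linear (\<lambda>h. cross3 (A *v h) x)"
    by (auto simp: linear_iff matrix_vector_right_distrib cross_add_left matrix_vector_mult_scaleR cross_mult_left)
  from matrix_vector_mul(2)[OF this] show ?thesis by (simp add: perp_matrix_def)
qed

lemma norm_perp_matrix_le: "norm x = 1 \<Longrightarrow> norm (perp_matrix x A) \<le> norm A"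
proof (rule power2_le_imp_le)
  assume x: "norm x = 1"
  have "(norm (cross3 y x))\<^sup>2 \<le> (norm y)\<^sup>2" for y
  proof -
    have "(norm (cross3 y x))\<^sup>2 + (y \<bullet> x)\<^sup>2 = (norm y)\<^sup>2" using norm_cross_dot[of y x] x by simp
    then show ?thesis using zero_le_power2[of "y \<bullet> x"] by linarith
  qed
  then show "(norm (perp_matrix x A))\<^sup>2 \<le> (norm A)\<^sup>2"
    unfolding norm_matrix_square perp_matrix_apply by (intro sum_mono)
qed simp

lemma matrix_eqI: "(\<And>b. b \<in> Basis \<Longrightarrow> (A :: real^3^3) *v b = B *v b) \<Longrightarrow> A = B"
proof -
  assume *: "\<And>b. b \<in> Basis \<Longrightarrow> A *v b = B *v b"
  have "(norm (A - B))\<^sup>2 = 0"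
    unfolding norm_matrix_square by (simp add: matrix_vector_mult_diff_rdistrib *)
  then show ?thesis by simp
qed

subsection \<open>Vanishing of functions with zero integrals over boxes\<close>

text \<open>Open boxes are intersection-stable and generate the Borel sets. The sets over which g
  integrates to 0 are closed under countable disjoint unions and, since the total integral vanishes,
  under complements.\<close>

lemma AE_zero_of_box_integrals:
  fixes g :: "'a::euclidean_space \<Rightarrow> real"
  assumes "finite_measure M" and M: "sets M = sets borel" and g: "integrable M g" and g0: "integral\<^sup>L M g = 0"
    and box: "\<And>a b. set_lebesgue_integral M (box a b) g = 0"
  shows "AE x in M. g x = 0"
proof -
  interpret finite_measure M by fact
  have sp: "space M = UNIV" using sets_eq_imp_space_eq[OF M] by simp
  have si: "set_integrable M A g" if "A \<in> sets borel" for A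
    unfolding set_integrable_def using g that M by (intro integrable_mult_indicator) auto
  have sig: "sets (borel :: 'a measure) = sigma_sets UNIV (range (\<lambda>(a, b). box a b))"
    by (subst borel_eq_box) simp
  have "set_lebesgue_integral M A g = 0" if "A \<in> sigma_sets UNIV (range (\<lambda>(a, b). box a b))" for A
  proof (rule sigma_sets_induct_disjoint[OF _ _ that])
    show "Int_stable (range (\<lambda>(a, b). box a b :: 'a set))"
      by (auto simp: Int_stable_def box_Int_box)
    show "set_lebesgue_integral M A g = 0" if "A \<in> range (\<lambda>(a, b). box a b)" for A
      using that box by auto
    show "set_lebesgue_integral M {} g = 0" by (simp add: set_lebesgue_integral_def)
  next
    fix A :: "'a set"
    assume "A \<in> sigma_sets UNIV (range (\<lambda>(a, b). box a b))" and A0: "set_lebesgue_integral M A g = 0"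
    then have A: "A \<in> sets borel" by (simp add: sig)
    have "set_lebesgue_integral M (A \<union> (UNIV - A)) g = set_lebesgue_integral M A g + set_lebesgue_integral M (UNIV - A) g"
      by (rule set_integral_Un) (use A in \<open>auto intro!: si\<close>)
    moreover have "set_lebesgue_integral M (A \<union> (UNIV - A)) g = 0"
      using g0 by (simp add: set_lebesgue_integral_def)
    ultimately show "set_lebesgue_integral M (UNIV - A) g = 0" using A0 by simp
  next
    fix A :: "nat \<Rightarrow> 'a set"
    assume d: "disjoint_family A" and "range A \<subseteq> sigma_sets UNIV (range (\<lambda>(a, b). box a b))"
      and A0: "\<And>i. set_lebesgue_integral M (A i) g = 0"
    then have A: "A i \<in> sets borel" for i by (auto simp: sig)
    have "set_lebesgue_integral M (\<Union>i. A i) g = (\<Sum>i. set_lebesgue_integral M (A i) g)"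
    proof (rule lebesgue_integral_countable_add)
      show "A i \<inter> A j = {}" if "i \<noteq> j" for i j using d that by (auto simp: disjoint_family_on_def)
    qed (use A M in \<open>auto intro!: si\<close>)
    then show "set_lebesgue_integral M (\<Union>i. A i) g = 0" using A0 by simp
  qed auto
  then show ?thesis using sig M by (intro density_zero g) auto
qed

subsection \<open>Square-integrable functions on a domain\<close>

lemma norm_powr_2: "norm a powr 2 = (norm a)\<^sup>2"
  by (cases "norm a = 0") auto

lemma borel_measurable_matrix_vector[measurable (raw)]:
  fixes T :: "'a \<Rightarrow> real^3^3" and v :: "'a \<Rightarrow> real^3"
  assumes "T \<in> borel_measurable M" "v \<in> borel_measurable M"
  shows "(\<lambda>x. T x *v v x) \<in> borel_measurable M"
  by (rule borel_measurable_continuous_Pair[OF assms])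
    (auto simp: matrix_vector_mult_def intro!: continuous_on_vec_lambda continuous_intros)

lemma borel_measurable_trace[measurable (raw)]:
  fixes T :: "'a \<Rightarrow> real^3^3"
  assumes "T \<in> borel_measurable M"
  shows "(\<lambda>x. trace (T x)) \<in> borel_measurable M"
  unfolding trace_def
  by (rule borel_measurable_continuous_on[OF _ assms]) (intro continuous_intros)

lemma borel_measurable_cross3[measurable (raw)]:
  assumes "f \<in> borel_measurable M" "g \<in> borel_measurable M"
  shows "(\<lambda>x. cross3 (f x) (g x)) \<in> borel_measurable M"
  by (rule borel_measurable_continuous_Pair[OF assms]) (intro continuous_on_cross continuous_intros)

lemma borel_measurable_perp_matrix[measurable (raw)]:
  assumes "T \<in> borel_measurable M" "f \<in> borel_measurable M"
  shows "(\<lambda>x. perp_matrix (f x) (T x)) \<in> borel_measurable M"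
  by (rule borel_measurable_continuous_Pair[OF assms(2,1)])
    (auto simp: perp_matrix_def matrix_def matrix_vector_mult_def intro!: continuous_on_vec_lambda continuous_intros continuous_on_cross)

locale sphere_domain =
  fixes \<Omega> :: "(real^3) set"
  assumes domain: "domain_S2 \<Omega>"
begin

lemma sphere_domain_open: obtains U where "open U" "\<Omega> = S2 \<inter> U"
  using domain by (auto simp: domain_S2_def openin_open)

lemma domain_unit: "x \<in> \<Omega> \<Longrightarrow> norm x = 1"
  using sphere_domain_open by (metis IntD1 dist_0_norm mem_sphere)

lemma domain_borel[measurable]: "\<Omega> \<in> sets borel"
proof -
  obtain U where "open U" "\<Omega> = S2 \<inter> U" using sphere_domain_open by blast
  then show ?thesis by (simp add: closed_sphere)
qed

lemma domain_inter: "\<Omega> \<inter> space surface \<in> sets surface"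
  by simp

lemma space_on: "space (surface_on \<Omega>) = \<Omega>"
  by (simp add: space_restrict_space)

lemma finite_on: "finite_measure (surface_on \<Omega>)"
  by (rule finite_measure_restrict_space) (use surface.finite_measure_axioms in auto)

lemma AE_on: "(AE x in surface_on \<Omega>. P x) \<longleftrightarrow> (AE x in surface. x \<in> \<Omega> \<longrightarrow> P x)"
  by (rule AE_restrict_space_iff[OF domain_inter])

lemma AE_onI: "(\<And>x. x \<in> \<Omega> \<Longrightarrow> P x) \<Longrightarrow> AE x in surface_on \<Omega>. P x"
  by (rule AE_I2) (simp add: space_on)

lemma measurable_on: "f \<in> borel_measurable borel \<Longrightarrow> f \<in> borel_measurable (surface_on \<Omega>)"
  by (rule measurable_restrict_space1) simp

lemma measurable_on_cong: "(\<And>x. x \<in> \<Omega> \<Longrightarrow> f x = g x) \<Longrightarrow> g \<in> borel_measurable borel \<Longrightarrow> f \<in> borel_measurable (surface_on \<Omega>)"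
proof -
  assume fg: "\<And>x. x \<in> \<Omega> \<Longrightarrow> f x = g x" and g: "g \<in> borel_measurable borel"
  have "f \<in> borel_measurable (surface_on \<Omega>) \<longleftrightarrow> g \<in> borel_measurable (surface_on \<Omega>)"
    by (rule measurable_cong) (simp add: space_on fg)
  with measurable_on[OF g] show ?thesis by blast
qed

lemma integral_on_extend:
  fixes f :: "real^3 \<Rightarrow> real"
  assumes f: "f \<in> borel_measurable borel" and z: "\<And>x. norm x = 1 \<Longrightarrow> x \<notin> \<Omega> \<Longrightarrow> f x = 0"
  shows "(LINT x|surface_on \<Omega>. f x) = (LINT x|surface. f x)"
  unfolding integral_restrict_space[OF domain_inter]
proof (rule integral_surface_cong)
  show "(\<lambda>x. indicator \<Omega> x *\<^sub>R f x) \<in> borel_measurable borel" using f by measurable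
  show "indicator \<Omega> x *\<^sub>R f x = f x" if "norm x = 1" for x
    using z[OF that] by (cases "x \<in> \<Omega>") auto
qed (rule f)

lemma integral_on_cong: "(\<And>x. x \<in> \<Omega> \<Longrightarrow> f x = g x) \<Longrightarrow> integral\<^sup>L (surface_on \<Omega>) f = integral\<^sup>L (surface_on \<Omega>) g"
  by (rule Bochner_Integration.integral_cong) (auto simp: space_on)

lemma integrable_on_cong: "(\<And>x. x \<in> \<Omega> \<Longrightarrow> f x = g x) \<Longrightarrow> integrable (surface_on \<Omega>) f = integrable (surface_on \<Omega>) g"
  by (rule Bochner_Integration.integrable_cong) (auto simp: space_on)

lemma is_L2_iff: "is_Lp 2 \<Omega> f \<longleftrightarrow> f \<in> borel_measurable (surface_on \<Omega>) \<and> integrable (surface_on \<Omega>) (\<lambda>x. (norm (f x))\<^sup>2)"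
  by (simp add: is_Lp_def norm_powr_2)

lemma L2_norm_square: "(Lp_norm 2 \<Omega> f)\<^sup>2 = (LINT x|surface_on \<Omega>. (norm (f x))\<^sup>2)"
  by (simp add: Lp_norm_def norm_powr_2 powr_half_sqrt)

lemma is_L2_combine:
  fixes f g :: "real^3 \<Rightarrow> 'b::{real_normed_vector, second_countable_topology}"
  assumes f: "is_Lp 2 \<Omega> f" and g: "is_Lp 2 \<Omega> g"
  shows "is_Lp 2 \<Omega> (\<lambda>x. f x + c *\<^sub>R g x)"
  unfolding is_L2_iff
proof
  have [measurable]: "f \<in> borel_measurable (surface_on \<Omega>)" "g \<in> borel_measurable (surface_on \<Omega>)"
    using f g by (auto simp: is_L2_iff)
  show m: "(\<lambda>x. f x + c *\<^sub>R g x) \<in> borel_measurable (surface_on \<Omega>)" by measurable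
  show "integrable (surface_on \<Omega>) (\<lambda>x. (norm (f x + c *\<^sub>R g x))\<^sup>2)"
  proof (rule Bochner_Integration.integrable_bound)
    show "integrable (surface_on \<Omega>) (\<lambda>x. 2 * (norm (f x))\<^sup>2 + 2 * c\<^sup>2 * (norm (g x))\<^sup>2)"
      using f g by (simp add: is_L2_iff)
    have "(norm (a + c *\<^sub>R b))\<^sup>2 \<le> 2 * (norm a)\<^sup>2 + 2 * c\<^sup>2 * (norm b)\<^sup>2" for a b :: 'b
    proof -
      have "(norm (a + c *\<^sub>R b))\<^sup>2 \<le> (norm a + \<bar>c\<bar> * norm b)\<^sup>2"
        using norm_triangle_ineq[of a "c *\<^sub>R b"] by (intro power_mono) auto
      also have "\<dots> \<le> 2 * (norm a)\<^sup>2 + 2 * (\<bar>c\<bar> * norm b)\<^sup>2"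
        using zero_le_power2[of "norm a - \<bar>c\<bar> * norm b"] by (simp add: power2_eq_square algebra_simps)
      finally show ?thesis by (simp add: power_mult_distrib)
    qed
    then show "AE x in surface_on \<Omega>. norm ((norm (f x + c *\<^sub>R g x))\<^sup>2) \<le> norm (2 * (norm (f x))\<^sup>2 + 2 * c\<^sup>2 * (norm (g x))\<^sup>2)"
      by (intro AE_I2) (simp add: add_nonneg_nonneg)
  qed (use m in measurable)
qed

text \<open>The measure is finite and t \<le> 1 + t^2, so a multiple of a square-integrable length
  is integrable.\<close>

lemma is_L2_integrable_mult:
  fixes f :: "real^3 \<Rightarrow> 'b::{real_normed_vector, second_countable_topology}"
  assumes f: "is_Lp 2 \<Omega> f" and [measurable]: "g \<in> borel_measurable (surface_on \<Omega>)"
    and b: "\<And>x. x \<in> \<Omega> \<Longrightarrow> \<bar>g x\<bar> \<le> B * norm (f x)"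
  shows "integrable (surface_on \<Omega>) g"
proof (rule Bochner_Integration.integrable_bound)
  interpret finite_measure "surface_on \<Omega>" by (rule finite_on)
  show "integrable (surface_on \<Omega>) (\<lambda>x. \<bar>B\<bar> * (1 + (norm (f x))\<^sup>2))"
    using f by (simp add: is_L2_iff)
  have "\<bar>g x\<bar> \<le> \<bar>B\<bar> * (1 + (norm (f x))\<^sup>2)" if x: "x \<in> \<Omega>" for x
  proof -
    have "B * norm (f x) \<le> \<bar>B\<bar> * norm (f x)" by (intro mult_right_mono) auto
    also have "\<dots> \<le> \<bar>B\<bar> * (1 + (norm (f x))\<^sup>2)"
    proof (intro mult_left_mono)
      have "0 \<le> (norm (f x) - 1)\<^sup>2" by simp
      then have "2 * norm (f x) \<le> 1 + (norm (f x))\<^sup>2" by (simp add: power2_diff)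
      then show "norm (f x) \<le> 1 + (norm (f x))\<^sup>2" using norm_ge_zero[of "f x"] by linarith
    qed simp
    finally show ?thesis using b[OF x] by linarith
  qed
  then show "AE x in surface_on \<Omega>. norm (g x) \<le> norm (\<bar>B\<bar> * (1 + (norm (f x))\<^sup>2))"
    by (intro AE_onI) (simp add: abs_mult)
qed measurable

subsection \<open>Test fields\<close>

lemma test_field_smooth: "v \<in> test_fields \<Omega> \<Longrightarrow> smooth_tangent_field v"
  by (auto simp: test_fields_def smooth_tangent_field_def)

text \<open>Outside the compact support the extension along rays vanishes on an open cone, so its
  derivative vanishes as well. Hence integrals over \<Omega> equal integrals over the
  sphere.\<close>

lemma test_field_zero:
  assumes v: "v \<in> test_fields \<Omega>" and x: "norm x = 1" "x \<notin> \<Omega>"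
  shows "v x = 0" "cov_smooth v x = 0"
proof -
  interpret smooth_tangent_field v by (rule test_field_smooth[OF v])
  obtain K where K: "compact K" "K \<subseteq> \<Omega>" "\<And>x. x \<in> S2 - K \<Longrightarrow> v x = 0"
    using v by (auto simp: test_fields_def)
  have xK: "x \<notin> K" using K x by auto
  show "v x = 0" using K(3) x xK by auto
  have o: "open (- {0::real^3} \<inter> sgn -` (- K))"
    by (rule continuous_open_preimage)
      (use K(1) in \<open>auto intro!: continuous_on_sgn continuous_intros simp: compact_imp_closed open_Compl\<close>)
  have x0: "x \<noteq> 0" using x by auto
  have sx: "sgn x = x" using x by (simp add: sgn_div_norm)
  have "(F has_derivative (\<lambda>h. 0)) (at x)"
  proof (rule has_derivative_transform_within_open[OF has_derivative_const[of 0] o])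
    show "x \<in> - {0} \<inter> sgn -` (- K)" using x0 xK sx by simp
    show "0 = F y" if "y \<in> - {0} \<inter> sgn -` (- K)" for y
      using that K(3)[of "sgn y"] by (simp add: F_def norm_sgn)
  qed
  from has_derivative_unique[OF F_deriv[OF x0] this] have "D x = (\<lambda>h. 0)" .
  then show "cov_smooth v x = 0"
    by (simp add: cov_smooth_def D_def F_def tangential_def matrix_def vec_eq_iff)
qed

lemma test_field_measurable:
  assumes v: "v \<in> test_fields \<Omega>"
  shows "v \<in> borel_measurable (surface_on \<Omega>)" "cov_smooth v \<in> borel_measurable (surface_on \<Omega>)"
proof -
  interpret smooth_tangent_field v by (rule test_field_smooth[OF v])
  show "v \<in> borel_measurable (surface_on \<Omega>)"
    by (rule measurable_on_cong[where g=F]) (auto simp: F_sphere domain_unit F_continuous intro: borel_measurable_punctured)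
  show "cov_smooth v \<in> borel_measurable (surface_on \<Omega>)"
    by (intro measurable_on borel_measurable_punctured cov_continuous)
qed

lemma test_field_bounded:
  assumes v: "v \<in> test_fields \<Omega>"
  obtains B where "B \<ge> 0" "\<And>x. x \<in> \<Omega> \<Longrightarrow> norm (v x) \<le> B" "\<And>x. x \<in> \<Omega> \<Longrightarrow> norm (cov_smooth v x) \<le> B"
proof -
  interpret smooth_tangent_field v by (rule test_field_smooth[OF v])
  obtain B where B: "\<And>x. norm x = 1 \<Longrightarrow> norm (F x) \<le> B" using bounded_on_sphere[OF F_continuous] by blast
  obtain C where C: "\<And>x. norm x = 1 \<Longrightarrow> norm (cov_smooth v x) \<le> C" using bounded_on_sphere[OF cov_continuous] by blast
  show ?thesis
  proof (rule that[of "\<bar>B\<bar> + \<bar>C\<bar>"])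
    fix x assume "x \<in> \<Omega>"
    then have x: "norm x = 1" by (rule domain_unit)
    show "norm (v x) \<le> \<bar>B\<bar> + \<bar>C\<bar>" using B[OF x] F_sphere[OF x] by simp
    show "norm (cov_smooth v x) \<le> \<bar>B\<bar> + \<bar>C\<bar>" using C[OF x] by simp
  qed simp
qed

lemma bounded_is_L2:
  assumes "f \<in> borel_measurable (surface_on \<Omega>)" "\<And>x. x \<in> \<Omega> \<Longrightarrow> norm (f x) \<le> B"
  shows "is_Lp 2 \<Omega> f"
proof -
  interpret finite_measure "surface_on \<Omega>" by (rule finite_on)
  have "integrable (surface_on \<Omega>) (\<lambda>x. (norm (f x))\<^sup>2)"
    by (rule integrable_const_bound[where B="B\<^sup>2"]) (use assms in \<open>auto intro!: AE_onI power_mono\<close>)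
  then show ?thesis using assms by (simp add: is_L2_iff)
qed

lemma test_field_L2: "v \<in> test_fields \<Omega> \<Longrightarrow> is_Lp 2 \<Omega> v" "v \<in> test_fields \<Omega> \<Longrightarrow> is_Lp 2 \<Omega> (cov_smooth v)"
  using test_field_measurable test_field_bounded bounded_is_L2 by metis+

lemma pairing_integrable:
  assumes T: "is_Lp 2 \<Omega> T" and v: "v \<in> test_fields \<Omega>" and w: "w \<in> test_fields \<Omega>"
  shows "integrable (surface_on \<Omega>) (\<lambda>x. (T x *v v x) \<bullet> w x)"
proof -
  have [measurable]: "T \<in> borel_measurable (surface_on \<Omega>)" using T by (simp add: is_L2_iff)
  note [measurable] = test_field_measurable[OF v] test_field_measurable[OF w]
  obtain B where B: "B \<ge> 0" "\<And>x. x \<in> \<Omega> \<Longrightarrow> norm (v x) \<le> B" using test_field_bounded[OF v] by metis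
  obtain C where C: "C \<ge> 0" "\<And>x. x \<in> \<Omega> \<Longrightarrow> norm (w x) \<le> C" using test_field_bounded[OF w] by metis
  show ?thesis
  proof (rule is_L2_integrable_mult[OF T, where B="B * C"])
    fix x assume x: "x \<in> \<Omega>"
    have "\<bar>(T x *v v x) \<bullet> w x\<bar> \<le> norm (T x *v v x) * norm (w x)" by (rule Cauchy_Schwarz_ineq2)
    also have "\<dots> \<le> (norm (T x) * B) * C"
    proof (rule mult_mono)
      show "norm (T x *v v x) \<le> norm (T x) * B"
        using norm_matrix_vector_le[of "T x" "v x"] mult_left_mono[OF B(2)[OF x], of "norm (T x)"] by simp
    qed (use C x B in auto)
    finally show "\<bar>(T x *v v x) \<bullet> w x\<bar> \<le> B * C * norm (T x)" by (simp add: mult_ac)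
  qed measurable
qed

lemma dual_pairing_integrable:
  assumes u: "is_Lp 2 \<Omega> u" and v: "v \<in> test_fields \<Omega>" and w: "w \<in> test_fields \<Omega>"
  shows "integrable (surface_on \<Omega>) (\<lambda>x. u x \<bullet> (cov_smooth w x *v v x + trace (cov_smooth v x) *\<^sub>R w x))"
proof -
  have [measurable]: "u \<in> borel_measurable (surface_on \<Omega>)" using u by (simp add: is_L2_iff)
  note [measurable] = test_field_measurable[OF v] test_field_measurable[OF w]
  obtain B where B: "B \<ge> 0" "\<And>x. x \<in> \<Omega> \<Longrightarrow> norm (v x) \<le> B" "\<And>x. x \<in> \<Omega> \<Longrightarrow> norm (cov_smooth v x) \<le> B"
    using test_field_bounded[OF v] by metis
  obtain C where C: "C \<ge> 0" "\<And>x. x \<in> \<Omega> \<Longrightarrow> norm (w x) \<le> C" "\<And>x. x \<in> \<Omega> \<Longrightarrow> norm (cov_smooth w x) \<le> C"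
    using test_field_bounded[OF w] by metis
  show ?thesis
  proof (rule is_L2_integrable_mult[OF u, where B="C * B + 2 * B * C"])
    fix x assume x: "x \<in> \<Omega>"
    have 1: "norm (cov_smooth w x *v v x) \<le> C * B"
      by (rule order_trans[OF norm_matrix_vector_le]) (intro mult_mono B C x norm_ge_zero)
    have "\<bar>trace (cov_smooth v x)\<bar> \<le> 2 * B"
    proof (rule power2_le_imp_le)
      have "(trace (cov_smooth v x))\<^sup>2 \<le> 3 * (norm (cov_smooth v x))\<^sup>2" by (rule trace_square_le)
      also have "\<dots> \<le> 3 * B\<^sup>2" using B(3)[OF x] by (intro mult_left_mono power_mono) auto
      also have "\<dots> \<le> (2 * B)\<^sup>2" by (simp add: power_mult_distrib)
      finally show "\<bar>trace (cov_smooth v x)\<bar>\<^sup>2 \<le> (2 * B)\<^sup>2" by simp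
    qed (use B in simp)
    then have 2: "norm (trace (cov_smooth v x) *\<^sub>R w x) \<le> 2 * B * C"
      unfolding norm_scaleR using C x B by (intro mult_mono) auto
    have "\<bar>u x \<bullet> (cov_smooth w x *v v x + trace (cov_smooth v x) *\<^sub>R w x)\<bar>
        \<le> norm (u x) * norm (cov_smooth w x *v v x + trace (cov_smooth v x) *\<^sub>R w x)"
      by (rule Cauchy_Schwarz_ineq2)
    also have "\<dots> \<le> norm (u x) * (C * B + 2 * B * C)"
      by (intro mult_left_mono order_trans[OF norm_triangle_ineq] add_mono 1 2) auto
    finally show "\<bar>u x \<bullet> (cov_smooth w x *v v x + trace (cov_smooth v x) *\<^sub>R w x)\<bar> \<le> (C * B + 2 * B * C) * norm (u x)"
      by (simp add: mult.commute)
  qed measurable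
qed

subsection \<open>Operations on weak derivatives\<close>

text \<open>Fields and derivatives vanish outside \<Omega>, so integration by parts over the whole
  sphere gives the weak identity on \<Omega>. Normality on both sides comes from
  \<open>D_radial\<close> and \<open>D_inner\<close>.\<close>

lemma weak_cov_test:
  assumes u: "\<phi> \<in> test_fields \<Omega>"
  shows "is_weak_cov \<Omega> \<phi> (cov_smooth \<phi>)"
  unfolding is_weak_cov_def
proof (intro conjI ballI)
  interpret A: smooth_tangent_field \<phi> by (rule test_field_smooth[OF u])
  show "is_Lp 2 \<Omega> (cov_smooth \<phi>)" by (rule test_field_L2[OF u])
  fix x assume "x \<in> \<Omega>"
  then have x: "norm x = 1" by (rule domain_unit)
  then have x0: "x \<noteq> 0" by auto
  have xx: "x \<bullet> x = 1" using x by (simp add: dot_square_norm)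
  show "cov_smooth \<phi> x *v x = 0"
    unfolding A.cov_apply[OF x] by (simp add: A.D_radial[OF x0] A.F_tangent)
  show "x v* cov_smooth \<phi> x = 0"
  proof (rule vector_eq_ldot[THEN iffD1, rule_format])
    fix h
    have "h \<bullet> (x v* cov_smooth \<phi> x) = x \<bullet> (cov_smooth \<phi> x *v h)"
      by (metis dot_lmul_matrix inner_commute)
    also have "\<dots> = 0"
      unfolding A.cov_apply[OF x]
      using A.D_inner[OF x0, of h] inner_commute[of "A.D x h" x] by (simp add: inner_add_right xx)
    finally show "h \<bullet> (x v* cov_smooth \<phi> x) = h \<bullet> 0" by simp
  qed
next
  fix v w assume v: "v \<in> test_fields \<Omega>" and w: "w \<in> test_fields \<Omega>"
  let ?L = "\<lambda>x. (cov_smooth \<phi> x *v v x) \<bullet> w x"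
  let ?R = "\<lambda>x. \<phi> x \<bullet> (cov_smooth w x *v v x + trace (cov_smooth v x) *\<^sub>R w x)"
  interpret A: smooth_tangent_field \<phi> by (rule test_field_smooth[OF u])
  interpret V: smooth_tangent_field v by (rule test_field_smooth[OF v])
  interpret B: smooth_tangent_field w by (rule test_field_smooth[OF w])
  let ?G = "\<lambda>x. (cov_smooth \<phi> x *v v (sgn x)) \<bullet> w (sgn x)
    + \<phi> (sgn x) \<bullet> (cov_smooth w x *v v (sgn x) + trace (cov_smooth v x) *\<^sub>R w (sgn x))"
  have sx: "sgn x = x" if "norm x = 1" for x :: "real^3" using that by (simp add: sgn_div_norm)
  have m: "?G \<in> borel_measurable borel"
  proof -
    have [measurable]: "(\<lambda>x. \<phi> (sgn x)) \<in> borel_measurable borel" "(\<lambda>x. v (sgn x)) \<in> borel_measurable borel" "(\<lambda>x. w (sgn x)) \<in> borel_measurable borel"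
      using A.F_continuous B.F_continuous V.F_continuous unfolding A.F_def B.F_def V.F_def o_def
      by (auto intro: borel_measurable_punctured)
    note [measurable] = A.cov_continuous[THEN borel_measurable_punctured] B.cov_continuous[THEN borel_measurable_punctured]
      V.cov_continuous[THEN borel_measurable_punctured]
    show ?thesis by measurable
  qed
  have "(LINT x|surface_on \<Omega>. ?L x) + (LINT x|surface_on \<Omega>. ?R x) = (LINT x|surface_on \<Omega>. ?L x + ?R x)"
    by (rule Bochner_Integration.integral_add[symmetric])
      (intro pairing_integrable dual_pairing_integrable test_field_L2 u v w)+
  also have "\<dots> = (LINT x|surface_on \<Omega>. ?G x)"
    by (rule integral_on_cong) (simp add: sx domain_unit)
  also have "\<dots> = (LINT x|surface. ?G x)"
    by (rule integral_on_extend[OF m]) (simp add: sx test_field_zero[OF u] test_field_zero[OF v])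
  also have "\<dots> = 0"
    by (rule smooth_integration_by_parts) unfold_locales
  finally show "(LINT x|surface_on \<Omega>. ?L x) = - (LINT x|surface_on \<Omega>. ?R x)" by simp
qed

lemma weak_cov_combine:
  assumes u: "is_Lp 2 \<Omega> u" "is_weak_cov \<Omega> u T" and u': "is_Lp 2 \<Omega> u'" "is_weak_cov \<Omega> u' T'"
  shows "is_weak_cov \<Omega> (\<lambda>x. u x + c *\<^sub>R u' x) (\<lambda>x. T x + c *\<^sub>R T' x)"
  unfolding is_weak_cov_def
proof (intro conjI ballI)
  have T: "is_Lp 2 \<Omega> T" "is_Lp 2 \<Omega> T'" using u u' by (auto simp: is_weak_cov_def)
  show "is_Lp 2 \<Omega> (\<lambda>x. T x + c *\<^sub>R T' x)" by (rule is_L2_combine[OF T])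
  fix x assume x: "x \<in> \<Omega>"
  have z: "T x *v x = 0" "T' x *v x = 0" "x v* T x = 0" "x v* T' x = 0"
    using u u' x by (auto simp: is_weak_cov_def)
  show "(T x + c *\<^sub>R T' x) *v x = 0"
    by (simp add: matrix_vector_mult_add_rdistrib z scaleR_matrix_vector_assoc[symmetric])
  show "x v* (T x + c *\<^sub>R T' x) = 0"
  proof (rule vector_eq_ldot[THEN iffD1, rule_format])
    fix h
    have "h \<bullet> (x v* (T x + c *\<^sub>R T' x)) = x \<bullet> ((T x + c *\<^sub>R T' x) *v h)"
      by (metis dot_lmul_matrix inner_commute)
    also have "\<dots> = x \<bullet> (T x *v h) + c * (x \<bullet> (T' x *v h))"
      by (simp add: matrix_vector_mult_add_rdistrib scaleR_matrix_vector_assoc[symmetric] inner_add_right)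
    also have "\<dots> = 0" unfolding dot_lmul_matrix[symmetric] z by simp
    finally show "h \<bullet> (x v* (T x + c *\<^sub>R T' x)) = h \<bullet> 0" by simp
  qed
next
  have T: "is_Lp 2 \<Omega> T" "is_Lp 2 \<Omega> T'" using u u' by (auto simp: is_weak_cov_def)
  fix v w assume v: "v \<in> test_fields \<Omega>" and w: "w \<in> test_fields \<Omega>"
  let ?k = "\<lambda>x. cov_smooth w x *v v x + trace (cov_smooth v x) *\<^sub>R w x"
  have e: "(LINT x|surface_on \<Omega>. (T x *v v x) \<bullet> w x) = - (LINT x|surface_on \<Omega>. u x \<bullet> ?k x)"
    "(LINT x|surface_on \<Omega>. (T' x *v v x) \<bullet> w x) = - (LINT x|surface_on \<Omega>. u' x \<bullet> ?k x)"
    using u u' v w by (auto simp: is_weak_cov_def)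
  have "(LINT x|surface_on \<Omega>. ((T x + c *\<^sub>R T' x) *v v x) \<bullet> w x)
      = (LINT x|surface_on \<Omega>. (T x *v v x) \<bullet> w x + c * ((T' x *v v x) \<bullet> w x))"
    by (simp add: matrix_vector_mult_add_rdistrib scaleR_matrix_vector_assoc[symmetric] inner_add_left)
  also have "\<dots> = (LINT x|surface_on \<Omega>. (T x *v v x) \<bullet> w x) + c * (LINT x|surface_on \<Omega>. (T' x *v v x) \<bullet> w x)"
    using pairing_integrable[OF T(1) v w] pairing_integrable[OF T(2) v w] by simp
  also have "\<dots> = - ((LINT x|surface_on \<Omega>. u x \<bullet> ?k x) + c * (LINT x|surface_on \<Omega>. u' x \<bullet> ?k x))"
    unfolding e by simp
  also have "(LINT x|surface_on \<Omega>. u x \<bullet> ?k x) + c * (LINT x|surface_on \<Omega>. u' x \<bullet> ?k x)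
      = (LINT x|surface_on \<Omega>. (u x + c *\<^sub>R u' x) \<bullet> ?k x)"
    using dual_pairing_integrable[OF u(1) v w] dual_pairing_integrable[OF u'(1) v w]
    by (simp add: inner_add_left)
  finally show "(LINT x|surface_on \<Omega>. ((T x + c *\<^sub>R T' x) *v v x) \<bullet> w x)
      = - (LINT x|surface_on \<Omega>. (u x + c *\<^sub>R u' x) \<bullet> ?k x)" .
qed

lemma perp_test_field:
  assumes w: "w \<in> test_fields \<Omega>"
  shows "perp w \<in> test_fields \<Omega>"
proof -
  interpret smooth_tangent_field w by (rule test_field_smooth[OF w])
  have "smooth_tangent_field (perp w)" by (rule perp_smooth)
  moreover obtain K where "compact K" "K \<subseteq> \<Omega>" "\<forall>x\<in>S2 - K. w x = 0" using w by (auto simp: test_fields_def)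
  ultimately show ?thesis by (auto simp: test_fields_def smooth_tangent_field_def perp_def)
qed

text \<open>The rotation is antisymmetric. It is moved to the test field \<open>w\<close>, passes
  through the covariant derivative by \<open>cov_perp\<close>, and is moved back to
  \<open>u\<close>; the two signs combine.\<close>

lemma weak_cov_perp:
  assumes T: "is_weak_cov \<Omega> u T"
  shows "is_weak_cov \<Omega> (perp u) (\<lambda>x. perp_matrix x (T x))"
  unfolding is_weak_cov_def
proof (intro conjI ballI)
  have TL: "is_Lp 2 \<Omega> T" using T by (simp add: is_weak_cov_def)
  then have [measurable]: "T \<in> borel_measurable (surface_on \<Omega>)" by (simp add: is_L2_iff)
  have [measurable]: "(\<lambda>x. x) \<in> borel_measurable (surface_on \<Omega>)" by (rule measurable_on) simp
  show "is_Lp 2 \<Omega> (\<lambda>x. perp_matrix x (T x))"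
    unfolding is_L2_iff
  proof
    show m: "(\<lambda>x. perp_matrix x (T x)) \<in> borel_measurable (surface_on \<Omega>)" by measurable
    show "integrable (surface_on \<Omega>) (\<lambda>x. (norm (perp_matrix x (T x)))\<^sup>2)"
    proof (rule Bochner_Integration.integrable_bound)
      show "integrable (surface_on \<Omega>) (\<lambda>x. (norm (T x))\<^sup>2)" using TL by (simp add: is_L2_iff)
      show "AE x in surface_on \<Omega>. norm ((norm (perp_matrix x (T x)))\<^sup>2) \<le> norm ((norm (T x))\<^sup>2)"
        by (rule AE_onI) (simp add: power_mono norm_perp_matrix_le domain_unit)
    qed (use m in measurable)
  qed
  fix x assume x: "x \<in> \<Omega>"
  show "perp_matrix x (T x) *v x = 0"
    using T x by (simp add: perp_matrix_apply is_weak_cov_def)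
  show "x v* perp_matrix x (T x) = 0"
  proof (rule vector_eq_ldot[THEN iffD1, rule_format])
    fix h
    have "h \<bullet> (x v* perp_matrix x (T x)) = x \<bullet> (perp_matrix x (T x) *v h)"
      by (metis dot_lmul_matrix inner_commute)
    then show "h \<bullet> (x v* perp_matrix x (T x)) = h \<bullet> 0"
      by (simp add: perp_matrix_apply dot_cross_self)
  qed
next
  fix v w assume v: "v \<in> test_fields \<Omega>" and w: "w \<in> test_fields \<Omega>"
  interpret B: smooth_tangent_field w by (rule test_field_smooth[OF w])
  have sw: "cross3 a x \<bullet> b = - (a \<bullet> cross3 b x)" for a b x :: "real^3"
    by (simp add: cross_components inner_vec_def sum_3 algebra_simps)
  have "(LINT x|surface_on \<Omega>. (perp_matrix x (T x) *v v x) \<bullet> w x) = - (LINT x|surface_on \<Omega>. (T x *v v x) \<bullet> perp w x)"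
    by (simp add: perp_matrix_apply sw perp_def)
  also have "\<dots> = (LINT x|surface_on \<Omega>. u x \<bullet> (cov_smooth (perp w) x *v v x + trace (cov_smooth v x) *\<^sub>R perp w x))"
    using T v perp_test_field[OF w] by (simp add: is_weak_cov_def)
  also have "\<dots> = (LINT x|surface_on \<Omega>. - (perp u x \<bullet> (cov_smooth w x *v v x + trace (cov_smooth v x) *\<^sub>R w x)))"
    by (rule integral_on_cong)
      (simp add: B.cov_perp domain_unit perp_def sw inner_add_right)
  finally show "(LINT x|surface_on \<Omega>. (perp_matrix x (T x) *v v x) \<bullet> w x)
      = - (LINT x|surface_on \<Omega>. perp u x \<bullet> (cov_smooth w x *v v x + trace (cov_smooth v x) *\<^sub>R w x))" by simp
qed

end

subsection \<open>Uniqueness of the weak derivative\<close>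

lemma bump_bounds: "0 \<le> bump t" "bump t \<le> 1"
  by (auto simp: bump_def)

lemma bump_scale_tendsto: "(\<lambda>n. bump (real (Suc n) * t)) \<longlonglongrightarrow> (if t > 0 then 1 else 0)"
proof (cases "t > 0")
  case True
  have "(\<lambda>n. exp (- (1 / t) * (1 / real (Suc n)))) \<longlonglongrightarrow> exp (- (1 / t) * 0)"
    by (intro tendsto_intros LIMSEQ_Suc[OF lim_1_over_n])
  moreover have "bump (real (Suc n) * t) = exp (- (1 / t) * (1 / real (Suc n)))" for n
    using True by (simp add: bump_def mult.commute)
  ultimately show ?thesis using True by simp
next
  case False
  then have "bump (real (Suc n) * t) = 0" for n
    by (auto simp: bump_def zero_less_mult_iff)
  then show ?thesis using False by simp
qed

text \<open>A product of one-dimensional bumps in the scaled distances to the faces. It increases to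
  the indicator of the open box as k tends to infinity. Putting k inside the inner product lets
  \<open>Ck_scalar_inner\<close> apply directly.\<close>

definition box_bump :: "real \<Rightarrow> real^3 \<Rightarrow> real^3 \<Rightarrow> real^3 \<Rightarrow> real" where
  "box_bump k l u x = (\<Prod>i\<in>Basis. bump ((x - l) \<bullet> (k *\<^sub>R i)) * bump ((u - x) \<bullet> (k *\<^sub>R i)))"

lemma box_bump_bounds: "0 \<le> box_bump k l u x" "box_bump k l u x \<le> 1"
  unfolding box_bump_def
  by (auto intro!: prod_nonneg prod_le_1 mult_le_one bump_bounds mult_nonneg_nonneg)

lemma box_bump_zero:
  assumes "k > 0" "x \<notin> box l u"
  shows "box_bump k l u x = 0"
proof -
  obtain i where i: "i \<in> Basis" "\<not> (l \<bullet> i < x \<bullet> i \<and> x \<bullet> i < u \<bullet> i)" using assms(2) by (auto simp: mem_box)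
  then have "bump ((x - l) \<bullet> (k *\<^sub>R i)) * bump ((u - x) \<bullet> (k *\<^sub>R i)) = 0"
    using assms(1) by (auto simp: bump_def inner_diff_left zero_less_mult_iff)
  then show ?thesis unfolding box_bump_def using i(1) by (intro prod_zero) auto
qed

lemma box_bump_tendsto: "(\<lambda>n. box_bump (real (Suc n)) l u x) \<longlonglongrightarrow> indicator (box l u) x"
proof -
  have "(\<lambda>n. \<Prod>i\<in>Basis. bump (real (Suc n) * ((x - l) \<bullet> i)) * bump (real (Suc n) * ((u - x) \<bullet> i)))
      \<longlonglongrightarrow> (\<Prod>i\<in>Basis. (if (x - l) \<bullet> i > 0 then 1 else 0) * (if (u - x) \<bullet> i > 0 then 1 else 0))"
    by (intro tendsto_prod tendsto_mult bump_scale_tendsto)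
  moreover have "(\<Prod>i\<in>Basis. (if (x - l) \<bullet> i > 0 then 1 else 0) * (if (u - x) \<bullet> i > 0 then 1 else 0)) = (indicator (box l u) x :: real)"
  proof (cases "x \<in> box l u")
    case True
    then have "(if (x - l) \<bullet> i > 0 then 1 else 0) * (if (u - x) \<bullet> i > 0 then 1 else 0) = (1::real)" if "i \<in> Basis" for i
      using that by (auto simp: mem_box inner_diff_left)
    then show ?thesis using True by simp
  next
    case False
    then obtain i where "i \<in> Basis" "\<not> (l \<bullet> i < x \<bullet> i \<and> x \<bullet> i < u \<bullet> i)" by (auto simp: mem_box)
    then have "(\<Prod>i\<in>Basis. (if (x - l) \<bullet> i > 0 then 1 else 0) * (if (u - x) \<bullet> i > 0 then 1 else 0)) = (0::real)"
      by (intro prod_zero) (auto simp: inner_diff_left intro!: bexI[of _ i])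
    then show ?thesis using False by simp
  qed
  ultimately show ?thesis by (simp add: box_bump_def)
qed

lemma box_bump_smooth: "Ck_scalar k (\<lambda>x. box_bump c l u (sgn x)) (- {0})"
proof -
  have o: "open (- {0 :: real^3})" by auto
  have 1: "Ck_on k (\<lambda>x. sgn x - l) (- {0})" "Ck_on k (\<lambda>x. u - sgn x) (- {0})"
    using Ck_on_add[OF o Ck_on_sgn Ck_on_const[OF o], of k "- l"]
      Ck_on_add[OF o Ck_on_const[OF o] Ck_on_linear[OF o bounded_linear_minus[OF bounded_linear_ident] Ck_on_sgn], of k u]
    by simp_all
  show ?thesis unfolding box_bump_def
    by (intro Ck_scalar_prod[OF o] Ck_scalar_mult[OF o] Ck_scalar_bump[OF o] Ck_scalar_inner[OF o] 1 Ck_on_const[OF o]) simp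
qed

lemma linear_zero_on_Basis:
  fixes L :: "'a::euclidean_space \<Rightarrow> real"
  assumes "linear L" "\<And>b. b \<in> Basis \<Longrightarrow> L b = 0"
  shows "L c = 0"
proof -
  have "L (\<Sum>b\<in>Basis. (c \<bullet> b) *\<^sub>R b) = (\<Sum>b\<in>Basis. (c \<bullet> b) * L b)"
    using assms(1) by (simp add: linear_sum linear_scale)
  then show ?thesis using assms(2) by (simp add: euclidean_representation)
qed

text \<open>The fields \<open>e \<times> x\<close> span the tangent plane.\<close>

lemma tangent_matrix_zero:
  fixes A :: "real^3^3"
  assumes x: "norm x = 1" and A: "A *v x = 0" "x v* A = 0"
    and z: "\<And>e e'. e \<in> Basis \<Longrightarrow> e' \<in> Basis \<Longrightarrow> (A *v cross3 e x) \<bullet> cross3 e' x = 0"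
  shows "A = 0"
proof -
  have xx: "x \<bullet> x = 1" using x by (simp add: dot_square_norm)
  have dec: "h = (x \<bullet> h) *\<^sub>R x + cross3 (cross3 x h) x" for h
    by (simp add: cross_cross xx inner_commute)
  have 1: "(A *v cross3 e x) \<bullet> cross3 c x = 0" if "e \<in> Basis" for e c
  proof (rule linear_zero_on_Basis[where L="\<lambda>c. (A *v cross3 e x) \<bullet> cross3 c x"])
    show "linear (\<lambda>c. (A *v cross3 e x) \<bullet> cross3 c x)"
      by (auto simp: linear_iff cross_add_left cross_mult_left inner_add_right)
  qed (use z that in auto)
  have 2: "(A *v cross3 c' x) \<bullet> cross3 c x = 0" for c c'
  proof (rule linear_zero_on_Basis[where L="\<lambda>c'. (A *v cross3 c' x) \<bullet> cross3 c x"])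
    show "linear (\<lambda>c'. (A *v cross3 c' x) \<bullet> cross3 c x)"
      by (auto simp: linear_iff cross_add_left cross_mult_left inner_add_left matrix_vector_right_distrib matrix_vector_mult_scaleR)
  qed (use 1 in auto)
  have Ah: "A *v h = A *v cross3 (cross3 x h) x" for h
    using arg_cong[OF dec[of h], of "(*v) A"] by (simp add: matrix_vector_right_distrib matrix_vector_mult_scaleR A)
  have Ax: "(A *v h) \<bullet> x = 0" for h
    using dot_lmul_matrix[of x A h] by (simp add: A inner_commute)
  have "(A *v h) \<bullet> k = 0" for h k
  proof -
    have "(A *v h) \<bullet> k = (A *v h) \<bullet> cross3 (cross3 x k) x"
      using arg_cong[OF dec[of k], of "\<lambda>k. (A *v h) \<bullet> k"] by (simp add: inner_add_right Ax)
    then show ?thesis unfolding Ah[of h] using 2 by simp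
  qed
  then have "A *v h = 0" for h by (metis inner_eq_zero_iff)
  then show ?thesis by (intro matrix_eqI) simp
qed

context sphere_domain
begin

lemma bump_field_test:
  assumes k: "k > 0" and lu: "cbox l u \<inter> S2 \<subseteq> \<Omega>"
  shows "(\<lambda>x. box_bump k l u x *\<^sub>R cross3 e x) \<in> test_fields \<Omega>"
proof -
  have o: "open (- {0 :: real^3})" by auto
  have lin: "bounded_linear (cross3 e)"
    by (rule bounded_bilinear.bounded_linear_right[OF bilinear_cross[unfolded bilinear_conv_bounded_bilinear]])
  have "Ck_on j (\<lambda>x. box_bump k l u (sgn x) *\<^sub>R cross3 e (sgn x)) (- {0})" for j
    by (intro Ck_on_scaleR[OF o] box_bump_smooth Ck_on_linear[OF o lin] Ck_on_sgn)
  then have "smooth_S2 (\<lambda>x. box_bump k l u x *\<^sub>R cross3 e x)" by (simp add: smooth_S2_def o_def)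
  moreover have "tangent_on S2 (\<lambda>x. box_bump k l u x *\<^sub>R cross3 e x)"
    by (simp add: tangent_on_def dot_cross_self)
  moreover have "\<exists>K. compact K \<and> K \<subseteq> \<Omega> \<and> (\<forall>x\<in>S2 - K. box_bump k l u x *\<^sub>R cross3 e x = 0)"
  proof (intro exI conjI ballI)
    show "compact (cbox l u \<inter> S2)" by (intro compact_Int_closed) auto
    show "cbox l u \<inter> S2 \<subseteq> \<Omega>" by (rule lu)
    show "box_bump k l u x *\<^sub>R cross3 e x = 0" if "x \<in> S2 - cbox l u \<inter> S2" for x
      using box_bump_zero[OF k, of x l u] box_subset_cbox[of l u] that by auto
  qed
  ultimately show ?thesis by (simp add: test_fields_def)
qed

text \<open>The domain is covered by boxes whose closures lie in an ambient open set U with \<Omega>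
  = S2 \<inter> U. On each of them the hypothesis controls all subboxes, so g vanishes almost
  everywhere; Lindelof leaves countably many null sets to unite.\<close>

lemma AE_zero_on_domain:
  assumes g: "integrable (surface_on \<Omega>) g"
    and box: "\<And>l u. cbox l u \<inter> S2 \<subseteq> \<Omega> \<Longrightarrow> (LINT x|surface_on \<Omega>. indicator (box l u) x * g x) = 0"
  shows "AE x in surface_on \<Omega>. g x = (0::real)"
proof -
  obtain U where U: "open U" "\<Omega> = S2 \<inter> U" using sphere_domain_open by blast
  have loc: "AE x in surface. x \<in> \<Omega> \<inter> box l0 u0 \<longrightarrow> g x = 0" if lu: "cbox l0 u0 \<subseteq> U" for l0 u0
  proof -
    have lu': "cbox l0 u0 \<inter> S2 \<subseteq> \<Omega>" using lu U by auto
    define G where "G x = indicator (box l0 u0) x *\<^sub>R (indicator \<Omega> x *\<^sub>R g x)" for x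
    have "integrable surface (\<lambda>x. indicator \<Omega> x *\<^sub>R g x)"
      using g unfolding integrable_restrict_space[OF domain_inter] .
    then have iG: "integrable surface G"
      unfolding G_def by (rule integrable_mult_indicator[rotated]) simp
    have b: "(LINT x|surface. indicator (box a b) x * G x) = 0" for a b
    proof -
      define l where "l = (\<Sum>i\<in>Basis. max (a \<bullet> i) (l0 \<bullet> i) *\<^sub>R i)"
      define u where "u = (\<Sum>i\<in>Basis. min (b \<bullet> i) (u0 \<bullet> i) *\<^sub>R i)"
      have c: "l \<bullet> i = max (a \<bullet> i) (l0 \<bullet> i)" "u \<bullet> i = min (b \<bullet> i) (u0 \<bullet> i)" if "i \<in> Basis" for i
        using that by (simp_all add: l_def u_def)
      have "cbox l u \<inter> S2 \<subseteq> \<Omega>"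
      proof -
        have "cbox l u \<subseteq> cbox l0 u0" by (auto simp: mem_box c)
        then show ?thesis using lu' by blast
      qed
      moreover have "indicator (box a b) x * G x = indicator \<Omega> x *\<^sub>R (indicator (box l u) x * g x)" for x
      proof -
        have "box a b \<inter> box l0 u0 = box l u" unfolding l_def u_def by (rule box_Int_box)
        then have "indicator (box l u) x = (indicator (box a b) x * indicator (box l0 u0) x :: real)"
          by (metis indicator_inter_arith)
        then show ?thesis by (simp add: G_def)
      qed
      ultimately show ?thesis using box[of l u] by (simp add: integral_restrict_space[OF domain_inter])
    qed
    have "AE x in surface. G x = 0"
    proof (rule AE_zero_of_box_integrals[OF _ _ iG])
      show "finite_measure surface" by unfold_locales
      show "integral\<^sup>L surface G = 0"
      proof -
        have "(\<lambda>x. indicator (box l0 u0) x * G x) = G" by (auto simp: G_def indicator_def)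
        then show ?thesis using b[of l0 u0] by simp
      qed
      show "set_lebesgue_integral surface (box a b) G = 0" for a b
        using b[of a b] by (simp add: set_lebesgue_integral_def)
    qed simp
    then show ?thesis by eventually_elim (auto simp: G_def)
  qed
  define \<F> where "\<F> = {box l u |l u. cbox l u \<subseteq> U}"
  have "\<And>S. S \<in> \<F> \<Longrightarrow> open S" by (auto simp: \<F>_def open_box)
  then obtain \<F>' where F': "\<F>' \<subseteq> \<F>" "countable \<F>'" "\<Union>\<F>' = \<Union>\<F>" using Lindelof by metis
  have cover: "U \<subseteq> \<Union>\<F>"
  proof
    fix x assume "x \<in> U"
    then obtain e where e: "e > 0" "cball x e \<subseteq> U" using U(1) open_contains_cball by blast
    obtain a b where ab: "x \<in> box a b" "box a b \<subseteq> ball x e" using rational_boxes[OF e(1), of x] by blast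
    have "cbox a b = closure (box a b)" using ab(1) by (intro closure_box[symmetric]) auto
    also have "\<dots> \<subseteq> cball x e" using closure_mono[OF ab(2)] e(1) by simp
    finally have "box a b \<in> \<F>" using e(2) by (auto simp: \<F>_def)
    then show "x \<in> \<Union>\<F>" using ab(1) by blast
  qed
  have "AE x in surface. \<forall>B\<in>\<F>'. x \<in> \<Omega> \<inter> B \<longrightarrow> g x = 0"
    using F'(1) loc by (intro AE_ball_countable'[OF _ F'(2)]) (auto simp: \<F>_def)
  then show ?thesis
    unfolding AE_on by eventually_elim (use cover F'(3) U(2) in blast)
qed

text \<open>The difference A annihilates all pairs of test fields. Bumps times the rotation fields
  are such test fields, and in the limit the functions (A (e \<times> x)) \<bullet> (e' \<times> x)
  integrate to 0 over boxes. Uniqueness is what makes the choice in \<open>cov\<close> irrelevant up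
  to null sets.\<close>

lemma weak_cov_unique:
  assumes T: "is_weak_cov \<Omega> u T" and T': "is_weak_cov \<Omega> u T'"
  shows "AE x in surface_on \<Omega>. T x = T' x"
proof -
  define A where "A x = T x + (- 1) *\<^sub>R T' x" for x
  have L: "is_Lp 2 \<Omega> T" "is_Lp 2 \<Omega> T'" using T T' by (auto simp: is_weak_cov_def)
  have AL: "is_Lp 2 \<Omega> A" unfolding A_def by (rule is_L2_combine[OF L])
  have [measurable]: "A \<in> borel_measurable (surface_on \<Omega>)" using AL by (simp add: is_L2_iff)
  have [measurable]: "(\<lambda>x. x) \<in> borel_measurable (surface_on \<Omega>)" by (rule measurable_on) simp
  have Ax: "A x *v x = 0" "x v* A x = 0" if x: "x \<in> \<Omega>" for x
  proof -
    have z: "T x *v x = 0" "T' x *v x = 0" "x v* T x = 0" "x v* T' x = 0"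
      using T T' x by (auto simp: is_weak_cov_def)
    show "A x *v x = 0" by (simp add: A_def matrix_vector_mult_diff_rdistrib z)
    show "x v* A x = 0"
    proof (rule vector_eq_ldot[THEN iffD1, rule_format])
      fix h
      have "h \<bullet> (x v* A x) = x \<bullet> (A x *v h)" by (metis dot_lmul_matrix inner_commute)
      also have "\<dots> = x \<bullet> (T x *v h) - x \<bullet> (T' x *v h)"
        by (simp add: A_def matrix_vector_mult_diff_rdistrib inner_diff_right)
      also have "\<dots> = 0" unfolding dot_lmul_matrix[symmetric] z by simp
      finally show "h \<bullet> (x v* A x) = h \<bullet> 0" by simp
    qed
  qed
  have zero: "(LINT x|surface_on \<Omega>. (A x *v v x) \<bullet> w x) = 0" if v: "v \<in> test_fields \<Omega>" and w: "w \<in> test_fields \<Omega>" for v w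
  proof -
    have "(LINT x|surface_on \<Omega>. (A x *v v x) \<bullet> w x) = (LINT x|surface_on \<Omega>. (T x *v v x) \<bullet> w x - (T' x *v v x) \<bullet> w x)"
      by (simp add: A_def matrix_vector_mult_diff_rdistrib inner_diff_left)
    also have "\<dots> = (LINT x|surface_on \<Omega>. (T x *v v x) \<bullet> w x) - (LINT x|surface_on \<Omega>. (T' x *v v x) \<bullet> w x)"
      by (rule Bochner_Integration.integral_diff) (intro pairing_integrable L v w)+
    finally show ?thesis using T T' v w by (simp add: is_weak_cov_def)
  qed
  define g where "g e e' x = (A x *v cross3 e x) \<bullet> cross3 e' x" for e e' x
  have [measurable]: "g e e' \<in> borel_measurable (surface_on \<Omega>)" for e e'
    unfolding g_def[abs_def] by measurable
  have ig: "integrable (surface_on \<Omega>) (g e e')" for e e'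
  proof (rule is_L2_integrable_mult[OF AL, where B="norm e * norm e'"])
    fix x assume "x \<in> \<Omega>"
    then have x: "norm x = 1" by (rule domain_unit)
    have c: "norm (cross3 y x) \<le> norm y" for y
    proof (rule power2_le_imp_le)
      have "(norm (cross3 y x))\<^sup>2 + (y \<bullet> x)\<^sup>2 = (norm y)\<^sup>2" using norm_cross_dot[of y x] x by simp
      then show "(norm (cross3 y x))\<^sup>2 \<le> (norm y)\<^sup>2" using zero_le_power2[of "y \<bullet> x"] by linarith
    qed simp
    have "\<bar>g e e' x\<bar> \<le> norm (A x *v cross3 e x) * norm (cross3 e' x)" unfolding g_def by (rule Cauchy_Schwarz_ineq2)
    also have "\<dots> \<le> (norm (A x) * norm e) * norm e'"
      by (intro mult_mono order_trans[OF norm_matrix_vector_le] mult_left_mono c) auto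
    finally show "\<bar>g e e' x\<bar> \<le> norm e * norm e' * norm (A x)" by (simp add: mult_ac)
  qed measurable
  have "AE x in surface_on \<Omega>. g e e' x = 0" for e e'
  proof (rule AE_zero_on_domain[OF ig])
    fix l u assume lu: "cbox l u \<inter> S2 \<subseteq> \<Omega>"
    let ?b = "\<lambda>n. box_bump (real (Suc n)) l u"
    have mb: "?b n \<in> borel_measurable borel" for n
      unfolding box_bump_def[abs_def] bump_def by measurable
    note [measurable] = measurable_on[OF mb]
    \<comment> \<open>The bump enters squared because it multiplies both test fields; the square of
      an indicator is the indicator.\<close>
    have 1: "(\<lambda>n. LINT x|surface_on \<Omega>. (?b n x)\<^sup>2 * g e e' x) \<longlonglongrightarrow> (LINT x|surface_on \<Omega>. indicator (box l u) x * g e e' x)"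
    proof (rule integral_dominated_convergence[where w="\<lambda>x. \<bar>g e e' x\<bar>"])
      show "AE x in surface_on \<Omega>. (\<lambda>n. (?b n x)\<^sup>2 * g e e' x) \<longlonglongrightarrow> indicator (box l u) x * g e e' x"
      proof (rule AE_I2)
        fix x
        have "(\<lambda>n. (?b n x)\<^sup>2 * g e e' x) \<longlonglongrightarrow> (indicator (box l u) x)\<^sup>2 * g e e' x"
          by (intro tendsto_intros box_bump_tendsto)
        moreover have "(indicator (box l u) x)\<^sup>2 = (indicator (box l u) x :: real)" by (simp add: indicator_def)
        ultimately show "(\<lambda>n. (?b n x)\<^sup>2 * g e e' x) \<longlonglongrightarrow> indicator (box l u) x * g e e' x" by simp
      qed
      show "AE x in surface_on \<Omega>. norm ((?b n x)\<^sup>2 * g e e' x) \<le> \<bar>g e e' x\<bar>" for n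
      proof (rule AE_I2)
        fix x
        have "(?b n x)\<^sup>2 \<le> 1" using box_bump_bounds[of "real (Suc n)" l u x] by (simp add: power_le_one)
        then show "norm ((?b n x)\<^sup>2 * g e e' x) \<le> \<bar>g e e' x\<bar>" by (simp add: abs_mult mult_left_le_one_le)
      qed
      show "integrable (surface_on \<Omega>) (\<lambda>x. \<bar>g e e' x\<bar>)" using ig by (rule integrable_abs)
      have "(indicator (box l u) :: real^3 \<Rightarrow> real) \<in> borel_measurable borel" by simp
      note [measurable] = measurable_on[OF this]
      show "(\<lambda>x. indicator (box l u) x * g e e' x) \<in> borel_measurable (surface_on \<Omega>)" by measurable
    qed measurable
    have 2: "(LINT x|surface_on \<Omega>. (?b n x)\<^sup>2 * g e e' x) = 0" for n
    proof -
      have "(LINT x|surface_on \<Omega>. (?b n x)\<^sup>2 * g e e' x)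
          = (LINT x|surface_on \<Omega>. (A x *v (?b n x *\<^sub>R cross3 e x)) \<bullet> (?b n x *\<^sub>R cross3 e' x))"
        by (simp add: g_def matrix_vector_mult_scaleR power2_eq_square mult_ac)
      also have "\<dots> = 0" by (intro zero bump_field_test lu) auto
      finally show ?thesis .
    qed
    show "(LINT x|surface_on \<Omega>. indicator (box l u) x * g e e' x) = 0"
      using 1 unfolding 2 by (simp add: LIMSEQ_const_iff)
  qed
  then have "AE x in surface_on \<Omega>. \<forall>e\<in>Basis. \<forall>e'\<in>Basis. g e e' x = 0"
    by (intro AE_ball_countable' countable_finite) auto
  moreover have "AE x in surface_on \<Omega>. x \<in> \<Omega>" by (rule AE_onI)
  ultimately show ?thesis
  proof eventually_elim
    case (elim x)
    then have "A x = 0"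
      by (intro tangent_matrix_zero[OF domain_unit[OF elim(2)] Ax[OF elim(2)]]) (auto simp: g_def)
    then show ?case by (simp add: A_def)
  qed
qed

text \<open>Extension by zero turns all integrals into integrals over the sphere, where the Bochner
  identity trades the covariant derivative for divergence and rotation.\<close>

lemma test_field_inequality:
  assumes \<phi>: "\<phi> \<in> test_fields \<Omega>" and q: "q > 2"
  shows "integrable (surface_on \<Omega>) (\<lambda>x. norm (\<phi> x) powr q)"
    and "(LINT x|surface_on \<Omega>. norm (\<phi> x) powr q) \<le> (1 / (4 * pi)) powr ((q - 2) / 2) * (q / 2) powr (q / 2)
      * (LINT x|surface_on \<Omega>. (norm (\<phi> x))\<^sup>2)
      * ((LINT x|surface_on \<Omega>. (trace (cov_smooth \<phi> x))\<^sup>2) + (LINT x|surface_on \<Omega>. (trace (cov_smooth (perp \<phi>) x))\<^sup>2)) powr ((q - 2) / 2)"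
proof -
  interpret A: smooth_tangent_field \<phi> by (rule test_field_smooth[OF \<phi>])
  interpret P: smooth_tangent_field "perp \<phi>" by (rule A.perp_smooth)
  have F0: "A.F x = 0" if "norm x = 1" "x \<notin> \<Omega>" for x
    using test_field_zero(1)[OF \<phi> that] A.F_sphere[OF that(1)] by simp
  have cont: "continuous_on (- {0}) (\<lambda>x. trace (cov_smooth \<phi> x))" "continuous_on (- {0}) (\<lambda>x. trace (cov_smooth (perp \<phi>) x))"
    unfolding trace_def by (intro continuous_intros A.cov_continuous P.cov_continuous)+
  have Fq: "continuous_on (- {0}) (\<lambda>x. norm (A.F x) powr q)"
    by (intro continuous_on_powr' continuous_intros A.F_continuous) (use q in auto)
  have "integrable surface (\<lambda>x. indicator \<Omega> x *\<^sub>R (norm (A.F x) powr q))"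
    by (rule integrable_mult_indicator[OF _ integrable_surface[OF Fq]]) simp
  then have "integrable (surface_on \<Omega>) (\<lambda>x. norm (A.F x) powr q)"
    by (simp add: integrable_restrict_space)
  then show "integrable (surface_on \<Omega>) (\<lambda>x. norm (\<phi> x) powr q)"
    by (subst integrable_on_cong[where g="\<lambda>x. norm (A.F x) powr q"]) (simp_all add: A.F_sphere domain_unit)
  have 1: "(LINT x|surface_on \<Omega>. norm (\<phi> x) powr q) = (LINT x|surface. norm (A.F x) powr q)"
  proof -
    have "(LINT x|surface_on \<Omega>. norm (\<phi> x) powr q) = (LINT x|surface_on \<Omega>. norm (A.F x) powr q)"
      by (rule integral_on_cong) (simp add: A.F_sphere domain_unit)
    also have "\<dots> = (LINT x|surface. norm (A.F x) powr q)"
      by (rule integral_on_extend) (use F0 q Fq in \<open>auto intro: borel_measurable_punctured\<close>)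
    finally show ?thesis .
  qed
  have 2: "(LINT x|surface_on \<Omega>. (norm (\<phi> x))\<^sup>2) = (LINT x|surface. (norm (A.F x))\<^sup>2)"
  proof -
    have "(LINT x|surface_on \<Omega>. (norm (\<phi> x))\<^sup>2) = (LINT x|surface_on \<Omega>. (norm (A.F x))\<^sup>2)"
      by (rule integral_on_cong) (simp add: A.F_sphere domain_unit)
    also have "\<dots> = (LINT x|surface. (norm (A.F x))\<^sup>2)"
      by (rule integral_on_extend) (use F0 in \<open>auto intro!: borel_measurable_punctured continuous_intros A.F_continuous\<close>)
    finally show ?thesis .
  qed
  have 3: "(LINT x|surface_on \<Omega>. (trace (cov_smooth \<phi> x))\<^sup>2) + (LINT x|surface_on \<Omega>. (trace (cov_smooth (perp \<phi>) x))\<^sup>2)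
      = (LINT x|surface. (norm (cov_smooth \<phi> x))\<^sup>2 + (norm (A.F x))\<^sup>2)"
  proof -
    have tr0: "trace (0 :: real^3^3) = 0" by (simp add: trace_def)
    have "(LINT x|surface_on \<Omega>. (trace (cov_smooth \<phi> x))\<^sup>2) = (LINT x|surface. (trace (cov_smooth \<phi> x))\<^sup>2)"
      by (rule integral_on_extend)
        (use cont in \<open>auto simp: test_field_zero(2)[OF \<phi>] tr0 intro!: borel_measurable_punctured continuous_intros\<close>)
    moreover have "(LINT x|surface_on \<Omega>. (trace (cov_smooth (perp \<phi>) x))\<^sup>2) = (LINT x|surface. (trace (cov_smooth (perp \<phi>) x))\<^sup>2)"
      by (rule integral_on_extend)
        (use cont in \<open>auto simp: test_field_zero(2)[OF perp_test_field[OF \<phi>]] tr0 intro!: borel_measurable_punctured continuous_intros\<close>)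
    moreover have "integrable surface (\<lambda>x. (trace (cov_smooth \<phi> x))\<^sup>2)" "integrable surface (\<lambda>x. (trace (cov_smooth (perp \<phi>) x))\<^sup>2)"
      by (intro integrable_surface continuous_intros cont)+
    ultimately show ?thesis unfolding A.Bochner_identity by simp
  qed
  show "(LINT x|surface_on \<Omega>. norm (\<phi> x) powr q) \<le> (1 / (4 * pi)) powr ((q - 2) / 2) * (q / 2) powr (q / 2)
      * (LINT x|surface_on \<Omega>. (norm (\<phi> x))\<^sup>2)
      * ((LINT x|surface_on \<Omega>. (trace (cov_smooth \<phi> x))\<^sup>2) + (LINT x|surface_on \<Omega>. (trace (cov_smooth (perp \<phi>) x))\<^sup>2)) powr ((q - 2) / 2)"
    unfolding 1 2 3 by (rule A.field_inequality[OF q])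
qed

end

subsection \<open>Passage to the limit\<close>

text \<open>Expanding g = f + (g - f) leaves a cross term that Cauchy-Schwarz sends to 0.\<close>

lemma integral_square_tendsto:
  fixes f :: "'a \<Rightarrow> real"
  assumes [measurable]: "\<And>n. g n \<in> borel_measurable M" "f \<in> borel_measurable M"
    and f: "integrable M (\<lambda>x. (f x)\<^sup>2)" and d: "\<And>n. integrable M (\<lambda>x. (g n x - f x)\<^sup>2)"
    and lim: "(\<lambda>n. LINT x|M. (g n x - f x)\<^sup>2) \<longlonglongrightarrow> 0"
  shows "(\<lambda>n. LINT x|M. (g n x)\<^sup>2) \<longlonglongrightarrow> (LINT x|M. (f x)\<^sup>2)"
proof -
  define A where "A n = (LINT x|M. f x * (g n x - f x))" for n
  have i: "integrable M (\<lambda>x. f x * (g n x - f x))" for n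
    using integral_Cauchy_Schwarz(1)[OF _ _ f d[of n]] by simp
  have le: "(A n)\<^sup>2 \<le> (LINT x|M. (f x)\<^sup>2) * (LINT x|M. (g n x - f x)\<^sup>2)" for n
    unfolding A_def by (rule integral_Cauchy_Schwarz(2)[OF _ _ f d]) measurable
  have "(\<lambda>n. (LINT x|M. (f x)\<^sup>2) * (LINT x|M. (g n x - f x)\<^sup>2)) \<longlonglongrightarrow> 0"
    using tendsto_mult_left[OF lim, of "LINT x|M. (f x)\<^sup>2"] by simp
  from tendsto_sandwich[OF _ _ tendsto_const this, of "\<lambda>n. (A n)\<^sup>2"]
  have "(\<lambda>n. (A n)\<^sup>2) \<longlonglongrightarrow> 0" using le by simp
  from tendsto_real_sqrt[OF this] have "A \<longlonglongrightarrow> 0" by (simp add: tendsto_rabs_zero_iff)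
  then have "(\<lambda>n. (LINT x|M. (f x)\<^sup>2) + 2 * A n + (LINT x|M. (g n x - f x)\<^sup>2)) \<longlonglongrightarrow> (LINT x|M. (f x)\<^sup>2) + 2 * 0 + 0"
    by (intro tendsto_intros lim)
  moreover have "(LINT x|M. (g n x)\<^sup>2) = (LINT x|M. (f x)\<^sup>2) + 2 * A n + (LINT x|M. (g n x - f x)\<^sup>2)" for n
  proof -
    have "(LINT x|M. (g n x)\<^sup>2) = (LINT x|M. (f x)\<^sup>2 + 2 * (f x * (g n x - f x)) + (g n x - f x)\<^sup>2)"
      by (rule Bochner_Integration.integral_cong) (auto simp: power2_eq_square algebra_simps)
    then show ?thesis using f i d by (simp add: A_def)
  qed
  ultimately show ?thesis by simp
qed

lemma Fatou_powr:
  fixes u :: "'a \<Rightarrow> 'b::{real_normed_vector, second_countable_topology}"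
  assumes [measurable]: "u \<in> borel_measurable M" and q: "q > 0"
    and lim: "AE x in M. (\<lambda>n. \<phi> n x) \<longlonglongrightarrow> u x"
    and i: "\<And>n. integrable M (\<lambda>x. norm (\<phi> n x) powr q)"
    and c: "\<And>n. (LINT x|M. norm (\<phi> n x) powr q) \<le> c n" "c \<longlonglongrightarrow> C"
  shows "integrable M (\<lambda>x. norm (u x) powr q)" "(LINT x|M. norm (u x) powr q) \<le> C"
proof -
  have C0: "C \<ge> 0"
    by (rule LIMSEQ_le_const[OF c(2)]) (use order_trans[OF _ c(1)] in auto)
  have "(\<integral>\<^sup>+x. ennreal (norm (u x) powr q) \<partial>M) = (\<integral>\<^sup>+x. liminf (\<lambda>n. ennreal (norm (\<phi> n x) powr q)) \<partial>M)"
  proof (rule nn_integral_cong_AE)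
    show "AE x in M. ennreal (norm (u x) powr q) = liminf (\<lambda>n. ennreal (norm (\<phi> n x) powr q))"
      using lim
    proof eventually_elim
      case (elim x)
      have "(\<lambda>n. norm (\<phi> n x) powr q) \<longlonglongrightarrow> norm (u x) powr q"
        using q by (intro tendsto_powr' tendsto_norm elim) auto
      then show ?case by (intro lim_imp_Liminf[symmetric] tendsto_ennrealI) auto
    qed
  qed
  also have "\<dots> \<le> liminf (\<lambda>n. \<integral>\<^sup>+x. ennreal (norm (\<phi> n x) powr q) \<partial>M)"
    by (rule nn_integral_liminf) (use i in auto)
  also have "\<dots> \<le> liminf (\<lambda>n. ennreal (c n))"
    by (intro Liminf_mono always_eventually allI) (simp add: nn_integral_eq_integral[OF i] ennreal_leI[OF c(1)])
  also have "\<dots> = ennreal C"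
    by (intro lim_imp_Liminf tendsto_ennrealI c(2)) simp
  finally have le: "(\<integral>\<^sup>+x. ennreal (norm (u x) powr q) \<partial>M) \<le> ennreal C" .
  show "integrable M (\<lambda>x. norm (u x) powr q)"
  proof (rule integrableI_bounded)
    show "(\<integral>\<^sup>+x. ennreal (norm (norm (u x) powr q)) \<partial>M) < \<infinity>"
      using le by (simp add: ennreal_less_top order_le_less_trans)
  qed measurable
  show "(LINT x|M. norm (u x) powr q) \<le> C"
    by (subst integral_eq_nn_integral) (use le C0 in \<open>auto intro: enn2real_leI\<close>)
qed

context sphere_domain
begin

lemma weak_cov_cov: "is_weak_cov \<Omega> u T \<Longrightarrow> is_weak_cov \<Omega> u (cov \<Omega> u)"
  unfolding cov_def by (rule someI[of "is_weak_cov \<Omega> u"])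

lemma is_L2_trace:
  assumes T: "is_Lp 2 \<Omega> T"
  shows "integrable (surface_on \<Omega>) (\<lambda>x. (trace (T x))\<^sup>2)"
    and "(LINT x|surface_on \<Omega>. (trace (T x))\<^sup>2) \<le> 3 * (LINT x|surface_on \<Omega>. (norm (T x :: real^3^3))\<^sup>2)"
proof -
  have [measurable]: "T \<in> borel_measurable (surface_on \<Omega>)" using T by (simp add: is_L2_iff)
  have i: "integrable (surface_on \<Omega>) (\<lambda>x. 3 * (norm (T x))\<^sup>2)" using T by (simp add: is_L2_iff)
  show j: "integrable (surface_on \<Omega>) (\<lambda>x. (trace (T x))\<^sup>2)"
    by (rule Bochner_Integration.integrable_bound[OF i]) (auto intro!: AE_I2 simp: trace_square_le)
  have "(LINT x|surface_on \<Omega>. (trace (T x))\<^sup>2) \<le> (LINT x|surface_on \<Omega>. 3 * (norm (T x))\<^sup>2)"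
    by (rule integral_mono[OF j i]) (rule trace_square_le)
  then show "(LINT x|surface_on \<Omega>. (trace (T x))\<^sup>2) \<le> 3 * (LINT x|surface_on \<Omega>. (norm (T x))\<^sup>2)" by simp
qed

text \<open>The norm of u - \<phi> n involves \<open>cov\<close> of the difference, a separate
  choice. Linearity of weak derivatives and uniqueness identify it almost everywhere with the
  difference of the derivatives.\<close>

lemma H10_approximation:
  assumes u: "u \<in> H10 \<Omega>"
  obtains \<phi> where "\<And>n. \<phi> n \<in> test_fields \<Omega>"
    "(\<lambda>n. LINT x|surface_on \<Omega>. (norm (u x - \<phi> n x))\<^sup>2) \<longlonglongrightarrow> 0"
    "(\<lambda>n. LINT x|surface_on \<Omega>. (norm (cov \<Omega> u x - cov_smooth (\<phi> n) x))\<^sup>2) \<longlonglongrightarrow> 0"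
proof -
  obtain \<phi> where \<phi>: "\<And>n. \<phi> n \<in> test_fields \<Omega>" and lim: "(\<lambda>n. H1_norm \<Omega> (\<lambda>x. u x - \<phi> n x)) \<longlonglongrightarrow> 0"
    using u by (auto simp: H10_def)
  obtain T where uL: "is_Lp 2 \<Omega> u" and T: "is_weak_cov \<Omega> u T" using u by (auto simp: H10_def H1_def)
  define e where "e n = (LINT x|surface_on \<Omega>. (norm (u x - \<phi> n x))\<^sup>2)" for n
  define d where "d n = (LINT x|surface_on \<Omega>. (norm (cov \<Omega> u x - cov_smooth (\<phi> n) x))\<^sup>2)" for n
  have nn: "0 \<le> e n" "0 \<le> d n" for n by (auto simp: e_def d_def)
  have sq: "(H1_norm \<Omega> (\<lambda>x. u x - \<phi> n x))\<^sup>2 = e n + d n" for n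
  proof -
    have w: "is_weak_cov \<Omega> (\<lambda>x. u x - \<phi> n x) (\<lambda>x. cov \<Omega> u x - cov_smooth (\<phi> n) x)"
      using weak_cov_combine[OF uL weak_cov_cov[OF T] test_field_L2(1)[OF \<phi>] weak_cov_test[OF \<phi>], where c="- 1"] by simp
    note w' = weak_cov_cov[OF w]
    have [measurable]: "cov \<Omega> (\<lambda>x. u x - \<phi> n x) \<in> borel_measurable (surface_on \<Omega>)"
      "(\<lambda>x. cov \<Omega> u x - cov_smooth (\<phi> n) x) \<in> borel_measurable (surface_on \<Omega>)"
      using w w' by (auto simp: is_weak_cov_def is_L2_iff)
    have "(LINT x|surface_on \<Omega>. (norm (cov \<Omega> (\<lambda>x. u x - \<phi> n x) x))\<^sup>2) = d n"
      unfolding d_def by (rule integral_cong_AE) (use weak_cov_unique[OF w' w] in auto)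
    then show ?thesis by (simp add: H1_norm_def L2_norm_square e_def[symmetric] nn)
  qed
  have z: "(\<lambda>n. e n + d n) \<longlonglongrightarrow> 0"
    using tendsto_power[OF lim, of 2] unfolding sq by simp
  have "e \<longlonglongrightarrow> 0" "d \<longlonglongrightarrow> 0"
    by (rule tendsto_sandwich[OF _ _ tendsto_const z]; simp add: nn)+
  with \<phi> show ?thesis by (intro that[of \<phi>]) (simp_all add: e_def[abs_def] d_def[abs_def])
qed

text \<open>The trace is continuous from L2 matrices to L2 functions, so the divergences of the
  approximating fields tend to that of u, which is 0, and their rotations to that of u. The smooth
  inequality with both terms then passes to the limit.\<close>

lemma H10_inequality:
  assumes u: "u \<in> H10 \<Omega>" and div: "AE x in surface_on \<Omega>. sdiv \<Omega> u x = 0" and q: "q > 2"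
  shows "integrable (surface_on \<Omega>) (\<lambda>x. norm (u x) powr q)"
    and "(LINT x|surface_on \<Omega>. norm (u x) powr q) \<le> (1 / (4 * pi)) powr ((q - 2) / 2) * (q / 2) powr (q / 2)
      * (LINT x|surface_on \<Omega>. (norm (u x))\<^sup>2) * (LINT x|surface_on \<Omega>. (rot \<Omega> u x)\<^sup>2) powr ((q - 2) / 2)"
proof -
  let ?M = "surface_on \<Omega>"
  obtain \<phi> where \<phi>: "\<And>n. \<phi> n \<in> test_fields \<Omega>"
    and e: "(\<lambda>n. LINT x|?M. (norm (u x - \<phi> n x))\<^sup>2) \<longlonglongrightarrow> 0"
    and d: "(\<lambda>n. LINT x|?M. (norm (cov \<Omega> u x - cov_smooth (\<phi> n) x))\<^sup>2) \<longlonglongrightarrow> 0"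
    by (rule H10_approximation[OF u]) (rule that)
  obtain T0 where uL: "is_Lp 2 \<Omega> u" and T0: "is_weak_cov \<Omega> u T0" using u by (auto simp: H10_def H1_def)
  define T where "T = cov \<Omega> u"
  define R where "R = cov \<Omega> (perp u)"
  have T: "is_weak_cov \<Omega> u T" unfolding T_def by (rule weak_cov_cov[OF T0])
  have R: "is_weak_cov \<Omega> (perp u) R" unfolding R_def by (rule weak_cov_cov[OF weak_cov_perp[OF T0]])
  have [measurable]: "u \<in> borel_measurable ?M" "T \<in> borel_measurable ?M" "R \<in> borel_measurable ?M"
    using uL T R by (auto simp: is_weak_cov_def is_L2_iff)
  have rot: "rot \<Omega> u x = trace (R x)" for x by (simp add: rot_def sdiv_def R_def)
  have TL: "is_Lp 2 \<Omega> R" using R by (simp add: is_weak_cov_def)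
  note [measurable] = test_field_measurable[OF \<phi>] test_field_measurable[OF perp_test_field[OF \<phi>]]
  have [measurable]: "(\<lambda>x. x) \<in> borel_measurable ?M" by (rule measurable_on) simp
  \<comment> \<open>\<open>W n\<close> is the weak derivative of u - \<phi> n and \<open>P n\<close>
    that of its rotation; the latter is pointwise no longer than the former.\<close>
  define W where "W n x = T x - cov_smooth (\<phi> n) x" for n x
  define P where "P n x = perp_matrix x (W n x)" for n x
  have W: "is_weak_cov \<Omega> (\<lambda>x. u x - \<phi> n x) (W n)" for n
    using weak_cov_combine[OF uL T test_field_L2(1)[OF \<phi>] weak_cov_test[OF \<phi>], where c="- 1"] by (simp add: W_def[abs_def])
  have WL: "is_Lp 2 \<Omega> (W n)" for n using W by (simp add: is_weak_cov_def)
  have PL: "is_Lp 2 \<Omega> (P n)" for n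
    using weak_cov_perp[OF W] by (simp add: is_weak_cov_def P_def[abs_def])
  have W0: "(\<lambda>n. LINT x|?M. (norm (W n x))\<^sup>2) \<longlonglongrightarrow> 0" using d by (simp add: W_def T_def)
  have P0: "(\<lambda>n. LINT x|?M. (norm (P n x))\<^sup>2) \<longlonglongrightarrow> 0"
  proof (rule tendsto_sandwich[OF _ _ tendsto_const W0])
    have "(LINT x|?M. (norm (P n x))\<^sup>2) \<le> (LINT x|?M. (norm (W n x))\<^sup>2)" for n
      by (rule integral_mono_AE)
        (use PL WL in \<open>auto simp: is_L2_iff P_def power_mono norm_perp_matrix_le domain_unit intro!: AE_onI\<close>)
    then show "\<forall>\<^sub>F n in sequentially. (LINT x|?M. (norm (P n x))\<^sup>2) \<le> (LINT x|?M. (norm (W n x))\<^sup>2)" by simp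
  qed simp
  have trace_lim: "(\<lambda>n. LINT x|?M. (trace (A n x))\<^sup>2) \<longlonglongrightarrow> 0"
    if "\<And>n. is_Lp 2 \<Omega> (A n)" "(\<lambda>n. LINT x|?M. (norm (A n x))\<^sup>2) \<longlonglongrightarrow> 0" for A :: "nat \<Rightarrow> real^3 \<Rightarrow> real^3^3"
  proof (rule tendsto_sandwich[OF _ _ tendsto_const])
    show "(\<lambda>n. 3 * (LINT x|?M. (norm (A n x))\<^sup>2)) \<longlonglongrightarrow> 0" using tendsto_mult_left[OF that(2), of 3] by simp
  qed (use is_L2_trace(2)[OF that(1)] in auto)
  have div_lim: "(\<lambda>n. LINT x|?M. (trace (cov_smooth (\<phi> n) x))\<^sup>2) \<longlonglongrightarrow> 0"
  proof -
    have "(LINT x|?M. (trace (W n x))\<^sup>2) = (LINT x|?M. (trace (cov_smooth (\<phi> n) x))\<^sup>2)" for n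
    proof (rule integral_cong_AE)
      show "AE x in ?M. (trace (W n x))\<^sup>2 = (trace (cov_smooth (\<phi> n) x))\<^sup>2"
        using div by eventually_elim (simp add: W_def trace_sub sdiv_def T_def)
    qed (unfold W_def, measurable)
    with trace_lim[OF WL W0] show ?thesis by simp
  qed
  have rot_lim: "(\<lambda>n. LINT x|?M. (trace (cov_smooth (perp (\<phi> n)) x))\<^sup>2) \<longlonglongrightarrow> (LINT x|?M. (rot \<Omega> u x)\<^sup>2)"
  proof -
    have unit: "AE x in ?M. norm x = 1" by (rule AE_onI) (rule domain_unit)
    \<comment> \<open>\<open>rot\<close> uses the derivative chosen for the rotated field.
      Uniqueness identifies it with the rotated derivative of u, and \<open>cov_perp\<close> does
      the same for the smooth fields.\<close>
    have ae: "AE x in ?M. (trace (P n x))\<^sup>2 = (trace (cov_smooth (perp (\<phi> n)) x) - trace (R x))\<^sup>2" for n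
      using weak_cov_unique[OF R weak_cov_perp[OF T]] unit
    proof eventually_elim
      case (elim x)
      interpret smooth_tangent_field "\<phi> n" by (rule test_field_smooth[OF \<phi>])
      have "R x = P n x + cov_smooth (perp (\<phi> n)) x"
        unfolding elim(1) P_def W_def
        by (rule matrix_eqI)
          (simp add: perp_matrix_apply cov_perp[OF elim(2)] matrix_vector_mult_add_rdistrib cross_add_left[symmetric] matrix_vector_mult_diff_rdistrib)
      then show ?case by (simp add: trace_add)
    qed
    have mP: "P n \<in> borel_measurable ?M" for n using PL by (simp add: is_L2_iff)
    note [measurable] = mP
    have i: "integrable ?M (\<lambda>x. (trace (cov_smooth (perp (\<phi> n)) x) - trace (R x))\<^sup>2)" for n
      using is_L2_trace(1)[OF PL[of n]] by (rule integrable_cong_AE_imp) (use ae[of n] in \<open>auto\<close>)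
    have c: "(LINT x|?M. (trace (P n x))\<^sup>2) = (LINT x|?M. (trace (cov_smooth (perp (\<phi> n)) x) - trace (R x))\<^sup>2)" for n
      by (rule integral_cong_AE[OF _ _ ae]) measurable
    show ?thesis unfolding rot
      by (rule integral_square_tendsto[OF _ _ is_L2_trace(1)[OF TL] i])
        (use trace_lim[OF PL P0] in \<open>auto simp: c\<close>)
  qed
  have uphi: "integrable ?M (\<lambda>x. (norm (u x - \<phi> n x))\<^sup>2)" for n
    using is_L2_combine[OF uL test_field_L2(1)[OF \<phi>[of n]], where c="- 1"] by (simp add: is_L2_iff)
  have norm_lim: "(\<lambda>n. LINT x|?M. (norm (\<phi> n x))\<^sup>2) \<longlonglongrightarrow> (LINT x|?M. (norm (u x))\<^sup>2)"
  proof (rule integral_square_tendsto)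
    have le: "(norm (\<phi> n x) - norm (u x))\<^sup>2 \<le> (norm (u x - \<phi> n x))\<^sup>2" for n x
      using norm_triangle_ineq3[of "\<phi> n x" "u x"] by (subst norm_minus_commute) (simp add: abs_le_square_iff[symmetric])
    show i: "integrable ?M (\<lambda>x. (norm (\<phi> n x) - norm (u x))\<^sup>2)" for n
      by (rule Bochner_Integration.integrable_bound[OF uphi[of n]]) (use le in auto)
    show "(\<lambda>n. LINT x|?M. (norm (\<phi> n x) - norm (u x))\<^sup>2) \<longlonglongrightarrow> 0"
      by (rule tendsto_sandwich[OF _ _ tendsto_const e]) (auto intro!: always_eventually integral_mono i uphi le)
  qed (use uL in \<open>auto simp: is_L2_iff\<close>)
  define c where "c n = (1 / (4 * pi)) powr ((q - 2) / 2) * (q / 2) powr (q / 2)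
      * (LINT x|?M. (norm (\<phi> n x))\<^sup>2)
      * ((LINT x|?M. (trace (cov_smooth (\<phi> n) x))\<^sup>2) + (LINT x|?M. (trace (cov_smooth (perp (\<phi> n)) x))\<^sup>2)) powr ((q - 2) / 2)" for n
  let ?C = "(1 / (4 * pi)) powr ((q - 2) / 2) * (q / 2) powr (q / 2)
      * (LINT x|?M. (norm (u x))\<^sup>2) * (LINT x|?M. (rot \<Omega> u x)\<^sup>2) powr ((q - 2) / 2)"
  have "(\<lambda>n. ((LINT x|?M. (trace (cov_smooth (\<phi> n) x))\<^sup>2) + (LINT x|?M. (trace (cov_smooth (perp (\<phi> n)) x))\<^sup>2)) powr ((q - 2) / 2))
      \<longlonglongrightarrow> (0 + (LINT x|?M. (rot \<Omega> u x)\<^sup>2)) powr ((q - 2) / 2)"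
    using q by (intro tendsto_powr' tendsto_add div_lim rot_lim tendsto_const) auto
  then have c: "c \<longlonglongrightarrow> ?C"
    unfolding c_def[abs_def] by (intro tendsto_mult tendsto_const norm_lim) simp
  \<comment> \<open>Mean-square convergence gives convergence almost everywhere along a subsequence,
    as Fatou's lemma requires.\<close>
  obtain r where r: "strict_mono r" "AE x in ?M. (\<lambda>n. (norm (u x - \<phi> (r n) x))\<^sup>2) \<longlonglongrightarrow> 0"
    using tendsto_L1_AE_subseq[of ?M "\<lambda>n x. (norm (u x - \<phi> n x))\<^sup>2", OF uphi] e by auto
  have ae: "AE x in ?M. (\<lambda>n. \<phi> (r n) x) \<longlonglongrightarrow> u x"
    using r(2)
  proof eventually_elim
    case (elim x)
    from tendsto_real_sqrt[OF this] have "(\<lambda>n. norm (\<phi> (r n) x - u x)) \<longlonglongrightarrow> 0" by (simp add: norm_minus_commute)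
    then show ?case by (simp add: tendsto_norm_zero_iff LIM_zero_iff)
  qed
  have le: "(LINT x|?M. norm (\<phi> (r n) x) powr q) \<le> c (r n)" for n
    unfolding c_def by (rule test_field_inequality(2)[OF \<phi> q])
  have cr: "(\<lambda>n. c (r n)) \<longlonglongrightarrow> ?C" using LIMSEQ_subseq_LIMSEQ[OF c r(1)] by (simp add: o_def)
  have q0: "q > 0" using q by simp
  have um: "u \<in> borel_measurable ?M" by measurable
  note F = Fatou_powr[OF um q0 ae test_field_inequality(1)[OF \<phi> q] le cr]
  show "integrable ?M (\<lambda>x. norm (u x) powr q)" by (rule F(1))
  show "(LINT x|?M. norm (u x) powr q) \<le> ?C" by (rule F(2))
qed

end

theorem mainTheorem5:
  fixes \<Omega> :: "(real^3) set" and q :: real and u :: "real^3 \<Rightarrow> real^3"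
  assumes "domain_S2 \<Omega>"
    and "2 \<le> q"
    and "u \<in> H10 \<Omega>"
    and "AE x in surface_on \<Omega>. sdiv \<Omega> u x = 0"
  shows "is_Lp q \<Omega> u \<and>
    Lp_norm q \<Omega> u \<le> (1 / (4 * pi)) powr ((q - 2) / (2 * q)) * (q / 2) powr (1 / 2)
      * Lp_norm 2 \<Omega> u powr (2 / q)
      * (if q = 2 then 1 else Lp_norm 2 \<Omega> (rot \<Omega> u) powr (1 - 2 / q))"
proof (cases "q = 2")
  case True
  have "is_Lp 2 \<Omega> u" using assms(3) by (simp add: H10_def H1_def)
  \<comment> \<open>The exponents degenerate: the first constant has exponent 0, the second has base
    1, and both sides are the L2 norm.\<close>
  then show ?thesis using True by (simp add: Lp_norm_def)
next
  case False
  with assms(2) have q: "q > 2" by simp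
  interpret sphere_domain \<Omega> by unfold_locales (rule assms(1))
  let ?N = "LINT x|surface_on \<Omega>. (norm (u x))\<^sup>2" and ?E = "LINT x|surface_on \<Omega>. (rot \<Omega> u x)\<^sup>2"
  note H = H10_inequality[OF assms(3,4) q]
  have "is_Lp 2 \<Omega> u" using assms(3) by (simp add: H10_def H1_def)
  then have L: "is_Lp q \<Omega> u" using H(1) by (simp add: is_Lp_def)
  have "Lp_norm q \<Omega> u \<le> ((1 / (4 * pi)) powr ((q - 2) / 2) * (q / 2) powr (q / 2) * ?N * ?E powr ((q - 2) / 2)) powr (1 / q)"
    unfolding Lp_norm_def by (rule powr_mono2[OF _ _ H(2)]) (use q in auto)
  also have "\<dots> = (1 / (4 * pi)) powr ((q - 2) / (2 * q)) * (q / 2) powr (1 / 2) * ?N powr (1 / q) * ?E powr ((q - 2) / (2 * q))"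
    using q by (simp add: powr_mult powr_powr)
  also have "?N powr (1 / q) = Lp_norm 2 \<Omega> u powr (2 / q)"
    by (simp add: Lp_norm_def norm_powr_2 powr_powr)
  also have "?E powr ((q - 2) / (2 * q)) = Lp_norm 2 \<Omega> (rot \<Omega> u) powr (1 - 2 / q)"
  proof -
    have "1 / 2 * (1 - 2 / q) = (q - 2) / (2 * q)" using q by (simp add: field_simps)
    then show ?thesis unfolding Lp_norm_def norm_powr_2 powr_powr by (simp only: real_norm_def power2_abs)
  qed
  finally show ?thesis using L False by simp
qed

end
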